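(* Let $(\mathcal{U},\mathcal{R})$ and $(\mathcal{V},\mathcal{S})$ be simplicial ringed spaces, let $f,g:(\mathcal{U},\mathcal{R})\to(\mathcal{V},\mathcal{S})$ be two simplicial maps, and let $h=\{h_i\}$ be a simplicial homotopy between $f$ and $g$. For every object $\mathcal{E}=(E^\bullet,a)$ of $\mathrm{Tw}(\mathcal{V},\mathcal{S})$ let $\Phi_0(\mathcal{E}):f^*\mathcal{E}\to g^*\mathcal{E}$ be the degree $0$ morphism with components $$\Phi_0(\mathcal{E})^{k,-k}=\sum_{i=0}^k(-1)^i h_i^*(a^{k+1,-k}),\qquad k\ge 0,$$ and for every degree $m$ morphism $\phi:\mathcal{E}\to\mathcal{F}$ in $\mathrm{Tw}(\mathcal{V},\mathcal{S})$ let $\Phi_1(\phi):f^*\mathcal{E}\to g^*\mathcal{F}$ be the degree $m-1$ morphism with components $$\Phi_1(\phi)^{k,m-1-k}=(-1)^{m-1}\sum_{i=0}^k(-1)^i h_i^*(\phi^{k+1,m-k-1}),\qquad k\ge 0.$$ Put $\Phi_l=0$ for $l\geq 2$. Then the collection $\Phi=\{\Phi_0,\Phi_1,0,0,\ldots\}$ is an $A_\infty$-natural transformation from the dg-functor $f^*:\mathrm{Tw}(\mathcal{V},\mathcal{S})\to\mathrm{Tw}(\mathcal{U},\mathcal{R})$ to the dg-functor $g^*:\mathrm{Tw}(\mathcal{V},\mathcal{S})\to\mathrm{Tw}(\mathcal{U},\mathcal{R})$.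
   Context: **Ringed spaces.** A ringed space is a topological space with a sheaf of (not necessarily commutative) rings; modules are left modules. For a morphism $f$ of ringed spaces, $f^*$ denotes pullback of modules and of module maps; the canonical isomorphisms $(f\circ g)^*\cong g^*f^*$ are treated as identities. A simplicial ringed space $(\mathcal{U},\mathcal{R})$ is a simplicial object $n\mapsto(U_n,\mathcal{R}_n)$ in ringed spaces, with faces $\partial_i$ and degeneracies $s_i$; a simplicial map is a morphism of simplicial objects. For $k\ge p$ put $\rho_{k,p}=\partial_{p+1}\circ\cdots\circ\partial_k$ and $\tau_{k,p}=\partial_0\circ\cdots\circ\partial_0$ ($k-p$ factors), both maps $(U_k,\mathcal{R}_k)\to(U_p,\mathcal{R}_p)$. **Bigraded maps.** For graded sheaves of $\mathcal{R}_0$-modules $E^\bullet,F^\bullet$ on $U_0$, an element $u^{p,q}$ of bidegree $(p,q)$ is an element of $\mathrm{Hom}^q_{\mathcal{R}_p}(\tau_{p,0}^*E,\rho_{p,0}^*F)$ (maps of graded sheaves raising degree by $q$); its total degree is $p+q$, and $|u|$ denotes total degree. For $u^{p,q}$ from $F$ to $G$ and $v^{r,s}$ from $E$ to $F$, the composition is $(u\cdot v)^{p+r,q+s}=(-1)^{qr}(\rho_{p+r,p}^*u^{p,q})\circ(\tau_{p+r,r}^*v^{r,s})$. The operator $\delta$ of bidegree $(1,0)$ is $(\delta u)^{p+1,q}=\sum_{j=1}^{p}(-1)^j\partial_j^*u^{p,q}$. **Twisted complexes.** A twisted complex on $(\mathcal{U},\mathcal{R})$ is a pair $\mathcal{E}=(E^\bullet,a)$,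 with $E^\bullet$ a graded sheaf of $\mathcal{R}_0$-modules on $U_0$ and $a=(a^{k,1-k})_{k\ge0}$, $a^{k,1-k}\in\mathrm{Hom}^{1-k}_{\mathcal{R}_k}(\tau_{k,0}^*E,\rho_{k,0}^*E)$, such that $\delta a+a\cdot a=0$ and $a^{1,0}$ is invertible up to homotopy (as a chain map $(\tau_{1,0}^*E,\tau_{1,0}^*a^{0,1})\to(\rho_{1,0}^*E,\rho_{1,0}^*a^{0,1})$). A degree $m$ morphism $\theta:(E,a)\to(F,b)$ is a family $\theta=(\theta^{k,m-k})_{k\ge0}$, $\theta^{k,m-k}\in\mathrm{Hom}^{m-k}_{\mathcal{R}_k}(\tau_{k,0}^*E,\rho_{k,0}^*F)$, with differential $d\theta=\delta\theta+b\cdot\theta-(-1)^m\theta\cdot a$ and composition $\cdot$. These form a dg-category $\mathrm{Tw}(\mathcal{U},\mathcal{R})$. **Pullback.** A simplicial map $f:(\mathcal{U},\mathcal{R})\to(\mathcal{V},\mathcal{S})$ induces a dg-functor $f^*:\mathrm{Tw}(\mathcal{V},\mathcal{S})\to\mathrm{Tw}(\mathcal{U},\mathcal{R})$, $f^*(E,a)=(f_0^*E,(f_k^*a^{k,1-k})_k)$, $(f^*\phi)^{k,m-k}=f_k^*\phi^{k,m-k}$. **Simplicial homotopy.** A simplicial homotopy $h$ between $f,g:\mathcal{U}\to\mathcal{V}$ consists of morphisms of ringed spaces $h_i=h_i^p:U_p\to V_{p+1}$ for $p\geq 0$, $0\le i\le p$, such that: $\partial_0h_0=f_p$ and $\partial_{p+1}h_p=g_p$;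 $\partial_ih_j=h_{j-1}\partial_i$ if $i<j$, $\partial_ih_i=\partial_ih_{i-1}$ if $i=j\ne0$, $\partial_ih_j=h_j\partial_{i-1}$ if $i>j+1$; $s_ih_j=h_{j+1}s_i$ if $i\le j$, $s_ih_j=h_js_{i-1}$ if $i>j$. These give $\tau_{k+1,0}\circ h_i=f_0\circ\tau_{k,0}$ and $\rho_{k+1,0}\circ h_i=g_0\circ\rho_{k,0}$ for $0\le i\le k$, so that $h_i^*$ sends $\mathrm{Hom}_{\mathcal{S}_{k+1}}(\tau_{k+1,0}^*E,\rho_{k+1,0}^*F)$ to $\mathrm{Hom}_{\mathcal{R}_k}(\tau_{k,0}^*f_0^*E,\rho_{k,0}^*g_0^*F)$. **$A_\infty$-natural transformations.** dg-categories are over a fixed commutative ground ring over which everything is linear (e.g. $\mathbb{Z}$). Let $F,G:\mathcal{C}\to\mathcal{D}$ be dg-functors between dg-categories. An $A_\infty$-natural transformation $\Phi:F\Rightarrow G$ consists of $\Phi_0(X)\in\mathcal{D}^0(FX,GX)$ for each object $X$, and, for each $l\ge1$ and objects $X_0,\dots,X_l$, a linear map $\Phi_l:\mathcal{C}(X_{l-1},X_l)\otimes\cdots\otimes\mathcal{C}(X_0,X_1)\to\mathcal{D}(FX_0,GX_l)$ of degree $-l$, such that $d(\Phi_0(X))=0$ for all $X$ and, for all $l\ge1$ and homogeneous $u_i\in\mathcal{C}(X_{i-1},X_i)$, $i=1,\dots,l$, $$\begin{aligned}0=\;&d(\Phi_l(u_l\otimes\cdots\otimes u_1))+(-1)^{|u_l|-1}G(u_l)\Phi_{l-1}(u_{l-1}\otimes\cdots\otimes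 u_1)\\&+(-1)^{-|u_1|-\cdots-|u_l|+l-1}\Phi_{l-1}(u_l\otimes\cdots\otimes u_2)F(u_1)\\&+\sum_{i=1}^l(-1)^{|u_l|+\cdots+|u_{i+1}|+l-i+1}\Phi_l(u_l\otimes\cdots\otimes du_i\otimes\cdots\otimes u_1)\\&+\sum_{i=1}^{l-1}(-1)^{|u_l|+\cdots+|u_{i+1}|+l-i+1}\Phi_{l-1}(u_l\otimes\cdots\otimes u_{i+1}u_i\otimes\cdots\otimes u_1),\end{aligned}$$ where for $l=1$ the terms with $\Phi_{l-1}$ of no arguments mean $\Phi_0(X_0)$ (after $G(u_1)$) and $\Phi_0(X_1)$ (before $F(u_1)$), and the last sum is empty. *)

theory Defs
  imports "HOL-Analysis.Abstract_Topology" "HOL-Algebra.Module" "HOL-Algebra.QuotRing" "HOL-Algebra.Free_Abelian_Groups"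
begin

section \<open>Sheaves, ringed spaces and sheaves of modules\<close>

text \<open>Left modules over a not necessarily commutative ring; the library locale
  \<open>module\<close> requires a commutative base ring.\<close>

definition left_module :: "('r, 'x) ring_scheme \<Rightarrow> ('r, 'm, 'y) module_scheme \<Rightarrow> bool" where
  "left_module R M \<longleftrightarrow> ring R \<and> abelian_group M \<and>
     (\<forall>a\<in>carrier R. \<forall>m\<in>carrier M. a \<odot>\<^bsub>M\<^esub> m \<in> carrier M) \<and>
     (\<forall>a\<in>carrier R. \<forall>b\<in>carrier R. \<forall>m\<in>carrier M.
        (a \<oplus>\<^bsub>R\<^esub> b) \<odot>\<^bsub>M\<^esub> m = a \<odot>\<^bsub>M\<^esub> m \<oplus>\<^bsub>M\<^esub> b \<odot>\<^bsub>M\<^esub> m) \<and>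
     (\<forall>a\<in>carrier R. \<forall>m\<in>carrier M. \<forall>n\<in>carrier M.
        a \<odot>\<^bsub>M\<^esub> (m \<oplus>\<^bsub>M\<^esub> n) = a \<odot>\<^bsub>M\<^esub> m \<oplus>\<^bsub>M\<^esub> a \<odot>\<^bsub>M\<^esub> n) \<and>
     (\<forall>a\<in>carrier R. \<forall>b\<in>carrier R. \<forall>m\<in>carrier M.
        (a \<otimes>\<^bsub>R\<^esub> b) \<odot>\<^bsub>M\<^esub> m = a \<odot>\<^bsub>M\<^esub> (b \<odot>\<^bsub>M\<^esub> m)) \<and>
     (\<forall>m\<in>carrier M. \<one>\<^bsub>R\<^esub> \<odot>\<^bsub>M\<^esub> m = m)"

definition sheaf_of_sets ::
  "'a topology \<Rightarrow> ('a set \<Rightarrow> 'm set) \<Rightarrow> ('a set \<Rightarrow> 'a set \<Rightarrow> 'm \<Rightarrow> 'm) \<Rightarrow> bool" where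
  "sheaf_of_sets T S res \<longleftrightarrow>
     (\<forall>V W. openin T V \<and> openin T W \<and> W \<subseteq> V \<longrightarrow> res V W \<in> S V \<rightarrow> S W) \<and>
     (\<forall>V. openin T V \<longrightarrow> (\<forall>s\<in>S V. res V V s = s)) \<and>
     (\<forall>V W Z. openin T V \<and> openin T W \<and> openin T Z \<and> Z \<subseteq> W \<and> W \<subseteq> V \<longrightarrow>
        (\<forall>s\<in>S V. res W Z (res V W s) = res V Z s)) \<and>
     (\<forall>\<W> s. (\<forall>W\<in>\<W>. openin T W \<and> s W \<in> S W) \<and>
        (\<forall>W\<in>\<W>. \<forall>W'\<in>\<W>. res W (W \<inter> W') (s W) = res W' (W \<inter> W') (s W')) \<longrightarrow>
        (\<exists>!t. t \<in> S (\<Union>\<W>) \<and> (\<forall>W\<in>\<W>. res (\<Union>\<W>) W t = s W)))"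

record ('a, 'r) ringed_sp =
  rtop :: "'a topology"
  rsec :: "'a set \<Rightarrow> 'r ring"
  rres :: "'a set \<Rightarrow> 'a set \<Rightarrow> 'r \<Rightarrow> 'r"

definition ringed_space :: "('a, 'r) ringed_sp \<Rightarrow> bool" where
  "ringed_space X \<longleftrightarrow>
     sheaf_of_sets (rtop X) (\<lambda>W. carrier (rsec X W)) (rres X) \<and>
     (\<forall>W. openin (rtop X) W \<longrightarrow> ring (rsec X W)) \<and>
     (\<forall>V W. openin (rtop X) V \<and> openin (rtop X) W \<and> W \<subseteq> V \<longrightarrow>
        rres X V W \<in> ring_hom (rsec X V) (rsec X W))"

record ('a, 'r, 'm) mod_sh =
  msec :: "'a set \<Rightarrow> ('r, 'm) module"
  mres :: "'a set \<Rightarrow> 'a set \<Rightarrow> 'm \<Rightarrow> 'm"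

definition module_sheaf :: "('a, 'r) ringed_sp \<Rightarrow> ('a, 'r, 'm) mod_sh \<Rightarrow> bool" where
  "module_sheaf X M \<longleftrightarrow>
     sheaf_of_sets (rtop X) (\<lambda>W. carrier (msec M W)) (mres M) \<and>
     (\<forall>W. openin (rtop X) W \<longrightarrow> left_module (rsec X W) (msec M W)) \<and>
     (\<forall>V W. openin (rtop X) V \<and> openin (rtop X) W \<and> W \<subseteq> V \<longrightarrow>
        (\<forall>s\<in>carrier (msec M V). \<forall>t\<in>carrier (msec M V).
           mres M V W (s \<oplus>\<^bsub>msec M V\<^esub> t) = mres M V W s \<oplus>\<^bsub>msec M W\<^esub> mres M V W t) \<and>
        (\<forall>a\<in>carrier (rsec X V). \<forall>s\<in>carrier (msec M V).
           mres M V W (a \<odot>\<^bsub>msec M V\<^esub> s) = rres X V W a \<odot>\<^bsub>msec M W\<^esub> mres M V W s))"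

text \<open>Morphisms (of ringed spaces and of module sheaves) are extensional functions, so that
  equality of morphisms is equality in HOL.\<close>

type_synonym ('a, 'm, 'n) sh_map = "'a set \<Rightarrow> 'm \<Rightarrow> 'n"

definition sheaf_hom ::
  "('a, 'r) ringed_sp \<Rightarrow> ('a, 'r, 'm) mod_sh \<Rightarrow> ('a, 'r, 'n) mod_sh \<Rightarrow> ('a, 'm, 'n) sh_map set" where
  "sheaf_hom X M N =
     {u \<in> (\<Pi>\<^sub>E W\<in>{W. openin (rtop X) W}. carrier (msec M W) \<rightarrow>\<^sub>E carrier (msec N W)).
        (\<forall>W. openin (rtop X) W \<longrightarrow>
          (\<forall>s\<in>carrier (msec M W). \<forall>t\<in>carrier (msec M W).
             u W (s \<oplus>\<^bsub>msec M W\<^esub> t) = u W s \<oplus>\<^bsub>msec N W\<^esub> u W t) \<and>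
          (\<forall>a\<in>carrier (rsec X W). \<forall>s\<in>carrier (msec M W).
             u W (a \<odot>\<^bsub>msec M W\<^esub> s) = a \<odot>\<^bsub>msec N W\<^esub> u W s)) \<and>
        (\<forall>V W. openin (rtop X) V \<and> openin (rtop X) W \<and> W \<subseteq> V \<longrightarrow>
          (\<forall>s\<in>carrier (msec M V). u W (mres M V W s) = mres N V W (u V s)))}"

definition sh_add ::
  "('a, 'r) ringed_sp \<Rightarrow> ('a, 'r, 'm) mod_sh \<Rightarrow> ('a, 'r, 'n) mod_sh \<Rightarrow>
   ('a, 'm, 'n) sh_map \<Rightarrow> ('a, 'm, 'n) sh_map \<Rightarrow> ('a, 'm, 'n) sh_map" where
  "sh_add X M N u v = (\<lambda>W\<in>{W. openin (rtop X) W}. \<lambda>s\<in>carrier (msec M W). u W s \<oplus>\<^bsub>msec N W\<^esub> v W s)"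

definition sh_zero ::
  "('a, 'r) ringed_sp \<Rightarrow> ('a, 'r, 'm) mod_sh \<Rightarrow> ('a, 'r, 'n) mod_sh \<Rightarrow> ('a, 'm, 'n) sh_map" where
  "sh_zero X M N = (\<lambda>W\<in>{W. openin (rtop X) W}. \<lambda>s\<in>carrier (msec M W). \<zero>\<^bsub>msec N W\<^esub>)"

definition sh_id :: "('a, 'r) ringed_sp \<Rightarrow> ('a, 'r, 'm) mod_sh \<Rightarrow> ('a, 'm, 'm) sh_map" where
  "sh_id X M = (\<lambda>W\<in>{W. openin (rtop X) W}. \<lambda>s\<in>carrier (msec M W). s)"

definition sh_comp ::
  "('a, 'r) ringed_sp \<Rightarrow> ('a, 'r, 'm) mod_sh \<Rightarrow>
   ('a, 'n, 'p) sh_map \<Rightarrow> ('a, 'm, 'n) sh_map \<Rightarrow> ('a, 'm, 'p) sh_map" where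
  "sh_comp X M v u = (\<lambda>W\<in>{W. openin (rtop X) W}. \<lambda>s\<in>carrier (msec M W). v W (u W s))"

definition sh_inv ::
  "('a, 'r) ringed_sp \<Rightarrow> ('a, 'r, 'm) mod_sh \<Rightarrow> ('a, 'r, 'n) mod_sh \<Rightarrow>
   ('a, 'm, 'n) sh_map \<Rightarrow> ('a, 'n, 'm) sh_map" where
  "sh_inv X M N u = (\<lambda>W\<in>{W. openin (rtop X) W}. \<lambda>t\<in>carrier (msec N W). inv_into (carrier (msec M W)) (u W) t)"

subsection \<open>Morphisms of ringed spaces\<close>

record ('a, 'r, 'b, 's) rs_mor =
  src :: "('a, 'r) ringed_sp"
  tgt :: "('b, 's) ringed_sp"
  pt :: "'a \<Rightarrow> 'b"
  comor :: "'b set \<Rightarrow> 's \<Rightarrow> 'r"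

definition preim :: "('a, 'r, 'b, 's) rs_mor \<Rightarrow> 'b set \<Rightarrow> 'a set" where
  "preim f V = {x \<in> topspace (rtop (src f)). pt f x \<in> V}"

definition rs_morphism ::
  "('a, 'r) ringed_sp \<Rightarrow> ('b, 's) ringed_sp \<Rightarrow> ('a, 'r, 'b, 's) rs_mor \<Rightarrow> bool" where
  "rs_morphism X Y f \<longleftrightarrow>
     src f = X \<and> tgt f = Y \<and>
     pt f \<in> extensional (topspace (rtop X)) \<and> continuous_map (rtop X) (rtop Y) (pt f) \<and>
     comor f \<in> (\<Pi>\<^sub>E V\<in>{V. openin (rtop Y) V}. carrier (rsec Y V) \<rightarrow>\<^sub>E carrier (rsec X (preim f V))) \<and>
     (\<forall>V. openin (rtop Y) V \<longrightarrow> comor f V \<in> ring_hom (rsec Y V) (rsec X (preim f V))) \<and>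
     (\<forall>V W. openin (rtop Y) V \<and> openin (rtop Y) W \<and> W \<subseteq> V \<longrightarrow>
        (\<forall>s\<in>carrier (rsec Y V).
           comor f W (rres Y V W s) = rres X (preim f V) (preim f W) (comor f V s)))"

definition rs_id :: "('a, 'r) ringed_sp \<Rightarrow> ('a, 'r, 'a, 'r) rs_mor" where
  "rs_id X = \<lparr>src = X, tgt = X, pt = (\<lambda>x\<in>topspace (rtop X). x),
     comor = (\<lambda>V\<in>{V. openin (rtop X) V}. \<lambda>s\<in>carrier (rsec X V). s)\<rparr>"

definition rs_comp ::
  "('b, 's, 'c, 't) rs_mor \<Rightarrow> ('a, 'r, 'b, 's) rs_mor \<Rightarrow> ('a, 'r, 'c, 't) rs_mor" (infixr "\<circ>\<^sub>r" 55) where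
  "g \<circ>\<^sub>r f = \<lparr>src = src f, tgt = tgt g,
     pt = (\<lambda>x\<in>topspace (rtop (src f)). pt g (pt f x)),
     comor = (\<lambda>V\<in>{V. openin (rtop (tgt g)) V}. \<lambda>s\<in>carrier (rsec (tgt g) V).
                comor f (preim g V) (comor g V s))\<rparr>"

section \<open>Pullback of sheaves of modules\<close>

subsection \<open>Stalks\<close>

type_synonym ('a, 'm) germ = "('a set \<times> 'm) set"

definition germ_of ::
  "'a topology \<Rightarrow> ('a set \<Rightarrow> 'm set) \<Rightarrow> ('a set \<Rightarrow> 'a set \<Rightarrow> 'm \<Rightarrow> 'm) \<Rightarrow> 'a \<Rightarrow> 'a set \<Rightarrow> 'm \<Rightarrow> ('a, 'm) germ" where
  "germ_of T S res x W s =
     {(W', s'). openin T W' \<and> x \<in> W' \<and> s' \<in> S W' \<and>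
        (\<exists>Z. openin T Z \<and> x \<in> Z \<and> Z \<subseteq> W \<inter> W' \<and> res W Z s = res W' Z s')}"

definition rgerm :: "('a, 'r) ringed_sp \<Rightarrow> 'a \<Rightarrow> 'a set \<Rightarrow> 'r \<Rightarrow> ('a, 'r) germ" where
  "rgerm X = germ_of (rtop X) (\<lambda>W. carrier (rsec X W)) (rres X)"

definition mgerm :: "('a, 'r) ringed_sp \<Rightarrow> ('a, 'r, 'm) mod_sh \<Rightarrow> 'a \<Rightarrow> 'a set \<Rightarrow> 'm \<Rightarrow> ('a, 'm) germ" where
  "mgerm X M = germ_of (rtop X) (\<lambda>W. carrier (msec M W)) (mres M)"

text \<open>Operations on germs are given by unions over all representatives; all members of such a
  union coincide.\<close>

definition ring_stalk :: "('a, 'r) ringed_sp \<Rightarrow> 'a \<Rightarrow> ('a, 'r) germ ring" where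
  "ring_stalk X x = \<lparr>
     carrier = {rgerm X x W s |W s. openin (rtop X) W \<and> x \<in> W \<and> s \<in> carrier (rsec X W)},
     monoid.mult = (\<lambda>g h. \<Union>(V, s)\<in>g. \<Union>(W, t)\<in>h.
        rgerm X x (V \<inter> W) (rres X V (V \<inter> W) s \<otimes>\<^bsub>rsec X (V \<inter> W)\<^esub> rres X W (V \<inter> W) t)),
     monoid.one = rgerm X x (topspace (rtop X)) \<one>\<^bsub>rsec X (topspace (rtop X))\<^esub>,
     ring.zero = rgerm X x (topspace (rtop X)) \<zero>\<^bsub>rsec X (topspace (rtop X))\<^esub>,
     ring.add = (\<lambda>g h. \<Union>(V, s)\<in>g. \<Union>(W, t)\<in>h.
        rgerm X x (V \<inter> W) (rres X V (V \<inter> W) s \<oplus>\<^bsub>rsec X (V \<inter> W)\<^esub> rres X W (V \<inter> W) t))\<rparr>"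

text \<open>The fields \<open>mult\<close> and \<open>one\<close> of a module record carry no information.\<close>

definition mod_stalk ::
  "('a, 'r) ringed_sp \<Rightarrow> ('a, 'r, 'm) mod_sh \<Rightarrow> 'a \<Rightarrow> (('a, 'r) germ, ('a, 'm) germ) module" where
  "mod_stalk X M x = \<lparr>
     carrier = {mgerm X M x W s |W s. openin (rtop X) W \<and> x \<in> W \<and> s \<in> carrier (msec M W)},
     monoid.mult = undefined, monoid.one = undefined,
     ring.zero = mgerm X M x (topspace (rtop X)) \<zero>\<^bsub>msec M (topspace (rtop X))\<^esub>,
     ring.add = (\<lambda>g h. \<Union>(V, s)\<in>g. \<Union>(W, t)\<in>h.
        mgerm X M x (V \<inter> W) (mres M V (V \<inter> W) s \<oplus>\<^bsub>msec M (V \<inter> W)\<^esub> mres M W (V \<inter> W) t)),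
     module.smult = (\<lambda>a g. \<Union>(V, r)\<in>a. \<Union>(W, s)\<in>g.
        mgerm X M x (V \<inter> W) (rres X V (V \<inter> W) r \<odot>\<^bsub>msec M (V \<inter> W)\<^esub> mres M W (V \<inter> W) s))\<rparr>"

definition stalk_comor :: "('a, 'r, 'b, 's) rs_mor \<Rightarrow> 'a \<Rightarrow> ('b, 's) germ \<Rightarrow> ('a, 'r) germ" where
  "stalk_comor f x g = (\<Union>(V, s)\<in>g. rgerm (src f) x (preim f V) (comor f V s))"

subsection \<open>Extension of scalars\<close>

text \<open>For a ring homomorphism \<open>\<phi> : A \<rightarrow> B\<close> and a left \<open>A\<close>-module \<open>M\<close>, the left \<open>B\<close>-module
  \<open>B \<otimes>\<^sub>A M\<close> is the free abelian group on \<open>B \<times> M\<close> modulo the usual relations; \<open>A\<close> acts on \<open>B\<close>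
  from the right through \<open>\<phi>\<close>.\<close>

type_synonym ('b, 'm) tens = "('b \<times> 'm \<Rightarrow>\<^sub>0 int) set"

definition tens_rels :: "'a ring \<Rightarrow> 'b ring \<Rightarrow> ('a \<Rightarrow> 'b) \<Rightarrow> ('a, 'm) module \<Rightarrow> ('b \<times> 'm \<Rightarrow>\<^sub>0 int) set" where
  "tens_rels A B \<phi> M =
     {frag_of (b \<oplus>\<^bsub>B\<^esub> b', m) - frag_of (b, m) - frag_of (b', m) |b b' m.
        b \<in> carrier B \<and> b' \<in> carrier B \<and> m \<in> carrier M} \<union>
     {frag_of (b, m \<oplus>\<^bsub>M\<^esub> m') - frag_of (b, m) - frag_of (b, m') |b m m'.
        b \<in> carrier B \<and> m \<in> carrier M \<and> m' \<in> carrier M} \<union>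
     {frag_of (b \<otimes>\<^bsub>B\<^esub> \<phi> a, m) - frag_of (b, a \<odot>\<^bsub>M\<^esub> m) |b a m.
        b \<in> carrier B \<and> a \<in> carrier A \<and> m \<in> carrier M}"

abbreviation tens_free :: "'b ring \<Rightarrow> ('a, 'm) module \<Rightarrow> ('b \<times> 'm \<Rightarrow>\<^sub>0 int) monoid" where
  "tens_free B M \<equiv> free_Abelian_group (carrier B \<times> carrier M)"

definition tens_class ::
  "'a ring \<Rightarrow> 'b ring \<Rightarrow> ('a \<Rightarrow> 'b) \<Rightarrow> ('a, 'm) module \<Rightarrow> ('b \<times> 'm \<Rightarrow>\<^sub>0 int) \<Rightarrow> ('b, 'm) tens" where
  "tens_class A B \<phi> M c = generate (tens_free B M) (tens_rels A B \<phi> M) #>\<^bsub>tens_free B M\<^esub> c"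

definition ext_scalars ::
  "'a ring \<Rightarrow> 'b ring \<Rightarrow> ('a \<Rightarrow> 'b) \<Rightarrow> ('a, 'm) module \<Rightarrow> ('b, ('b, 'm) tens) module" where
  "ext_scalars A B \<phi> M = (let Q = tens_free B M Mod generate (tens_free B M) (tens_rels A B \<phi> M) in
     \<lparr>carrier = carrier Q, monoid.mult = undefined, monoid.one = undefined,
      ring.zero = \<one>\<^bsub>Q\<^esub>, ring.add = (\<lambda>t t'. t \<otimes>\<^bsub>Q\<^esub> t'),
      module.smult = (\<lambda>b t. \<Union>c\<in>t. tens_class A B \<phi> M (frag_extend (\<lambda>(b', m). frag_of (b \<otimes>\<^bsub>B\<^esub> b', m)) c))\<rparr>)"

text \<open>The map \<open>id \<otimes> g\<close> between extensions of scalars to \<open>B\<close>, where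
  \<open>A \<rightarrow> B\<close> and \<open>A' \<rightarrow> B\<close> may have different sources; the target is \<open>B \<otimes>\<^bsub>A'\<^esub> M'\<close>.\<close>

definition tens_map ::
  "'a ring \<Rightarrow> 'b ring \<Rightarrow> ('a \<Rightarrow> 'b) \<Rightarrow> ('a, 'm') module \<Rightarrow> ('m \<Rightarrow> 'm') \<Rightarrow> ('b, 'm) tens \<Rightarrow> ('b, 'm') tens" where
  "tens_map A' B \<phi>' M' g t =
     (\<Union>c\<in>t. tens_class A' B \<phi>' M' (frag_extend (\<lambda>(b, m). frag_of (b, g m)) c))"

subsection \<open>The pullback functor\<close>

text \<open>\<open>f\<^sup>*M = \<O>\<^sub>X \<otimes> f\<^sup>-\<^sup>1M\<close> (tensor product over \<open>f\<^sup>-\<^sup>1\<O>\<^sub>Y\<close>). As usual for a sheafification, its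
  sections are the families of elements of the stalks
  \<open>\<O>\<^sub>X\<^sub>,\<^sub>x \<otimes> M\<^sub>f\<^sub>x\<close> (over \<open>\<O>\<^sub>Y\<^sub>,\<^sub>f\<^sub>x\<close>) that are locally given by a finite sum
  \<open>\<Sum>\<^sub>i a\<^sub>i \<otimes> m\<^sub>i\<close> of sections.\<close>

type_synonym ('a, 'r, 'b, 'm) pbs = "'a \<Rightarrow> (('a, 'r) germ, ('b, 'm) germ) tens"

definition pb_stalk ::
  "('a, 'r, 'b, 's) rs_mor \<Rightarrow> ('b, 's, 'm) mod_sh \<Rightarrow> 'a \<Rightarrow>
   (('a, 'r) germ, (('a, 'r) germ, ('b, 'm) germ) tens) module" where
  "pb_stalk f M x = ext_scalars (ring_stalk (tgt f) (pt f x)) (ring_stalk (src f) x)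
     (stalk_comor f x) (mod_stalk (tgt f) M (pt f x))"

definition pb_tensor ::
  "('a, 'r, 'b, 's) rs_mor \<Rightarrow> ('b, 's, 'm) mod_sh \<Rightarrow> 'a \<Rightarrow>
   ('a, 'r) germ \<Rightarrow> ('b, 'm) germ \<Rightarrow> (('a, 'r) germ, ('b, 'm) germ) tens" where
  "pb_tensor f M x a m = tens_class (ring_stalk (tgt f) (pt f x)) (ring_stalk (src f) x)
     (stalk_comor f x) (mod_stalk (tgt f) M (pt f x)) (frag_of (a, m))"

definition pb_sections ::
  "('a, 'r, 'b, 's) rs_mor \<Rightarrow> ('b, 's, 'm) mod_sh \<Rightarrow> 'a set \<Rightarrow> ('a, 'r, 'b, 'm) pbs set" where
  "pb_sections f M W =
     {\<sigma> \<in> (\<Pi>\<^sub>E x\<in>W. carrier (pb_stalk f M x)).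
        \<forall>x\<in>W. \<exists>Z V (n::nat) a m. openin (rtop (src f)) Z \<and> x \<in> Z \<and> Z \<subseteq> W \<and>
          openin (rtop (tgt f)) V \<and> Z \<subseteq> preim f V \<and>
          (\<forall>i<n. a i \<in> carrier (rsec (src f) Z) \<and> m i \<in> carrier (msec M V)) \<and>
          (\<forall>y\<in>Z. \<sigma> y = (\<Oplus>\<^bsub>pb_stalk f M y\<^esub>i\<in>{..<n}.
             pb_tensor f M y (rgerm (src f) y Z (a i)) (mgerm (tgt f) M (pt f y) V (m i))))}"

definition pull :: "('a, 'r, 'b, 's) rs_mor \<Rightarrow> ('b, 's, 'm) mod_sh \<Rightarrow> ('a, 'r, ('a, 'r, 'b, 'm) pbs) mod_sh" where
  "pull f M = \<lparr>
     msec = (\<lambda>W. \<lparr>carrier = pb_sections f M W, monoid.mult = undefined, monoid.one = undefined,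
        ring.zero = (\<lambda>x\<in>W. \<zero>\<^bsub>pb_stalk f M x\<^esub>),
        ring.add = (\<lambda>\<sigma> \<tau>. \<lambda>x\<in>W. \<sigma> x \<oplus>\<^bsub>pb_stalk f M x\<^esub> \<tau> x),
        module.smult = (\<lambda>a \<sigma>. \<lambda>x\<in>W. rgerm (src f) x W a \<odot>\<^bsub>pb_stalk f M x\<^esub> \<sigma> x)\<rparr>),
     mres = (\<lambda>V W \<sigma>. restrict \<sigma> W)\<rparr>"

text \<open>The section \<open>1 \<otimes> m\<close> over the preimage of \<open>V\<close>, for a section \<open>m\<close> of \<open>M\<close> over \<open>V\<close>.\<close>

definition pull_sec ::
  "('a, 'r, 'b, 's) rs_mor \<Rightarrow> ('b, 's, 'm) mod_sh \<Rightarrow> 'b set \<Rightarrow> 'm \<Rightarrow> ('a, 'r, 'b, 'm) pbs" where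
  "pull_sec f M V m = (\<lambda>x\<in>preim f V.
     pb_tensor f M x \<one>\<^bsub>ring_stalk (src f) x\<^esub> (mgerm (tgt f) M (pt f x) V m))"

text \<open>\<open>f\<^sup>*u : f\<^sup>*M \<rightarrow> f\<^sup>*N\<close>, which is \<open>id \<otimes> u\<close> on stalks.\<close>

definition pull_map ::
  "('a, 'r, 'b, 's) rs_mor \<Rightarrow> ('b, 's, 'm) mod_sh \<Rightarrow> ('b, 's, 'n) mod_sh \<Rightarrow> ('b, 'm, 'n) sh_map \<Rightarrow>
   ('a, ('a, 'r, 'b, 'm) pbs, ('a, 'r, 'b, 'n) pbs) sh_map" where
  "pull_map f M N u = (\<lambda>W\<in>{W. openin (rtop (src f)) W}. \<lambda>\<sigma>\<in>carrier (msec (pull f M) W). \<lambda>x\<in>W.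
     tens_map (ring_stalk (tgt f) (pt f x)) (ring_stalk (src f) x) (stalk_comor f x)
       (mod_stalk (tgt f) N (pt f x))
       (\<lambda>g. \<Union>(V, m)\<in>g. mgerm (tgt f) N (pt f x) V (u V m)) (\<sigma> x))"

text \<open>The canonical isomorphism \<open>(f \<circ> q)\<^sup>*M \<rightarrow> q\<^sup>*f\<^sup>*M\<close>, given on stalks by
  \<open>b \<otimes> m \<mapsto> b \<otimes> (1 \<otimes> m)\<close>.\<close>

definition pull_comp ::
  "('a, 'r, 'b, 's) rs_mor \<Rightarrow> ('b, 's, 'c, 't) rs_mor \<Rightarrow> ('c, 't, 'm) mod_sh \<Rightarrow>
   ('a, ('a, 'r, 'c, 'm) pbs, ('a, 'r, 'b, ('b, 's, 'c, 'm) pbs) pbs) sh_map" where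
  "pull_comp q f M = (\<lambda>W\<in>{W. openin (rtop (src q)) W}. \<lambda>\<sigma>\<in>carrier (msec (pull (f \<circ>\<^sub>r q) M) W). \<lambda>x\<in>W.
     tens_map (ring_stalk (tgt q) (pt q x)) (ring_stalk (src q) x) (stalk_comor q x)
       (mod_stalk (tgt q) (pull f M) (pt q x))
       (\<lambda>g. \<Union>(V, m)\<in>g. mgerm (tgt q) (pull f M) (pt q x) (preim f V) (pull_sec f M V m)) (\<sigma> x))"

section \<open>Graded sheaves\<close>

type_synonym ('a, 'r, 'm) gr_sh = "int \<Rightarrow> ('a, 'r, 'm) mod_sh"
type_synonym ('a, 'm, 'n) gr_map = "int \<Rightarrow> ('a, 'm, 'n) sh_map"

text \<open>The abelian group of maps of graded sheaves that raise the degree by \<open>d\<close>; again \<open>mult\<close> and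
  \<open>one\<close> carry no information.\<close>

definition gr_hom ::
  "('a, 'r) ringed_sp \<Rightarrow> ('a, 'r, 'm) gr_sh \<Rightarrow> ('a, 'r, 'n) gr_sh \<Rightarrow> int \<Rightarrow> ('a, 'm, 'n) gr_map ring" where
  "gr_hom X A B d = \<lparr>
     carrier = {u. \<forall>n. u n \<in> sheaf_hom X (A n) (B (n + d))},
     monoid.mult = undefined, monoid.one = undefined,
     ring.zero = (\<lambda>n. sh_zero X (A n) (B (n + d))),
     ring.add = (\<lambda>u v n. sh_add X (A n) (B (n + d)) (u n) (v n))\<rparr>"

definition gr_id :: "('a, 'r) ringed_sp \<Rightarrow> ('a, 'r, 'm) gr_sh \<Rightarrow> ('a, 'm, 'm) gr_map" where
  "gr_id X A = (\<lambda>n. sh_id X (A n))"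

text \<open>Here \<open>d\<close> is the degree of the map \<open>u\<close> with source \<open>A\<close>.\<close>

definition gr_comp ::
  "('a, 'r) ringed_sp \<Rightarrow> ('a, 'r, 'm) gr_sh \<Rightarrow> int \<Rightarrow>
   ('a, 'n, 'p) gr_map \<Rightarrow> ('a, 'm, 'n) gr_map \<Rightarrow> ('a, 'm, 'p) gr_map" where
  "gr_comp X A d v u = (\<lambda>n. sh_comp X (A n) (v (n + d)) (u n))"

definition gr_pull ::
  "('a, 'r, 'b, 's) rs_mor \<Rightarrow> ('b, 's, 'm) gr_sh \<Rightarrow> ('a, 'r, ('a, 'r, 'b, 'm) pbs) gr_sh" where
  "gr_pull f E = (\<lambda>n. pull f (E n))"

text \<open>Pullback along \<open>q\<close> of a map \<open>u : t\<^sup>*E \<rightarrow> r\<^sup>*F\<close> of degree \<open>d\<close>, regarded as a map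
  \<open>(t \<circ> q)\<^sup>*E \<rightarrow> (r \<circ> q)\<^sup>*F\<close> through the canonical isomorphisms.\<close>

definition gr_pull_map ::
  "('a, 'r, 'b, 's) rs_mor \<Rightarrow> ('b, 's, 'c, 't) rs_mor \<Rightarrow> ('b, 's, 'c, 't) rs_mor \<Rightarrow>
   ('c, 't, 'm) gr_sh \<Rightarrow> ('c, 't, 'n) gr_sh \<Rightarrow> int \<Rightarrow>
   ('b, ('b, 's, 'c, 'm) pbs, ('b, 's, 'c, 'n) pbs) gr_map \<Rightarrow>
   ('a, ('a, 'r, 'c, 'm) pbs, ('a, 'r, 'c, 'n) pbs) gr_map" where
  "gr_pull_map q t r E F d u = (\<lambda>n.
     sh_comp (src q) (pull (t \<circ>\<^sub>r q) (E n))
       (sh_inv (src q) (pull (r \<circ>\<^sub>r q) (F (n + d))) (pull q (pull r (F (n + d)))) (pull_comp q r (F (n + d))))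
       (sh_comp (src q) (pull (t \<circ>\<^sub>r q) (E n))
         (pull_map q (pull t (E n)) (pull r (F (n + d))) (u n))
         (pull_comp q t (E n))))"

text \<open>A map \<open>(f \<circ> t)\<^sup>*E \<rightarrow> (g \<circ> r)\<^sup>*F\<close> of degree \<open>d\<close>, regarded as a map \<open>t\<^sup>*f\<^sup>*E \<rightarrow> r\<^sup>*g\<^sup>*F\<close>.\<close>

definition gr_regard ::
  "('a, 'r, 'b, 's) rs_mor \<Rightarrow> ('a, 'r, 'b, 's) rs_mor \<Rightarrow> ('b, 's, 'c, 't) rs_mor \<Rightarrow> ('b, 's, 'c, 't) rs_mor \<Rightarrow>
   ('c, 't, 'm) gr_sh \<Rightarrow> ('c, 't, 'n) gr_sh \<Rightarrow> int \<Rightarrow>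
   ('a, ('a, 'r, 'c, 'm) pbs, ('a, 'r, 'c, 'n) pbs) gr_map \<Rightarrow>
   ('a, ('a, 'r, 'b, ('b, 's, 'c, 'm) pbs) pbs, ('a, 'r, 'b, ('b, 's, 'c, 'n) pbs) pbs) gr_map" where
  "gr_regard t r f g E F d u = (\<lambda>n.
     sh_comp (src t) (pull t (pull f (E n)))
       (pull_comp r g (F (n + d)))
       (sh_comp (src t) (pull t (pull f (E n)))
         (u n)
         (sh_inv (src t) (pull (f \<circ>\<^sub>r t) (E n)) (pull t (pull f (E n))) (pull_comp t f (E n)))))"

definition chain_map ::
  "('a, 'r) ringed_sp \<Rightarrow> ('a, 'r, 'm) gr_sh \<Rightarrow> ('a, 'm, 'm) gr_map \<Rightarrow>
   ('a, 'r, 'n) gr_sh \<Rightarrow> ('a, 'n, 'n) gr_map \<Rightarrow> ('a, 'm, 'n) gr_map \<Rightarrow> bool" where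
  "chain_map X A dA B dB u \<longleftrightarrow> u \<in> carrier (gr_hom X A B 0) \<and> gr_comp X A 0 dB u = gr_comp X A 1 u dA"

definition chain_homotopic ::
  "('a, 'r) ringed_sp \<Rightarrow> ('a, 'r, 'm) gr_sh \<Rightarrow> ('a, 'm, 'm) gr_map \<Rightarrow>
   ('a, 'r, 'n) gr_sh \<Rightarrow> ('a, 'n, 'n) gr_map \<Rightarrow> ('a, 'm, 'n) gr_map \<Rightarrow> ('a, 'm, 'n) gr_map \<Rightarrow> bool" where
  "chain_homotopic X A dA B dB u v \<longleftrightarrow>
     (\<exists>s\<in>carrier (gr_hom X A B (-1)).
        u \<ominus>\<^bsub>gr_hom X A B 0\<^esub> v = gr_comp X A (-1) dB s \<oplus>\<^bsub>gr_hom X A B 0\<^esub> gr_comp X A 1 s dA)"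

definition homotopy_invertible ::
  "('a, 'r) ringed_sp \<Rightarrow> ('a, 'r, 'm) gr_sh \<Rightarrow> ('a, 'm, 'm) gr_map \<Rightarrow>
   ('a, 'r, 'n) gr_sh \<Rightarrow> ('a, 'n, 'n) gr_map \<Rightarrow> ('a, 'm, 'n) gr_map \<Rightarrow> bool" where
  "homotopy_invertible X A dA B dB u \<longleftrightarrow> chain_map X A dA B dB u \<and>
     (\<exists>v. chain_map X B dB A dA v \<and>
        chain_homotopic X A dA A dA (gr_comp X A 0 v u) (gr_id X A) \<and>
        chain_homotopic X B dB B dB (gr_comp X B 0 u v) (gr_id X B))"

section \<open>Simplicial ringed spaces\<close>

text \<open>The second argument of \<open>face\<close> and \<open>dgn\<close> is the level of the source:
  \<open>face \<U> k i : U\<^sub>k \<rightarrow> U\<^sub>k\<^sub>-\<^sub>1\<close> and \<open>dgn \<U> k i : U\<^sub>k \<rightarrow> U\<^sub>k\<^sub>+\<^sub>1\<close> for \<open>i \<le> k\<close>.\<close>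

record ('a, 'r) simp_rs =
  lev :: "nat \<Rightarrow> ('a, 'r) ringed_sp"
  face :: "nat \<Rightarrow> nat \<Rightarrow> ('a, 'r, 'a, 'r) rs_mor"
  dgn :: "nat \<Rightarrow> nat \<Rightarrow> ('a, 'r, 'a, 'r) rs_mor"

definition simplicial_ringed_space :: "('a, 'r) simp_rs \<Rightarrow> bool" where
  "simplicial_ringed_space U \<longleftrightarrow>
     (\<forall>k. ringed_space (lev U k)) \<and>
     (\<forall>k i. i \<le> Suc k \<longrightarrow> rs_morphism (lev U (Suc k)) (lev U k) (face U (Suc k) i)) \<and>
     (\<forall>k i. i \<le> k \<longrightarrow> rs_morphism (lev U k) (lev U (Suc k)) (dgn U k i)) \<and>
     (\<forall>k i j. i < j \<and> j \<le> k + 2 \<longrightarrow>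
        face U (k + 1) i \<circ>\<^sub>r face U (k + 2) j = face U (k + 1) (j - 1) \<circ>\<^sub>r face U (k + 2) i) \<and>
     (\<forall>k i j. i \<le> j \<and> j \<le> k \<longrightarrow>
        dgn U (k + 1) i \<circ>\<^sub>r dgn U k j = dgn U (k + 1) (j + 1) \<circ>\<^sub>r dgn U k i) \<and>
     (\<forall>k i j. i < j \<and> j \<le> k \<longrightarrow>
        face U (k + 1) i \<circ>\<^sub>r dgn U k j = dgn U (k - 1) (j - 1) \<circ>\<^sub>r face U k i) \<and>
     (\<forall>k j. j \<le> k \<longrightarrow> face U (k + 1) j \<circ>\<^sub>r dgn U k j = rs_id (lev U k) \<and>
        face U (k + 1) (j + 1) \<circ>\<^sub>r dgn U k j = rs_id (lev U k)) \<and>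
     (\<forall>k i j. j + 1 < i \<and> i \<le> k + 1 \<longrightarrow>
        face U (k + 1) i \<circ>\<^sub>r dgn U k j = dgn U (k - 1) j \<circ>\<^sub>r face U k (i - 1))"

definition simplicial_map ::
  "('a, 'r) simp_rs \<Rightarrow> ('b, 's) simp_rs \<Rightarrow> (nat \<Rightarrow> ('a, 'r, 'b, 's) rs_mor) \<Rightarrow> bool" where
  "simplicial_map U V f \<longleftrightarrow>
     (\<forall>k. rs_morphism (lev U k) (lev V k) (f k)) \<and>
     (\<forall>k i. i \<le> Suc k \<longrightarrow> face V (Suc k) i \<circ>\<^sub>r f (Suc k) = f k \<circ>\<^sub>r face U (Suc k) i) \<and>
     (\<forall>k i. i \<le> k \<longrightarrow> dgn V k i \<circ>\<^sub>r f k = f (Suc k) \<circ>\<^sub>r dgn U k i)"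

text \<open>\<open>h p i : U\<^sub>p \<rightarrow> V\<^sub>p\<^sub>+\<^sub>1\<close> for \<open>i \<le> p\<close>.\<close>

definition simplicial_homotopy ::
  "('a, 'r) simp_rs \<Rightarrow> ('b, 's) simp_rs \<Rightarrow> (nat \<Rightarrow> ('a, 'r, 'b, 's) rs_mor) \<Rightarrow>
   (nat \<Rightarrow> ('a, 'r, 'b, 's) rs_mor) \<Rightarrow> (nat \<Rightarrow> nat \<Rightarrow> ('a, 'r, 'b, 's) rs_mor) \<Rightarrow> bool" where
  "simplicial_homotopy U V f g h \<longleftrightarrow>
     (\<forall>p i. i \<le> p \<longrightarrow> rs_morphism (lev U p) (lev V (p + 1)) (h p i)) \<and>
     (\<forall>p. face V (p + 1) 0 \<circ>\<^sub>r h p 0 = f p) \<and>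
     (\<forall>p. face V (p + 1) (p + 1) \<circ>\<^sub>r h p p = g p) \<and>
     (\<forall>p i j. i < j \<and> j \<le> p \<longrightarrow>
        face V (p + 1) i \<circ>\<^sub>r h p j = h (p - 1) (j - 1) \<circ>\<^sub>r face U p i) \<and>
     (\<forall>p i. 0 < i \<and> i \<le> p \<longrightarrow> face V (p + 1) i \<circ>\<^sub>r h p i = face V (p + 1) i \<circ>\<^sub>r h p (i - 1)) \<and>
     (\<forall>p i j. j + 1 < i \<and> i \<le> p + 1 \<longrightarrow>
        face V (p + 1) i \<circ>\<^sub>r h p j = h (p - 1) j \<circ>\<^sub>r face U p (i - 1)) \<and>
     (\<forall>p i j. i \<le> j \<and> j \<le> p \<longrightarrow>
        dgn V (p + 1) i \<circ>\<^sub>r h p j = h (p + 1) (j + 1) \<circ>\<^sub>r dgn U p i) \<and>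
     (\<forall>p i j. j < i \<and> i \<le> p + 1 \<longrightarrow>
        dgn V (p + 1) i \<circ>\<^sub>r h p j = h (p + 1) j \<circ>\<^sub>r dgn U p (i - 1))"

text \<open>\<open>rho U k p = \<partial>\<^bsub>p+1\<^esub> \<circ> \<dots> \<circ> \<partial>\<^bsub>k\<^esub>\<close> and \<open>tau U k p = \<partial>\<^bsub>0\<^esub> \<circ> \<dots> \<circ> \<partial>\<^bsub>0\<^esub>\<close> from \<open>U\<^sub>k\<close> to \<open>U\<^sub>p\<close>, used for \<open>p \<le> k\<close>.\<close>

primrec rho :: "('a, 'r) simp_rs \<Rightarrow> nat \<Rightarrow> nat \<Rightarrow> ('a, 'r, 'a, 'r) rs_mor" where
  "rho U 0 p = rs_id (lev U 0)"
| "rho U (Suc k) p = (if Suc k \<le> p then rs_id (lev U (Suc k)) else rho U k p \<circ>\<^sub>r face U (Suc k) (Suc k))"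

primrec tau :: "('a, 'r) simp_rs \<Rightarrow> nat \<Rightarrow> nat \<Rightarrow> ('a, 'r, 'a, 'r) rs_mor" where
  "tau U 0 p = rs_id (lev U 0)"
| "tau U (Suc k) p = (if Suc k \<le> p then rs_id (lev U (Suc k)) else tau U k p \<circ>\<^sub>r face U (Suc k) 0)"

section \<open>Differential graded categories\<close>

definition sgn_act :: "('m, 'x) ring_scheme \<Rightarrow> int \<Rightarrow> 'm \<Rightarrow> 'm" where
  "sgn_act G n x = (if even n then x else \<ominus>\<^bsub>G\<^esub> x)"

text \<open>\<open>dhom C X Y n\<close> is the abelian group of degree \<open>n\<close> morphisms; its fields \<open>mult\<close> and \<open>one\<close>
  carry no information. In \<open>dcomp C X Y Z p q v u\<close> the morphism \<open>v : Y \<rightarrow> Z\<close> has degree \<open>p\<close> and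
  \<open>u : X \<rightarrow> Y\<close> has degree \<open>q\<close>. The ground ring is \<open>\<int>\<close>.\<close>

record ('o, 'm) dg_cat =
  dobj :: "'o set"
  dhom :: "'o \<Rightarrow> 'o \<Rightarrow> int \<Rightarrow> 'm ring"
  ddiff :: "'o \<Rightarrow> 'o \<Rightarrow> int \<Rightarrow> 'm \<Rightarrow> 'm"
  dcomp :: "'o \<Rightarrow> 'o \<Rightarrow> 'o \<Rightarrow> int \<Rightarrow> int \<Rightarrow> 'm \<Rightarrow> 'm \<Rightarrow> 'm"
  dident :: "'o \<Rightarrow> 'm"

definition additive_map :: "'m ring \<Rightarrow> 'n ring \<Rightarrow> ('m \<Rightarrow> 'n) \<Rightarrow> bool" where
  "additive_map G H f \<longleftrightarrow> f \<in> carrier G \<rightarrow> carrier H \<and>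
     (\<forall>x\<in>carrier G. \<forall>y\<in>carrier G. f (x \<oplus>\<^bsub>G\<^esub> y) = f x \<oplus>\<^bsub>H\<^esub> f y)"

definition dg_category :: "('o, 'm) dg_cat \<Rightarrow> bool" where
  "dg_category C \<longleftrightarrow>
     (\<forall>X\<in>dobj C. \<forall>Y\<in>dobj C. \<forall>n.
        abelian_group (dhom C X Y n) \<and>
        additive_map (dhom C X Y n) (dhom C X Y (n + 1)) (ddiff C X Y n) \<and>
        (\<forall>u\<in>carrier (dhom C X Y n).
           ddiff C X Y (n + 1) (ddiff C X Y n u) = \<zero>\<^bsub>dhom C X Y (n + 2)\<^esub>)) \<and>
     (\<forall>X\<in>dobj C. \<forall>Y\<in>dobj C. \<forall>Z\<in>dobj C. \<forall>p q.
        (\<forall>u\<in>carrier (dhom C X Y q).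
           additive_map (dhom C Y Z p) (dhom C X Z (p + q)) (\<lambda>v. dcomp C X Y Z p q v u)) \<and>
        (\<forall>v\<in>carrier (dhom C Y Z p).
           additive_map (dhom C X Y q) (dhom C X Z (p + q)) (dcomp C X Y Z p q v)) \<and>
        (\<forall>v\<in>carrier (dhom C Y Z p). \<forall>u\<in>carrier (dhom C X Y q).
           ddiff C X Z (p + q) (dcomp C X Y Z p q v u) =
             dcomp C X Y Z (p + 1) q (ddiff C Y Z p v) u \<oplus>\<^bsub>dhom C X Z (p + q + 1)\<^esub>
             sgn_act (dhom C X Z (p + q + 1)) p (dcomp C X Y Z p (q + 1) v (ddiff C X Y q u)))) \<and>
     (\<forall>W\<in>dobj C. \<forall>X\<in>dobj C. \<forall>Y\<in>dobj C. \<forall>Z\<in>dobj C. \<forall>p q r.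
        \<forall>w\<in>carrier (dhom C Y Z p). \<forall>v\<in>carrier (dhom C X Y q). \<forall>u\<in>carrier (dhom C W X r).
          dcomp C W Y Z p (q + r) w (dcomp C W X Y q r v u) =
          dcomp C W X Z (p + q) r (dcomp C X Y Z p q w v) u) \<and>
     (\<forall>X\<in>dobj C. dident C X \<in> carrier (dhom C X X 0)) \<and>
     (\<forall>X\<in>dobj C. \<forall>Y\<in>dobj C. \<forall>n. \<forall>u\<in>carrier (dhom C X Y n).
        dcomp C X Y Y 0 n (dident C Y) u = u \<and> dcomp C X X Y n 0 u (dident C X) = u)"

record ('o, 'm, 'p, 'n) dg_fun =
  fobj :: "'o \<Rightarrow> 'p"
  fmor :: "'o \<Rightarrow> 'o \<Rightarrow> int \<Rightarrow> 'm \<Rightarrow> 'n"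

definition dg_functor :: "('o, 'm) dg_cat \<Rightarrow> ('p, 'n) dg_cat \<Rightarrow> ('o, 'm, 'p, 'n) dg_fun \<Rightarrow> bool" where
  "dg_functor C D F \<longleftrightarrow>
     (\<forall>X\<in>dobj C. fobj F X \<in> dobj D) \<and>
     (\<forall>X\<in>dobj C. \<forall>Y\<in>dobj C. \<forall>n.
        additive_map (dhom C X Y n) (dhom D (fobj F X) (fobj F Y) n) (fmor F X Y n) \<and>
        (\<forall>u\<in>carrier (dhom C X Y n).
           fmor F X Y (n + 1) (ddiff C X Y n u) = ddiff D (fobj F X) (fobj F Y) n (fmor F X Y n u))) \<and>
     (\<forall>X\<in>dobj C. fmor F X X 0 (dident C X) = dident D (fobj F X)) \<and>
     (\<forall>X\<in>dobj C. \<forall>Y\<in>dobj C. \<forall>Z\<in>dobj C. \<forall>p q.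
        \<forall>v\<in>carrier (dhom C Y Z p). \<forall>u\<in>carrier (dhom C X Y q).
          fmor F X Z (p + q) (dcomp C X Y Z p q v u) =
          dcomp D (fobj F X) (fobj F Y) (fobj F Z) p q (fmor F Y Z p v) (fmor F X Y q u))"

text \<open>A homogeneous morphism, recorded with source, target and degree.\<close>

type_synonym ('o, 'm) arrow = "'o \<times> 'o \<times> int \<times> 'm"

text \<open>The list \<open>[u\<^sub>b, \<dots>, u\<^sub>a]\<close>, standing for \<open>u\<^sub>b \<otimes> \<dots> \<otimes> u\<^sub>a\<close>, where \<open>u\<^sub>i : X\<^sub>i\<^sub>-\<^sub>1 \<rightarrow> X\<^sub>i\<close> has degree
  \<open>m i\<close>; it is empty if \<open>b < a\<close>.\<close>

definition tensor_word :: "(nat \<Rightarrow> 'o) \<Rightarrow> (nat \<Rightarrow> int) \<Rightarrow> (nat \<Rightarrow> 'm) \<Rightarrow> nat \<Rightarrow> nat \<Rightarrow> ('o, 'm) arrow list" where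
  "tensor_word X m u b a = map (\<lambda>i. (X (i - 1), X i, m i, u i)) (rev [a..<Suc b])"

definition composable :: "('o, 'm) dg_cat \<Rightarrow> nat \<Rightarrow> (nat \<Rightarrow> 'o) \<Rightarrow> (nat \<Rightarrow> int) \<Rightarrow> (nat \<Rightarrow> 'm) \<Rightarrow> bool" where
  "composable C l X m u \<longleftrightarrow> (\<forall>i\<le>l. X i \<in> dobj C) \<and>
     (\<forall>i\<in>{1..l}. u i \<in> carrier (dhom C (X (i - 1)) (X i) (m i)))"

text \<open>The components of a transformation are \<open>\<Phi> X [] = \<Phi>\<^sub>0(X)\<close> and
  \<open>\<Phi> X\<^sub>0 [u\<^sub>l, \<dots>, u\<^sub>1] = \<Phi>\<^sub>l(u\<^sub>l \<otimes> \<dots> \<otimes> u\<^sub>1)\<close>, where \<open>X\<^sub>0\<close> is the source of \<open>u\<^sub>1\<close>. Linearity on the tensor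
  product is additivity in each argument. Since \<open>tensor_word X m u 0 1 = []\<close>, the
  terms with \<open>\<Phi>\<^sub>l\<^sub>-\<^sub>1\<close> of no arguments are the ones with \<open>\<Phi>\<^sub>0(X\<^sub>0)\<close> and \<open>\<Phi>\<^sub>0(X\<^sub>1)\<close> if \<open>l = 1\<close>.\<close>

definition A_infinity_nat_trans ::
  "('o, 'm) dg_cat \<Rightarrow> ('p, 'n) dg_cat \<Rightarrow> ('o, 'm, 'p, 'n) dg_fun \<Rightarrow> ('o, 'm, 'p, 'n) dg_fun \<Rightarrow>
   ('o \<Rightarrow> ('o, 'm) arrow list \<Rightarrow> 'n) \<Rightarrow> bool" where
  "A_infinity_nat_trans C D F G \<Phi> \<longleftrightarrow>
     dg_category C \<and> dg_category D \<and> dg_functor C D F \<and> dg_functor C D G \<and>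
     (\<forall>X\<in>dobj C. \<Phi> X [] \<in> carrier (dhom D (fobj F X) (fobj G X) 0) \<and>
        ddiff D (fobj F X) (fobj G X) 0 (\<Phi> X []) = \<zero>\<^bsub>dhom D (fobj F X) (fobj G X) 1\<^esub>) \<and>
     (\<forall>l\<ge>1. \<forall>X m u. composable C l X m u \<longrightarrow>
        \<Phi> (X 0) (tensor_word X m u l 1) \<in> carrier (dhom D (fobj F (X 0)) (fobj G (X l)) ((\<Sum>j=1..l. m j) - int l))) \<and>
     (\<forall>l\<ge>1. \<forall>X m u. composable C l X m u \<longrightarrow>
        (\<forall>i\<in>{1..l}. \<forall>v\<in>carrier (dhom C (X (i - 1)) (X i) (m i)).
           \<Phi> (X 0) (tensor_word X m (u(i := u i \<oplus>\<^bsub>dhom C (X (i - 1)) (X i) (m i)\<^esub> v)) l 1) =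
             \<Phi> (X 0) (tensor_word X m u l 1)
             \<oplus>\<^bsub>dhom D (fobj F (X 0)) (fobj G (X l)) ((\<Sum>j=1..l. m j) - int l)\<^esub>
             \<Phi> (X 0) (tensor_word X m (u(i := v)) l 1))) \<and>
     (\<forall>l\<ge>1. \<forall>X m u. composable C l X m u \<longrightarrow>
        (let H = dhom D (fobj F (X 0)) (fobj G (X l)) ((\<Sum>j=1..l. m j) - int l + 1) in
         \<zero>\<^bsub>H\<^esub> =
           ddiff D (fobj F (X 0)) (fobj G (X l)) ((\<Sum>j=1..l. m j) - int l) (\<Phi> (X 0) (tensor_word X m u l 1))
           \<oplus>\<^bsub>H\<^esub> sgn_act H (m l - 1)
               (dcomp D (fobj F (X 0)) (fobj G (X (l - 1))) (fobj G (X l))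
                  (m l) ((\<Sum>j=1..l-1. m j) - (int l - 1))
                  (fmor G (X (l - 1)) (X l) (m l) (u l)) (\<Phi> (X 0) (tensor_word X m u (l - 1) 1)))
           \<oplus>\<^bsub>H\<^esub> sgn_act H (- (\<Sum>j=1..l. m j) + int l - 1)
               (dcomp D (fobj F (X 0)) (fobj F (X 1)) (fobj G (X l))
                  ((\<Sum>j=2..l. m j) - (int l - 1)) (m 1)
                  (\<Phi> (X 1) (tensor_word X m u l 2)) (fmor F (X 0) (X 1) (m 1) (u 1)))
           \<oplus>\<^bsub>H\<^esub> (\<Oplus>\<^bsub>H\<^esub>i\<in>{1..l}. sgn_act H ((\<Sum>j=i+1..l. m j) + int l - int i + 1)
               (\<Phi> (X 0) (tensor_word X m u l (i + 1) @
                  [(X (i - 1), X i, m i + 1, ddiff C (X (i - 1)) (X i) (m i) (u i))] @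
                  tensor_word X m u (i - 1) 1)))
           \<oplus>\<^bsub>H\<^esub> (\<Oplus>\<^bsub>H\<^esub>i\<in>{1..l-1}. sgn_act H ((\<Sum>j=i+1..l. m j) + int l - int i + 1)
               (\<Phi> (X 0) (tensor_word X m u l (i + 2) @
                  [(X (i - 1), X (i + 1), m (i + 1) + m i,
                    dcomp C (X (i - 1)) (X i) (X (i + 1)) (m (i + 1)) (m i) (u (i + 1)) (u i))] @
                  tensor_word X m u (i - 1) 1)))))"

section \<open>Twisted complexes\<close>

text \<open>The maps \<open>\<tau>\<^bsub>k,0\<^esub>\<^sup>*E \<rightarrow> \<rho>\<^bsub>k,0\<^esub>\<^sup>*F\<close> (all \<open>k\<close>) over a simplicial ringed space; \<open>'m\<close> is the type of
  sections of \<open>E\<close> and \<open>F\<close>.\<close>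

type_synonym ('a, 'r, 'm) tw_mor = "nat \<Rightarrow> ('a, ('a, 'r, 'a, 'm) pbs, ('a, 'r, 'a, 'm) pbs) gr_map"
type_synonym ('a, 'r, 'm) tw_obj = "('a, 'r, 'm) gr_sh \<times> ('a, 'r, 'm) tw_mor"

definition bi_hom ::
  "('a, 'r) simp_rs \<Rightarrow> ('a, 'r, 'm) gr_sh \<Rightarrow> ('a, 'r, 'm) gr_sh \<Rightarrow> nat \<Rightarrow> int \<Rightarrow>
   ('a, ('a, 'r, 'a, 'm) pbs, ('a, 'r, 'a, 'm) pbs) gr_map ring" where
  "bi_hom U E F p q = gr_hom (lev U p) (gr_pull (tau U p 0) E) (gr_pull (rho U p 0) F) q"

text \<open>Families \<open>\<theta>\<^bsup>k,m-k\<^esup>\<close> of total degree \<open>m\<close>.\<close>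

definition tw_hom ::
  "('a, 'r) simp_rs \<Rightarrow> ('a, 'r, 'm) gr_sh \<Rightarrow> ('a, 'r, 'm) gr_sh \<Rightarrow> int \<Rightarrow> ('a, 'r, 'm) tw_mor ring" where
  "tw_hom U E F m = \<lparr>
     carrier = {\<theta>. \<forall>k. \<theta> k \<in> carrier (bi_hom U E F k (m - int k))},
     monoid.mult = undefined, monoid.one = undefined,
     ring.zero = (\<lambda>k. \<zero>\<^bsub>bi_hom U E F k (m - int k)\<^esub>),
     ring.add = (\<lambda>\<theta> \<eta> k. \<theta> k \<oplus>\<^bsub>bi_hom U E F k (m - int k)\<^esub> \<eta> k)\<rparr>"

text \<open>For \<open>q : U\<^sub>k \<rightarrow> U\<^sub>p\<close>, the pullback \<open>q\<^sup>*u\<close> of a map \<open>u : \<tau>\<^bsub>p,0\<^esub>\<^sup>*E \<rightarrow> \<rho>\<^bsub>p,0\<^esub>\<^sup>*F\<close> of degree \<open>d\<close>.\<close>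

definition bi_pull ::
  "('a, 'r) simp_rs \<Rightarrow> ('a, 'r, 'a, 'r) rs_mor \<Rightarrow> ('a, 'r, 'm) gr_sh \<Rightarrow> ('a, 'r, 'm) gr_sh \<Rightarrow> nat \<Rightarrow> int \<Rightarrow>
   ('a, ('a, 'r, 'a, 'm) pbs, ('a, 'r, 'a, 'm) pbs) gr_map \<Rightarrow>
   ('a, ('a, 'r, 'a, 'm) pbs, ('a, 'r, 'a, 'm) pbs) gr_map" where
  "bi_pull U q E F p d u = gr_pull_map q (tau U p 0) (rho U p 0) E F d u"

text \<open>\<open>m\<close> is the total degree of \<open>\<theta>\<close>.\<close>

definition tw_delta ::
  "('a, 'r) simp_rs \<Rightarrow> ('a, 'r, 'm) gr_sh \<Rightarrow> ('a, 'r, 'm) gr_sh \<Rightarrow> int \<Rightarrow>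
   ('a, 'r, 'm) tw_mor \<Rightarrow> ('a, 'r, 'm) tw_mor" where
  "tw_delta U E F m \<theta> = (\<lambda>k.
     \<Oplus>\<^bsub>bi_hom U E F k (m + 1 - int k)\<^esub>j\<in>{1..<k}. sgn_act (bi_hom U E F k (m + 1 - int k)) (int j)
       (bi_pull U (face U k j) E F (k - 1) (m - int (k - 1)) (\<theta> (k - 1))))"

text \<open>\<open>u : F \<rightarrow> G\<close> and \<open>v : E \<rightarrow> F\<close> have total degrees \<open>m\<close> and \<open>m'\<close>; the sum is over
  \<open>p + r = k\<close>, and the sign is \<open>(-1)\<^bsup>qr\<^esup>\<close> with \<open>q = m - p\<close>.\<close>

definition tw_comp ::
  "('a, 'r) simp_rs \<Rightarrow> ('a, 'r, 'm) gr_sh \<Rightarrow> ('a, 'r, 'm) gr_sh \<Rightarrow> ('a, 'r, 'm) gr_sh \<Rightarrow> int \<Rightarrow> int \<Rightarrow>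
   ('a, 'r, 'm) tw_mor \<Rightarrow> ('a, 'r, 'm) tw_mor \<Rightarrow> ('a, 'r, 'm) tw_mor" where
  "tw_comp U E F G m m' u v = (\<lambda>k.
     \<Oplus>\<^bsub>bi_hom U E G k (m + m' - int k)\<^esub>p\<in>{..k}.
       let r = k - p; q = m - int p; s = m' - int r in
       sgn_act (bi_hom U E G k (m + m' - int k)) (q * int r)
         (gr_comp (lev U k) (gr_pull (tau U k 0) E) s
            (bi_pull U (rho U k p) F G p q (u p))
            (bi_pull U (tau U k r) E F r s (v r))))"

definition twisted_complex :: "('a, 'r) simp_rs \<Rightarrow> ('a, 'r, 'm) tw_obj \<Rightarrow> bool" where
  "twisted_complex U \<E> \<longleftrightarrow> (case \<E> of (E, a) \<Rightarrow>
     (\<forall>n. module_sheaf (lev U 0) (E n)) \<and>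
     a \<in> carrier (tw_hom U E E 1) \<and>
     tw_delta U E E 1 a \<oplus>\<^bsub>tw_hom U E E 2\<^esub> tw_comp U E E E 1 1 a a = \<zero>\<^bsub>tw_hom U E E 2\<^esub> \<and>
     homotopy_invertible (lev U 1)
       (gr_pull (tau U 1 0) E) (bi_pull U (tau U 1 0) E E 0 1 (a 0))
       (gr_pull (rho U 1 0) E) (bi_pull U (rho U 1 0) E E 0 1 (a 0))
       (a 1))"

definition tw_diff ::
  "('a, 'r) simp_rs \<Rightarrow> ('a, 'r, 'm) tw_obj \<Rightarrow> ('a, 'r, 'm) tw_obj \<Rightarrow> int \<Rightarrow>
   ('a, 'r, 'm) tw_mor \<Rightarrow> ('a, 'r, 'm) tw_mor" where
  "tw_diff U \<E> \<F> m \<theta> = (case \<E> of (E, a) \<Rightarrow> case \<F> of (F, b) \<Rightarrow>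
     let H = tw_hom U E F (m + 1) in
     (tw_delta U E F m \<theta> \<oplus>\<^bsub>H\<^esub> tw_comp U E F F 1 m b \<theta>)
       \<ominus>\<^bsub>H\<^esub> sgn_act H m (tw_comp U E E F m 1 \<theta> a))"

definition tw_ident :: "('a, 'r) simp_rs \<Rightarrow> ('a, 'r, 'm) tw_obj \<Rightarrow> ('a, 'r, 'm) tw_mor" where
  "tw_ident U \<E> = (\<lambda>k. if k = 0 then gr_id (lev U 0) (gr_pull (tau U 0 0) (fst \<E>))
     else \<zero>\<^bsub>bi_hom U (fst \<E>) (fst \<E>) k (- int k)\<^esub>)"

definition Tw :: "('a, 'r) simp_rs \<Rightarrow> (('a, 'r, 'm) tw_obj, ('a, 'r, 'm) tw_mor) dg_cat" where
  "Tw U = \<lparr>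
     dobj = {\<E>. twisted_complex U \<E>},
     dhom = (\<lambda>\<E> \<F> m. tw_hom U (fst \<E>) (fst \<F>) m),
     ddiff = tw_diff U,
     dcomp = (\<lambda>\<E> \<F> \<G> m m' u v. tw_comp U (fst \<E>) (fst \<F>) (fst \<G>) m m' u v),
     dident = tw_ident U\<rparr>"

subsection \<open>Pullback of twisted complexes and homotopies\<close>

text \<open>For \<open>q : U\<^sub>k \<rightarrow> V\<^sub>l\<close> with \<open>\<tau>\<^bsub>l,0\<^esub> \<circ> q = f\<^sub>0 \<circ> \<tau>\<^bsub>k,0\<^esub>\<close> and \<open>\<rho>\<^bsub>l,0\<^esub> \<circ> q = g\<^sub>0 \<circ> \<rho>\<^bsub>k,0\<^esub>\<close>, the pullback
  along \<open>q\<close> sends a map \<open>\<tau>\<^bsub>l,0\<^esub>\<^sup>*E \<rightarrow> \<rho>\<^bsub>l,0\<^esub>\<^sup>*F\<close> of degree \<open>d\<close> to a map \<open>\<tau>\<^bsub>k,0\<^esub>\<^sup>*f\<^sub>0\<^sup>*E \<rightarrow> \<rho>\<^bsub>k,0\<^esub>\<^sup>*g\<^sub>0\<^sup>*F\<close>.\<close>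

definition simp_pull ::
  "('a, 'r) simp_rs \<Rightarrow> ('b, 's) simp_rs \<Rightarrow> ('a, 'r, 'b, 's) rs_mor \<Rightarrow> ('a, 'r, 'b, 's) rs_mor \<Rightarrow>
   nat \<Rightarrow> nat \<Rightarrow> ('a, 'r, 'b, 's) rs_mor \<Rightarrow> ('b, 's, 'm) gr_sh \<Rightarrow> ('b, 's, 'm) gr_sh \<Rightarrow> int \<Rightarrow>
   ('b, ('b, 's, 'b, 'm) pbs, ('b, 's, 'b, 'm) pbs) gr_map \<Rightarrow>
   ('a, ('a, 'r, 'a, ('a, 'r, 'b, 'm) pbs) pbs, ('a, 'r, 'a, ('a, 'r, 'b, 'm) pbs) pbs) gr_map" where
  "simp_pull U V f0 g0 k l q E F d u =
     gr_regard (tau U k 0) (rho U k 0) f0 g0 E F d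
       (gr_pull_map q (tau V l 0) (rho V l 0) E F d u)"

definition tw_pull_mor ::
  "('a, 'r) simp_rs \<Rightarrow> ('b, 's) simp_rs \<Rightarrow> (nat \<Rightarrow> ('a, 'r, 'b, 's) rs_mor) \<Rightarrow>
   ('b, 's, 'm) gr_sh \<Rightarrow> ('b, 's, 'm) gr_sh \<Rightarrow> int \<Rightarrow>
   ('b, 's, 'm) tw_mor \<Rightarrow> ('a, 'r, ('a, 'r, 'b, 'm) pbs) tw_mor" where
  "tw_pull_mor U V f E F m \<phi> = (\<lambda>k. simp_pull U V (f 0) (f 0) k k (f k) E F (m - int k) (\<phi> k))"

definition tw_pullback ::
  "('a, 'r) simp_rs \<Rightarrow> ('b, 's) simp_rs \<Rightarrow> (nat \<Rightarrow> ('a, 'r, 'b, 's) rs_mor) \<Rightarrow>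
   (('b, 's, 'm) tw_obj, ('b, 's, 'm) tw_mor,
    ('a, 'r, ('a, 'r, 'b, 'm) pbs) tw_obj, ('a, 'r, ('a, 'r, 'b, 'm) pbs) tw_mor) dg_fun" where
  "tw_pullback U V f = \<lparr>
     fobj = (\<lambda>(E, a). (gr_pull (f 0) E, tw_pull_mor U V f E E 1 a)),
     fmor = (\<lambda>\<E> \<F> m \<phi>. tw_pull_mor U V f (fst \<E>) (fst \<F>) m \<phi>)\<rparr>"

text \<open>The family \<open>\<Sum>\<^bsub>i\<le>k\<^esub> (-1)\<^bsup>i\<^esup> h\<^sub>i\<^sup>*(\<phi>\<^bsup>k+1,m-k-1\<^esup>)\<close>, of total degree \<open>m - 1\<close>.\<close>

definition homotopy_sum ::
  "('a, 'r) simp_rs \<Rightarrow> ('b, 's) simp_rs \<Rightarrow> (nat \<Rightarrow> ('a, 'r, 'b, 's) rs_mor) \<Rightarrow>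
   (nat \<Rightarrow> ('a, 'r, 'b, 's) rs_mor) \<Rightarrow> (nat \<Rightarrow> nat \<Rightarrow> ('a, 'r, 'b, 's) rs_mor) \<Rightarrow>
   ('b, 's, 'm) gr_sh \<Rightarrow> ('b, 's, 'm) gr_sh \<Rightarrow> int \<Rightarrow>
   ('b, 's, 'm) tw_mor \<Rightarrow> ('a, 'r, ('a, 'r, 'b, 'm) pbs) tw_mor" where
  "homotopy_sum U V f g h E F m \<phi> = (\<lambda>k.
     let H = bi_hom U (gr_pull (f 0) E) (gr_pull (g 0) F) k (m - 1 - int k) in
     \<Oplus>\<^bsub>H\<^esub>i\<in>{..k}. sgn_act H (int i)
       (simp_pull U V (f 0) (g 0) k (k + 1) (h k i) E F (m - int (k + 1)) (\<phi> (k + 1))))"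

text \<open>\<open>\<Phi>\<^sub>0\<close>, \<open>\<Phi>\<^sub>1\<close> and \<open>\<Phi>\<^sub>l = 0\<close> for \<open>l \<ge> 2\<close>, in the encoding described before
  \<open>A_infinity_nat_trans\<close>. In the last case the value is the zero of the group of morphisms from \<open>f\<^sup>*\<E>\<close> to
  \<open>g\<^sup>*\<F>\<close> of degree \<open>\<bar>u\<^sub>l\<bar> + \<dots> + \<bar>u\<^sub>1\<bar> - l\<close>, where \<open>\<F>\<close> is the target of \<open>u\<^sub>l\<close>.\<close>

definition homotopy_transformation ::
  "('a, 'r) simp_rs \<Rightarrow> ('b, 's) simp_rs \<Rightarrow> (nat \<Rightarrow> ('a, 'r, 'b, 's) rs_mor) \<Rightarrow>
   (nat \<Rightarrow> ('a, 'r, 'b, 's) rs_mor) \<Rightarrow> (nat \<Rightarrow> nat \<Rightarrow> ('a, 'r, 'b, 's) rs_mor) \<Rightarrow>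
   ('b, 's, 'm) tw_obj \<Rightarrow> (('b, 's, 'm) tw_obj, ('b, 's, 'm) tw_mor) arrow list \<Rightarrow>
   ('a, 'r, ('a, 'r, 'b, 'm) pbs) tw_mor" where
  "homotopy_transformation U V f g h \<E> us = (case us of
      [] \<Rightarrow> homotopy_sum U V f g h (fst \<E>) (fst \<E>) 1 (snd \<E>)
    | [(_, \<F>, m, \<phi>)] \<Rightarrow>
        sgn_act (tw_hom U (gr_pull (f 0) (fst \<E>)) (gr_pull (g 0) (fst \<F>)) (m - 1)) (m - 1)
          (homotopy_sum U V f g h (fst \<E>) (fst \<F>) m \<phi>)
    | (_, \<F>, _, _) # _ # _ \<Rightarrow>
        \<zero>\<^bsub>tw_hom U (gr_pull (f 0) (fst \<E>)) (gr_pull (g 0) (fst \<F>))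
           (sum_list (map (\<lambda>(_, _, m, _). m) us) - int (length us))\<^esub>)"

end

theory Submission
  imports Defs
begin

text \<open>Put \<open>Hu = \<Sum>\<^sub>i (-1)\<^sup>i h\<^sub>i\<^sup>*u\<close>. In \<open>H(\<delta>u)\<close> the terms \<open>h\<^sub>i\<^sup>*\<partial>\<^sub>j\<^sup>*u\<close> with \<open>j\<close> equal to \<open>i\<close> or \<open>i + 1\<close> cancel in
  pairs, and the others give \<open>-\<delta>(Hu)\<close>. In \<open>H(u \<cdot> v)\<close> a map \<open>h\<^sub>i\<close> restricts to a homotopy map on the front
  face and to \<open>f\<close> on the back one, or to \<open>g\<close> on the front face and a homotopy map on the back one, so
  \<open>H(u \<cdot> v) = Hu \<cdot> f\<^sup>*v + (-1)\<^bsup>|u|\<^esup> g\<^sup>*u \<cdot> Hv\<close>. Applied to \<open>\<delta>a + a \<cdot> a = 0\<close>, to \<open>d\<phi>\<close> and to a composition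
  of two morphisms, these identities are the relations for \<open>l = 1, 2\<close> and closedness of \<open>\<Phi>\<^sub>0\<close>; for \<open>l = 3\<close>
  and beyond every term vanishes. The canonical isomorphisms of pullbacks are handled on stalks, as
  extensions of scalars.\<close>

text \<open>In the statement (f g)^* = g^*f^* is treated as an identity, but here composite and
  iterated pullbacks have sections of different types, and the identification is the explicit map
  \<open>pull_comp\<close> with an inverse picked by \<open>inv_into\<close>. Every formula carries
  these isomorphisms, so naturality and a cocycle rule for them are needed before any sign can be
  compared. They are accessible because f^*M is locally generated by the sections 1 \<otimes> m:
  module maps out of it agree as soon as they agree on \<open>pull_sec\<close>, and each coherence
  becomes a computation with elements such as 1 \<otimes> (1 \<otimes> m). Once
  \<open>gr_transport\<close> absorbs pullbacks on both sides, what remains are equalities between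
  composites of faces and homotopy maps, together with bijections between index sets of double sums.
  The sign (-1)^(m-1) of \<open>\<Phi>\<^sub>1\<close> in degree m is the one for which the two
  summands of H(u \<cdot> v) cancel in the relation for l = 2.\<close>

abbreviation "opn X \<equiv> openin (rtop X)"
abbreviation "pts X \<equiv> topspace (rtop X)"
abbreviation "rsecs X W \<equiv> carrier (rsec X W)"
abbreviation "secs M W \<equiv> carrier (msec M W)"
abbreviation "rgerms X x \<equiv> carrier (ring_stalk X x)"
abbreviation "mgerms X M x \<equiv> carrier (mod_stalk X M x)"
abbreviation "gr_maps X A B d \<equiv> carrier (gr_hom X A B d)"
abbreviation "bi_maps U E F k d \<equiv> carrier (bi_hom U E F k d)"
abbreviation "tw_maps U E F m \<equiv> carrier (tw_hom U E F m)"

notation rs_comp (infixr "\<cdot>" 55)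

section \<open>Additive maps and signed sums\<close>

text \<open>Unlike \<open>additive_map\<close>, this allows arbitrary record extensions on both
  sides: sections and stalks of module sheaves are \<open>module\<close> records, whereas groups of
  maps are plain \<open>ring\<close> records.\<close>

definition add_hom :: "('a, 'x) ring_scheme \<Rightarrow> ('b, 'y) ring_scheme \<Rightarrow> ('a \<Rightarrow> 'b) \<Rightarrow> bool" where
  "add_hom G H f \<longleftrightarrow> f \<in> carrier G \<rightarrow> carrier H \<and> (\<forall>x\<in>carrier G. \<forall>y\<in>carrier G. f (x \<oplus>\<^bsub>G\<^esub> y) = f x \<oplus>\<^bsub>H\<^esub> f y)"

lemma additive_map_iff_add_hom: "additive_map G H f \<longleftrightarrow> add_hom G H f" by (simp add: additive_map_def add_hom_def)

lemma add_homI: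
  assumes "\<And>x. x \<in> carrier G \<Longrightarrow> f x \<in> carrier H"
    and "\<And>x y. x \<in> carrier G \<Longrightarrow> y \<in> carrier G \<Longrightarrow> f (x \<oplus>\<^bsub>G\<^esub> y) = f x \<oplus>\<^bsub>H\<^esub> f y"
  shows "add_hom G H f" using assms by (auto simp: add_hom_def)

lemma add_hom_closed: "add_hom G H f \<Longrightarrow> x \<in> carrier G \<Longrightarrow> f x \<in> carrier H" by (auto simp: add_hom_def)

lemma add_hom_add: "\<lbrakk>add_hom G H f; x \<in> carrier G; y \<in> carrier G\<rbrakk> \<Longrightarrow> f (x \<oplus>\<^bsub>G\<^esub> y) = f x \<oplus>\<^bsub>H\<^esub> f y"
  by (auto simp: add_hom_def)

lemma add_hom_zero:
  assumes "abelian_group G" "abelian_group H" "add_hom G H f"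
  shows "f \<zero>\<^bsub>G\<^esub> = \<zero>\<^bsub>H\<^esub>"
proof -
  interpret G: abelian_group G by fact
  interpret H: abelian_group H by fact
  have "f \<zero>\<^bsub>G\<^esub> \<oplus>\<^bsub>H\<^esub> f \<zero>\<^bsub>G\<^esub> = f \<zero>\<^bsub>G\<^esub>" using add_hom_add[OF assms(3), of "\<zero>\<^bsub>G\<^esub>" "\<zero>\<^bsub>G\<^esub>"] by simp
  then show ?thesis using add_hom_closed[OF assms(3)] by (metis G.zero_closed H.add.r_cancel_one')
qed

lemma add_hom_minus:
  assumes "abelian_group G" "abelian_group H" "add_hom G H f" "x \<in> carrier G"
  shows "f (\<ominus>\<^bsub>G\<^esub> x) = \<ominus>\<^bsub>H\<^esub> f x"
proof -
  interpret G: abelian_group G by fact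
  interpret H: abelian_group H by fact
  have "f (\<ominus>\<^bsub>G\<^esub> x) \<oplus>\<^bsub>H\<^esub> f x = \<zero>\<^bsub>H\<^esub>"
    using add_hom_add[OF assms(3), of "\<ominus>\<^bsub>G\<^esub> x" x] assms add_hom_zero[OF assms(1,2,3)]
    by (simp add: G.l_neg)
  then show ?thesis using add_hom_closed[OF assms(3)] assms(4) by (metis G.a_inv_closed H.minus_equality)
qed

lemma add_hom_diff:
  assumes "abelian_group G" "abelian_group H" "add_hom G H f" "x \<in> carrier G" "y \<in> carrier G"
  shows "f (x \<ominus>\<^bsub>G\<^esub> y) = f x \<ominus>\<^bsub>H\<^esub> f y"
proof -
  interpret G: abelian_group G by fact
  interpret H: abelian_group H by fact
  show ?thesis using assms by (simp add: a_minus_def add_hom_add[OF assms(3)] add_hom_minus[OF assms(1-3)])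
qed

lemma add_hom_finsum:
  assumes "abelian_group G" "abelian_group H" "add_hom G H f" "x \<in> I \<rightarrow> carrier G"
  shows "f (\<Oplus>\<^bsub>G\<^esub>i\<in>I. x i) = (\<Oplus>\<^bsub>H\<^esub>i\<in>I. f (x i))"
proof -
  interpret G: abelian_group G by fact
  interpret H: abelian_group H by fact
  show ?thesis using assms(4)
  proof (induction I rule: infinite_finite_induct)
    case (insert j I)
    then show ?case using add_hom_closed[OF assms(3)]
      by (simp add: G.finsum_insert H.finsum_insert add_hom_add[OF assms(3)] Pi_def)
  qed (simp_all add: add_hom_zero[OF assms(1-3)])
qed

lemma add_hom_compose: "add_hom G H f \<Longrightarrow> add_hom H K g \<Longrightarrow> add_hom G K (\<lambda>x. g (f x))"
  by (auto simp: add_hom_def Pi_def)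

section \<open>Germs\<close>

text \<open>Germs involve only restriction maps, so structure sheaves and module sheaves are treated
  together; neither algebraic structure nor gluing enters here.\<close>

locale presheaf_on =
  fixes T :: "'a topology" and S :: "'a set \<Rightarrow> 'm set" and res :: "'a set \<Rightarrow> 'a set \<Rightarrow> 'm \<Rightarrow> 'm"
  assumes res_closed: "\<lbrakk>openin T V; openin T W; W \<subseteq> V; s \<in> S V\<rbrakk> \<Longrightarrow> res V W s \<in> S W"
    and res_id: "\<lbrakk>openin T V; s \<in> S V\<rbrakk> \<Longrightarrow> res V V s = s"
    and res_res: "\<lbrakk>openin T V; openin T W; openin T Z; Z \<subseteq> W; W \<subseteq> V; s \<in> S V\<rbrakk> \<Longrightarrow> res W Z (res V W s) = res V Z s"
begin

abbreviation "G \<equiv> germ_of T S res"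

lemma germ_mem_iff: "(V, t) \<in> G x W s \<longleftrightarrow> openin T V \<and> x \<in> V \<and> t \<in> S V \<and>
     (\<exists>Z. openin T Z \<and> x \<in> Z \<and> Z \<subseteq> W \<inter> V \<and> res W Z s = res V Z t)" by (simp add: germ_of_def)

lemma germ_self: "\<lbrakk>openin T W; x \<in> W; s \<in> S W\<rbrakk> \<Longrightarrow> (W, s) \<in> G x W s" by (auto simp: germ_mem_iff)

lemma germ_eqI:
  assumes W: "openin T W" "s \<in> S W" and V: "openin T V" "t \<in> S V"
    and Z: "openin T Z" "x \<in> Z" "Z \<subseteq> W \<inter> V" "res W Z s = res V Z t"
  shows "G x W s = G x V t"
proof -
  have *: "G x W s \<subseteq> G x V t" if W: "openin T W" "s \<in> S W" and V: "openin T V" "t \<in> S V"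
    and Z: "openin T Z" "x \<in> Z" "Z \<subseteq> W \<inter> V" "res W Z s = res V Z t" for W V s t Z
  proof
    fix p assume "p \<in> G x W s"
    then obtain W' s' Z' where p: "p = (W', s')" "openin T W'" "x \<in> W'" "s' \<in> S W'"
      "openin T Z'" "x \<in> Z'" "Z' \<subseteq> W \<inter> W'" "res W Z' s = res W' Z' s'" by (auto simp: germ_of_def)
    let ?Y = "Z \<inter> Z'"
    have Y: "openin T ?Y" using Z p by blast
    have "res V ?Y t = res Z ?Y (res V Z t)" using Y Z V by (subst res_res) auto
    also have "\<dots> = res Z ?Y (res W Z s)" using Z by simp
    also have "\<dots> = res Z' ?Y (res W Z' s)" using Y Z W p by (subst (1 2) res_res) auto
    also have "\<dots> = res W' ?Y s'" using p Y by (simp add: res_res)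
    finally show "p \<in> G x V t" using p Z Y by (auto simp: germ_mem_iff intro!: exI[of _ ?Y])
  qed
  show ?thesis using *[OF W V Z] *[OF V W Z(1,2)] Z by auto
qed

lemma germ_eqD:
  assumes "openin T W" "s \<in> S W" "openin T V" "t \<in> S V" "x \<in> V" "G x W s = G x V t"
  obtains Z where "openin T Z" "x \<in> Z" "Z \<subseteq> W \<inter> V" "res W Z s = res V Z t"
  using germ_self[of V x t] assms unfolding assms(6)[symmetric] germ_mem_iff by blast

lemma germ_memD:
  assumes "openin T W" "s \<in> S W" "(V, t) \<in> G x W s"
  shows "openin T V" "x \<in> V" "t \<in> S V" "G x V t = G x W s"
proof -
  show *: "openin T V" "x \<in> V" "t \<in> S V" using assms by (auto simp: germ_mem_iff)
  obtain Z where "openin T Z" "x \<in> Z" "Z \<subseteq> W \<inter> V" "res W Z s = res V Z t"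
    using assms by (auto simp: germ_mem_iff)
  then show "G x V t = G x W s" using assms * germ_eqI[of W s V t Z x] by simp
qed

lemma germ_res:
  assumes "openin T W" "s \<in> S W" "openin T Z" "x \<in> Z" "Z \<subseteq> W"
  shows "G x Z (res W Z s) = G x W s" using assms res_closed[of W Z s]
  by (intro germ_eqI[of _ _ _ _ Z]) (auto simp: res_id)

text \<open>Operations on stalks are defined as unions over all representatives of a germ. Such a
  union is \<open>c\<close> once every representative contributes \<open>c\<close>, and the index
  set is nonempty because \<open>(W, s)\<close> represents its own germ.\<close>

lemma UN_germ:
  assumes "openin T W" "s \<in> S W" "x \<in> W"
    and "\<And>V t. \<lbrakk>openin T V; x \<in> V; t \<in> S V; G x V t = G x W s\<rbrakk> \<Longrightarrow> F V t = c"
  shows "(\<Union>(V, t)\<in>G x W s. F V t) = c"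
proof -
  have "(\<lambda>(V, t). F V t) p = c" if "p \<in> G x W s" for p
    using that germ_memD[of W s "fst p" "snd p" x] assms by (cases p) auto
  moreover have "(W, s) \<in> G x W s" using assms by (auto intro: germ_self)
  ultimately show ?thesis by (auto simp: case_prod_beta)
qed

end

text \<open>Any two representatives can be restricted to one neighbourhood on which they agree with
  the chosen sections, and the operation commutes with restriction. The three presheaves are
  independent, so that addition, multiplication and the action of a ring on a module are all
  instances.\<close>

lemma germ_binop:
  fixes op :: "'a set \<Rightarrow> 'm \<Rightarrow> 'n \<Rightarrow> 'p"
  assumes P1: "presheaf_on T S1 r1" and P2: "presheaf_on T S2 r2" and P3: "presheaf_on T S3 r3"
    and op: "\<And>V s t. \<lbrakk>openin T V; s \<in> S1 V; t \<in> S2 V\<rbrakk> \<Longrightarrow> op V s t \<in> S3 V"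
    and op_res: "\<And>V W s t. \<lbrakk>openin T V; openin T W; W \<subseteq> V; s \<in> S1 V; t \<in> S2 V\<rbrakk> \<Longrightarrow>
        r3 V W (op V s t) = op W (r1 V W s) (r2 V W t)"
    and W: "openin T W" "x \<in> W" "s \<in> S1 W" "t \<in> S2 W"
  shows "(\<Union>(V, s')\<in>germ_of T S1 r1 x W s. \<Union>(V', t')\<in>germ_of T S2 r2 x W t.
            germ_of T S3 r3 x (V \<inter> V') (op (V \<inter> V') (r1 V (V \<inter> V') s') (r2 V' (V \<inter> V') t'))) =
         germ_of T S3 r3 x W (op W s t)"
proof -
  interpret P1: presheaf_on T S1 r1 by fact
  interpret P2: presheaf_on T S2 r2 by fact
  interpret P3: presheaf_on T S3 r3 by fact
  show ?thesis
  proof (intro P1.UN_germ P2.UN_germ W)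
    fix V s' V' t'
    assume V: "openin T V" "x \<in> V" "s' \<in> S1 V" "P1.G x V s' = P1.G x W s"
      and V': "openin T V'" "x \<in> V'" "t' \<in> S2 V'" "P2.G x V' t' = P2.G x W t"
    obtain Z1 where Z1: "openin T Z1" "x \<in> Z1" "Z1 \<subseteq> V \<inter> W" "r1 V Z1 s' = r1 W Z1 s"
      using P1.germ_eqD[of V s' W s x] V W by auto
    obtain Z2 where Z2: "openin T Z2" "x \<in> Z2" "Z2 \<subseteq> V' \<inter> W" "r2 V' Z2 t' = r2 W Z2 t"
      using P2.germ_eqD[of V' t' W t x] V' W by auto
    let ?Z = "Z1 \<inter> Z2" and ?V = "V \<inter> V'"
    have Z: "openin T ?Z" "openin T ?V" using Z1 Z2 V V' by auto
    have sub: "?Z \<subseteq> ?V" "?Z \<subseteq> W" "?V \<subseteq> V" "?V \<subseteq> V'" using Z1 Z2 by auto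
    have 1: "r1 V ?Z s' = r1 W ?Z s" using P1.res_res[of V Z1 ?Z s'] P1.res_res[of W Z1 ?Z s] Z1 Z V W by auto
    have 2: "r2 V' ?Z t' = r2 W ?Z t" using P2.res_res[of V' Z2 ?Z t'] P2.res_res[of W Z2 ?Z t] Z2 Z V' W by auto
    show "P3.G x ?V (op ?V (r1 V ?V s') (r2 V' ?V t')) = P3.G x W (op W s t)"
    proof (rule P3.germ_eqI[of _ _ _ _ ?Z])
      have "r3 ?V ?Z (op ?V (r1 V ?V s') (r2 V' ?V t')) = op ?Z (r1 V ?Z s') (r2 V' ?Z t')"
        using V V' Z sub by (simp add: op_res P1.res_closed P2.res_closed P1.res_res P2.res_res)
      also have "\<dots> = r3 W ?Z (op W s t)" using W Z sub 1 2 by (simp add: op_res)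
      finally show "r3 ?V ?Z (op ?V (r1 V ?V s') (r2 V' ?V t')) = r3 W ?Z (op W s t)" .
    qed (use V V' W Z Z1 Z2 in "auto intro!: op P1.res_closed P2.res_closed")
  qed
qed

lemma sheaf_of_sets_presheaf: "sheaf_of_sets T S res \<Longrightarrow> presheaf_on T S res"
proof
  assume S: "sheaf_of_sets T S res"
  show "res V W s \<in> S W" if "openin T V" "openin T W" "W \<subseteq> V" "s \<in> S V" for V W s
  proof -
    have "\<forall>V W. openin T V \<and> openin T W \<and> W \<subseteq> V \<longrightarrow> res V W \<in> S V \<rightarrow> S W"
      using S unfolding sheaf_of_sets_def by (elim conjE)
    then show ?thesis using that by blast
  qed
  show "res V V s = s" if "openin T V" "s \<in> S V" for V s using S that unfolding sheaf_of_sets_def by metis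
  show "res W Z (res V W s) = res V Z s"
    if "openin T V" "openin T W" "openin T Z" "Z \<subseteq> W" "W \<subseteq> V" "s \<in> S V" for V W Z s
  proof -
    have "\<forall>V W Z. openin T V \<and> openin T W \<and> openin T Z \<and> Z \<subseteq> W \<and> W \<subseteq> V \<longrightarrow>
        (\<forall>s\<in>S V. res W Z (res V W s) = res V Z s)" using S unfolding sheaf_of_sets_def by (elim conjE)
    then show ?thesis using that by blast
  qed
qed

lemma presheaf_ringed: "ringed_space X \<Longrightarrow> presheaf_on (rtop X) (\<lambda>W. rsecs X W) (rres X)"
  by (simp add: ringed_space_def sheaf_of_sets_presheaf)

lemma presheaf_module: "module_sheaf X M \<Longrightarrow> presheaf_on (rtop X) (\<lambda>W. secs M W) (mres M)"
  by (simp add: module_sheaf_def sheaf_of_sets_presheaf)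

lemmas rgerm_eqI = presheaf_on.germ_eqI[OF presheaf_ringed, folded rgerm_def]
lemmas rgerm_eqD = presheaf_on.germ_eqD[OF presheaf_ringed, folded rgerm_def]
lemmas rgerm_res = presheaf_on.germ_res[OF presheaf_ringed, folded rgerm_def]
lemmas UN_rgerm = presheaf_on.UN_germ[OF presheaf_ringed, folded rgerm_def]
lemmas rres_closed = presheaf_on.res_closed[OF presheaf_ringed]
lemmas mgerm_eqD = presheaf_on.germ_eqD[OF presheaf_module, folded mgerm_def]
lemmas mgerm_res = presheaf_on.germ_res[OF presheaf_module, folded mgerm_def]
lemmas UN_mgerm = presheaf_on.UN_germ[OF presheaf_module, folded mgerm_def]
lemmas mres_closed = presheaf_on.res_closed[OF presheaf_module]
lemmas mres_mres = presheaf_on.res_res[OF presheaf_module]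

lemma ringed_space_ring: "ringed_space X \<Longrightarrow> opn X W \<Longrightarrow> ring (rsec X W)" by (simp add: ringed_space_def)

lemma rres_hom: "\<lbrakk>ringed_space X; opn X V; opn X W; W \<subseteq> V\<rbrakk> \<Longrightarrow> rres X V W \<in> ring_hom (rsec X V) (rsec X W)"
  by (simp add: ringed_space_def)

lemma left_moduleD:
  assumes "left_module R M"
  shows "ring R" "abelian_group M"
    and "\<And>a m. a \<in> carrier R \<Longrightarrow> m \<in> carrier M \<Longrightarrow> a \<odot>\<^bsub>M\<^esub> m \<in> carrier M"
    and "\<And>a b m. \<lbrakk>a \<in> carrier R; b \<in> carrier R; m \<in> carrier M\<rbrakk> \<Longrightarrow> (a \<oplus>\<^bsub>R\<^esub> b) \<odot>\<^bsub>M\<^esub> m = a \<odot>\<^bsub>M\<^esub> m \<oplus>\<^bsub>M\<^esub> b \<odot>\<^bsub>M\<^esub> m"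
    and "\<And>a m n. \<lbrakk>a \<in> carrier R; m \<in> carrier M; n \<in> carrier M\<rbrakk> \<Longrightarrow> a \<odot>\<^bsub>M\<^esub> (m \<oplus>\<^bsub>M\<^esub> n) = a \<odot>\<^bsub>M\<^esub> m \<oplus>\<^bsub>M\<^esub> a \<odot>\<^bsub>M\<^esub> n"
    and "\<And>a b m. \<lbrakk>a \<in> carrier R; b \<in> carrier R; m \<in> carrier M\<rbrakk> \<Longrightarrow> (a \<otimes>\<^bsub>R\<^esub> b) \<odot>\<^bsub>M\<^esub> m = a \<odot>\<^bsub>M\<^esub> (b \<odot>\<^bsub>M\<^esub> m)"
    and "\<And>m. m \<in> carrier M \<Longrightarrow> \<one>\<^bsub>R\<^esub> \<odot>\<^bsub>M\<^esub> m = m" using assms unfolding left_module_def by blast+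

lemma left_module_smult_zero:
  assumes "left_module R M" "a \<in> carrier R"
  shows "a \<odot>\<^bsub>M\<^esub> \<zero>\<^bsub>M\<^esub> = \<zero>\<^bsub>M\<^esub>" using left_moduleD[OF assms(1)] assms(2)
  by (intro add_hom_zero[of M M "\<lambda>m. a \<odot>\<^bsub>M\<^esub> m"] add_homI)

lemma module_sheafD:
  assumes "module_sheaf X M"
  shows "sheaf_of_sets (rtop X) (\<lambda>W. secs M W) (mres M)"
    and "\<And>W. opn X W \<Longrightarrow> left_module (rsec X W) (msec M W)"
    and "\<And>V W. \<lbrakk>opn X V; opn X W; W \<subseteq> V\<rbrakk> \<Longrightarrow> add_hom (msec M V) (msec M W) (mres M V W)"
    and "\<And>V W a s. \<lbrakk>opn X V; opn X W; W \<subseteq> V; a \<in> rsecs X V; s \<in> secs M V\<rbrakk> \<Longrightarrow>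
           mres M V W (a \<odot>\<^bsub>msec M V\<^esub> s) = rres X V W a \<odot>\<^bsub>msec M W\<^esub> mres M V W s"
proof -
  have *: "\<forall>V W. opn X V \<and> opn X W \<and> W \<subseteq> V \<longrightarrow> (\<forall>s\<in>secs M V. \<forall>t\<in>secs M V.
           mres M V W (s \<oplus>\<^bsub>msec M V\<^esub> t) = mres M V W s \<oplus>\<^bsub>msec M W\<^esub> mres M V W t) \<and> (\<forall>a\<in>rsecs X V. \<forall>s\<in>secs M V.
           mres M V W (a \<odot>\<^bsub>msec M V\<^esub> s) = rres X V W a \<odot>\<^bsub>msec M W\<^esub> mres M V W s)"
    using assms by (simp add: module_sheaf_def)
  show "sheaf_of_sets (rtop X) (\<lambda>W. secs M W) (mres M)" "opn X W \<Longrightarrow> left_module (rsec X W) (msec M W)" for W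
    using assms by (simp_all add: module_sheaf_def)
  show "add_hom (msec M V) (msec M W) (mres M V W)" if "opn X V" "opn X W" "W \<subseteq> V" for V W
    using *[THEN spec, THEN spec, of V W] that mres_closed[OF assms that] by (intro add_homI) simp_all
  show "mres M V W (a \<odot>\<^bsub>msec M V\<^esub> s) = rres X V W a \<odot>\<^bsub>msec M W\<^esub> mres M V W s"
    if "opn X V" "opn X W" "W \<subseteq> V" "a \<in> rsecs X V" "s \<in> secs M V" for V W a s
    using *[THEN spec, THEN spec, of V W] that by simp
qed

lemma module_sheaf_ab: "module_sheaf X M \<Longrightarrow> opn X W \<Longrightarrow> abelian_group (msec M W)"
  using module_sheafD(2) left_moduleD(2) by blast

section \<open>Stalks\<close>

lemma rgerm_add:
  assumes X: "ringed_space X" and "opn X W" "x \<in> W" "s \<in> rsecs X W" "t \<in> rsecs X W"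
  shows "rgerm X x W s \<oplus>\<^bsub>ring_stalk X x\<^esub> rgerm X x W t = rgerm X x W (s \<oplus>\<^bsub>rsec X W\<^esub> t)"
  unfolding ring_stalk_def ring_record_simps rgerm_def
  by (rule germ_binop[OF presheaf_ringed[OF X] presheaf_ringed[OF X] presheaf_ringed[OF X],
        where op = "\<lambda>W. ring.add (rsec X W)"])
     (use assms in "simp_all add: ring.ring_simprules(1)[OF ringed_space_ring] ring_hom_add[OF rres_hom]")

lemma rgerm_mult:
  assumes X: "ringed_space X" and "opn X W" "x \<in> W" "s \<in> rsecs X W" "t \<in> rsecs X W"
  shows "rgerm X x W s \<otimes>\<^bsub>ring_stalk X x\<^esub> rgerm X x W t = rgerm X x W (s \<otimes>\<^bsub>rsec X W\<^esub> t)"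
  unfolding ring_stalk_def monoid.select_convs rgerm_def
  by (rule germ_binop[OF presheaf_ringed[OF X] presheaf_ringed[OF X] presheaf_ringed[OF X],
        where op = "\<lambda>W. monoid.mult (rsec X W)"])
     (use assms in "simp_all add: ring.ring_simprules(5)[OF ringed_space_ring] ring_hom_mult[OF rres_hom]")

lemma mgerm_add:
  assumes M: "module_sheaf X M" and "opn X W" "x \<in> W" "s \<in> secs M W" "t \<in> secs M W"
  shows "mgerm X M x W s \<oplus>\<^bsub>mod_stalk X M x\<^esub> mgerm X M x W t = mgerm X M x W (s \<oplus>\<^bsub>msec M W\<^esub> t)"
  unfolding mod_stalk_def ring_record_simps mgerm_def
  by (rule germ_binop[OF presheaf_module[OF M] presheaf_module[OF M] presheaf_module[OF M],
        where op = "\<lambda>W. ring.add (msec M W)"])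
     (use assms in "simp_all add: abelian_groupE(1)[OF module_sheaf_ab] add_hom_add[OF module_sheafD(3)]")

lemma mgerm_smult:
  assumes X: "ringed_space X" and M: "module_sheaf X M" and "opn X W" "x \<in> W" "s \<in> rsecs X W" "t \<in> secs M W"
  shows "rgerm X x W s \<odot>\<^bsub>mod_stalk X M x\<^esub> mgerm X M x W t = mgerm X M x W (s \<odot>\<^bsub>msec M W\<^esub> t)"
  unfolding mod_stalk_def module.select_convs mgerm_def rgerm_def
  by (rule germ_binop[OF presheaf_ringed[OF X] presheaf_module[OF M] presheaf_module[OF M],
        where op = "\<lambda>W. module.smult (msec M W)"])
     (use assms in "simp_all add: left_moduleD(3)[OF module_sheafD(2)] module_sheafD(4)")

lemma ring_stalk_carrier: "\<lbrakk>opn X W; x \<in> W; s \<in> rsecs X W\<rbrakk> \<Longrightarrow> rgerm X x W s \<in> rgerms X x"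
  by (auto simp: ring_stalk_def)

lemma mod_stalk_carrier: "\<lbrakk>opn X W; x \<in> W; s \<in> secs M W\<rbrakk> \<Longrightarrow> mgerm X M x W s \<in> mgerms X M x"
  by (auto simp: mod_stalk_def)

lemma ring_stalk_rep:
  assumes "g \<in> rgerms X x"
  obtains W s where "opn X W" "x \<in> W" "s \<in> rsecs X W" "g = rgerm X x W s"
  using assms by (auto simp: ring_stalk_def)

lemma mod_stalk_rep:
  assumes "g \<in> mgerms X M x"
  obtains W s where "opn X W" "x \<in> W" "s \<in> secs M W" "g = mgerm X M x W s"
  using assms by (auto simp: mod_stalk_def)

text \<open>Shrinking the representative of one germ into the domain of another is the device by
  which several germs get sections over a common open set.\<close>

lemma ring_stalk_rep_within:
  assumes "ringed_space X" "g \<in> rgerms X x" "opn X V" "x \<in> V"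
  obtains W s where "opn X W" "x \<in> W" "W \<subseteq> V" "s \<in> rsecs X W" "g = rgerm X x W s"
proof -
  obtain W s where W: "opn X W" "x \<in> W" "s \<in> rsecs X W" "g = rgerm X x W s"
    using ring_stalk_rep[OF assms(2)] .
  show ?thesis by (rule that[of "W \<inter> V" "rres X W (W \<inter> V) s"])
       (use W assms in "auto simp: rgerm_res rres_closed openin_Int")
qed

lemma mod_stalk_rep_within:
  assumes "module_sheaf X M" "g \<in> mgerms X M x" "opn X V" "x \<in> V"
  obtains W s where "opn X W" "x \<in> W" "W \<subseteq> V" "s \<in> secs M W" "g = mgerm X M x W s"
proof -
  obtain W s where W: "opn X W" "x \<in> W" "s \<in> secs M W" "g = mgerm X M x W s"
    using mod_stalk_rep[OF assms(2)] .
  show ?thesis by (rule that[of "W \<inter> V" "mres M W (W \<inter> V) s"])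
       (use W assms in "auto simp: mgerm_res mres_closed openin_Int")
qed

text \<open>Three germs are as many as associativity and distributivity mention; for fewer,
  arguments are repeated.\<close>

lemma ring_stalk_rep3:
  assumes X: "ringed_space X" and g: "g \<in> rgerms X x" "h \<in> rgerms X x" "k \<in> rgerms X x"
  obtains W s t u where "opn X W" "x \<in> W" "s \<in> rsecs X W" "t \<in> rsecs X W" "u \<in> rsecs X W"
    "g = rgerm X x W s" "h = rgerm X x W t" "k = rgerm X x W u"
proof -
  obtain W s where 1: "opn X W" "x \<in> W" "s \<in> rsecs X W" "g = rgerm X x W s"
    using ring_stalk_rep[OF g(1)] .
  obtain V t where 2: "opn X V" "x \<in> V" "V \<subseteq> W" "t \<in> rsecs X V" "h = rgerm X x V t"
    using ring_stalk_rep_within[OF X g(2) 1(1,2)] .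
  obtain Z u where 3: "opn X Z" "x \<in> Z" "Z \<subseteq> V" "u \<in> rsecs X Z" "k = rgerm X x Z u"
    using ring_stalk_rep_within[OF X g(3) 2(1,2)] .
  show ?thesis by (rule that[of Z "rres X W Z s" "rres X V Z t" u])
       (use 1 2 3 X in "auto simp: rgerm_res rres_closed openin_Int")
qed

lemma mod_stalk_rep3:
  assumes X: "module_sheaf X M" and g: "g \<in> mgerms X M x" "h \<in> mgerms X M x" "k \<in> mgerms X M x"
  obtains W s t u where "opn X W" "x \<in> W" "s \<in> secs M W" "t \<in> secs M W" "u \<in> secs M W"
    "g = mgerm X M x W s" "h = mgerm X M x W t" "k = mgerm X M x W u"
proof -
  obtain W s where 1: "opn X W" "x \<in> W" "s \<in> secs M W" "g = mgerm X M x W s"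
    using mod_stalk_rep[OF g(1)] .
  obtain V t where 2: "opn X V" "x \<in> V" "V \<subseteq> W" "t \<in> secs M V" "h = mgerm X M x V t"
    using mod_stalk_rep_within[OF X g(2) 1(1,2)] .
  obtain Z u where 3: "opn X Z" "x \<in> Z" "Z \<subseteq> V" "u \<in> secs M Z" "k = mgerm X M x Z u"
    using mod_stalk_rep_within[OF X g(3) 2(1,2)] .
  show ?thesis by (rule that[of Z "mres M W Z s" "mres M V Z t" u])
       (use 1 2 3 X in "auto simp: mgerm_res mres_closed openin_Int")
qed

text \<open>The neutral elements of a stalk are defined by germs over the whole space. To compute
  with a representative over \<open>W\<close> they have to be restricted to \<open>W\<close>; the
  same is done for the unit and for module stalks below.\<close>

lemma rgerm_zero:
  assumes "ringed_space X" "opn X W" "x \<in> W"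
  shows "\<zero>\<^bsub>ring_stalk X x\<^esub> = rgerm X x W \<zero>\<^bsub>rsec X W\<^esub>"
proof -
  have *: "W \<subseteq> pts X" using assms by (auto simp: openin_subset)
  have "rres X (pts X) W \<zero>\<^bsub>rsec X (pts X)\<^esub> = \<zero>\<^bsub>rsec X W\<^esub>"
    using assms * by (intro ring_hom_zero[OF rres_hom]) (auto simp: ringed_space_ring)
  then show ?thesis using rgerm_res[OF assms(1), of "pts X" "\<zero>\<^bsub>rsec X (pts X)\<^esub>" W x] assms *
    by (simp add: ring_stalk_def ringed_space_ring ring.ring_simprules(2))
qed

lemma rgerm_one:
  assumes "ringed_space X" "opn X W" "x \<in> W"
  shows "\<one>\<^bsub>ring_stalk X x\<^esub> = rgerm X x W \<one>\<^bsub>rsec X W\<^esub>"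
proof -
  have *: "W \<subseteq> pts X" using assms by (auto simp: openin_subset)
  have "rres X (pts X) W \<one>\<^bsub>rsec X (pts X)\<^esub> = \<one>\<^bsub>rsec X W\<^esub>" using assms * by (intro ring_hom_one[OF rres_hom]) auto
  then show ?thesis using rgerm_res[OF assms(1), of "pts X" "\<one>\<^bsub>rsec X (pts X)\<^esub>" W x] assms *
    by (simp add: ring_stalk_def ringed_space_ring ring.ring_simprules(6))
qed

lemma mgerm_zero:
  assumes "module_sheaf X M" "opn X W" "x \<in> W"
  shows "\<zero>\<^bsub>mod_stalk X M x\<^esub> = mgerm X M x W \<zero>\<^bsub>msec M W\<^esub>"
proof -
  have *: "W \<subseteq> pts X" using assms by (auto simp: openin_subset)
  have "mres M (pts X) W \<zero>\<^bsub>msec M (pts X)\<^esub> = \<zero>\<^bsub>msec M W\<^esub>"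
    using assms * by (intro add_hom_zero[OF _ _ module_sheafD(3)]) (auto simp: module_sheaf_ab)
  then show ?thesis using mgerm_res[OF assms(1), of "pts X" "\<zero>\<^bsub>msec M (pts X)\<^esub>" W x] assms *
      abelian_groupE(2)[OF module_sheaf_ab[OF assms(1)]] by (simp add: mod_stalk_def)
qed

lemma ring_ring_stalk:
  assumes X: "ringed_space X" and x: "x \<in> pts X"
  shows "ring (ring_stalk X x)"
proof -
  let ?R = "ring_stalk X x"
  note [simp] = rgerm_add[OF X] rgerm_mult[OF X] ring_stalk_carrier
    and [simp] = ring.ring_simprules[OF ringed_space_ring[OF X]]
  have z: "\<zero>\<^bsub>?R\<^esub> \<in> carrier ?R" "\<one>\<^bsub>?R\<^esub> \<in> carrier ?R"
    using rgerm_zero[OF X openin_topspace x] rgerm_one[OF X openin_topspace x] x by simp_all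
  show ?thesis
  proof (intro ringI abelian_groupI monoidI z)
    fix g h k assume g: "g \<in> carrier ?R" "h \<in> carrier ?R" "k \<in> carrier ?R"
    obtain W s t u where W: "opn X W" "x \<in> W" "s \<in> rsecs X W" "t \<in> rsecs X W" "u \<in> rsecs X W"
        "g = rgerm X x W s" "h = rgerm X x W t" "k = rgerm X x W u" using ring_stalk_rep3[OF X g] .
    then show "g \<oplus>\<^bsub>?R\<^esub> h \<oplus>\<^bsub>?R\<^esub> k = g \<oplus>\<^bsub>?R\<^esub> (h \<oplus>\<^bsub>?R\<^esub> k)" "g \<otimes>\<^bsub>?R\<^esub> h \<otimes>\<^bsub>?R\<^esub> k = g \<otimes>\<^bsub>?R\<^esub> (h \<otimes>\<^bsub>?R\<^esub> k)"
      "(g \<oplus>\<^bsub>?R\<^esub> h) \<otimes>\<^bsub>?R\<^esub> k = g \<otimes>\<^bsub>?R\<^esub> k \<oplus>\<^bsub>?R\<^esub> h \<otimes>\<^bsub>?R\<^esub> k" "k \<otimes>\<^bsub>?R\<^esub> (g \<oplus>\<^bsub>?R\<^esub> h) = k \<otimes>\<^bsub>?R\<^esub> g \<oplus>\<^bsub>?R\<^esub> k \<otimes>\<^bsub>?R\<^esub> h"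
      by simp_all
  next
    fix g h assume g: "g \<in> carrier ?R" "h \<in> carrier ?R"
    obtain W s t where W: "opn X W" "x \<in> W" "s \<in> rsecs X W" "t \<in> rsecs X W"
        "g = rgerm X x W s" "h = rgerm X x W t" by (rule ring_stalk_rep3[OF X g(1,2,2)])
    then show "g \<oplus>\<^bsub>?R\<^esub> h \<in> carrier ?R" "g \<otimes>\<^bsub>?R\<^esub> h \<in> carrier ?R" "g \<oplus>\<^bsub>?R\<^esub> h = h \<oplus>\<^bsub>?R\<^esub> g" by simp_all
  next
    fix g assume g: "g \<in> carrier ?R"
    then obtain W s where W: "opn X W" "x \<in> W" "s \<in> rsecs X W" "g = rgerm X x W s" by (rule ring_stalk_rep)
    then show "\<zero>\<^bsub>?R\<^esub> \<oplus>\<^bsub>?R\<^esub> g = g" "\<one>\<^bsub>?R\<^esub> \<otimes>\<^bsub>?R\<^esub> g = g" "g \<otimes>\<^bsub>?R\<^esub> \<one>\<^bsub>?R\<^esub> = g"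
      by (simp_all add: rgerm_zero[OF X W(1,2)] rgerm_one[OF X W(1,2)] monoid.r_one[OF ring.is_monoid[OF ringed_space_ring[OF X]]])
    show "\<exists>y\<in>carrier ?R. y \<oplus>\<^bsub>?R\<^esub> g = \<zero>\<^bsub>?R\<^esub>"
      using W by (intro bexI[of _ "rgerm X x W (\<ominus>\<^bsub>rsec X W\<^esub> s)"]) (simp_all add: rgerm_zero[OF X W(1,2)])
  qed
qed

lemma left_module_mod_stalk:
  assumes X: "ringed_space X" and M: "module_sheaf X M" and x: "x \<in> pts X"
  shows "left_module (ring_stalk X x) (mod_stalk X M x)"
proof -
  let ?R = "ring_stalk X x" and ?N = "mod_stalk X M x"
  note [simp] = rgerm_add[OF X] rgerm_mult[OF X] ring_stalk_carrier mod_stalk_carrier mgerm_add[OF M] mgerm_smult[OF X M]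
    and [simp] = ring.ring_simprules[OF ringed_space_ring[OF X]]
    and [simp] = abelian_groupE(1,2,3,5)[OF module_sheaf_ab[OF M]] left_moduleD(3-7)[OF module_sheafD(2)[OF M]]
  \<comment> \<open>Represents two ring germs and two module germs over a single open set, shrinking
    first to \<open>V\<close> and then to \<open>Z\<close>; axioms with fewer variables repeat
    arguments.\<close>
  have mix: thesis if g: "g \<in> carrier ?R" "h \<in> carrier ?R" "m \<in> carrier ?N" "n \<in> carrier ?N" and
      *: "\<And>W s t u v. \<lbrakk>opn X W; x \<in> W; s \<in> rsecs X W; t \<in> rsecs X W;
        u \<in> secs M W; v \<in> secs M W; g = rgerm X x W s; h = rgerm X x W t;
        m = mgerm X M x W u; n = mgerm X M x W v\<rbrakk> \<Longrightarrow> thesis" for g h m n thesis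
  proof -
    obtain W s t where W: "opn X W" "x \<in> W" "s \<in> rsecs X W" "t \<in> rsecs X W"
        "g = rgerm X x W s" "h = rgerm X x W t" by (rule ring_stalk_rep3[OF X g(1,2,2)])
    obtain V u where V: "opn X V" "x \<in> V" "V \<subseteq> W" "u \<in> secs M V" "m = mgerm X M x V u"
      using mod_stalk_rep_within[OF M g(3) W(1,2)] .
    obtain Z v where Z: "opn X Z" "x \<in> Z" "Z \<subseteq> V" "v \<in> secs M Z" "n = mgerm X M x Z v"
      using mod_stalk_rep_within[OF M g(4) V(1,2)] .
    show thesis by (rule *[of Z "rres X W Z s" "rres X W Z t" "mres M V Z u" v])
        (use W V Z X M in "auto simp: mgerm_res mres_closed rgerm_res rres_closed")
  qed
  have ab: "abelian_group ?N"
  proof (intro abelian_groupI)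
    show "\<zero>\<^bsub>?N\<^esub> \<in> carrier ?N" using mgerm_zero[OF M openin_topspace x] x by simp
  next
    fix g h k assume g: "g \<in> carrier ?N" "h \<in> carrier ?N" "k \<in> carrier ?N"
    obtain W s t u where W: "opn X W" "x \<in> W" "s \<in> secs M W" "t \<in> secs M W" "u \<in> secs M W"
        "g = mgerm X M x W s" "h = mgerm X M x W t" "k = mgerm X M x W u" using mod_stalk_rep3[OF M g] .
    then show "g \<oplus>\<^bsub>?N\<^esub> h \<oplus>\<^bsub>?N\<^esub> k = g \<oplus>\<^bsub>?N\<^esub> (h \<oplus>\<^bsub>?N\<^esub> k)" by (simp add: abelian_groupE(3)[OF module_sheaf_ab[OF M]])
  next
    fix g h assume g: "g \<in> carrier ?N" "h \<in> carrier ?N"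
    obtain W s t where W: "opn X W" "x \<in> W"
        "s \<in> secs M W" "t \<in> secs M W" "g = mgerm X M x W s" "h = mgerm X M x W t"
      by (rule mod_stalk_rep3[OF M g(1,2,2)])
    then show "g \<oplus>\<^bsub>?N\<^esub> h \<in> carrier ?N" "g \<oplus>\<^bsub>?N\<^esub> h = h \<oplus>\<^bsub>?N\<^esub> g"
      using abelian_groupE(4)[OF module_sheaf_ab[OF M W(1)] W(3,4)] by simp_all
  next
    fix g assume g: "g \<in> carrier ?N"
    then obtain W s where W: "opn X W" "x \<in> W" "s \<in> secs M W" "g = mgerm X M x W s" by (rule mod_stalk_rep)
    then show "\<zero>\<^bsub>?N\<^esub> \<oplus>\<^bsub>?N\<^esub> g = g" by (simp add: mgerm_zero[OF M W(1,2)])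
    show "\<exists>y\<in>carrier ?N. y \<oplus>\<^bsub>?N\<^esub> g = \<zero>\<^bsub>?N\<^esub>"
    proof -
      obtain y where "y \<in> secs M W" "y \<oplus>\<^bsub>msec M W\<^esub> s = \<zero>\<^bsub>msec M W\<^esub>"
        using abelian_groupE(6)[OF module_sheaf_ab[OF M W(1)] W(3)] by blast
      then show ?thesis using W by (intro bexI[of _ "mgerm X M x W y"]) (simp_all add: mgerm_zero[OF M W(1,2)])
    qed
  qed
  show ?thesis unfolding left_module_def
  proof (intro conjI ballI ab ring_ring_stalk[OF X x])
    fix a b m n assume *: "a \<in> carrier ?R" "b \<in> carrier ?R" "m \<in> carrier ?N" "n \<in> carrier ?N"
    show "(a \<oplus>\<^bsub>?R\<^esub> b) \<odot>\<^bsub>?N\<^esub> m = a \<odot>\<^bsub>?N\<^esub> m \<oplus>\<^bsub>?N\<^esub> b \<odot>\<^bsub>?N\<^esub> m" "(a \<otimes>\<^bsub>?R\<^esub> b) \<odot>\<^bsub>?N\<^esub> m = a \<odot>\<^bsub>?N\<^esub> (b \<odot>\<^bsub>?N\<^esub> m)"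
      by (rule mix[OF *]; simp)+
  next
    fix a m n assume *: "a \<in> carrier ?R" "m \<in> carrier ?N" "n \<in> carrier ?N"
    show "a \<odot>\<^bsub>?N\<^esub> (m \<oplus>\<^bsub>?N\<^esub> n) = a \<odot>\<^bsub>?N\<^esub> m \<oplus>\<^bsub>?N\<^esub> a \<odot>\<^bsub>?N\<^esub> n" by (rule mix[OF *(1,1,2,3)]; simp)
  next
    fix a m assume *: "a \<in> carrier ?R" "m \<in> carrier ?N"
    show "a \<odot>\<^bsub>?N\<^esub> m \<in> carrier ?N" by (rule mix[OF *(1,1,2,2)]; simp)
  next
    fix m assume *: "m \<in> carrier ?N"
    then obtain W s where W: "opn X W" "x \<in> W" "s \<in> secs M W" "m = mgerm X M x W s" by (rule mod_stalk_rep)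
    then show "\<one>\<^bsub>?R\<^esub> \<odot>\<^bsub>?N\<^esub> m = m" by (simp add: rgerm_one[OF X W(1,2)])
  qed
qed

section \<open>Morphisms of ringed spaces\<close>

lemma rs_morphismD:
  assumes "rs_morphism X Y f"
  shows "src f = X" "tgt f = Y" "pt f \<in> extensional (pts X)" "continuous_map (rtop X) (rtop Y) (pt f)"
    "comor f \<in> (\<Pi>\<^sub>E V\<in>{V. opn Y V}. rsecs Y V \<rightarrow>\<^sub>E rsecs X (preim f V))"
    "\<And>V. opn Y V \<Longrightarrow> comor f V \<in> ring_hom (rsec Y V) (rsec X (preim f V))"
    "\<And>V W s. \<lbrakk>opn Y V; opn Y W; W \<subseteq> V; s\<in>rsecs Y V\<rbrakk> \<Longrightarrow>
           comor f W (rres Y V W s) = rres X (preim f V) (preim f W) (comor f V s)"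
  using assms unfolding rs_morphism_def by simp_all

lemma preim_open: "rs_morphism X Y f \<Longrightarrow> opn Y V \<Longrightarrow> opn X (preim f V)"
  using rs_morphismD(1,4) openin_continuous_map_preimage unfolding preim_def by blast

lemma preim_mono: "V \<subseteq> W \<Longrightarrow> preim f V \<subseteq> preim f W" by (auto simp: preim_def)

lemma preim_Int: "preim f (V \<inter> W) = preim f V \<inter> preim f W" by (auto simp: preim_def)

lemma mem_preim: "rs_morphism X Y f \<Longrightarrow> x \<in> preim f V \<longleftrightarrow> x \<in> pts X \<and> pt f x \<in> V"
  by (auto simp: preim_def rs_morphismD(1))

lemma pt_topspace: "rs_morphism X Y f \<Longrightarrow> x \<in> pts X \<Longrightarrow> pt f x \<in> pts Y"
  using rs_morphismD(4) continuous_map_image_subset_topspace by blast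

lemma comor_closed: "\<lbrakk>rs_morphism X Y f; opn Y V; s \<in> rsecs Y V\<rbrakk> \<Longrightarrow> comor f V s \<in> rsecs X (preim f V)"
  using rs_morphismD(6) ring_hom_closed by metis

text \<open>The union that defines \<open>stalk_comor\<close> has a single value because comorphisms
  commute with restriction.\<close>

lemma stalk_comor_rgerm:
  assumes "ringed_space X" "ringed_space Y" "rs_morphism X Y f" "x \<in> pts X"
    "opn Y V" "pt f x \<in> V" "s \<in> rsecs Y V"
  shows "stalk_comor f x (rgerm Y (pt f x) V s) = rgerm X x (preim f V) (comor f V s)"
  unfolding stalk_comor_def rs_morphismD(1)[OF assms(3)]
proof (intro UN_rgerm[OF assms(2)] assms)
  fix W t assume W: "opn Y W" "pt f x \<in> W" "t \<in> rsecs Y W"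
    and eq: "rgerm Y (pt f x) W t = rgerm Y (pt f x) V s"
  obtain Z where Z: "opn Y Z" "pt f x \<in> Z" "Z \<subseteq> W \<inter> V" "rres Y W Z t = rres Y V Z s"
    using rgerm_eqD[OF assms(2) W(1,3) assms(5,7,6) eq] .
  show "rgerm X x (preim f W) (comor f W t) = rgerm X x (preim f V) (comor f V s)"
  proof (rule rgerm_eqI[OF assms(1), where Z = "preim f Z"])
    show "rres X (preim f W) (preim f Z) (comor f W t) = rres X (preim f V) (preim f Z) (comor f V s)"
      using Z W assms rs_morphismD(7)[OF assms(3), of W Z t] rs_morphismD(7)[OF assms(3), of V Z s] by auto
  qed (use Z W assms in "auto simp: preim_open comor_closed mem_preim")
qed

lemma stalk_comor_hom:
  assumes X: "ringed_space X" and Y: "ringed_space Y" and f: "rs_morphism X Y f" and x: "x \<in> pts X"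
  shows "stalk_comor f x \<in> ring_hom (ring_stalk Y (pt f x)) (ring_stalk X x)"
proof -
  have px: "pt f x \<in> pts Y" using f x by (rule pt_topspace)
  note [simp] = stalk_comor_rgerm[OF X Y f x] ring_stalk_carrier preim_open[OF f] mem_preim[OF f] x
     comor_closed[OF f] rgerm_add[OF X] rgerm_add[OF Y] rgerm_mult[OF X] rgerm_mult[OF Y]
     and [simp] = ring.ring_simprules[OF ringed_space_ring[OF X]] ring.ring_simprules[OF ringed_space_ring[OF Y]]
     and [simp] = ring_hom_add[OF rs_morphismD(6)[OF f]] ring_hom_mult[OF rs_morphismD(6)[OF f]] ring_hom_one[OF rs_morphismD(6)[OF f]]
  show ?thesis
  proof (rule ring_hom_memI)
    fix g h assume g: "g \<in> rgerms Y (pt f x)" "h \<in> rgerms Y (pt f x)"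
    obtain W s t where W: "opn Y W" "pt f x \<in> W" "s \<in> rsecs Y W" "t \<in> rsecs Y W"
        "g = rgerm Y (pt f x) W s" "h = rgerm Y (pt f x) W t" by (rule ring_stalk_rep3[OF Y g(1,2,2)])
    show "stalk_comor f x (g \<otimes>\<^bsub>ring_stalk Y (pt f x)\<^esub> h) = stalk_comor f x g \<otimes>\<^bsub>ring_stalk X x\<^esub> stalk_comor f x h"
      "stalk_comor f x (g \<oplus>\<^bsub>ring_stalk Y (pt f x)\<^esub> h) = stalk_comor f x g \<oplus>\<^bsub>ring_stalk X x\<^esub> stalk_comor f x h"
      using W by simp_all
  next
    fix g assume g: "g \<in> rgerms Y (pt f x)"
    then obtain W s where W: "opn Y W" "pt f x \<in> W" "s \<in> rsecs Y W" "g = rgerm Y (pt f x) W s"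
      by (rule ring_stalk_rep)
    then show "stalk_comor f x g \<in> rgerms X x" by simp
  next
    have o: "opn X (preim f (pts Y))" by simp
    show "stalk_comor f x \<one>\<^bsub>ring_stalk Y (pt f x)\<^esub> = \<one>\<^bsub>ring_stalk X x\<^esub>"
      using px by (simp add: rgerm_one[OF Y openin_topspace px] rgerm_one[OF X o])
  qed
qed

section \<open>Extension of scalars\<close>

text \<open>\<open>E\<close> is the extension of scalars of M along \<phi>, made of cosets of the
  relation subgroup \<open>K\<close> in the free abelian group \<open>F\<close>; \<open>cl\<close>
  is the quotient map and \<open>t b m\<close> the pure tensor b \<otimes> m.\<close>

locale tens =
  fixes A :: "'a ring" and B :: "'b ring" and \<phi> :: "'a \<Rightarrow> 'b" and M :: "('a, 'm) module"
  assumes A: "ring A" and B: "ring B" and phi: "\<phi> \<in> ring_hom A B" and M: "left_module A M"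
begin

abbreviation "F \<equiv> tens_free B M"
abbreviation "K \<equiv> generate F (tens_rels A B \<phi> M)"
abbreviation "cl \<equiv> tens_class A B \<phi> M"
abbreviation "E \<equiv> ext_scalars A B \<phi> M"
abbreviation "t b m \<equiv> tens_class A B \<phi> M (frag_of (b, m))"

lemma F: "comm_group F" by (rule abelian_free_Abelian_group)

lemma rels_subset: "tens_rels A B \<phi> M \<subseteq> carrier F"
proof -
  note [simp] = ring.ring_simprules(1,5)[OF B] abelian_groupE(1)[OF left_moduleD(2)[OF M]]
    left_moduleD(3)[OF M] ring_hom_closed[OF phi]
  have *: "frag_of x - frag_of y \<in> carrier F" "frag_of x - frag_of y - frag_of z \<in> carrier F"
    if "x \<in> carrier B \<times> carrier M" "y \<in> carrier B \<times> carrier M" "z \<in> carrier B \<times> carrier M" for x y z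
    using that keys_diff[of "frag_of x" "frag_of y"] keys_diff[of "frag_of x - frag_of y" "frag_of z"] by auto
  show ?thesis unfolding tens_rels_def by (auto simp del: carrier_free_Abelian_group_iff intro!: *)
qed

lemma K_subgroup: "subgroup K F" using group.generate_is_subgroup[OF group_free_Abelian_group rels_subset] .

lemma K_normal: "K \<lhd> F" using comm_group.subgroup_imp_normal[OF F K_subgroup] .

lemma class_def: "cl c = K #>\<^bsub>F\<^esub> c" by (simp add: tens_class_def)

lemma E_carrier: "carrier E = cl ` carrier F"
  by (auto simp: ext_scalars_def Let_def FactGroup_def RCOSETS_def class_def)

lemma class_closed [simp]: "c \<in> carrier F \<Longrightarrow> cl c \<in> carrier E" by (auto simp: E_carrier)

lemma class_add: "c \<in> carrier F \<Longrightarrow> d \<in> carrier F \<Longrightarrow> cl (c + d) = cl c \<oplus>\<^bsub>E\<^esub> cl d"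
  using normal.rcos_sum[OF K_normal, of c d] by (simp add: ext_scalars_def Let_def class_def)

lemma class_zero: "k \<in> K \<Longrightarrow> cl k = \<zero>\<^bsub>E\<^esub>" using subgroup.rcos_const[OF K_subgroup group_free_Abelian_group]
  by (simp add: ext_scalars_def Let_def class_def FactGroup_def)

lemma zero_class: "\<zero>\<^bsub>E\<^esub> = cl 0" using class_zero[of 0] subgroup.one_closed[OF K_subgroup] by simp

lemma E_abelian: "abelian_group E"
proof -
  interpret Q: comm_group "F Mod K" by (rule comm_group.abelian_FactGroup[OF F K_subgroup])
  have e: "carrier E = carrier (F Mod K)" "ring.add E = monoid.mult (F Mod K)" "\<zero>\<^bsub>E\<^esub> = \<one>\<^bsub>F Mod K\<^esub>"
    by (simp_all add: ext_scalars_def Let_def)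
  show ?thesis
    by (rule abelian_groupI, unfold e) (rule Q.m_closed Q.one_closed Q.m_assoc Q.m_comm Q.l_one Q.l_inv_ex; assumption)+
qed

lemma class_minus: "c \<in> carrier F \<Longrightarrow> \<ominus>\<^bsub>E\<^esub> cl c = cl (- c)"
  using abelian_group.minus_equality[OF E_abelian, of "cl (- c)" "cl c"] class_add[of "- c" c] zero_class
  by simp

text \<open>Two of the three kinds of relations have the form x - y - z, and this gives additivity
  of the tensor in each argument; the third kind is treated directly in
  \<open>t_balanced\<close>.\<close>

lemma class_rel:
  assumes "x - y - z \<in> tens_rels A B \<phi> M" "y \<in> carrier F" "z \<in> carrier F"
  shows "cl x = cl y \<oplus>\<^bsub>E\<^esub> cl z"
proof -
  have k: "x - y - z \<in> K" using assms(1) by (rule generate.incl)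
  have yz: "y + z \<in> carrier F"
    using monoid.m_closed[OF group.is_monoid[OF group_free_Abelian_group] assms(2,3)] by simp
  have "cl x = cl ((x - y - z) + (y + z))" by simp
  also have "\<dots> = cl (x - y - z) \<oplus>\<^bsub>E\<^esub> cl (y + z)"
    using subgroup.subset[OF K_subgroup] k yz by (intro class_add) blast+
  also have "\<dots> = cl y \<oplus>\<^bsub>E\<^esub> cl z" using assms yz k abelian_groupE(5)[OF E_abelian class_closed[OF yz]]
    by (simp add: class_zero class_add del: carrier_free_Abelian_group_iff)
  finally show ?thesis .
qed

lemma t_closed [simp]: "b \<in> carrier B \<Longrightarrow> m \<in> carrier M \<Longrightarrow> t b m \<in> carrier E" by simp

lemma t_add_left:
  assumes "b \<in> carrier B" "b' \<in> carrier B" "m \<in> carrier M"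
  shows "t (b \<oplus>\<^bsub>B\<^esub> b') m = t b m \<oplus>\<^bsub>E\<^esub> t b' m"
  using assms by (intro class_rel) (auto simp: tens_rels_def)

lemma t_add_right:
  assumes "b \<in> carrier B" "m \<in> carrier M" "m' \<in> carrier M"
  shows "t b (m \<oplus>\<^bsub>M\<^esub> m') = t b m \<oplus>\<^bsub>E\<^esub> t b m'"
  using assms by (intro class_rel) (auto simp: tens_rels_def)

lemma t_balanced:
  assumes "b \<in> carrier B" "a \<in> carrier A" "m \<in> carrier M"
  shows "t (b \<otimes>\<^bsub>B\<^esub> \<phi> a) m = t b (a \<odot>\<^bsub>M\<^esub> m)"
proof -
  let ?x = "frag_of (b \<otimes>\<^bsub>B\<^esub> \<phi> a, m)" and ?y = "frag_of (b, a \<odot>\<^bsub>M\<^esub> m)"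
  have y: "?y \<in> carrier F" using assms left_moduleD(3)[OF M] by simp
  have k: "?x - ?y \<in> K" using assms by (intro generate.incl) (auto simp: tens_rels_def)
  have "cl ?x = cl ((?x - ?y) + ?y)" by simp
  also have "\<dots> = cl (?x - ?y) \<oplus>\<^bsub>E\<^esub> cl ?y" using subgroup.subset[OF K_subgroup] k y by (intro class_add) blast+
  also have "\<dots> = cl ?y" using y k abelian_groupE(5)[OF E_abelian] class_closed by (simp add: class_zero)
  finally show ?thesis .
qed

lemma t_add_hom_left: "m \<in> carrier M \<Longrightarrow> add_hom B E (\<lambda>b. t b m)" by (intro add_homI) (simp_all add: t_add_left)

lemma t_minus: "b \<in> carrier B \<Longrightarrow> m \<in> carrier M \<Longrightarrow> \<ominus>\<^bsub>E\<^esub> t b m = t (\<ominus>\<^bsub>B\<^esub> b) m"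
  using add_hom_minus[OF _ E_abelian t_add_hom_left] B by (metis ring_def)

text \<open>Pure tensors generate under addition alone, so no case for negatives is needed: -(b
  \<otimes> m) = (-b) \<otimes> m.\<close>

lemma tens_induct [consumes 1, case_names zero tensor add]:
  assumes x: "x \<in> carrier E" and 0: "P \<zero>\<^bsub>E\<^esub>"
    and 1: "\<And>b m. b \<in> carrier B \<Longrightarrow> m \<in> carrier M \<Longrightarrow> P (t b m)"
    and 2: "\<And>x y. \<lbrakk>x \<in> carrier E; y \<in> carrier E; P x; P y\<rbrakk> \<Longrightarrow> P (x \<oplus>\<^bsub>E\<^esub> y)"
  shows "P x"
proof -
  obtain c where c: "c \<in> carrier F" "x = cl c" using x by (auto simp: E_carrier)
  \<comment> \<open>The induction rule of the free abelian group has a step for differences x - y,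
    so the claim is carried for \<open>c\<close> and its negative at once.\<close>
  have "P (cl c) \<and> P (cl (- c))"
  proof (rule free_Abelian_group_induct[of c "carrier B \<times> carrier M"])
    show "Poly_Mapping.keys c \<subseteq> carrier B \<times> carrier M" using c by simp
    show "P (cl 0) \<and> P (cl (- 0))" using 0 by (simp add: zero_class)
    fix a assume "a \<in> carrier B \<times> carrier M"
    then obtain b m where a: "a = (b, m)" "b \<in> carrier B" "m \<in> carrier M" by auto
    have "cl (- frag_of a) = t (\<ominus>\<^bsub>B\<^esub> b) m" using a class_minus[of "frag_of (b, m)"] t_minus by simp
    then show "P (cl (frag_of a)) \<and> P (cl (- frag_of a))" using 1 a ring.ring_simprules(3)[OF B] by simp
  next
    fix x y assume xy: "Poly_Mapping.keys x \<subseteq> carrier B \<times> carrier M" "Poly_Mapping.keys y \<subseteq> carrier B \<times> carrier M"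
      and P: "P (cl x) \<and> P (cl (- x))" "P (cl y) \<and> P (cl (- y))"
    have "cl (x - y) = cl x \<oplus>\<^bsub>E\<^esub> cl (- y)" "cl (- (x - y)) = cl y \<oplus>\<^bsub>E\<^esub> cl (- x)"
      using class_add[of x "- y"] class_add[of y "- x"] xy by simp_all
    then show "P (cl (x - y)) \<and> P (cl (- (x - y)))"
      using xy P by (auto intro!: 2 class_closed simp del: minus_diff_eq)
  qed
  then show ?thesis using c by simp
qed

text \<open>A homomorphism on the free abelian group that respects the three kinds of relations
  kills \<open>K\<close>, hence is constant on cosets. It serves both the universal property in
  \<open>lift\<close> and the operations defined as unions over cosets in
  \<open>UN_lift\<close>.\<close>

lemma lift_const:
  assumes N: "abelian_group N" and h: "h \<in> hom F (add_monoid N)"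
    and add1: "\<And>b b' m. \<lbrakk>b \<in> carrier B; b' \<in> carrier B; m \<in> carrier M\<rbrakk> \<Longrightarrow>
      h (frag_of (b \<oplus>\<^bsub>B\<^esub> b', m)) = h (frag_of (b, m)) \<oplus>\<^bsub>N\<^esub> h (frag_of (b', m))"
    and add2: "\<And>b m m'. \<lbrakk>b \<in> carrier B; m \<in> carrier M; m' \<in> carrier M\<rbrakk> \<Longrightarrow>
      h (frag_of (b, m \<oplus>\<^bsub>M\<^esub> m')) = h (frag_of (b, m)) \<oplus>\<^bsub>N\<^esub> h (frag_of (b, m'))"
    and bal: "\<And>b a m. \<lbrakk>b \<in> carrier B; a \<in> carrier A; m \<in> carrier M\<rbrakk> \<Longrightarrow>
      h (frag_of (b \<otimes>\<^bsub>B\<^esub> \<phi> a, m)) = h (frag_of (b, a \<odot>\<^bsub>M\<^esub> m))"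
    and c: "c \<in> cl d" and d: "d \<in> carrier F"
  shows "h c = h d"
proof -
  interpret N: abelian_group N by fact
  interpret h: group_hom F "add_monoid N" h using h N.a_group by (simp add: group_hom_def group_hom_axioms_def)
  have hc: "h x \<in> carrier N" if "x \<in> carrier F" for x using h.hom_closed[OF that] by simp
  have ha: "h (x + y) = h x \<oplus>\<^bsub>N\<^esub> h y" if "x \<in> carrier F" "y \<in> carrier F" for x y using h.hom_mult[OF that] by simp
  \<comment> \<open>Relations are differences, while the target has only its carrier-based
    operations. So instead of computing h(r) one exhibits some \<open>y\<close> with h(r + y) = h(y)
    and cancels.\<close>
  have hrel: "h r = \<zero>\<^bsub>N\<^esub>" if "r \<in> carrier F" "y \<in> carrier F" "h (r + y) = h y" for r y
    using that hc ha[of r y] by (metis N.add.r_cancel_one)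
  have frag: "frag_of p \<in> carrier F" if "p \<in> carrier B \<times> carrier M" for p using that by simp
  have Fadd: "x + y \<in> carrier F" if "x \<in> carrier F" "y \<in> carrier F" for x y using h.m_closed[OF that] by simp
  have "h r = \<zero>\<^bsub>N\<^esub>" if r: "r \<in> tens_rels A B \<phi> M" for r
  proof -
    have rF: "r \<in> carrier F" using r rels_subset by blast
    have "\<exists>y\<in>carrier F. h (r + y) = h y" using r unfolding tens_rels_def
    proof (elim UnE CollectE exE conjE)
      fix b b' m assume *: "r = frag_of (b \<oplus>\<^bsub>B\<^esub> b', m) - frag_of (b, m) - frag_of (b', m)"
        "b \<in> carrier B" "b' \<in> carrier B" "m \<in> carrier M"
      then show ?thesis using add1 ha frag Fadd by (intro bexI[of _ "frag_of (b, m) + frag_of (b', m)"]) simp_all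
    next
      fix b m m' assume *: "r = frag_of (b, m \<oplus>\<^bsub>M\<^esub> m') - frag_of (b, m) - frag_of (b, m')"
        "b \<in> carrier B" "m \<in> carrier M" "m' \<in> carrier M"
      then show ?thesis using add2 ha frag Fadd by (intro bexI[of _ "frag_of (b, m) + frag_of (b, m')"]) simp_all
    next
      fix b a m assume *: "r = frag_of (b \<otimes>\<^bsub>B\<^esub> \<phi> a, m) - frag_of (b, a \<odot>\<^bsub>M\<^esub> m)"
        "b \<in> carrier B" "a \<in> carrier A" "m \<in> carrier M"
      then show ?thesis using bal left_moduleD(3)[OF M] by (intro bexI[of _ "frag_of (b, a \<odot>\<^bsub>M\<^esub> m)"]) simp_all
    qed
    then show ?thesis using hrel rF by blast
  qed
  then have "tens_rels A B \<phi> M \<subseteq> kernel F (add_monoid N) h"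
    using rels_subset by (auto simp: kernel_def simp del: carrier_free_Abelian_group_iff)
  then have "K \<subseteq> kernel F (add_monoid N) h" using h.subgroup_kernel h.generate_subgroup_incl by blast
  moreover obtain k where k: "k \<in> K" "c = k + d" using c by (auto simp: class_def r_coset_def)
  ultimately have "k \<in> carrier F" "h k = \<zero>\<^bsub>N\<^esub>" by (auto simp: kernel_def)
  then show ?thesis using ha[of k d] d k(2) hc[of d] by (simp del: carrier_free_Abelian_group_iff)
qed

lemma class_self: "d \<in> carrier F \<Longrightarrow> d \<in> cl d"
  unfolding class_def by (rule group.rcos_self[OF group_free_Abelian_group _ K_subgroup])

text \<open>The universal property of the tensor product, with any abelian group as target.
  Linearity over B is left aside, since the later targets are modules over another ring and the maps
  into them are semilinear.\<close>

lemma lift: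
  assumes N: "abelian_group N"
    and cl: "\<And>b m. b \<in> carrier B \<Longrightarrow> m \<in> carrier M \<Longrightarrow> \<beta> b m \<in> carrier N"
    and add1: "\<And>b b' m. \<lbrakk>b \<in> carrier B; b' \<in> carrier B; m \<in> carrier M\<rbrakk> \<Longrightarrow> \<beta> (b \<oplus>\<^bsub>B\<^esub> b') m = \<beta> b m \<oplus>\<^bsub>N\<^esub> \<beta> b' m"
    and add2: "\<And>b m m'. \<lbrakk>b \<in> carrier B; m \<in> carrier M; m' \<in> carrier M\<rbrakk> \<Longrightarrow> \<beta> b (m \<oplus>\<^bsub>M\<^esub> m') = \<beta> b m \<oplus>\<^bsub>N\<^esub> \<beta> b m'"
    and bal: "\<And>b a m. \<lbrakk>b \<in> carrier B; a \<in> carrier A; m \<in> carrier M\<rbrakk> \<Longrightarrow> \<beta> (b \<otimes>\<^bsub>B\<^esub> \<phi> a) m = \<beta> b (a \<odot>\<^bsub>M\<^esub> m)"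
  obtains \<psi> where "add_hom E N \<psi>" "\<And>b m. b \<in> carrier B \<Longrightarrow> m \<in> carrier M \<Longrightarrow> \<psi> (t b m) = \<beta> b m"
proof -
  interpret N: abelian_group N by fact
  have "(\<lambda>(b, m). \<beta> b m) ` (carrier B \<times> carrier M) \<subseteq> carrier (add_monoid N)" using cl by auto
  then obtain h where h: "h \<in> hom F (add_monoid N)"
    and hf: "\<And>x. x \<in> carrier B \<times> carrier M \<Longrightarrow> h (frag_of x) = (\<lambda>(b, m). \<beta> b m) x"
    using comm_group.free_Abelian_group_universal[OF N.a_comm_group] by metis
  note [simp] = ring.ring_simprules(1,5)[OF B] abelian_groupE(1)[OF left_moduleD(2)[OF M]]
    left_moduleD(3)[OF M] ring_hom_closed[OF phi]
  have const: "h c = h d" if "c \<in> cl d" "d \<in> carrier F" for c d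
    by (rule lift_const[OF N h _ _ _ that]) (simp_all add: hf add1 add2 bal)
  \<comment> \<open>An arbitrary member of the coset may be chosen, since \<open>h\<close> takes the
    same value on all of them.\<close>
  define \<psi> where "\<psi> T = h (SOME c. c \<in> T)" for T
  have psi: "\<psi> (cl d) = h d" if "d \<in> carrier F" for d
    unfolding \<psi>_def by (rule const[OF someI that]) (rule class_self[OF that])
  show thesis
  proof (rule that[of \<psi>])
    show "add_hom E N \<psi>"
    proof (rule add_homI)
      fix x assume "x \<in> carrier E"
      then obtain c where c: "c \<in> carrier F" "x = cl c" by (auto simp: E_carrier)
      show "\<psi> x \<in> carrier N" using c psi hom_in_carrier[OF h c(1)] by simp
      fix y assume "y \<in> carrier E"
      then obtain d where d: "d \<in> carrier F" "y = cl d" by (auto simp: E_carrier)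
      have cd: "c + d \<in> carrier F"
        using monoid.m_closed[OF group.is_monoid[OF group_free_Abelian_group] c(1) d(1)] by simp
      show "\<psi> (x \<oplus>\<^bsub>E\<^esub> y) = \<psi> x \<oplus>\<^bsub>N\<^esub> \<psi> y" using c d cd psi hom_mult[OF h c(1) d(1)]
        by (simp add: class_add[symmetric] del: carrier_free_Abelian_group_iff)
    qed
    show "\<psi> (t b m) = \<beta> b m" if "b \<in> carrier B" "m \<in> carrier M" for b m
      using that psi[of "frag_of (b, m)"] hf by simp
  qed
qed

text \<open>Scalar multiplication on \<open>ext_scalars\<close> and the map \<open>tens_map\<close>
  are unions, over the members of a coset, of classes obtained from a map \<open>k\<close> on
  generators. The conditions on \<open>k\<close> make all these classes equal, so the union is that
  class and depends additively on the coset.\<close>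

lemma UN_lift:
  assumes E': "tens A' B' \<phi>' M'"
    and cl: "\<And>b m. b \<in> carrier B \<Longrightarrow> m \<in> carrier M \<Longrightarrow> k (b, m) \<in> carrier (tens_free B' M')"
    and add1: "\<And>b b' m. \<lbrakk>b \<in> carrier B; b' \<in> carrier B; m \<in> carrier M\<rbrakk> \<Longrightarrow>
      tens_class A' B' \<phi>' M' (k (b \<oplus>\<^bsub>B\<^esub> b', m)) = tens_class A' B' \<phi>' M' (k (b, m))
        \<oplus>\<^bsub>ext_scalars A' B' \<phi>' M'\<^esub> tens_class A' B' \<phi>' M' (k (b', m))"
    and add2: "\<And>b m m'. \<lbrakk>b \<in> carrier B; m \<in> carrier M; m' \<in> carrier M\<rbrakk> \<Longrightarrow>
      tens_class A' B' \<phi>' M' (k (b, m \<oplus>\<^bsub>M\<^esub> m')) = tens_class A' B' \<phi>' M' (k (b, m))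
        \<oplus>\<^bsub>ext_scalars A' B' \<phi>' M'\<^esub> tens_class A' B' \<phi>' M' (k (b, m'))"
    and bal: "\<And>b a m. \<lbrakk>b \<in> carrier B; a \<in> carrier A; m \<in> carrier M\<rbrakk> \<Longrightarrow>
      tens_class A' B' \<phi>' M' (k (b \<otimes>\<^bsub>B\<^esub> \<phi> a, m)) = tens_class A' B' \<phi>' M' (k (b, a \<odot>\<^bsub>M\<^esub> m))"
  shows "add_hom E (ext_scalars A' B' \<phi>' M') (\<lambda>T. \<Union>c\<in>T. tens_class A' B' \<phi>' M' (frag_extend k c))"
    and "\<And>b m. b \<in> carrier B \<Longrightarrow> m \<in> carrier M \<Longrightarrow>
      (\<Union>c\<in>t b m. tens_class A' B' \<phi>' M' (frag_extend k c)) = tens_class A' B' \<phi>' M' (k (b, m))"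
proof -
  interpret E': tens A' B' \<phi>' M' by fact
  have fe: "frag_extend k c \<in> carrier E'.F" if "c \<in> carrier F" for c
    using that cl keys_frag_extend[of k c] by fastforce
  define h where "h c = E'.cl (frag_extend k c)" for c
  have h: "h \<in> hom F (add_monoid E'.E)" by (rule homI)
       (simp_all add: h_def frag_extend_add E'.class_add fe del: carrier_free_Abelian_group_iff)
  note [simp] = ring.ring_simprules(1,5)[OF B] abelian_groupE(1)[OF left_moduleD(2)[OF M]]
    left_moduleD(3)[OF M] ring_hom_closed[OF phi]
  have const: "h c = h d" if "c \<in> cl d" "d \<in> carrier F" for c d
    by (rule lift_const[OF E'.E_abelian h _ _ _ that]) (simp_all add: h_def add1 add2 bal)
  have U: "(\<Union>c\<in>cl d. E'.cl (frag_extend k c)) = h d" if "d \<in> carrier F" for d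
    using const[OF _ that] class_self[OF that] unfolding h_def by blast
  show "(\<Union>c\<in>t b m. E'.cl (frag_extend k c)) = E'.cl (k (b, m))" if "b \<in> carrier B" "m \<in> carrier M" for b m
    using U[of "frag_of (b, m)"] that by (simp add: h_def)
  show "add_hom E E'.E (\<lambda>T. \<Union>c\<in>T. E'.cl (frag_extend k c))"
  proof (rule add_homI)
    fix x assume "x \<in> carrier E"
    then obtain c where c: "c \<in> carrier F" "x = cl c" by (auto simp: E_carrier)
    show "(\<Union>c\<in>x. E'.cl (frag_extend k c)) \<in> carrier E'.E" using c U[OF c(1)] hom_in_carrier[OF h c(1)] by simp
    fix y assume "y \<in> carrier E"
    then obtain d where d: "d \<in> carrier F" "y = cl d" by (auto simp: E_carrier)
    have cd: "c + d \<in> carrier F"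
      using monoid.m_closed[OF group.is_monoid[OF group_free_Abelian_group] c(1) d(1)] by simp
    show "(\<Union>c\<in>x \<oplus>\<^bsub>E\<^esub> y. E'.cl (frag_extend k c)) =
      (\<Union>c\<in>x. E'.cl (frag_extend k c)) \<oplus>\<^bsub>E'.E\<^esub> (\<Union>c\<in>y. E'.cl (frag_extend k c))"
      using U[OF c(1)] U[OF d(1)] U[OF cd] hom_mult[OF h c(1) d(1)] c d
      by (simp add: class_add[symmetric] del: carrier_free_Abelian_group_iff)
  qed
qed

lemma
  assumes b: "b \<in> carrier B"
  shows smult_add_hom: "add_hom E E (\<lambda>x. b \<odot>\<^bsub>E\<^esub> x)"
    and smult_t: "\<And>b' m. b' \<in> carrier B \<Longrightarrow> m \<in> carrier M \<Longrightarrow> b \<odot>\<^bsub>E\<^esub> t b' m = t (b \<otimes>\<^bsub>B\<^esub> b') m"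
proof -
  note [simp] = ring.ring_simprules(1,5)[OF B] abelian_groupE(1)[OF left_moduleD(2)[OF M]]
    left_moduleD(3)[OF M] ring_hom_closed[OF phi] t_add_left t_add_right t_balanced[symmetric]
  have eq: "(\<lambda>x. b \<odot>\<^bsub>E\<^esub> x) = (\<lambda>T. \<Union>c\<in>T. cl (frag_extend (\<lambda>(b', m). frag_of (b \<otimes>\<^bsub>B\<^esub> b', m)) c))"
    by (simp add: ext_scalars_def Let_def)
  note L = UN_lift[OF tens_axioms, of "\<lambda>(b', m). frag_of (b \<otimes>\<^bsub>B\<^esub> b', m)"]
  note d = ring.ring_simprules(23)[OF B] ring.ring_simprules(11)[OF B]
  show "add_hom E E (\<lambda>x. b \<odot>\<^bsub>E\<^esub> x)" unfolding eq by (rule L) (use b in "simp_all add: ring.ring_simprules[OF B]")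
  show "b \<odot>\<^bsub>E\<^esub> t b' m = t (b \<otimes>\<^bsub>B\<^esub> b') m" if "b' \<in> carrier B" "m \<in> carrier M" for b' m unfolding eq[THEN fun_cong]
    by (subst L(2)) (use b that in "simp_all add: ring.ring_simprules[OF B]")
qed

lemma E_left_module: "left_module B E"
proof -
  note E_add = abelian_groupE(1)[OF E_abelian]
  note cl = add_hom_closed[OF smult_add_hom] and ad = add_hom_add[OF smult_add_hom]
    and ze = add_hom_zero[OF E_abelian E_abelian smult_add_hom]
  note [simp] = E_add abelian_groupE(2)[OF E_abelian] ring.ring_simprules(1,5,6)[OF B] smult_t cl ad ze
    ring.ring_simprules(12)[OF B]
  interpret E: abelian_group E by (rule E_abelian)
  interpret B: ring B by (rule B)
  show ?thesis unfolding left_module_def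
  proof (intro conjI ballI E_abelian B)
    fix a b x assume ab: "a \<in> carrier B" "b \<in> carrier B" and x: "x \<in> carrier E"
    show "(a \<oplus>\<^bsub>B\<^esub> b) \<odot>\<^bsub>E\<^esub> x = a \<odot>\<^bsub>E\<^esub> x \<oplus>\<^bsub>E\<^esub> b \<odot>\<^bsub>E\<^esub> x" using x
    proof (induction x rule: tens_induct)
      case (add x y)
      then show ?case using ab by (simp add: E.add.m_ac)
    qed (use ab in "simp_all add: B.l_distr t_add_left")
    show "(a \<otimes>\<^bsub>B\<^esub> b) \<odot>\<^bsub>E\<^esub> x = a \<odot>\<^bsub>E\<^esub> (b \<odot>\<^bsub>E\<^esub> x)"
      using x by (induction x rule: tens_induct) (use ab in "simp_all add: B.m_assoc")
  next
    fix x assume x: "x \<in> carrier E"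
    show "\<one>\<^bsub>B\<^esub> \<odot>\<^bsub>E\<^esub> x = x" using x by (induction x rule: tens_induct) simp_all
  qed simp_all
qed

lemma hom_eqI:
  assumes "abelian_group N" "add_hom E N u" "add_hom E N v"
    and "\<And>b m. b \<in> carrier B \<Longrightarrow> m \<in> carrier M \<Longrightarrow> u (t b m) = v (t b m)"
    and "x \<in> carrier E"
  shows "u x = v x" using assms(5)
proof (induction x rule: tens_induct)
  case zero
  then show ?case using add_hom_zero[OF E_abelian assms(1)] assms(2,3) by metis
next
  case (add x y)
  then show ?case using add_hom_add[OF assms(2)] add_hom_add[OF assms(3)] by simp
qed (use assms in auto)

end

text \<open>The base rings may differ: \<open>g\<close> is semilinear over \<alpha> from A to A',
  where \<phi>' after \<alpha> is \<phi>. Such data arise when a morphism to Y factors through Y',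
  with M and M' stalks over Y and over Y'. Balance survives because \<phi>(a) = \<phi>'(\<alpha>(a))
  can be moved across the second tensor product.\<close>

lemma
  assumes T: "tens A B \<phi> M" and T': "tens A' B \<phi>' M'" and g: "add_hom M M' g"
    and \<alpha>: "\<And>a. a \<in> carrier A \<Longrightarrow> \<alpha> a \<in> carrier A'" "\<And>a. a \<in> carrier A \<Longrightarrow> \<phi>' (\<alpha> a) = \<phi> a"
    and lin: "\<And>a m. a \<in> carrier A \<Longrightarrow> m \<in> carrier M \<Longrightarrow> g (a \<odot>\<^bsub>M\<^esub> m) = \<alpha> a \<odot>\<^bsub>M'\<^esub> g m"
  shows tens_map_add_hom: "add_hom (ext_scalars A B \<phi> M) (ext_scalars A' B \<phi>' M') (tens_map A' B \<phi>' M' g)"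
    and tens_map_tensor: "\<And>b m. b \<in> carrier B \<Longrightarrow> m \<in> carrier M \<Longrightarrow>
      tens_map A' B \<phi>' M' g (tens_class A B \<phi> M (frag_of (b, m))) = tens_class A' B \<phi>' M' (frag_of (b, g m))"
    and tens_map_smult: "\<And>b x. b \<in> carrier B \<Longrightarrow> x \<in> carrier (ext_scalars A B \<phi> M) \<Longrightarrow>
      tens_map A' B \<phi>' M' g (b \<odot>\<^bsub>ext_scalars A B \<phi> M\<^esub> x) = b \<odot>\<^bsub>ext_scalars A' B \<phi>' M'\<^esub> tens_map A' B \<phi>' M' g x"
proof -
  interpret T: tens A B \<phi> M by fact
  interpret T': tens A' B \<phi>' M' by fact
  have eq: "tens_map A' B \<phi>' M' g = (\<lambda>T. \<Union>c\<in>T. T'.cl (frag_extend (\<lambda>(b, m). frag_of (b, g m)) c))"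
    by (simp add: tens_map_def fun_eq_iff)
  have bal: "T'.t (b \<otimes>\<^bsub>B\<^esub> \<phi> a) (g m) = T'.t b (\<alpha> a \<odot>\<^bsub>M'\<^esub> g m)"
    if "b \<in> carrier B" "a \<in> carrier A" "m \<in> carrier M" for b a m
    using that \<alpha> T'.t_balanced[of b "\<alpha> a" "g m"] add_hom_closed[OF g] by simp
  note L = T.UN_lift[OF T', of "\<lambda>(b, m). frag_of (b, g m)"]
  note [simp] = add_hom_closed[OF g] add_hom_add[OF g] lin T'.t_add_left T'.t_add_right bal
  show hom: "add_hom T.E T'.E (tens_map A' B \<phi>' M' g)" unfolding eq by (rule L) simp_all
  show ten: "tens_map A' B \<phi>' M' g (T.t b m) = T'.t b (g m)" if "b \<in> carrier B" "m \<in> carrier M" for b m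
    unfolding eq by (subst L(2)) (use that in simp_all)
  show "tens_map A' B \<phi>' M' g (b \<odot>\<^bsub>T.E\<^esub> x) = b \<odot>\<^bsub>T'.E\<^esub> tens_map A' B \<phi>' M' g x"
    if b: "b \<in> carrier B" and x: "x \<in> carrier T.E" for b x
  proof (rule T.hom_eqI[OF T'.E_abelian _ _ _ x])
    show "add_hom T.E T'.E (\<lambda>x. tens_map A' B \<phi>' M' g (b \<odot>\<^bsub>T.E\<^esub> x))"
      by (rule add_hom_compose[OF T.smult_add_hom[OF b] hom])
    show "add_hom T.E T'.E (\<lambda>x. b \<odot>\<^bsub>T'.E\<^esub> tens_map A' B \<phi>' M' g x)"
      by (rule add_hom_compose[OF hom T'.smult_add_hom[OF b]])
    fix b' m assume "b' \<in> carrier B" "m \<in> carrier M"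
    then show "tens_map A' B \<phi>' M' g (b \<odot>\<^bsub>T.E\<^esub> T.t b' m) = b \<odot>\<^bsub>T'.E\<^esub> tens_map A' B \<phi>' M' g (T.t b' m)"
      using b ring.ring_simprules(5)[OF T.B] by (simp add: ten T.smult_t T'.smult_t)
  qed
qed

section \<open>The pullback sheaf\<close>

lemma sheaf_of_setsI:
  assumes 1: "\<And>V W s. \<lbrakk>openin T V; openin T W; W \<subseteq> V; s \<in> S V\<rbrakk> \<Longrightarrow> res V W s \<in> S W"
    and 2: "\<And>V s. openin T V \<Longrightarrow> s \<in> S V \<Longrightarrow> res V V s = s"
    and 3: "\<And>V W Z s. \<lbrakk>openin T V; openin T W; openin T Z; Z \<subseteq> W; W \<subseteq> V; s \<in> S V\<rbrakk> \<Longrightarrow>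
        res W Z (res V W s) = res V Z s"
    and 4: "\<And>\<W> s. \<lbrakk>(\<And>W. W \<in> \<W> \<Longrightarrow> openin T W); (\<And>W. W \<in> \<W> \<Longrightarrow> s W \<in> S W); (\<And>W W'. W \<in> \<W> \<Longrightarrow> W' \<in> \<W> \<Longrightarrow> res W (W \<inter> W') (s W) = res W' (W \<inter> W') (s W'))\<rbrakk> \<Longrightarrow>
        \<exists>!t. t \<in> S (\<Union>\<W>) \<and> (\<forall>W\<in>\<W>. res (\<Union>\<W>) W t = s W)"
  shows "sheaf_of_sets T S res" unfolding sheaf_of_sets_def
proof (intro conjI allI impI ballI Pi_I)
  fix \<W> s
  assume *: "(\<forall>W\<in>\<W>. openin T W \<and> s W \<in> S W) \<and> (\<forall>W\<in>\<W>. \<forall>W'\<in>\<W>. res W (W \<inter> W') (s W) = res W' (W \<inter> W') (s W'))"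
  show "\<exists>!t. t \<in> S (\<Union>\<W>) \<and> (\<forall>W\<in>\<W>. res (\<Union>\<W>) W t = s W)" by (rule 4) (use * in blast)+
qed (simp_all add: 1 2 3)

lemma sheaf_of_sets_glue:
  assumes S: "sheaf_of_sets T S res"
    and "\<And>W. W \<in> \<W> \<Longrightarrow> openin T W" "\<And>W. W \<in> \<W> \<Longrightarrow> s W \<in> S W"
    and "\<And>W W'. W \<in> \<W> \<Longrightarrow> W' \<in> \<W> \<Longrightarrow> res W (W \<inter> W') (s W) = res W' (W \<inter> W') (s W')"
  shows "\<exists>!t. t \<in> S (\<Union>\<W>) \<and> (\<forall>W\<in>\<W>. res (\<Union>\<W>) W t = s W)"
proof -
  have *: "\<forall>\<W> s. (\<forall>W\<in>\<W>. openin T W \<and> s W \<in> S W) \<and> (\<forall>W\<in>\<W>. \<forall>W'\<in>\<W>. res W (W \<inter> W') (s W) = res W' (W \<inter> W') (s W')) \<longrightarrow>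
        (\<exists>!t. t \<in> S (\<Union>\<W>) \<and> (\<forall>W\<in>\<W>. res (\<Union>\<W>) W t = s W))"
    using S unfolding sheaf_of_sets_def by (elim conjE)
  show ?thesis using assms(2-4) by (intro *[THEN spec, THEN spec, THEN mp]) blast
qed

locale rs_map =
  fixes X :: "('a, 'r) ringed_sp" and Y :: "('b, 's) ringed_sp" and f :: "('a, 'r, 'b, 's) rs_mor"
  assumes X: "ringed_space X" and Y: "ringed_space Y" and f: "rs_morphism X Y f"

locale pullback = rs_map X Y f
  for X :: "('a, 'r) ringed_sp" and Y :: "('b, 's) ringed_sp" and f :: "('a, 'r, 'b, 's) rs_mor" +
  fixes M :: "('b, 's, 'm) mod_sh"
  assumes M: "module_sheaf Y M"
begin

lemma src_f [simp]: "src f = X" and tgt_f [simp]: "tgt f = Y" using rs_morphismD(1,2)[OF f] by auto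

abbreviation "Sec \<equiv> pb_sections f M"
abbreviation "Mst x \<equiv> mod_stalk Y M (pt f x)"
abbreviation "Mg x \<equiv> mgerms Y M (pt f x)"
abbreviation "S x \<equiv> pb_stalk f M x"
abbreviation "ten y a m \<equiv> pb_tensor f M y a m"

lemma tens_at: "x \<in> pts X \<Longrightarrow>
     tens (ring_stalk Y (pt f x)) (ring_stalk X x) (stalk_comor f x) (Mst x)"
  by (rule tens.intro) (simp_all add: ring_ring_stalk X Y pt_topspace[OF f] stalk_comor_hom[OF X Y f]
      left_module_mod_stalk[OF Y M])

lemma S_eq: "S x = ext_scalars (ring_stalk Y (pt f x)) (ring_stalk X x) (stalk_comor f x) (Mst x)"
  by (simp add: pb_stalk_def)

lemma ten_eq: "ten x a m = tens_class (ring_stalk Y (pt f x)) (ring_stalk X x) (stalk_comor f x)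
    (Mst x) (frag_of (a, m))" by (simp add: pb_tensor_def)

lemma S_left_module: "x \<in> pts X \<Longrightarrow> left_module (ring_stalk X x) (S x)"
  unfolding S_eq by (rule tens.E_left_module[OF tens_at])

lemma S_abelian: "x \<in> pts X \<Longrightarrow> abelian_group (S x)" using S_left_module left_moduleD(2) by blast

lemma ten_closed: "\<lbrakk>x \<in> pts X; a \<in> rgerms X x; m \<in> Mg x\<rbrakk> \<Longrightarrow> ten x a m \<in> carrier (S x)"
  unfolding S_eq ten_eq by (rule tens.t_closed[OF tens_at])

lemma ten_add_right: "\<lbrakk>x \<in> pts X; a \<in> rgerms X x; m \<in> Mg x; m' \<in> Mg x\<rbrakk> \<Longrightarrow>
     ten x a (m \<oplus>\<^bsub>Mst x\<^esub> m') = ten x a m \<oplus>\<^bsub>S x\<^esub> ten x a m'"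
  unfolding S_eq ten_eq by (rule tens.t_add_right[OF tens_at])

lemma ten_balanced: "\<lbrakk>x \<in> pts X; b \<in> rgerms X x; a \<in> rgerms Y (pt f x); m \<in> Mg x\<rbrakk> \<Longrightarrow>
     ten x (b \<otimes>\<^bsub>ring_stalk X x\<^esub> stalk_comor f x a) m = ten x b (a \<odot>\<^bsub>Mst x\<^esub> m)"
  unfolding S_eq ten_eq by (rule tens.t_balanced[OF tens_at])

lemma smult_ten: "\<lbrakk>x \<in> pts X; b \<in> rgerms X x; a \<in> rgerms X x; m \<in> Mg x\<rbrakk> \<Longrightarrow>
     b \<odot>\<^bsub>S x\<^esub> ten x a m = ten x (b \<otimes>\<^bsub>ring_stalk X x\<^esub> a) m"
  unfolding S_eq ten_eq by (rule tens.smult_t[OF tens_at])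

text \<open>The value at \<open>y\<close> of the local section a \<otimes> m.\<close>

definition pure :: "'a set \<Rightarrow> 'r \<Rightarrow> 'b set \<Rightarrow> 'm \<Rightarrow> 'a \<Rightarrow> (('a, 'r) germ, ('b, 'm) germ) tens" where
  "pure Z a V m y = ten y (rgerm X y Z a) (mgerm Y M (pt f y) V m)"

text \<open>The local condition in \<open>pb_sections\<close>, isolated so that it can be
  restricted, added and used for induction. All summands share one open set \<open>V\<close> of Y,
  hence sums over different sets must first be moved to their intersection.\<close>

definition fin_sum :: "'a set \<Rightarrow> ('a, 'r, 'b, 'm) pbs \<Rightarrow> bool" where
  "fin_sum Z sg \<longleftrightarrow> (\<exists>V (n::nat) a m. opn Y V \<and> Z \<subseteq> preim f V \<and> (\<forall>i<n. a i \<in> rsecs X Z \<and> m i \<in> secs M V) \<and>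
     (\<forall>y\<in>Z. sg y = (\<Oplus>\<^bsub>S y\<^esub>i\<in>{..<n}. pure Z (a i) V (m i) y)))"

lemma pb_sections_iff: "sg \<in> Sec W \<longleftrightarrow> sg \<in> (\<Pi>\<^sub>E x\<in>W. carrier (S x)) \<and>
     (\<forall>x\<in>W. \<exists>Z. opn X Z \<and> x \<in> Z \<and> Z \<subseteq> W \<and> fin_sum Z sg)"
  unfolding pb_sections_def fin_sum_def pure_def by (simp only: src_f tgt_f mem_Collect_eq) metis

lemma open_top: "opn X Z \<Longrightarrow> y \<in> Z \<Longrightarrow> y \<in> pts X" using openin_subset by blast

lemma pure_closed:
  assumes "opn X Z" "a \<in> rsecs X Z" "opn Y V" "m \<in> secs M V" "Z \<subseteq> preim f V" "y \<in> Z"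
  shows "pure Z a V m y \<in> carrier (S y)"
proof -
  have "pt f y \<in> V" using assms(5,6) mem_preim[OF f] by blast
  then show ?thesis
    unfolding pure_def using assms open_top by (intro ten_closed ring_stalk_carrier mod_stalk_carrier)
qed

lemma pure_restrict:
  assumes "opn X Z" "a \<in> rsecs X Z" "opn Y V" "m \<in> secs M V"
    "opn X Z'" "Z' \<subseteq> Z" "opn Y V'" "V' \<subseteq> V" "Z' \<subseteq> preim f V'" "y \<in> Z'"
  shows "pure Z' (rres X Z Z' a) V' (mres M V V' m) y = pure Z a V m y"
proof -
  have "pt f y \<in> V'" using assms(9,10) mem_preim[OF f] by blast
  then show ?thesis using assms by (simp add: pure_def rgerm_res[OF X] mgerm_res[OF M])
qed

lemma fin_sum_cong: "(\<And>y. y \<in> Z \<Longrightarrow> sg y = tg y) \<Longrightarrow> fin_sum Z sg \<longleftrightarrow> fin_sum Z tg" unfolding fin_sum_def by auto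

lemma fin_sum_zero: "opn X Z \<Longrightarrow> fin_sum Z (\<lambda>y. \<zero>\<^bsub>S y\<^esub>)" unfolding fin_sum_def
  using abelian_group.axioms(1)[OF S_abelian] open_top pt_topspace[OF f]
  by (intro exI[of _ "pts Y"] exI[of _ 0]) (auto simp: mem_preim[OF f] abelian_monoid.finsum_empty)

lemma fin_sum_pure:
  assumes "opn X Z" "a \<in> rsecs X Z" "opn Y V" "m \<in> secs M V" "Z \<subseteq> preim f V"
  shows "fin_sum Z (pure Z a V m)"
proof -
  have "pure Z a V m y = (\<Oplus>\<^bsub>S y\<^esub>i\<in>{..<Suc 0}. pure Z a V m y)" if "y \<in> Z" for y
  proof -
    interpret Sy: abelian_group "S y" using S_abelian open_top assms(1) that by blast
    show ?thesis using pure_closed[OF assms that] by (simp add: lessThan_Suc Sy.finsum_insert)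
  qed
  then show ?thesis unfolding fin_sum_def using assms
    by (intro exI[of _ V] exI[of _ "Suc 0"] exI[of _ "\<lambda>_. a"] exI[of _ "\<lambda>_. m"]) auto
qed

text \<open>\<open>Z\<close> and \<open>V\<close> shrink independently: the first when passing to a
  smaller neighbourhood, the second when two finite sums are brought over a common open set of
  Y.\<close>

lemma fin_sum_restrict_both:
  assumes Z: "opn X Z" and Z': "opn X Z'" "Z' \<subseteq> Z"
    and V: "opn Y V" "Z \<subseteq> preim f V" and V': "opn Y V'" "V' \<subseteq> V" "Z' \<subseteq> preim f V'"
    and am: "\<forall>i<n. a i \<in> rsecs X Z \<and> m i \<in> secs M V"
    and y: "y \<in> Z'"
  shows "(\<Oplus>\<^bsub>S y\<^esub>i\<in>{..<n}. pure Z (a i) V (m i) y) =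
         (\<Oplus>\<^bsub>S y\<^esub>i\<in>{..<n}. pure Z' (rres X Z Z' (a i)) V' (mres M V V' (m i)) y)"
proof -
  interpret Sy: abelian_group "S y" using S_abelian open_top Z'(1) y by blast
  have "y \<in> Z" using y Z'(2) by blast
  then show ?thesis using assms pure_closed[OF Z _ V(1) _ V(2)]
    by (intro Sy.finsum_cong') (auto simp: pure_restrict)
qed

lemma fin_sum_restrict:
  assumes Z: "opn X Z" and Z': "opn X Z'" "Z' \<subseteq> Z" and s: "fin_sum Z sg"
  shows "fin_sum Z' sg"
proof -
  obtain V n a m where V: "opn Y V" "Z \<subseteq> preim f V"
    and am: "\<forall>i<(n::nat). a i \<in> rsecs X Z \<and> m i \<in> secs M V"
    and eq: "\<forall>y\<in>Z. sg y = (\<Oplus>\<^bsub>S y\<^esub>i\<in>{..<n}. pure Z (a i) V (m i) y)"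
    using s unfolding fin_sum_def by blast
  have V': "opn Y V" "V \<subseteq> V" "Z' \<subseteq> preim f V" using V Z' by auto
  show ?thesis unfolding fin_sum_def
  proof (intro exI conjI)
    show "\<forall>y\<in>Z'. sg y = (\<Oplus>\<^bsub>S y\<^esub>i\<in>{..<n}. pure Z' (rres X Z Z' (a i)) V (mres M V V (m i)) y)"
      using eq fin_sum_restrict_both[OF Z Z' V V' am] Z'(2) by auto
  qed (use V V' Z Z' am in "auto simp: rres_closed[OF X] mres_closed[OF M]")
qed

lemma finsum_append:
  assumes "abelian_group G" "\<And>i. i < n \<Longrightarrow> x i \<in> carrier G" "\<And>i. i < k \<Longrightarrow> y i \<in> carrier G"
  shows "(\<Oplus>\<^bsub>G\<^esub>i\<in>{..<n + (k::nat)}. if i < n then x i else y (i - n)) =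
         (\<Oplus>\<^bsub>G\<^esub>i\<in>{..<n}. x i) \<oplus>\<^bsub>G\<^esub> (\<Oplus>\<^bsub>G\<^esub>i\<in>{..<k}. y i)"
proof -
  interpret G: abelian_group G by fact
  show ?thesis using assms(3)
  proof (induction k)
    case 0
    have "(\<Oplus>\<^bsub>G\<^esub>i\<in>{..<n}. if i < n then x i else y (i - n)) = (\<Oplus>\<^bsub>G\<^esub>i\<in>{..<n}. x i)"
      using assms(2) by (intro G.finsum_cong') auto
    then show ?case using assms(2) by (simp add: Pi_def)
  next
    case (Suc k)
    have c: "(\<lambda>i. if i < n then x i else y (i - n)) \<in> {..<n + k} \<rightarrow> carrier G" using assms(2) Suc.prems by auto
    have y: "y \<in> {..<k} \<rightarrow> carrier G" "x \<in> {..<n} \<rightarrow> carrier G" using assms(2) Suc.prems by auto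
    have "(\<Oplus>\<^bsub>G\<^esub>i\<in>{..<n + Suc k}. if i < n then x i else y (i - n)) =
      y k \<oplus>\<^bsub>G\<^esub> (\<Oplus>\<^bsub>G\<^esub>i\<in>{..<n + k}. if i < n then x i else y (i - n))"
      using c Suc.prems by (simp add: lessThan_Suc G.finsum_insert)
    also have "\<dots> = y k \<oplus>\<^bsub>G\<^esub> ((\<Oplus>\<^bsub>G\<^esub>i\<in>{..<n}. x i) \<oplus>\<^bsub>G\<^esub> (\<Oplus>\<^bsub>G\<^esub>i\<in>{..<k}. y i))" using Suc by simp
    also have "\<dots> = (\<Oplus>\<^bsub>G\<^esub>i\<in>{..<n}. x i) \<oplus>\<^bsub>G\<^esub> (\<Oplus>\<^bsub>G\<^esub>i\<in>{..<Suc k}. y i)"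
      using y Suc.prems by (simp add: lessThan_Suc G.finsum_insert G.add.m_lcomm)
    finally show ?case .
  qed
qed

lemma fin_sum_add:
  assumes Z: "opn X Z" and s: "fin_sum Z sg" and t: "fin_sum Z tg"
  shows "fin_sum Z (\<lambda>y. sg y \<oplus>\<^bsub>S y\<^esub> tg y)"
proof -
  obtain V n a m where V: "opn Y V" "Z \<subseteq> preim f V"
    and am: "\<forall>i<(n::nat). a i \<in> rsecs X Z \<and> m i \<in> secs M V"
    and eq: "\<forall>y\<in>Z. sg y = (\<Oplus>\<^bsub>S y\<^esub>i\<in>{..<n}. pure Z (a i) V (m i) y)"
    using s unfolding fin_sum_def by blast
  obtain V' n' a' m' where V': "opn Y V'" "Z \<subseteq> preim f V'"
    and am': "\<forall>i<(n'::nat). a' i \<in> rsecs X Z \<and> m' i \<in> secs M V'"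
    and eq': "\<forall>y\<in>Z. tg y = (\<Oplus>\<^bsub>S y\<^esub>i\<in>{..<n'}. pure Z (a' i) V' (m' i) y)"
    using t unfolding fin_sum_def by blast
  let ?V = "V \<inter> V'"
  \<comment> \<open>Restriction from \<open>Z\<close> to itself is the identity; it is written out
    so that both halves have the shape delivered by \<open>fin_sum_restrict_both\<close>.\<close>
  let ?a = "\<lambda>i. if i < n then rres X Z Z (a i) else rres X Z Z (a' (i - n))"
  let ?m = "\<lambda>i. if i < n then mres M V ?V (m i) else mres M V' ?V (m' (i - n))"
  have V2: "opn Y ?V" "?V \<subseteq> V" "?V \<subseteq> V'" "Z \<subseteq> preim f ?V" using V V' by (auto simp: preim_Int)
  have cl: "i < n + n' \<Longrightarrow> ?a i \<in> rsecs X Z \<and> ?m i \<in> secs M ?V" for i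
    using am am' Z V V' V2 by (auto simp: rres_closed[OF X] mres_closed[OF M])
  show ?thesis unfolding fin_sum_def
  proof (intro exI conjI ballI)
    fix y assume y: "y \<in> Z"
    interpret Sy: abelian_group "S y" using S_abelian open_top Z y by blast
    have "(\<Oplus>\<^bsub>S y\<^esub>i\<in>{..<n + n'}. pure Z (?a i) ?V (?m i) y) =
      (\<Oplus>\<^bsub>S y\<^esub>i\<in>{..<n + n'}. if i < n then pure Z (rres X Z Z (a i)) ?V (mres M V ?V (m i)) y
         else pure Z (rres X Z Z (a' (i - n))) ?V (mres M V' ?V (m' (i - n))) y)"
      by (rule arg_cong[of _ _ "\<lambda>g. finsum (S y) g _"]) (rule ext, simp)
    also have "\<dots> = (\<Oplus>\<^bsub>S y\<^esub>i\<in>{..<n}. pure Z (rres X Z Z (a i)) ?V (mres M V ?V (m i)) y) \<oplus>\<^bsub>S y\<^esub>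
       (\<Oplus>\<^bsub>S y\<^esub>i\<in>{..<n'}. pure Z (rres X Z Z (a' i)) ?V (mres M V' ?V (m' i)) y)"
      using am am' Z V V' V2 y
      by (intro finsum_append) (auto intro!: pure_closed simp: Sy.abelian_group_axioms rres_closed[OF X] mres_closed[OF M])
    also have "\<dots> = sg y \<oplus>\<^bsub>S y\<^esub> tg y" using fin_sum_restrict_both[OF Z Z order_refl V V2(1,2,4) am y]
        fin_sum_restrict_both[OF Z Z order_refl V' V2(1,3,4) am' y] eq eq' y by simp
    finally show "sg y \<oplus>\<^bsub>S y\<^esub> tg y = (\<Oplus>\<^bsub>S y\<^esub>i\<in>{..<n + n'}. pure Z (?a i) ?V (?m i) y)" by simp
  qed (use cl V2 in auto)
qed

text \<open>Builds a finite sum one tensor at a time. The conclusion concerns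
  \<open>restrict sg Z\<close> because \<open>fin_sum Z sg\<close> says nothing about
  \<open>sg\<close> outside \<open>Z\<close>.\<close>

lemma fin_sum_induct [consumes 2, case_names zero add]:
  assumes Z: "opn X Z" and s: "fin_sum Z sg"
    and 0: "P (\<lambda>y\<in>Z. \<zero>\<^bsub>S y\<^esub>)"
    and 1: "\<And>tg a V m. \<lbrakk>P tg; tg \<in> (\<Pi>\<^sub>E y\<in>Z. carrier (S y)); fin_sum Z tg; a \<in> rsecs X Z;
       opn Y V; Z \<subseteq> preim f V; m \<in> secs M V\<rbrakk> \<Longrightarrow> P (\<lambda>y\<in>Z. pure Z a V m y \<oplus>\<^bsub>S y\<^esub> tg y)"
  shows "P (restrict sg Z)"
proof -
  obtain V n a m where V: "opn Y V" "Z \<subseteq> preim f V"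
    and am: "\<forall>i<(n::nat). a i \<in> rsecs X Z \<and> m i \<in> secs M V"
    and eq: "\<forall>y\<in>Z. sg y = (\<Oplus>\<^bsub>S y\<^esub>i\<in>{..<n}. pure Z (a i) V (m i) y)"
    using s unfolding fin_sum_def by blast
  have cl: "pure Z (a i) V (m i) y \<in> carrier (S y)" if "i < n" "y \<in> Z" for i y
    using that am V Z by (auto intro: pure_closed)
  have *: "P (\<lambda>y\<in>Z. \<Oplus>\<^bsub>S y\<^esub>i\<in>{..<k}. pure Z (a i) V (m i) y)" if "k \<le> n" for k using that
  proof (induction k)
    case 0
    have "(\<lambda>y\<in>Z. \<Oplus>\<^bsub>S y\<^esub>i\<in>{..<0::nat}. pure Z (a i) V (m i) y) = (\<lambda>y\<in>Z. \<zero>\<^bsub>S y\<^esub>)"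
      using S_abelian open_top[OF Z] by (auto simp: fun_eq_iff restrict_def abelian_group_def abelian_monoid.finsum_empty)
    with assms(3) show ?case by (simp only:)
  next
    case (Suc k)
    have eq: "(\<lambda>y\<in>Z. \<Oplus>\<^bsub>S y\<^esub>i\<in>{..<Suc k}. pure Z (a i) V (m i) y) =
      (\<lambda>y\<in>Z. pure Z (a k) V (m k) y \<oplus>\<^bsub>S y\<^esub> (\<lambda>y\<in>Z. \<Oplus>\<^bsub>S y\<^esub>i\<in>{..<k}. pure Z (a i) V (m i) y) y)"
    proof (rule restrict_ext)
      fix y assume y: "y \<in> Z"
      interpret Sy: abelian_group "S y" using S_abelian open_top Z y by blast
      show "(\<Oplus>\<^bsub>S y\<^esub>i\<in>{..<Suc k}. pure Z (a i) V (m i) y) =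
        pure Z (a k) V (m k) y \<oplus>\<^bsub>S y\<^esub> (\<lambda>y\<in>Z. \<Oplus>\<^bsub>S y\<^esub>i\<in>{..<k}. pure Z (a i) V (m i) y) y"
        using cl y Suc.prems by (simp add: lessThan_Suc Sy.finsum_insert Pi_def)
    qed
    show ?case unfolding eq
    proof (rule 1)
      show "P (\<lambda>y\<in>Z. \<Oplus>\<^bsub>S y\<^esub>i\<in>{..<k}. pure Z (a i) V (m i) y)" using Suc.prems by (intro Suc.IH) simp
      show "(\<lambda>y\<in>Z. \<Oplus>\<^bsub>S y\<^esub>i\<in>{..<k}. pure Z (a i) V (m i) y) \<in> (\<Pi>\<^sub>E y\<in>Z. carrier (S y))"
      proof (rule restrict_PiE_iff[THEN iffD2], rule ballI)
        fix y assume y: "y \<in> Z"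
        interpret Sy: abelian_group "S y" using S_abelian open_top Z y by blast
        show "(\<Oplus>\<^bsub>S y\<^esub>i\<in>{..<k}. pure Z (a i) V (m i) y) \<in> carrier (S y)"
          using cl y Suc.prems by (intro Sy.finsum_closed) auto
      qed
      show "fin_sum Z (\<lambda>y\<in>Z. \<Oplus>\<^bsub>S y\<^esub>i\<in>{..<k}. pure Z (a i) V (m i) y)" unfolding fin_sum_def using V am Suc.prems
        by (intro exI[of _ V] exI[of _ k] exI[of _ a] exI[of _ m]) auto
    qed (use V am Suc.prems in auto)
  qed
  have "restrict sg Z = (\<lambda>y\<in>Z. \<Oplus>\<^bsub>S y\<^esub>i\<in>{..<n}. pure Z (a i) V (m i) y)" using eq by (intro restrict_ext) simp
  then show ?thesis using *[OF order_refl] by (simp only:)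
qed

lemma smult_pure:
  assumes "opn X Z" "a \<in> rsecs X Z" "opn Y V" "m \<in> secs M V" "Z \<subseteq> preim f V"
    and "b \<in> rsecs X Z" "y \<in> Z"
  shows "rgerm X y Z b \<odot>\<^bsub>S y\<^esub> pure Z a V m y = pure Z (b \<otimes>\<^bsub>rsec X Z\<^esub> a) V m y"
proof -
  have "pt f y \<in> V" using assms(5,7) mem_preim[OF f] by blast
  then show ?thesis unfolding pure_def using assms open_top
    by (simp add: smult_ten ring_stalk_carrier mod_stalk_carrier rgerm_mult[OF X])
qed

lemma fin_sum_smult:
  assumes Z: "opn X Z" and b: "b \<in> rsecs X Z" and s: "fin_sum Z sg"
  shows "fin_sum Z (\<lambda>y. rgerm X y Z b \<odot>\<^bsub>S y\<^esub> sg y)"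
proof -
  have "fin_sum Z (\<lambda>y. rgerm X y Z b \<odot>\<^bsub>S y\<^esub> (restrict sg Z) y)" using Z s
  proof (induction rule: fin_sum_induct)
    case zero
    have "fin_sum Z (\<lambda>y. rgerm X y Z b \<odot>\<^bsub>S y\<^esub> (\<lambda>y\<in>Z. \<zero>\<^bsub>S y\<^esub>) y) \<longleftrightarrow> fin_sum Z (\<lambda>y. \<zero>\<^bsub>S y\<^esub>)"
      using Z b open_top by (intro fin_sum_cong) (simp add: left_module_smult_zero[OF S_left_module] ring_stalk_carrier)
    then show ?case using fin_sum_zero Z by simp
  next
    case (add tg a V m)
    have "fin_sum Z (\<lambda>y. rgerm X y Z b \<odot>\<^bsub>S y\<^esub> (\<lambda>y\<in>Z. pure Z a V m y \<oplus>\<^bsub>S y\<^esub> tg y) y) \<longleftrightarrow>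
      fin_sum Z (\<lambda>y. pure Z (b \<otimes>\<^bsub>rsec X Z\<^esub> a) V m y \<oplus>\<^bsub>S y\<^esub> rgerm X y Z b \<odot>\<^bsub>S y\<^esub> tg y)"
    proof (rule fin_sum_cong)
      fix y assume y: "y \<in> Z"
      have ty: "tg y \<in> carrier (S y)" using add(2) y by auto
      have "pure Z a V m y \<in> carrier (S y)" using add y Z by (intro pure_closed)
      then show "rgerm X y Z b \<odot>\<^bsub>S y\<^esub> (\<lambda>y\<in>Z. pure Z a V m y \<oplus>\<^bsub>S y\<^esub> tg y) y =
        pure Z (b \<otimes>\<^bsub>rsec X Z\<^esub> a) V m y \<oplus>\<^bsub>S y\<^esub> rgerm X y Z b \<odot>\<^bsub>S y\<^esub> tg y"
        using y ty Z b open_top add smult_pure[OF Z, of a V m b y]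
        by (simp add: left_moduleD(5)[OF S_left_module] ring_stalk_carrier)
    qed
    moreover have "b \<otimes>\<^bsub>rsec X Z\<^esub> a \<in> rsecs X Z"
      using ring.ring_simprules(5)[OF ringed_space_ring[OF X Z]] b add by blast
    ultimately show ?case using fin_sum_add[OF Z fin_sum_pure add(1)] Z add by simp
  qed
  then show ?thesis by (subst fin_sum_cong[of Z _ "\<lambda>y. rgerm X y Z b \<odot>\<^bsub>S y\<^esub> (restrict sg Z) y"]) auto
qed

lemma section_closed: "sg \<in> Sec W \<Longrightarrow> x \<in> W \<Longrightarrow> sg x \<in> carrier (S x)" by (auto simp: pb_sections_iff)

lemma section_ext: "\<lbrakk>sg \<in> Sec W; tg \<in> Sec W; (\<And>x. x \<in> W \<Longrightarrow> sg x = tg x)\<rbrakk> \<Longrightarrow> sg = tg"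
  by (rule PiE_ext[of _ W "\<lambda>x. carrier (S x)"]) (auto simp: pb_sections_iff)

lemma section_rep:
  assumes "sg \<in> Sec W" "x \<in> W"
  obtains Z where "opn X Z" "x \<in> Z" "Z \<subseteq> W" "fin_sum Z sg" using assms by (auto simp: pb_sections_iff)

lemma sectionI:
  assumes "\<And>x. x \<in> W \<Longrightarrow> sg x \<in> carrier (S x)"
    and "\<And>x. x \<in> W \<Longrightarrow> \<exists>Z. opn X Z \<and> x \<in> Z \<and> Z \<subseteq> W \<and> fin_sum Z sg"
  shows "restrict sg W \<in> Sec W" unfolding pb_sections_iff
proof (intro conjI ballI)
  fix x assume "x \<in> W"
  then obtain Z where Z: "opn X Z" "x \<in> Z" "Z \<subseteq> W" "fin_sum Z sg" using assms(2) by blast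
  moreover have "fin_sum Z (restrict sg W) \<longleftrightarrow> fin_sum Z sg" using Z by (intro fin_sum_cong) auto
  ultimately show "\<exists>Z. opn X Z \<and> x \<in> Z \<and> Z \<subseteq> W \<and> fin_sum Z (restrict sg W)" by blast
qed (use assms(1) in auto)

lemma section_restrict:
  assumes "opn X W" "W \<subseteq> V" "sg \<in> Sec V"
  shows "restrict sg W \<in> Sec W"
proof (rule sectionI)
  fix x assume x: "x \<in> W"
  then show "sg x \<in> carrier (S x)" using assms section_closed by blast
  obtain Z where Z: "opn X Z" "x \<in> Z" "Z \<subseteq> V" "fin_sum Z sg" using section_rep[OF assms(3)] x assms by blast
  have "fin_sum (Z \<inter> W) sg" using fin_sum_restrict[OF Z(1) _ _ Z(4)] Z assms by (simp add: openin_Int)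
  then show "\<exists>Z. opn X Z \<and> x \<in> Z \<and> Z \<subseteq> W \<and> fin_sum Z sg" using Z x assms by (intro exI[of _ "Z \<inter> W"]) auto
qed

lemma pull_simps: "secs (pull f M) W = Sec W" "\<zero>\<^bsub>msec (pull f M) W\<^esub> = (\<lambda>x\<in>W. \<zero>\<^bsub>S x\<^esub>)"
  "sg \<oplus>\<^bsub>msec (pull f M) W\<^esub> tg = (\<lambda>x\<in>W. sg x \<oplus>\<^bsub>S x\<^esub> tg x)"
  "a \<odot>\<^bsub>msec (pull f M) W\<^esub> sg = (\<lambda>x\<in>W. rgerm X x W a \<odot>\<^bsub>S x\<^esub> sg x)" "mres (pull f M) V W sg = restrict sg W"
  by (simp_all add: pull_def)

lemma section_add:
  assumes W: "opn X W" and s: "sg \<in> Sec W" and t: "tg \<in> Sec W"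
  shows "(\<lambda>x\<in>W. sg x \<oplus>\<^bsub>S x\<^esub> tg x) \<in> Sec W"
proof (rule sectionI)
  fix x assume x: "x \<in> W"
  show "sg x \<oplus>\<^bsub>S x\<^esub> tg x \<in> carrier (S x)"
    using abelian_groupE(1)[OF S_abelian[OF open_top[OF W x]]] section_closed s t x by blast
  obtain Z where Z: "opn X Z" "x \<in> Z" "Z \<subseteq> W" "fin_sum Z sg" using section_rep[OF s x] .
  obtain Z' where Z': "opn X Z'" "x \<in> Z'" "Z' \<subseteq> W" "fin_sum Z' tg" using section_rep[OF t x] .
  have o: "opn X (Z \<inter> Z')" using Z Z' by blast
  have "fin_sum (Z \<inter> Z') (\<lambda>x. sg x \<oplus>\<^bsub>S x\<^esub> tg x)"
    using fin_sum_restrict[OF Z(1) o _ Z(4)] fin_sum_restrict[OF Z'(1) o _ Z'(4)] by (intro fin_sum_add o) simp_all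
  then show "\<exists>Z. opn X Z \<and> x \<in> Z \<and> Z \<subseteq> W \<and> fin_sum Z (\<lambda>x. sg x \<oplus>\<^bsub>S x\<^esub> tg x)"
    using o Z Z' by (intro exI[of _ "Z \<inter> Z'"]) auto
qed

lemma section_zero: "opn X W \<Longrightarrow> (\<lambda>x\<in>W. \<zero>\<^bsub>S x\<^esub>) \<in> Sec W"
  by (rule sectionI) (use open_top fin_sum_zero abelian_groupE(2)[OF S_abelian] in blast)+

lemma section_smult:
  assumes W: "opn X W" and a: "a \<in> rsecs X W" and s: "sg \<in> Sec W"
  shows "(\<lambda>x\<in>W. rgerm X x W a \<odot>\<^bsub>S x\<^esub> sg x) \<in> Sec W"
proof (rule sectionI)
  fix x assume x: "x \<in> W"
  show "rgerm X x W a \<odot>\<^bsub>S x\<^esub> sg x \<in> carrier (S x)"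
    using left_moduleD(3)[OF S_left_module[OF open_top[OF W x]] ring_stalk_carrier[OF W x a] section_closed[OF s x]] .
  obtain Z where Z: "opn X Z" "x \<in> Z" "Z \<subseteq> W" "fin_sum Z sg" using section_rep[OF s x] .
  have "fin_sum Z (\<lambda>y. rgerm X y Z (rres X W Z a) \<odot>\<^bsub>S y\<^esub> sg y)"
    using Z W a by (intro fin_sum_smult) (simp_all add: rres_closed[OF X])
  moreover have "fin_sum Z (\<lambda>y. rgerm X y Z (rres X W Z a) \<odot>\<^bsub>S y\<^esub> sg y) \<longleftrightarrow> fin_sum Z (\<lambda>x. rgerm X x W a \<odot>\<^bsub>S x\<^esub> sg x)"
    using Z W a by (intro fin_sum_cong) (simp add: rgerm_res[OF X])
  ultimately show "\<exists>Z. opn X Z \<and> x \<in> Z \<and> Z \<subseteq> W \<and> fin_sum Z (\<lambda>x. rgerm X x W a \<odot>\<^bsub>S x\<^esub> sg x)"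
    using Z by blast
qed

lemma pull_left_module:
  assumes W: "opn X W"
  shows "left_module (rsec X W) (msec (pull f M) W)"
proof -
  let ?P = "msec (pull f M) W"
  note St = open_top[OF W]
  note [simp] = ring_stalk_carrier[OF W] section_closed
    abelian_groupE(1,2,5)[OF S_abelian[OF St]] left_moduleD(3,7)[OF S_left_module[OF St]]
  have ext: "restrict F W = restrict G W" if "\<And>x. x \<in> W \<Longrightarrow> F x = G x" for F G :: "('a, 'r, 'b, 'm) pbs"
    using that by (rule restrict_ext)
  have self: "restrict sg W = sg" if "sg \<in> Sec W" for sg
    using that by (auto simp: pb_sections_iff PiE_def extensional_restrict)
  have sm: "(\<lambda>x\<in>W. rgerm X x W a \<odot>\<^bsub>S x\<^esub> sg x) \<in> Sec W"
    if "a \<in> rsecs X W" "sg \<in> Sec W" for a sg using section_smult[OF W that] .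
  have one: "rgerm X x W \<one>\<^bsub>rsec X W\<^esub> \<odot>\<^bsub>S x\<^esub> sg x = sg x" if "sg \<in> Sec W" "x \<in> W" for sg x
    using that rgerm_one[OF X W that(2)] left_moduleD(7)[OF S_left_module[OF St[OF that(2)]]] by simp
  have ab: "abelian_group ?P"
  proof (intro abelian_groupI, unfold pull_simps)
    fix sg assume s: "sg \<in> Sec W"
    show "(\<lambda>x\<in>W. (\<lambda>x\<in>W. \<zero>\<^bsub>S x\<^esub>) x \<oplus>\<^bsub>S x\<^esub> sg x) = sg" using s by (subst (2) self[symmetric]) (auto intro!: ext)
    \<comment> \<open>The negative of a section is obtained as (-1) times it, so that
      \<open>section_smult\<close> shows that it is again a section.\<close>
    let ?m = "\<ominus>\<^bsub>rsec X W\<^esub> \<one>\<^bsub>rsec X W\<^esub>"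
    interpret R: ring "rsec X W" by (rule ringed_space_ring[OF X W])
    have "(\<lambda>x\<in>W. (\<lambda>x\<in>W. rgerm X x W ?m \<odot>\<^bsub>S x\<^esub> sg x) x \<oplus>\<^bsub>S x\<^esub> sg x) = (\<lambda>x\<in>W. \<zero>\<^bsub>S x\<^esub>)"
    proof (rule ext)
      fix x assume x: "x \<in> W"
      note lm = left_moduleD[OF S_left_module[OF St[OF x]]]
      have A: "add_hom (rsec X W) (S x) (\<lambda>a. rgerm X x W a \<odot>\<^bsub>S x\<^esub> sg x)"
        using s x by (intro add_homI) (simp_all add: rgerm_add[OF X W x, symmetric] lm(4))
      show "(\<lambda>x\<in>W. rgerm X x W ?m \<odot>\<^bsub>S x\<^esub> sg x) x \<oplus>\<^bsub>S x\<^esub> sg x = \<zero>\<^bsub>S x\<^esub>"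
        using add_hom_add[OF A, of ?m "\<one>\<^bsub>rsec X W\<^esub>"] add_hom_zero[OF R.abelian_group_axioms lm(2) A] one[OF s x] x
        by (simp add: R.l_neg)
    qed
    then show "\<exists>tg\<in>Sec W. (\<lambda>x\<in>W. tg x \<oplus>\<^bsub>S x\<^esub> sg x) = (\<lambda>x\<in>W. \<zero>\<^bsub>S x\<^esub>)" using sm[OF _ s, of ?m] by blast
    fix tg assume t: "tg \<in> Sec W"
    show "(\<lambda>x\<in>W. sg x \<oplus>\<^bsub>S x\<^esub> tg x) \<in> Sec W" by (rule section_add[OF W s t])
    show "(\<lambda>x\<in>W. sg x \<oplus>\<^bsub>S x\<^esub> tg x) = (\<lambda>x\<in>W. tg x \<oplus>\<^bsub>S x\<^esub> sg x)"
      using s t by (intro ext abelian_groupE(4)[OF S_abelian[OF St]]) simp_all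
    fix \<upsilon> assume u: "\<upsilon> \<in> Sec W"
    show "(\<lambda>x\<in>W. (\<lambda>x\<in>W. sg x \<oplus>\<^bsub>S x\<^esub> tg x) x \<oplus>\<^bsub>S x\<^esub> \<upsilon> x) = (\<lambda>x\<in>W. sg x \<oplus>\<^bsub>S x\<^esub> (\<lambda>x\<in>W. tg x \<oplus>\<^bsub>S x\<^esub> \<upsilon> x) x)"
      using s t u by (intro ext) (simp add: abelian_groupE(3)[OF S_abelian[OF St]])
  qed (rule section_zero[OF W])
  show ?thesis unfolding left_module_def
  proof (intro conjI ballI ab ringed_space_ring[OF X W], unfold pull_simps)
    fix a sg assume a: "a \<in> rsecs X W" and s: "sg \<in> Sec W"
    show "(\<lambda>x\<in>W. rgerm X x W a \<odot>\<^bsub>S x\<^esub> sg x) \<in> Sec W" by (rule sm[OF a s])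
    fix tg assume t: "tg \<in> Sec W"
    show "(\<lambda>x\<in>W. rgerm X x W a \<odot>\<^bsub>S x\<^esub> (\<lambda>x\<in>W. sg x \<oplus>\<^bsub>S x\<^esub> tg x) x) =
      (\<lambda>x\<in>W. (\<lambda>x\<in>W. rgerm X x W a \<odot>\<^bsub>S x\<^esub> sg x) x \<oplus>\<^bsub>S x\<^esub> (\<lambda>x\<in>W. rgerm X x W a \<odot>\<^bsub>S x\<^esub> tg x) x)"
      using a s t by (intro ext) (simp add: left_moduleD(5)[OF S_left_module[OF St]])
  next
    fix a b sg assume ab: "a \<in> rsecs X W" "b \<in> rsecs X W" and s: "sg \<in> Sec W"
    show "(\<lambda>x\<in>W. rgerm X x W (a \<oplus>\<^bsub>rsec X W\<^esub> b) \<odot>\<^bsub>S x\<^esub> sg x) =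
      (\<lambda>x\<in>W. (\<lambda>x\<in>W. rgerm X x W a \<odot>\<^bsub>S x\<^esub> sg x) x \<oplus>\<^bsub>S x\<^esub> (\<lambda>x\<in>W. rgerm X x W b \<odot>\<^bsub>S x\<^esub> sg x) x)"
      using ab s by (intro ext) (simp add: rgerm_add[OF X W, symmetric] left_moduleD(4)[OF S_left_module[OF St]])
    show "(\<lambda>x\<in>W. rgerm X x W (a \<otimes>\<^bsub>rsec X W\<^esub> b) \<odot>\<^bsub>S x\<^esub> sg x) =
      (\<lambda>x\<in>W. rgerm X x W a \<odot>\<^bsub>S x\<^esub> (\<lambda>x\<in>W. rgerm X x W b \<odot>\<^bsub>S x\<^esub> sg x) x)"
      using ab s by (intro ext) (simp add: rgerm_mult[OF X W, symmetric] left_moduleD(6)[OF S_left_module[OF St]])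
  next
    fix sg assume s: "sg \<in> Sec W"
    show "(\<lambda>x\<in>W. rgerm X x W \<one>\<^bsub>rsec X W\<^esub> \<odot>\<^bsub>S x\<^esub> sg x) = sg"
      using s one[OF s] by (subst (2) self[OF s, symmetric]) (auto intro!: ext)
  qed
qed

text \<open>Sections are families indexed by points and the condition on them is local, so gluing is
  done point by point, as for any sheafification.\<close>

lemma pull_sheaf: "sheaf_of_sets (rtop X) (\<lambda>W. secs (pull f M) W) (mres (pull f M))"
proof (rule sheaf_of_setsI, unfold pull_simps)
  fix V W sg assume "opn X V" "opn X W" "W \<subseteq> V" "sg \<in> Sec V"
  then show "restrict sg W \<in> Sec W" using section_restrict by blast
next
  fix V sg assume "sg \<in> Sec V"
  then show "restrict sg V = sg" by (auto simp: pb_sections_iff PiE_def extensional_restrict)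
next
  fix V W Z sg assume "opn X V" "opn X W" "opn X Z" "Z \<subseteq> W" "W \<subseteq> V"
  then show "restrict (restrict sg W) Z = restrict sg Z" by (simp add: Int_absorb1)
next
  fix \<W> and s :: "'a set \<Rightarrow> ('a, 'r, 'b, 'm) pbs"
  assume 1: "\<And>W. W \<in> \<W> \<Longrightarrow> opn X W" "\<And>W. W \<in> \<W> \<Longrightarrow> s W \<in> Sec W"
    "\<And>W W'. W \<in> \<W> \<Longrightarrow> W' \<in> \<W> \<Longrightarrow> restrict (s W) (W \<inter> W') = restrict (s W') (W \<inter> W')"
  then have *: "(\<forall>W\<in>\<W>. opn X W \<and> s W \<in> Sec W) \<and>
    (\<forall>W\<in>\<W>. \<forall>W'\<in>\<W>. restrict (s W) (W \<inter> W') = restrict (s W') (W \<inter> W'))" by blast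
  \<comment> \<open>\<open>c x\<close> is some member of the cover that contains \<open>x\<close>;
    by \<open>agree\<close> below, the glued value at \<open>x\<close> does not depend on
    it.\<close>
  define c where "c x = (SOME W. W \<in> \<W> \<and> x \<in> W)" for x
  have c: "c x \<in> \<W>" "x \<in> c x" if "x \<in> \<Union>\<W>" for x
    unfolding c_def using someI_ex[of "\<lambda>W. W \<in> \<W> \<and> x \<in> W"] that by auto
  let ?t = "\<lambda>x\<in>\<Union>\<W>. s (c x) x"
  have agree: "s W x = s W' x" if "W \<in> \<W>" "W' \<in> \<W>" "x \<in> W" "x \<in> W'" for W W' x
  proof -
    have "restrict (s W) (W \<inter> W') x = restrict (s W') (W \<inter> W') x" using * that by metis
    then show ?thesis using that by simp
  qed
  have tW: "restrict ?t W = s W" if "W \<in> \<W>" for W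
  proof -
    have "restrict ?t W = restrict (s W) W"
    proof (rule restrict_ext)
      fix x assume x: "x \<in> W"
      then have "x \<in> \<Union>\<W>" using that by blast
      then show "?t x = s W x" using agree[OF c(1) that c(2) x] by simp
    qed
    also have "\<dots> = s W" using * that by (auto simp: pb_sections_iff PiE_def extensional_restrict)
    finally show ?thesis .
  qed
  have t: "?t \<in> Sec (\<Union>\<W>)"
  proof (rule sectionI)
    fix x assume x: "x \<in> \<Union>\<W>"
    show "s (c x) x \<in> carrier (S x)" using * c[OF x] section_closed by blast
    obtain Z where Z: "opn X Z" "x \<in> Z" "Z \<subseteq> c x" "fin_sum Z (s (c x))"
      using section_rep[of "s (c x)" "c x" x] * c[OF x] by blast
    moreover have "fin_sum Z (\<lambda>x. s (c x) x) \<longleftrightarrow> fin_sum Z (s (c x))"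
      using Z c[OF x] by (intro fin_sum_cong agree c) auto
    ultimately show "\<exists>Z. opn X Z \<and> x \<in> Z \<and> Z \<subseteq> \<Union>\<W> \<and> fin_sum Z (\<lambda>x. s (c x) x)"
      using c[OF x] by (intro exI[of _ Z]) auto
  qed
  show "\<exists>!t. t \<in> Sec (\<Union>\<W>) \<and> (\<forall>W\<in>\<W>. restrict t W = s W)"
  proof (rule ex1I[of _ ?t])
    fix t' assume t': "t' \<in> Sec (\<Union>\<W>) \<and> (\<forall>W\<in>\<W>. restrict t' W = s W)"
    show "t' = ?t"
    proof (rule section_ext[OF _ t])
      fix x assume "x \<in> \<Union>\<W>"
      then obtain W where W: "W \<in> \<W>" "x \<in> W" by auto
      have "restrict t' W = restrict ?t W" unfolding tW[OF \<open>W \<in> \<W>\<close>] using t' \<open>W \<in> \<W>\<close> by blast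
      from fun_cong[OF this, of x] show "t' x = ?t x" using \<open>x \<in> W\<close> \<open>W \<in> \<W>\<close> by simp
    qed (use t' in simp)
  qed (use t tW in auto)
qed

lemma pull_module_sheaf: "module_sheaf X (pull f M)" unfolding module_sheaf_def
proof (intro conjI allI impI ballI pull_sheaf pull_left_module)
  fix V W sg tg assume VW: "opn X V \<and> opn X W \<and> W \<subseteq> V"
  then show "mres (pull f M) V W (sg \<oplus>\<^bsub>msec (pull f M) V\<^esub> tg) =
     mres (pull f M) V W sg \<oplus>\<^bsub>msec (pull f M) W\<^esub> mres (pull f M) V W tg"
    unfolding pull_simps by (auto simp: restrict_def fun_eq_iff)
  fix a assume "a \<in> rsecs X V"
  then show "mres (pull f M) V W (a \<odot>\<^bsub>msec (pull f M) V\<^esub> sg) =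
     rres X V W a \<odot>\<^bsub>msec (pull f M) W\<^esub> mres (pull f M) V W sg"
    using VW unfolding pull_simps by (auto simp: restrict_def fun_eq_iff rgerm_res[OF X])
qed simp_all

end

section \<open>Composition of morphisms\<close>

lemma pt_comp [simp]: "x \<in> pts (src f) \<Longrightarrow> pt (g \<cdot> f) x = pt g (pt f x)" by (simp add: rs_comp_def)

lemma src_comp [simp]: "src (g \<cdot> f) = src f" and tgt_comp [simp]: "tgt (g \<cdot> f) = tgt g"
  by (simp_all add: rs_comp_def)

lemma preim_comp:
  assumes "rs_morphism X Y f" "rs_morphism Y Z g"
  shows "preim (g \<cdot> f) V = preim f (preim g V)"
  using rs_morphismD(1)[OF assms(1)] rs_morphismD(1)[OF assms(2)] pt_topspace[OF assms(1)]
  by (auto simp: preim_def)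

lemma comor_comp: "opn (tgt g) V \<Longrightarrow> s \<in> rsecs (tgt g) V \<Longrightarrow> comor (g \<cdot> f) V s = comor f (preim g V) (comor g V s)"
  by (simp add: rs_comp_def)

lemma rs_morphismI:
  assumes "src f = X" "tgt f = Y" "pt f \<in> extensional (pts X)" "continuous_map (rtop X) (rtop Y) (pt f)"
    "comor f \<in> extensional {V. opn Y V}" "\<And>V. opn Y V \<Longrightarrow> comor f V \<in> extensional (rsecs Y V)"
    "\<And>V. opn Y V \<Longrightarrow> comor f V \<in> ring_hom (rsec Y V) (rsec X (preim f V))"
    "\<And>V W s. \<lbrakk>opn Y V; opn Y W; W \<subseteq> V; s\<in>rsecs Y V\<rbrakk> \<Longrightarrow>
           comor f W (rres Y V W s) = rres X (preim f V) (preim f W) (comor f V s)"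
  shows "rs_morphism X Y f"
proof -
  have "comor f \<in> (\<Pi>\<^sub>E V\<in>{V. opn Y V}. rsecs Y V \<rightarrow>\<^sub>E rsecs X (preim f V))"
    using assms(5,6) ring_hom_closed[OF assms(7)] by (auto simp: PiE_def)
  then show ?thesis using assms unfolding rs_morphism_def by simp
qed

lemma rs_morphism_comp:
  assumes Z: "ringed_space Z" and f: "rs_morphism X Y f" and g: "rs_morphism Y Z g"
  shows "rs_morphism X Z (g \<cdot> f)"
proof (rule rs_morphismI)
  note [simp] = rs_morphismD(1,2)[OF f] rs_morphismD(1,2)[OF g] preim_comp[OF f g]
  show "src (g \<cdot> f) = X" "tgt (g \<cdot> f) = Z" by simp_all
  show "pt (g \<cdot> f) \<in> extensional (pts X)" by (simp add: rs_comp_def)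
  show "continuous_map (rtop X) (rtop Z) (pt (g \<cdot> f))"
    by (rule continuous_map_eq[OF continuous_map_compose[OF rs_morphismD(4)[OF f] rs_morphismD(4)[OF g]]]) simp
  show "comor (g \<cdot> f) \<in> extensional {V. opn Z V}" by (simp add: rs_comp_def)
  fix V assume V: "opn Z V"
  note pV = preim_open[OF g V]
  show "comor (g \<cdot> f) V \<in> extensional (rsecs Z V)" using V by (simp add: rs_comp_def)
  have c: "comor (g \<cdot> f) V s = comor f (preim g V) (comor g V s)" if "s \<in> rsecs Z V" for s
    using that V by (simp add: comor_comp)
  have h: "(comor f (preim g V) \<circ> comor g V) \<in> ring_hom (rsec Z V) (rsec X (preim f (preim g V)))"
    using ring_hom_trans[OF rs_morphismD(6)[OF g V] rs_morphismD(6)[OF f pV]] .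
  show "comor (g \<cdot> f) V \<in> ring_hom (rsec Z V) (rsec X (preim (g \<cdot> f) V))"
    using ring.ring_hom_restrict[OF ringed_space_ring[OF Z V] h] c by simp
  fix W s assume W: "opn Z W" "W \<subseteq> V" and s: "s \<in> rsecs Z V"
  show "comor (g \<cdot> f) W (rres Z V W s) = rres X (preim (g \<cdot> f) V) (preim (g \<cdot> f) W) (comor (g \<cdot> f) V s)"
    using rs_morphismD(7)[OF g V W s] rres_closed[OF Z V W s] V W s
      rs_morphismD(7)[OF f pV preim_open[OF g W(1)] preim_mono[OF W(2)] comor_closed[OF g V s]]
    by (simp add: comor_comp)
qed

lemma rs_id_simps [simp]: "src (rs_id X) = X" "tgt (rs_id X) = X" by (simp_all add: rs_id_def)

lemma pt_rs_id [simp]: "x \<in> pts X \<Longrightarrow> pt (rs_id X) x = x" by (simp add: rs_id_def)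

lemma preim_rs_id: "opn X V \<Longrightarrow> preim (rs_id X) V = V" using openin_subset by (fastforce simp: preim_def rs_id_def)

lemma comor_rs_id: "opn X V \<Longrightarrow> s \<in> rsecs X V \<Longrightarrow> comor (rs_id X) V s = s" by (simp add: rs_id_def)

lemma rs_morphism_id: "ringed_space X \<Longrightarrow> rs_morphism X X (rs_id X)"
proof (rule rs_morphismI)
  assume X: "ringed_space X"
  show "continuous_map (rtop X) (rtop X) (pt (rs_id X))" by (rule continuous_map_eq[OF continuous_map_id]) simp
  fix V assume V: "opn X V"
  show "comor (rs_id X) V \<in> ring_hom (rsec X V) (rsec X (preim (rs_id X) V))" unfolding preim_rs_id[OF V]
    by (rule ring_hom_memI) (simp_all add: comor_rs_id[OF V] ring.ring_simprules[OF ringed_space_ring[OF X V]])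
  fix W s assume "opn X W" "W \<subseteq> V" "s \<in> rsecs X V"
  then show "comor (rs_id X) W (rres X V W s) = rres X (preim (rs_id X) V) (preim (rs_id X) W) (comor (rs_id X) V s)"
    using V rres_closed[OF X V] by (simp add: comor_rs_id preim_rs_id)
qed (simp_all add: rs_id_def)

text \<open>Morphisms are extensional, so agreement on points and sections is equality. The point
  maps come first: only when they coincide do the comorphisms have the same target rings over
  \<open>preim f V\<close>.\<close>

lemma rs_mor_eqI:
  assumes f: "rs_morphism X Y f" and g: "rs_morphism X Y g"
    and "\<And>x. x \<in> pts X \<Longrightarrow> pt f x = pt g x"
    and "\<And>V s. opn Y V \<Longrightarrow> s \<in> rsecs Y V \<Longrightarrow> comor f V s = comor g V s"
  shows "f = g"
proof -
  have pt: "pt f = pt g"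
    by (rule extensionalityI[OF rs_morphismD(3)[OF f] rs_morphismD(3)[OF g]]) (use assms(3) in simp)
  then have preim: "preim f V = preim g V" for V
    using rs_morphismD(1)[OF f] rs_morphismD(1)[OF g] by (simp add: preim_def)
  have "comor f = comor g"
  proof (rule PiE_ext[OF rs_morphismD(5)[OF f]])
    show "comor g \<in> (\<Pi>\<^sub>E V\<in>{V. opn Y V}. rsecs Y V \<rightarrow>\<^sub>E rsecs X (preim f V))"
      using rs_morphismD(5)[OF g] unfolding preim .
    fix V assume "V \<in> {V. opn Y V}"
    then have V: "opn Y V" by simp
    have "comor f V \<in> rsecs Y V \<rightarrow>\<^sub>E rsecs X (preim f V)" "comor g V \<in> rsecs Y V \<rightarrow>\<^sub>E rsecs X (preim g V)"
      using PiE_mem[OF rs_morphismD(5)[OF f]] PiE_mem[OF rs_morphismD(5)[OF g]] V by simp_all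
    then show "comor f V = comor g V" unfolding preim by (rule PiE_ext) (use assms(4) V in simp)
  qed
  then show ?thesis using pt rs_morphismD(1,2)[OF f] rs_morphismD(1,2)[OF g] by (intro rs_mor.equality) simp_all
qed

lemma rs_comp_id_right:
  assumes "ringed_space X" "ringed_space Y" "rs_morphism X Y f"
  shows "f \<cdot> rs_id X = f"
  by (rule rs_mor_eqI[OF rs_morphism_comp[OF assms(2) rs_morphism_id[OF assms(1)] assms(3)] assms(3)])
     (simp_all add: rs_morphismD(2)[OF assms(3)] comor_comp comor_rs_id preim_open[OF assms(3)] comor_closed[OF assms(3)])

lemma rs_comp_id_left:
  assumes "ringed_space X" "ringed_space Y" "rs_morphism X Y f"
  shows "rs_id Y \<cdot> f = f"
  by (rule rs_mor_eqI[OF rs_morphism_comp[OF assms(2,3) rs_morphism_id[OF assms(2)]] assms(3)])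
     (simp_all add: rs_morphismD(1,2)[OF assms(3)] comor_comp comor_rs_id preim_rs_id pt_topspace[OF assms(3)])

lemma rs_comp_assoc:
  assumes "ringed_space W" "ringed_space X" "ringed_space Y" "ringed_space Z"
    and f: "rs_morphism W X f" and g: "rs_morphism X Y g" and h: "rs_morphism Y Z h"
  shows "(h \<cdot> g) \<cdot> f = h \<cdot> (g \<cdot> f)"
proof (rule rs_mor_eqI[of W Z])
  note [simp] = rs_morphismD(1,2)[OF f] rs_morphismD(1,2)[OF g] rs_morphismD(1,2)[OF h]
  show "rs_morphism W Z ((h \<cdot> g) \<cdot> f)" "rs_morphism W Z (h \<cdot> (g \<cdot> f))" by (intro rs_morphism_comp assms; fact)+
  show "pt ((h \<cdot> g) \<cdot> f) x = pt (h \<cdot> (g \<cdot> f)) x" if "x \<in> pts W" for x using that pt_topspace[OF f] by simp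
  show "comor ((h \<cdot> g) \<cdot> f) V s = comor (h \<cdot> (g \<cdot> f)) V s" if "opn Z V" "s \<in> rsecs Z V" for V s
    using that preim_open[OF h] comor_closed[OF h] by (simp add: comor_comp preim_comp[OF g h])
qed

lemma stalk_comor_comp:
  assumes X: "ringed_space X" and Y: "ringed_space Y" and Z: "ringed_space Z"
    and f: "rs_morphism X Y f" and g: "rs_morphism Y Z g" and x: "x \<in> pts X"
    and a: "a \<in> rgerms Z (pt g (pt f x))"
  shows "stalk_comor (g \<cdot> f) x a = stalk_comor f x (stalk_comor g (pt f x) a)"
proof -
  note [simp] = rs_morphismD(1,2)[OF f] rs_morphismD(1,2)[OF g]
  obtain V s where V: "opn Z V" "pt g (pt f x) \<in> V" "s \<in> rsecs Z V" "a = rgerm Z (pt g (pt f x)) V s"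
    using ring_stalk_rep[OF a] .
  have px: "pt f x \<in> pts Y" using pt_topspace[OF f x] .
  have "stalk_comor (g \<cdot> f) x a = rgerm X x (preim f (preim g V)) (comor f (preim g V) (comor g V s))"
    using stalk_comor_rgerm[OF X Z rs_morphism_comp[OF Z f g] x V(1), of s] V x
    by (simp add: preim_comp[OF f g] comor_comp)
  also have "\<dots> = stalk_comor f x (rgerm Y (pt f x) (preim g V) (comor g V s))"
    using V px by (subst stalk_comor_rgerm[OF X Y f x])
      (simp_all add: preim_open[OF g] mem_preim[OF g] comor_closed[OF g])
  also have "rgerm Y (pt f x) (preim g V) (comor g V s) = stalk_comor g (pt f x) a"
    using V px by (simp add: stalk_comor_rgerm[OF Y Z g])
  finally show ?thesis .
qed

section \<open>Morphisms of sheaves over a morphism of spaces\<close>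

text \<open>A morphism \<open>M \<rightarrow> f\<^sub>*N\<close>.\<close>

definition f_map :: "('a, 'r, 'b, 's) rs_mor \<Rightarrow> ('b, 's, 'm) mod_sh \<Rightarrow> ('a, 'r, 'n) mod_sh \<Rightarrow> ('b set \<Rightarrow> 'm \<Rightarrow> 'n) \<Rightarrow> bool" where
  "f_map f M N c \<longleftrightarrow> (\<forall>V. opn (tgt f) V \<longrightarrow> add_hom (msec M V) (msec N (preim f V)) (c V) \<and>
     (\<forall>a\<in>rsecs (tgt f) V. \<forall>m\<in>secs M V. c V (a \<odot>\<^bsub>msec M V\<^esub> m) = comor f V a \<odot>\<^bsub>msec N (preim f V)\<^esub> c V m) \<and>
     (\<forall>W. opn (tgt f) W \<and> W \<subseteq> V \<longrightarrow> (\<forall>m\<in>secs M V. c W (mres M V W m) = mres N (preim f V) (preim f W) (c V m))))"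

lemma f_mapD:
  assumes "f_map f M N c" "opn (tgt f) V"
  shows "add_hom (msec M V) (msec N (preim f V)) (c V)"
    and "\<And>m. m \<in> secs M V \<Longrightarrow> c V m \<in> secs N (preim f V)"
    and "\<And>a m. a \<in> rsecs (tgt f) V \<Longrightarrow> m \<in> secs M V \<Longrightarrow>
        c V (a \<odot>\<^bsub>msec M V\<^esub> m) = comor f V a \<odot>\<^bsub>msec N (preim f V)\<^esub> c V m"
    and "\<And>W m. \<lbrakk>opn (tgt f) W; W \<subseteq> V; m \<in> secs M V\<rbrakk> \<Longrightarrow>
        c W (mres M V W m) = mres N (preim f V) (preim f W) (c V m)"
proof -
  show a: "add_hom (msec M V) (msec N (preim f V)) (c V)" using assms unfolding f_map_def by simp
  show "c V m \<in> secs N (preim f V)" if "m \<in> secs M V" for m using add_hom_closed[OF a that] .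
qed (use assms in "simp_all add: f_map_def")

lemma f_mapI:
  assumes "\<And>V. opn (tgt f) V \<Longrightarrow> add_hom (msec M V) (msec N (preim f V)) (c V)"
    and "\<And>V a m. \<lbrakk>opn (tgt f) V; a \<in> rsecs (tgt f) V; m \<in> secs M V\<rbrakk> \<Longrightarrow>
        c V (a \<odot>\<^bsub>msec M V\<^esub> m) = comor f V a \<odot>\<^bsub>msec N (preim f V)\<^esub> c V m"
    and "\<And>V W m. \<lbrakk>opn (tgt f) V; opn (tgt f) W; W \<subseteq> V; m \<in> secs M V\<rbrakk> \<Longrightarrow>
        c W (mres M V W m) = mres N (preim f V) (preim f W) (c V m)"
  shows "f_map f M N c" unfolding f_map_def by (intro allI impI conjI ballI; (elim conjE)?; rule assms)

lemma f_map_comp: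
  assumes q: "rs_morphism X Y q" and f: "rs_morphism Y Z f"
    and c: "f_map f M N c" and d: "f_map q N P d"
  shows "f_map (f \<cdot> q) M P (\<lambda>V m. d (preim f V) (c V m))"
proof (rule f_mapI)
  note [simp] = rs_morphismD(1,2)[OF q] rs_morphismD(1,2)[OF f] preim_comp[OF q f]
  fix V assume V: "opn (tgt (f \<cdot> q)) V"
  then have V': "opn (tgt f) V" "opn (tgt q) (preim f V)" using preim_open[OF f] by simp_all
  show "add_hom (msec M V) (msec P (preim (f \<cdot> q) V)) (\<lambda>m. d (preim f V) (c V m))"
    using add_hom_compose[OF f_mapD(1)[OF c V'(1)] f_mapD(1)[OF d V'(2)]] by simp
  fix a m assume "a \<in> rsecs (tgt (f \<cdot> q)) V" "m \<in> secs M V"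
  then show "d (preim f V) (c V (a \<odot>\<^bsub>msec M V\<^esub> m)) =
      comor (f \<cdot> q) V a \<odot>\<^bsub>msec P (preim (f \<cdot> q) V)\<^esub> d (preim f V) (c V m)"
    using V' f_mapD[OF c V'(1)] f_mapD[OF d V'(2)] comor_closed[OF f] by (simp add: comor_comp)
next
  note [simp] = rs_morphismD(1,2)[OF q] rs_morphismD(1,2)[OF f] preim_comp[OF q f]
  fix V W m assume V: "opn (tgt (f \<cdot> q)) V" "opn (tgt (f \<cdot> q)) W" "W \<subseteq> V" "m \<in> secs M V"
  then have V': "opn (tgt f) V" "opn (tgt q) (preim f V)" "opn (tgt q) (preim f W)"
    using preim_open[OF f] by simp_all
  show "d (preim f W) (c W (mres M V W m)) = mres P (preim (f \<cdot> q) V) (preim (f \<cdot> q) W) (d (preim f V) (c V m))"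
    using V V' f_mapD[OF c V'(1)] f_mapD[OF d V'(2)] by (simp add: preim_mono)
qed

lemma ex1_eqI: "\<exists>!x. P x \<Longrightarrow> P a \<Longrightarrow> P b \<Longrightarrow> a = b" by blast

text \<open>The open sets on which \<open>s\<close> and \<open>t\<close> agree cover
  \<open>W\<close>. Both glue the restrictions of \<open>s\<close> to this cover, so uniqueness of
  gluing identifies them.\<close>

lemma module_sheaf_eqI:
  assumes N: "module_sheaf X N" and s: "s \<in> secs N W" and t: "t \<in> secs N W"
    and W: "opn X W"
    and loc: "\<And>x. x \<in> W \<Longrightarrow> \<exists>Z. opn X Z \<and> x \<in> Z \<and> Z \<subseteq> W \<and> mres N W Z s = mres N W Z t"
  shows "s = t"
proof -
  let ?W = "{Z. opn X Z \<and> Z \<subseteq> W \<and> mres N W Z s = mres N W Z t}"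
  have U: "\<Union>?W = W" using loc by fast
  have "\<exists>!r. r \<in> secs N (\<Union>?W) \<and> (\<forall>Z\<in>?W. mres N (\<Union>?W) Z r = mres N W Z s)"
  proof (rule sheaf_of_sets_glue[OF module_sheafD(1)[OF N], of ?W "\<lambda>Z. mres N W Z s"])
    fix Z Z' assume "Z \<in> ?W" "Z' \<in> ?W"
    then show "mres N Z (Z \<inter> Z') (mres N W Z s) = mres N Z' (Z \<inter> Z') (mres N W Z' s)"
      using W s t by (simp add: mres_mres[OF N] openin_Int)
  qed (use W s t in "simp_all add: mres_closed[OF N]")
  then have ex1: "\<exists>!r. r \<in> secs N W \<and> (\<forall>Z\<in>?W. mres N W Z r = mres N W Z s)" unfolding U .
  show ?thesis by (rule ex1_eqI[OF ex1]) (use s t in simp_all)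
qed

lemma module_sheaf_germ_eqI:
  assumes N: "module_sheaf X N" and s: "s \<in> secs N W" and t: "t \<in> secs N W"
    and W: "opn X W"
    and germ: "\<And>x. x \<in> W \<Longrightarrow> mgerm X N x W s = mgerm X N x W t"
  shows "s = t"
proof (rule module_sheaf_eqI[OF N s t W])
  fix x assume x: "x \<in> W"
  obtain Z where "opn X Z" "x \<in> Z" "Z \<subseteq> W \<inter> W" "mres N W Z s = mres N W Z t"
    using mgerm_eqD[OF N W s W t x germ[OF x]] .
  then show "\<exists>Z. opn X Z \<and> x \<in> Z \<and> Z \<subseteq> W \<and> mres N W Z s = mres N W Z t" by auto
qed

text \<open>Local sections with the prescribed germs agree on overlaps because their germs do, so
  they glue. This turns maps built on stalks back into maps of sections.\<close>

lemma module_sheaf_glue_germs: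
  assumes N: "module_sheaf X N" and W: "opn X W"
    and loc: "\<And>x. x \<in> W \<Longrightarrow> \<exists>Z t. opn X Z \<and> x \<in> Z \<and> Z \<subseteq> W \<and> t \<in> secs N Z \<and> (\<forall>y\<in>Z. mgerm X N y Z t = \<gamma> y)"
  shows "\<exists>t\<in>secs N W. \<forall>x\<in>W. mgerm X N x W t = \<gamma> x"
proof -
  let ?P = "\<lambda>Z t. t \<in> secs N Z \<and> (\<forall>y\<in>Z. mgerm X N y Z t = \<gamma> y)"
  let ?W = "{Z. opn X Z \<and> Z \<subseteq> W \<and> (\<exists>t. ?P Z t)}"
  define s where "s Z = (SOME t. ?P Z t)" for Z
  have s: "?P Z (s Z)" if "Z \<in> ?W" for Z unfolding s_def using that by (intro someI_ex[of "?P Z"]) blast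
  have U: "\<Union>?W = W" using loc by fast
  have "\<exists>!r. r \<in> secs N (\<Union>?W) \<and> (\<forall>Z\<in>?W. mres N (\<Union>?W) Z r = s Z)"
  proof (rule sheaf_of_sets_glue[OF module_sheafD(1)[OF N]])
    fix Z Z' assume Z: "Z \<in> ?W" "Z' \<in> ?W"
    then have o: "opn X Z" "opn X Z'" "opn X (Z \<inter> Z')" by auto
    show "mres N Z (Z \<inter> Z') (s Z) = mres N Z' (Z \<inter> Z') (s Z')" using s[OF Z(1)] s[OF Z(2)] o
      by (intro module_sheaf_germ_eqI[OF N _ _ o(3)]) (simp_all add: mres_closed[OF N] mgerm_res[OF N])
  next
    show "s Z \<in> secs N Z" if "Z \<in> ?W" for Z using s[OF that] by blast
  qed simp
  from ex1_implies_ex[OF this[unfolded U]]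
  obtain r where r': "r \<in> secs N W \<and> (\<forall>Z\<in>?W. mres N W Z r = s Z)" by (elim exE)
  note r = r'[THEN conjunct1] r'[THEN conjunct2]
  have "mgerm X N x W r = \<gamma> x" if x: "x \<in> W" for x
  proof -
    from x have "x \<in> \<Union>?W" unfolding U .
    then obtain Z where Z: "Z \<in> ?W" "x \<in> Z" by (rule UnionE)
    then have Z': "opn X Z" "Z \<subseteq> W" by auto
    have "mres N W Z r = s Z" using r(2) Z(1) by (rule bspec)
    then have "mgerm X N x W r = mgerm X N x Z (s Z)" using mgerm_res[OF N W r(1) Z'(1) Z(2) Z'(2)] by simp
    then show ?thesis using s[OF Z(1)] Z(2) by simp
  qed
  then show ?thesis using r(1) by (intro bexI[of _ r]) simp_all
qed

text \<open>In \<open>\<Union>(V, m)\<in>g. \<dots>\<close> the open set of the image germ is written \<open>P V\<close> because the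
  definition of \<open>pull_map\<close> writes \<open>V\<close> instead of the preimage of \<open>V\<close> when \<open>k\<close> is an identity.\<close>

lemma
  assumes Y': "ringed_space Y'" and Y: "ringed_space Y" and k: "rs_morphism Y' Y k"
    and M: "module_sheaf Y M" and M': "module_sheaf Y' M'" and c: "f_map k M M' c"
    and P: "\<And>V. opn Y V \<Longrightarrow> P V = preim k V" and y: "y \<in> pts Y'"
  defines "cg \<equiv> \<lambda>g. \<Union>(V, m)\<in>g. mgerm Y' M' y (P V) (c V m)"
  shows f_map_germ: "\<And>V m. \<lbrakk>opn Y V; pt k y \<in> V; m \<in> secs M V\<rbrakk> \<Longrightarrow>
      cg (mgerm Y M (pt k y) V m) = mgerm Y' M' y (preim k V) (c V m)"
    and f_map_germ_add_hom: "add_hom (mod_stalk Y M (pt k y)) (mod_stalk Y' M' y) cg"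
    and f_map_germ_smult: "\<And>a g. a \<in> rgerms Y (pt k y) \<Longrightarrow> g \<in> mgerms Y M (pt k y) \<Longrightarrow>
      cg (a \<odot>\<^bsub>mod_stalk Y M (pt k y)\<^esub> g) = stalk_comor k y a \<odot>\<^bsub>mod_stalk Y' M' y\<^esub> cg g"
proof -
  note [simp] = rs_morphismD(1,2)[OF k] preim_open[OF k] mem_preim[OF k] comor_closed[OF k] y
  have c': "\<And>V m. opn Y V \<Longrightarrow> m \<in> secs M V \<Longrightarrow> c V m \<in> secs M' (preim k V)" using f_mapD(2)[OF c] by simp
  show germ: "cg (mgerm Y M (pt k y) V m) = mgerm Y' M' y (preim k V) (c V m)"
    if V: "opn Y V" "pt k y \<in> V" "m \<in> secs M V" for V m unfolding cg_def
  proof (rule UN_mgerm[OF M V(1,3,2)])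
    fix W n assume W: "opn Y W" "pt k y \<in> W" "n \<in> secs M W"
      and eq: "mgerm Y M (pt k y) W n = mgerm Y M (pt k y) V m"
    obtain Z where Z: "opn Y Z" "pt k y \<in> Z" "Z \<subseteq> W \<inter> V" "mres M W Z n = mres M V Z m"
      using mgerm_eqD[OF M W(1,3) V(1,3,2) eq] .
    have "mgerm Y' M' y (preim k W) (c W n) = mgerm Y' M' y (preim k Z) (mres M' (preim k W) (preim k Z) (c W n))"
      using Z W c' by (subst mgerm_res[OF M']) (simp_all add: preim_mono)
    also have "\<dots> = mgerm Y' M' y (preim k Z) (mres M' (preim k V) (preim k Z) (c V m))"
      using Z W V f_mapD(4)[OF c, of W Z n] f_mapD(4)[OF c, of V Z m] by simp
    also have "\<dots> = mgerm Y' M' y (preim k V) (c V m)"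
      using Z V c' by (subst mgerm_res[OF M']) (simp_all add: preim_mono)
    finally show "mgerm Y' M' y (P W) (c W n) = mgerm Y' M' y (preim k V) (c V m)" using P W by simp
  qed
  show "add_hom (mod_stalk Y M (pt k y)) (mod_stalk Y' M' y) cg"
  proof (rule add_homI)
    fix g assume g: "g \<in> mgerms Y M (pt k y)"
    then obtain V m where V: "opn Y V" "pt k y \<in> V" "m \<in> secs M V" "g = mgerm Y M (pt k y) V m"
      by (rule mod_stalk_rep)
    then show "cg g \<in> mgerms Y' M' y" by (simp add: germ mod_stalk_carrier c')
    fix g' assume g': "g' \<in> mgerms Y M (pt k y)"
    obtain W s t where W: "opn Y W" "pt k y \<in> W" "s \<in> secs M W" "t \<in> secs M W"
        "g = mgerm Y M (pt k y) W s" "g' = mgerm Y M (pt k y) W t"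
      by (rule mod_stalk_rep3[OF M g g' g'])
    then show "cg (g \<oplus>\<^bsub>mod_stalk Y M (pt k y)\<^esub> g') = cg g \<oplus>\<^bsub>mod_stalk Y' M' y\<^esub> cg g'"
      using abelian_groupE(1)[OF module_sheaf_ab[OF M]] f_mapD(1)[OF c, of W]
      by (simp add: mgerm_add[OF M] mgerm_add[OF M'] germ c' add_hom_add[of "msec M W"])
  qed
  fix a g assume a: "a \<in> rgerms Y (pt k y)" and g: "g \<in> mgerms Y M (pt k y)"
  obtain V s where V: "opn Y V" "pt k y \<in> V" "s \<in> rsecs Y V" "a = rgerm Y (pt k y) V s"
    by (rule ring_stalk_rep[OF a])
  obtain W m where W: "opn Y W" "pt k y \<in> W" "W \<subseteq> V" "m \<in> secs M W" "g = mgerm Y M (pt k y) W m"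
    by (rule mod_stalk_rep_within[OF M g V(1,2)])
  let ?s = "rres Y V W s"
  have s: "?s \<in> rsecs Y W" "a = rgerm Y (pt k y) W ?s"
    using V W by (simp_all add: rres_closed[OF Y] rgerm_res[OF Y])
  show "cg (a \<odot>\<^bsub>mod_stalk Y M (pt k y)\<^esub> g) = stalk_comor k y a \<odot>\<^bsub>mod_stalk Y' M' y\<^esub> cg g"
    using s W left_moduleD(3)[OF module_sheafD(2)[OF M W(1)]] f_mapD(3)[OF c, of W ?s m]
    by (simp add: mgerm_smult[OF Y M] germ stalk_comor_rgerm[OF Y' Y k] mgerm_smult[OF Y' M'] c')
qed

section \<open>Universal property of the pulled-back sheaf\<close>

context pullback
begin

lemma pull_sec_pure:
  assumes "opn Y V" "x \<in> preim f V"
  shows "pull_sec f M V m x = pure (preim f V) \<one>\<^bsub>rsec X (preim f V)\<^esub> V m x"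
  using assms rgerm_one[OF X preim_open[OF f assms(1)] assms(2)] by (simp add: pull_sec_def pure_def)

lemma pull_sec_section:
  assumes V: "opn Y V" and m: "m \<in> secs M V"
  shows "pull_sec f M V m \<in> Sec (preim f V)"
proof -
  note o = preim_open[OF f V] and one = ring.ring_simprules(6)[OF ringed_space_ring[OF X preim_open[OF f V]]]
  have "restrict (pure (preim f V) \<one>\<^bsub>rsec X (preim f V)\<^esub> V m) (preim f V) \<in> Sec (preim f V)"
    using pure_closed[OF o one V m order_refl] fin_sum_pure[OF o one V m order_refl] o
    by (intro sectionI) auto
  also have "restrict (pure (preim f V) \<one>\<^bsub>rsec X (preim f V)\<^esub> V m) (preim f V) = pull_sec f M V m"
    using pull_sec_pure[OF V] by (auto simp: fun_eq_iff restrict_def pull_sec_def)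
  finally show ?thesis .
qed

text \<open>The unit m \<mapsto> 1 \<otimes> m of the adjunction between pullback and direct image.
  Compatibility with scalars from Y is the balance of the tensor product.\<close>

lemma pull_sec_f_map: "f_map f M (pull f M) (pull_sec f M)"
proof (rule f_mapI)
  fix V assume "opn (tgt f) V"
  then have V: "opn Y V" by simp
  have x: "x \<in> pts X" "pt f x \<in> V" if "x \<in> preim f V" for x using that mem_preim[OF f] by auto
  have one: "\<one>\<^bsub>ring_stalk X x\<^esub> \<in> rgerms X x" if "x \<in> pts X" for x
    using ring.ring_simprules(6)[OF ring_ring_stalk[OF X that]] .
  show "add_hom (msec M V) (msec (pull f M) (preim f V)) (pull_sec f M V)" unfolding pull_simps
  proof (rule add_homI, unfold pull_simps)
    fix m n assume mn: "m \<in> secs M V" "n \<in> secs M V"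
    show "pull_sec f M V m \<in> Sec (preim f V)" by (rule pull_sec_section[OF V mn(1)])
    show "pull_sec f M V (m \<oplus>\<^bsub>msec M V\<^esub> n) = (\<lambda>x\<in>preim f V. pull_sec f M V m x \<oplus>\<^bsub>S x\<^esub> pull_sec f M V n x)"
      unfolding pull_sec_def
      by (rule restrict_ext) (use V mn x one in "simp add: mgerm_add[OF M, symmetric] ten_add_right mod_stalk_carrier")
  qed
  fix a m assume "a \<in> rsecs (tgt f) V" and m: "m \<in> secs M V"
  then have a: "a \<in> rsecs Y V" by simp
  show "pull_sec f M V (a \<odot>\<^bsub>msec M V\<^esub> m) = comor f V a \<odot>\<^bsub>msec (pull f M) (preim f V)\<^esub> pull_sec f M V m"
    unfolding pull_simps unfolding pull_sec_def
  proof (rule restrict_ext)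
    fix y assume y: "y \<in> preim f V"
    interpret R: ring "ring_stalk X y" using ring_ring_stalk[OF X x(1)[OF y]] .
    have c: "stalk_comor f y (rgerm Y (pt f y) V a) = rgerm X y (preim f V) (comor f V a)"
      using stalk_comor_rgerm[OF X Y f x(1)[OF y] V x(2)[OF y] a] .
    have cc: "rgerm X y (preim f V) (comor f V a) \<in> rgerms X y"
      using y by (intro ring_stalk_carrier preim_open[OF f V] comor_closed[OF f V a])
    show "pb_tensor f M y \<one>\<^bsub>ring_stalk (src f) y\<^esub> (mgerm (tgt f) M (pt f y) V (a \<odot>\<^bsub>msec M V\<^esub> m)) =
       rgerm X y (preim f V) (comor f V a) \<odot>\<^bsub>S y\<^esub>
       (\<lambda>x\<in>preim f V. pb_tensor f M x \<one>\<^bsub>ring_stalk (src f) x\<^esub> (mgerm (tgt f) M (pt f x) V m)) y"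
      using y x[OF y] a m V one[OF x(1)[OF y]] cc c
        ten_balanced[OF x(1)[OF y], of "\<one>\<^bsub>ring_stalk X y\<^esub>" "rgerm Y (pt f y) V a" "mgerm Y M (pt f y) V m"]
      by (simp add: mgerm_smult[OF Y M, symmetric] ring_stalk_carrier mod_stalk_carrier smult_ten)
  qed
next
  fix V W m assume "opn (tgt f) V" "opn (tgt f) W" "W \<subseteq> V" "m \<in> secs M V"
  then show "pull_sec f M W (mres M V W m) = mres (pull f M) (preim f V) (preim f W) (pull_sec f M V m)"
    unfolding pull_simps unfolding pull_sec_def using preim_mono[of W V f]
    by (subst restrict_restrict) (auto simp: fun_eq_iff restrict_def mgerm_res[OF M] mem_preim[OF f] Int_absorb1)
qed

text \<open>Since a \<otimes> m = a (1 \<otimes> m), the sections \<open>pull_sec\<close> generate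
  the pullback locally as a module.\<close>

lemma pure_eq_smult_pull_sec:
  assumes Z: "opn X Z" and a: "a \<in> rsecs X Z" and V: "opn Y V" "Z \<subseteq> preim f V"
    and m: "m \<in> secs M V"
  shows "(\<lambda>y\<in>Z. pure Z a V m y) = a \<odot>\<^bsub>msec (pull f M) Z\<^esub> mres (pull f M) (preim f V) Z (pull_sec f M V m)"
  unfolding pull_simps
proof (rule restrict_ext)
  fix y assume y: "y \<in> Z"
  then have yV: "y \<in> preim f V" "pt f y \<in> V" "y \<in> pts X" using V(2) mem_preim[OF f] by auto
  interpret R: ring "ring_stalk X y" using ring_ring_stalk[OF X yV(3)] .
  show "pure Z a V m y = rgerm X y Z a \<odot>\<^bsub>S y\<^esub> restrict (pull_sec f M V m) Z y" using y yV V m Z a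
    by (simp add: pure_def pull_sec_def smult_ten ring_stalk_carrier mod_stalk_carrier)
qed

text \<open>The uniqueness half of the universal property. Near each point a section is a finite sum
  of multiples of sections 1 \<otimes> m, on which both maps agree, and \<open>N\<close> being a
  sheaf, local agreement suffices. A general \<open>q\<close> is allowed because one composite of
  \<open>pull_comp\<close> with its inverse is tested on a morphism over \<open>q\<close>.\<close>

lemma f_map_ext:
  assumes X': "ringed_space X'" and q: "rs_morphism X' X q" and N: "module_sheaf X' N"
    and c: "f_map q (pull f M) N c" and d: "f_map q (pull f M) N d"
    and gen: "\<And>V m. opn Y V \<Longrightarrow> m \<in> secs M V \<Longrightarrow>
        c (preim f V) (pull_sec f M V m) = d (preim f V) (pull_sec f M V m)"
    and W: "opn X W" and s: "sg \<in> Sec W"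
  shows "c W sg = d W sg"
proof (rule module_sheaf_eqI[OF N])
  note [simp] = rs_morphismD(1,2)[OF q]
  have cc: "e V tg \<in> secs N (preim q V)" if "opn X V" "tg \<in> Sec V" "f_map q (pull f M) N e" for V tg e
    using f_mapD(2)[OF that(3)] that(1,2) by (simp add: pull_simps)
  show "c W sg \<in> secs N (preim q W)" "d W sg \<in> secs N (preim q W)" using cc W s c d by blast+
  show oW: "opn X' (preim q W)" by (rule preim_open[OF q W])
  fix x assume x: "x \<in> preim q W"
  then have "pt q x \<in> W" using mem_preim[OF q] by blast
  then obtain Z where Z: "opn X Z" "pt q x \<in> Z" "Z \<subseteq> W" "fin_sum Z sg" using section_rep[OF s] by blast
  note ab = pull_module_sheaf[THEN module_sheaf_ab, OF Z(1)] N[THEN module_sheaf_ab, OF preim_open[OF q Z(1)]]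
  have ch: "add_hom (msec (pull f M) Z) (msec N (preim q Z)) (c Z)" "add_hom (msec (pull f M) Z) (msec N (preim q Z)) (d Z)"
    using f_mapD(1)[OF c] f_mapD(1)[OF d] Z(1) by simp_all
  have "c Z (restrict sg Z) = d Z (restrict sg Z) \<and> restrict sg Z \<in> Sec Z" using Z(1,4)
  proof (induction rule: fin_sum_induct)
    case zero
    have "c Z \<zero>\<^bsub>msec (pull f M) Z\<^esub> = d Z \<zero>\<^bsub>msec (pull f M) Z\<^esub>" using add_hom_zero[OF ab] ch by metis
    then show ?case using section_zero[OF Z(1)] unfolding pull_simps by blast
  next
    case (add tg a V m)
    let ?p = "mres (pull f M) (preim f V) Z (pull_sec f M V m)"
    have o: "opn X (preim f V)" using preim_open[OF f] add by blast
    have ps: "pull_sec f M V m \<in> secs (pull f M) (preim f V)" using pull_sec_section add by (simp add: pull_simps)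
    have p: "?p \<in> secs (pull f M) Z" by (rule mres_closed[OF pull_module_sheaf o Z(1) add(6) ps])
    have ap: "a \<odot>\<^bsub>msec (pull f M) Z\<^esub> ?p \<in> secs (pull f M) Z"
      using left_moduleD(3)[OF pull_left_module[OF Z(1)] add(4) p] .
    have eqp: "c Z ?p = d Z ?p"
      using f_mapD(4)[OF c, of "preim f V" Z] f_mapD(4)[OF d, of "preim f V" Z] o Z(1) add ps gen by simp
    have eqap: "c Z (a \<odot>\<^bsub>msec (pull f M) Z\<^esub> ?p) = d Z (a \<odot>\<^bsub>msec (pull f M) Z\<^esub> ?p)"
      using f_mapD(3)[OF c, of Z a ?p] f_mapD(3)[OF d, of Z a ?p] Z(1) add p eqp by simp
    have t: "tg \<in> secs (pull f M) Z" "c Z tg = d Z tg" using add by (simp_all add: pull_simps)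
    have sum: "(\<lambda>y\<in>Z. pure Z a V m y \<oplus>\<^bsub>S y\<^esub> tg y) = a \<odot>\<^bsub>msec (pull f M) Z\<^esub> ?p \<oplus>\<^bsub>msec (pull f M) Z\<^esub> tg"
      unfolding pure_eq_smult_pull_sec[OF Z(1) add(4,5,6,7), symmetric] pull_simps(3)
      by (rule restrict_ext) simp
    show ?case unfolding sum using t ap eqap add_hom_add[OF ch(1) ap t(1)] add_hom_add[OF ch(2) ap t(1)]
        abelian_groupE(1)[OF ab(1) ap t(1)] by (simp add: pull_simps(1))
  qed
  then have "mres N (preim q W) (preim q Z) (c W sg) = mres N (preim q W) (preim q Z) (d W sg)"
    using f_mapD(4)[OF c, of W Z sg] f_mapD(4)[OF d, of W Z sg] W Z s by (simp add: pull_simps)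
  moreover have "x \<in> preim q Z" using x Z mem_preim[OF q] by blast
  ultimately show "\<exists>Z. opn X' Z \<and> x \<in> Z \<and> Z \<subseteq> preim q W \<and>
      mres N (preim q W) Z (c W sg) = mres N (preim q W) Z (d W sg)"
    using preim_open[OF q Z(1)] preim_mono[OF Z(3)] by (intro exI[of _ "preim q Z"]) simp
qed

end

context pullback
begin

text \<open>The existence half: a morphism c from M to N over f \<circ> q factors through the unit.
  On stalks the factor can only be b \<otimes> g \<mapsto> q(b) c(g), where q(b) is the image of b
  under the comorphism; it then has to be shown that these stalk maps come from maps of
  sections.\<close>

lemma f_map_extend:
  assumes X': "ringed_space X'" and q: "rs_morphism X' X q" and N: "module_sheaf X' N"
    and c: "f_map (f \<cdot> q) M N c"
  obtains w where "f_map q (pull f M) N w"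
    "\<And>V m. opn Y V \<Longrightarrow> m \<in> secs M V \<Longrightarrow> w (preim f V) (pull_sec f M V m) = c V m"
proof -
  note fq = rs_morphism_comp[OF Y q f]
  note [simp] = rs_morphismD(1,2)[OF q]
  let ?g = "\<lambda>x W. mgerm X' N x (preim q W)" and ?n = "\<lambda>W. secs N (preim q W)" and ?m' = "\<lambda>W. msec N (preim q W)"
  have pf: "preim (f \<cdot> q) V = preim q (preim f V)" for V by (rule preim_comp[OF q f])
  define cg where "cg x = (\<lambda>g. \<Union>(V, m)\<in>g. mgerm X' N x (preim (f \<cdot> q) V) (c V m))" for x
  let ?R = "\<lambda>x. ring_stalk X' x" and ?N = "\<lambda>x. mod_stalk X' N x"
  have ptq: "pt q x \<in> pts X" if "x \<in> pts X'" for x by (rule pt_topspace[OF q that])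
  have ptfq: "pt (f \<cdot> q) x = pt f (pt q x)" if "x \<in> pts X'" for x using that by simp
  have cg: "cg x (mgerm Y M (pt f (pt q x)) V m) = ?g x (preim f V) (c V m)"
    if "x \<in> pts X'" "opn Y V" "pt f (pt q x) \<in> V" "m \<in> secs M V" for x V m
    using f_map_germ[OF X' Y fq M N c refl, of x V m] that by (simp add: pf cg_def)
  have cga: "add_hom (mod_stalk Y M (pt f (pt q x))) (?N x) (cg x)" if "x \<in> pts X'" for x
    using f_map_germ_add_hom[OF X' Y fq M N c refl, of x] that by (simp add: cg_def)
  have cgm: "cg x (a \<odot>\<^bsub>mod_stalk Y M (pt f (pt q x))\<^esub> g) = stalk_comor q x (stalk_comor f (pt q x) a) \<odot>\<^bsub>?N x\<^esub> cg x g"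
    if "x \<in> pts X'" "a \<in> rgerms Y (pt f (pt q x))" "g \<in> mgerms Y M (pt f (pt q x))" for x a g
    using f_map_germ_smult[OF X' Y fq M N c refl, of x a g] that by (simp add: cg_def stalk_comor_comp[OF X' X Y q f])
  have lmN: "left_module (?R x) (?N x)" if "x \<in> pts X'" for x by (rule left_module_mod_stalk[OF X' N that])
  have sq: "stalk_comor q x \<in> ring_hom (ring_stalk X (pt q x)) (?R x)" if "x \<in> pts X'" for x
    by (rule stalk_comor_hom[OF X' X q that])
  \<comment> \<open>Balance of b \<otimes> g \<mapsto> q(b) c(g) holds because the map induced by
    \<open>c\<close> on germs is semilinear over the composite comorphism of f and q.\<close>
  have "\<exists>\<psi>. add_hom (S (pt q x)) (?N x) \<psi> \<and> (\<forall>b\<in>rgerms X (pt q x). \<forall>g\<in>mgerms Y M (pt f (pt q x)).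
         \<psi> (ten (pt q x) b g) = stalk_comor q x b \<odot>\<^bsub>?N x\<^esub> cg x g)" if x: "x \<in> pts X'" for x
  proof -
    note [simp] = ring_hom_closed[OF sq[OF x]] add_hom_closed[OF cga[OF x]] left_moduleD(3)[OF lmN[OF x]]
    have mon: "stalk_comor f (pt q x) a \<in> rgerms X (pt q x)" if "a \<in> rgerms Y (pt f (pt q x))" for a
      using ring_hom_closed[OF stalk_comor_hom[OF X Y f ptq[OF x]] that] .
    obtain \<psi> where "add_hom (S (pt q x)) (?N x) \<psi>"
        "\<And>b g. b \<in> rgerms X (pt q x) \<Longrightarrow> g \<in> mgerms Y M (pt f (pt q x)) \<Longrightarrow>
         \<psi> (ten (pt q x) b g) = stalk_comor q x b \<odot>\<^bsub>?N x\<^esub> cg x g" unfolding S_eq ten_eq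
      by (rule tens.lift[OF tens_at[OF ptq[OF x]] left_moduleD(2)[OF lmN[OF x]],
            of "\<lambda>b g. stalk_comor q x b \<odot>\<^bsub>?N x\<^esub> cg x g"])
         (simp_all add: mon ring_hom_add[OF sq[OF x]] ring_hom_mult[OF sq[OF x]] left_moduleD(4-6)[OF lmN[OF x]]
            add_hom_add[OF cga[OF x]] cgm[OF x])
    then show ?thesis by blast
  qed
  then obtain \<psi> where psi: "\<And>x. x \<in> pts X' \<Longrightarrow> add_hom (S (pt q x)) (?N x) (\<psi> x)"
    and psi_ten: "\<And>x b g. \<lbrakk>x \<in> pts X'; b \<in> rgerms X (pt q x); g \<in> mgerms Y M (pt f (pt q x))\<rbrakk> \<Longrightarrow> \<psi> x (ten (pt q x) b g) = stalk_comor q x b \<odot>\<^bsub>?N x\<^esub> cg x g"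
    by metis
  have psi_smult: "\<psi> x (b \<odot>\<^bsub>S (pt q x)\<^esub> t) = stalk_comor q x b \<odot>\<^bsub>?N x\<^esub> \<psi> x t"
    if x: "x \<in> pts X'" and b: "b \<in> rgerms X (pt q x)" and t: "t \<in> carrier (S (pt q x))" for x b t
  proof -
    have sb: "add_hom (S (pt q x)) (S (pt q x)) (\<lambda>t. b \<odot>\<^bsub>S (pt q x)\<^esub> t)"
      unfolding S_eq by (rule tens.smult_add_hom[OF tens_at[OF ptq[OF x]] b])
    have nb: "add_hom (?N x) (?N x) (\<lambda>t. stalk_comor q x b \<odot>\<^bsub>?N x\<^esub> t)"
      using left_moduleD(3,5)[OF lmN[OF x]] ring_hom_closed[OF sq[OF x] b] by (intro add_homI) simp_all
    show ?thesis
    proof (rule tens.hom_eqI[OF tens_at[OF ptq[OF x]] left_moduleD(2)[OF lmN[OF x]], folded S_eq ten_eq, OF _ _ _ t])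
      show "add_hom (S (pt q x)) (?N x) (\<lambda>t. \<psi> x (b \<odot>\<^bsub>S (pt q x)\<^esub> t))" by (rule add_hom_compose[OF sb psi[OF x]])
      show "add_hom (S (pt q x)) (?N x) (\<lambda>t. stalk_comor q x b \<odot>\<^bsub>?N x\<^esub> \<psi> x t)" by (rule add_hom_compose[OF psi[OF x] nb])
      fix a g assume ag: "a \<in> rgerms X (pt q x)" "g \<in> mgerms Y M (pt f (pt q x))"
      have ba: "b \<otimes>\<^bsub>ring_stalk X (pt q x)\<^esub> a \<in> rgerms X (pt q x)"
        using ring.ring_simprules(5)[OF ring_ring_stalk[OF X ptq[OF x]] b ag(1)] .
      show "\<psi> x (b \<odot>\<^bsub>S (pt q x)\<^esub> ten (pt q x) a g) = stalk_comor q x b \<odot>\<^bsub>?N x\<^esub> \<psi> x (ten (pt q x) a g)"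
        using ag b x ba add_hom_closed[OF cga[OF x]]
        by (simp add: smult_ten ptq psi_ten ring_hom_mult[OF sq[OF x]] ring_hom_closed[OF sq[OF x]] left_moduleD(6)[OF lmN[OF x]])
    qed
  qed
  \<comment> \<open>The values \<open>\<psi> y (sg (pt q y))\<close> vary with \<open>y\<close> like
    the germs of one section. For a single tensor a \<otimes> m this section is the image of a times
    the restriction of c(m); finite sums follow by induction.\<close>
  have loc: "\<exists>t\<in>?n Z. \<forall>y\<in>preim q Z. ?g y Z t = \<psi> y (restrict sg Z (pt q y))"
    if Z: "opn X Z" and fs: "fin_sum Z sg" for Z sg using Z fs
  proof (induction rule: fin_sum_induct)
    case zero
    note oZ = preim_open[OF q Z]
    have "?g y Z \<zero>\<^bsub>?m' Z\<^esub> = \<psi> y ((\<lambda>x\<in>Z. \<zero>\<^bsub>S x\<^esub>) (pt q y))" if y: "y \<in> preim q Z" for y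
    proof -
      have "y \<in> pts X'" "pt q y \<in> Z" using y mem_preim[OF q] by auto
      then show ?thesis
        using add_hom_zero[OF S_abelian left_moduleD(2)[OF lmN] psi] ptq mgerm_zero[OF N oZ y] by simp
    qed
    then show ?case using abelian_groupE(2)[OF module_sheaf_ab[OF N oZ]] by blast
  next
    case (add tg a V m)
    note oZ = preim_open[OF q Z]
    have o: "opn X (preim f V)" "opn X' (preim q (preim f V))"
      using preim_open[OF f add(5)] preim_open[OF q preim_open[OF f add(5)]] .
    obtain t where t: "t \<in> ?n Z"
      "\<forall>y\<in>preim q Z. ?g y Z t = \<psi> y (tg (pt q y))" using add(1) by blast
    have cV: "c V m \<in> ?n (preim f V)" using f_mapD(2)[OF c, of V m] add(5,7) pf by simp
    let ?m = "mres N (preim q (preim f V)) (preim q Z) (c V m)"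
    have sub: "preim q Z \<subseteq> preim q (preim f V)" by (rule preim_mono[OF add(6)])
    have m: "?m \<in> ?n Z" by (rule mres_closed[OF N o(2) oZ sub cV])
    have a: "comor q Z a \<in> rsecs X' (preim q Z)" by (rule comor_closed[OF q Z add(4)])
    note lm = left_moduleD[OF module_sheafD(2)[OF N oZ]]
    have am: "comor q Z a \<odot>\<^bsub>?m' Z\<^esub> ?m \<in> ?n Z" by (rule lm(3)[OF a m])
    have "?g y Z (comor q Z a \<odot>\<^bsub>?m' Z\<^esub> ?m \<oplus>\<^bsub>?m' Z\<^esub> t) =
        \<psi> y ((\<lambda>y\<in>Z. pure Z a V m y \<oplus>\<^bsub>S y\<^esub> tg y) (pt q y))" if y: "y \<in> preim q Z" for y
    proof -
      have yt: "y \<in> pts X'" "pt q y \<in> Z" using y mem_preim[OF q] by auto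
      have yf: "pt f (pt q y) \<in> V" using yt add(6) mem_preim[OF f] by blast
      have "\<psi> y ((\<lambda>y\<in>Z. pure Z a V m y \<oplus>\<^bsub>S y\<^esub> tg y) (pt q y)) =
        \<psi> y (pure Z a V m (pt q y)) \<oplus>\<^bsub>?N y\<^esub> \<psi> y (tg (pt q y))"
        using yt add_hom_add[OF psi[OF yt(1)]] pure_closed[OF Z add(4,5,7,6) yt(2)] PiE_mem[OF add(2) yt(2)] by simp
      moreover have "\<psi> y (pure Z a V m (pt q y)) = ?g y Z (comor q Z a \<odot>\<^bsub>?m' Z\<^esub> ?m)"
        using yt yf Z add(4,5,7) y oZ a m
        by (simp add: pure_def psi_ten ring_stalk_carrier mod_stalk_carrier cg stalk_comor_rgerm[OF X' X q]
            mgerm_smult[OF X' N, symmetric] mgerm_res[OF N o(2) cV oZ y sub])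
      ultimately show ?thesis using t(2) y oZ am t(1) by (simp add: mgerm_add[OF N, symmetric])
    qed
    moreover have "comor q Z a \<odot>\<^bsub>?m' Z\<^esub> ?m \<oplus>\<^bsub>?m' Z\<^esub> t \<in> ?n Z" by (rule abelian_groupE(1)[OF lm(2) am t(1)])
    ultimately show ?case by blast
  qed
  have glob: "\<exists>t\<in>?n W. \<forall>y\<in>preim q W. ?g y W t = \<psi> y (sg (pt q y))"
    if W: "opn X W" and s: "sg \<in> Sec W" for W sg
  proof (rule module_sheaf_glue_germs[OF N preim_open[OF q W]])
    fix x assume "x \<in> preim q W"
    then have x: "x \<in> pts X'" "pt q x \<in> W" using mem_preim[OF q] by auto
    obtain Z where Z: "opn X Z" "pt q x \<in> Z" "Z \<subseteq> W" "fin_sum Z sg" by (rule section_rep[OF s x(2)])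
    obtain t where t: "t \<in> ?n Z"
        "\<forall>y\<in>preim q Z. ?g y Z t = \<psi> y (restrict sg Z (pt q y))" using loc[OF Z(1,4)] by blast
    have "\<forall>y\<in>preim q Z. ?g y Z t = \<psi> y (sg (pt q y))" using t(2) mem_preim[OF q] by auto
    then show "\<exists>Z t. opn X' Z \<and> x \<in> Z \<and> Z \<subseteq> preim q W \<and> t \<in> secs N Z \<and>
        (\<forall>y\<in>Z. mgerm X' N y Z t = \<psi> y (sg (pt q y)))"
      using t(1) preim_open[OF q Z(1)] preim_mono[OF Z(3)] x Z(2) mem_preim[OF q]
      by (intro exI[of _ "preim q Z"] exI[of _ t]) simp
  qed
  \<comment> \<open>The chosen section is unique because its germs are prescribed, so additivity,
    linearity and compatibility with restriction can all be checked on germs.\<close>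
  define w where "w W sg = (SOME t. t \<in> ?n W \<and>
      (\<forall>y\<in>preim q W. ?g y W t = \<psi> y (sg (pt q y))))" for W sg
  have w: "w W sg \<in> ?n W \<and> (\<forall>y\<in>preim q W. ?g y W (w W sg) = \<psi> y (sg (pt q y)))"
    if "opn X W" "sg \<in> Sec W" for W sg
    unfolding w_def by (rule someI_ex) (use glob[OF that] in blast)
  have wc: "w W sg \<in> ?n W" if "opn X W" "sg \<in> Sec W" for W sg using w[OF that] by blast
  have wg: "?g y W (w W sg) = \<psi> y (sg (pt q y))"
    if "opn X W" "sg \<in> Sec W" "y \<in> preim q W" for W sg y
    using w[OF that(1,2)] that(3) by blast
  show thesis
  proof (rule that[of w])
    show "f_map q (pull f M) N w"
    proof (rule f_mapI)
      fix W assume "opn (tgt q) W"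
      then have W: "opn X W" by simp
      note oW = preim_open[OF q W]
      note lm = left_moduleD[OF module_sheafD(2)[OF N oW]]
      note lp = left_moduleD[OF pull_left_module[OF W], unfolded pull_simps(1)]
      have y: "y \<in> pts X'" "pt q y \<in> W" if "y \<in> preim q W" for y using that mem_preim[OF q] by auto
      show "add_hom (msec (pull f M) W) (?m' W) (w W)"
      proof (rule add_homI, unfold pull_simps(1))
        fix sg assume s: "sg \<in> Sec W"
        then show "w W sg \<in> ?n W" by (rule wc[OF W])
        fix tg assume t: "tg \<in> Sec W"
        have st: "sg \<oplus>\<^bsub>msec (pull f M) W\<^esub> tg \<in> Sec W" using section_add[OF W s t] by (simp add: pull_simps)
        show "w W (sg \<oplus>\<^bsub>msec (pull f M) W\<^esub> tg) = w W sg \<oplus>\<^bsub>?m' W\<^esub> w W tg"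
        proof (rule module_sheaf_germ_eqI[OF N wc[OF W st] abelian_groupE(1)[OF lm(2) wc[OF W s] wc[OF W t]] oW])
          fix x assume x: "x \<in> preim q W"
          have "\<psi> x ((sg \<oplus>\<^bsub>msec (pull f M) W\<^esub> tg) (pt q x)) = \<psi> x (sg (pt q x)) \<oplus>\<^bsub>?N x\<^esub> \<psi> x (tg (pt q x))"
            using y[OF x] add_hom_add[OF psi[OF y(1)[OF x]]] section_closed s t by (simp add: pull_simps)
          then show "?g x W (w W (sg \<oplus>\<^bsub>msec (pull f M) W\<^esub> tg)) =
              ?g x W (w W sg \<oplus>\<^bsub>?m' W\<^esub> w W tg)"
            using wg[OF W _ x] s t st oW x wc[OF W] by (simp add: mgerm_add[OF N, symmetric])
        qed
      qed
      fix a sg assume "a \<in> rsecs (tgt q) W" "sg \<in> secs (pull f M) W"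
      then have a: "a \<in> rsecs X W" and s: "sg \<in> Sec W" by (simp_all add: pull_simps)
      have as: "a \<odot>\<^bsub>msec (pull f M) W\<^esub> sg \<in> Sec W" using section_smult[OF W a s] by (simp add: pull_simps)
      show "w W (a \<odot>\<^bsub>msec (pull f M) W\<^esub> sg) = comor q W a \<odot>\<^bsub>?m' W\<^esub> w W sg"
      proof (rule module_sheaf_germ_eqI[OF N wc[OF W as] lm(3)[OF comor_closed[OF q W a] wc[OF W s]] oW])
        fix x assume x: "x \<in> preim q W"
        have "\<psi> x ((a \<odot>\<^bsub>msec (pull f M) W\<^esub> sg) (pt q x)) = rgerm X' x (preim q W) (comor q W a) \<odot>\<^bsub>?N x\<^esub> \<psi> x (sg (pt q x))"
          using y[OF x] a W section_closed[OF s]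
          by (simp add: pull_simps psi_smult ring_stalk_carrier stalk_comor_rgerm[OF X' X q])
        then show "?g x W (w W (a \<odot>\<^bsub>msec (pull f M) W\<^esub> sg)) =
            ?g x W (comor q W a \<odot>\<^bsub>?m' W\<^esub> w W sg)"
          using wg[OF W _ x] s as oW x wc[OF W] comor_closed[OF q W a] by (simp add: mgerm_smult[OF X' N, symmetric])
      qed
    next
      fix V W sg assume "opn (tgt q) V" "opn (tgt q) W" and WV: "W \<subseteq> V" and "sg \<in> secs (pull f M) V"
      then have V: "opn X V" and W: "opn X W" and s: "sg \<in> Sec V" by (simp_all add: pull_simps)
      have sW: "restrict sg W \<in> Sec W" by (rule section_restrict[OF W WV s])
      note oV = preim_open[OF q V] and oW = preim_open[OF q W] and mo = preim_mono[OF WV, of q]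
      show "w W (mres (pull f M) V W sg) = mres N (preim q V) (preim q W) (w V sg)" unfolding pull_simps
      proof (rule module_sheaf_germ_eqI[OF N wc[OF W sW] mres_closed[OF N oV oW mo wc[OF V s]] oW])
        fix x assume x: "x \<in> preim q W"
        then have "x \<in> preim q V" "pt q x \<in> W" using WV mem_preim[OF q] by auto
        then show "?g x W (w W (restrict sg W)) =
            ?g x W (mres N (preim q V) (preim q W) (w V sg))"
          using wg[OF W sW x] wg[OF V s, of x] mgerm_res[OF N oV wc[OF V s] oW x mo] by simp
      qed
    qed
    fix V m assume V: "opn Y V" and m: "m \<in> secs M V"
    note oV = preim_open[OF f V] and oqV = preim_open[OF q preim_open[OF f V]]
    have cV: "c V m \<in> ?n (preim f V)" using f_mapD(2)[OF c, of V m] V m pf by simp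
    have ps: "pull_sec f M V m \<in> Sec (preim f V)" by (rule pull_sec_section[OF V m])
    show "w (preim f V) (pull_sec f M V m) = c V m"
    proof (rule module_sheaf_germ_eqI[OF N wc[OF oV ps] cV oqV])
      fix x assume x: "x \<in> preim q (preim f V)"
      then have y: "x \<in> pts X'" "pt q x \<in> preim f V" "pt f (pt q x) \<in> V" using mem_preim[OF q] mem_preim[OF f] by auto
      interpret R: ring "ring_stalk X (pt q x)" by (rule ring_ring_stalk[OF X ptq[OF y(1)]])
      have g: "mgerm Y M (pt f (pt q x)) V m \<in> mgerms Y M (pt f (pt q x))"
        using V y m by (simp add: mod_stalk_carrier)
      have "\<psi> x (pull_sec f M V m (pt q x)) = cg x (mgerm Y M (pt f (pt q x)) V m)"
        using y V m g add_hom_closed[OF cga[OF y(1)] g]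
        by (simp add: pull_sec_def psi_ten ring_hom_one[OF sq] left_moduleD(7)[OF lmN])
      also have "\<dots> = ?g x (preim f V) (c V m)" by (rule cg[OF y(1) V y(3) m])
      finally show "?g x (preim f V) (w (preim f V) (pull_sec f M V m)) =
          ?g x (preim f V) (c V m)" using wg[OF oV ps x] by simp
    qed
  qed
qed

text \<open>Both \<open>pull_map\<close> and \<open>pull_comp\<close> are instances of the following map induced on \<open>f\<^sup>*M\<close>,
  \<open>f = k \<circ> f'\<close>, by a morphism of sheaves over \<open>k\<close>.\<close>

definition induced_map where "induced_map f' M' P c = (\<lambda>W\<in>{W. opn X W}. \<lambda>sg\<in>secs (pull f M) W. \<lambda>x\<in>W.
     tens_map (ring_stalk (tgt f') (pt f' x)) (ring_stalk X x) (stalk_comor f' x) (mod_stalk (tgt f') M' (pt f' x))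
       (\<lambda>g. \<Union>(V, m)\<in>g. mgerm (tgt f') M' (pt f' x) (P V) (c V m)) (sg x))"

text \<open>On the stalk at x the map is id \<otimes> c, with c passed to germs, to which the
  results on \<open>tens_map\<close> apply. What remains is that the image of a section is a
  section, and that 1 \<otimes> m goes to 1 \<otimes> c(m).\<close>

lemma
  fixes Y' :: "('c, 't) ringed_sp" and M' :: "('c, 't, 'n) mod_sh"
  assumes Y': "ringed_space Y'" and f': "rs_morphism X Y' f'" and k: "rs_morphism Y' Y k" and fk: "f = k \<cdot> f'"
    and M': "module_sheaf Y' M'" and c: "f_map k M M' c" and P: "\<And>V. opn Y V \<Longrightarrow> P V = preim k V"
  shows induced_map_hom: "induced_map f' M' P c \<in> sheaf_hom X (pull f M) (pull f' M')"
    and induced_map_pull_sec: "\<And>V m. opn Y V \<Longrightarrow> m \<in> secs M V \<Longrightarrow>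
      induced_map f' M' P c (preim f V) (pull_sec f M V m) = pull_sec f' M' (preim k V) (c V m)"
proof -
  interpret P': pullback X Y' f' M' by unfold_locales (rule X Y' f' M')+
  let ?g = "\<lambda>x g. \<Union>(V, m)\<in>g. mgerm Y' M' (pt f' x) (P V) (c V m)"
  let ?\<Lambda> = "\<lambda>x. tens_map (ring_stalk Y' (pt f' x)) (ring_stalk X x) (stalk_comor f' x) (mod_stalk Y' M' (pt f' x)) (?g x)"
  have fpt: "pt f x = pt k (pt f' x)" if "x \<in> pts X" for x using that fk by simp
  have fp: "preim f V = preim f' (preim k V)" for V unfolding fk by (rule preim_comp[OF f' k])
  have yt: "pt f' x \<in> pts Y'" if "x \<in> pts X" for x by (rule pt_topspace[OF f' that])
  note cgs = f_map_germ[OF Y' Y k M M' c P] f_map_germ_add_hom[OF Y' Y k M M' c P] f_map_germ_smult[OF Y' Y k M M' c P]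
  have T: "add_hom (S x) (P'.S x) (?\<Lambda> x) \<and>
     (\<forall>a\<in>rgerms X x. \<forall>g\<in>Mg x. ?\<Lambda> x (ten x a g) = P'.ten x a (?g x g)) \<and>
     (\<forall>a\<in>rgerms X x. \<forall>t\<in>carrier (S x). ?\<Lambda> x (a \<odot>\<^bsub>S x\<^esub> t) = a \<odot>\<^bsub>P'.S x\<^esub> ?\<Lambda> x t)" if x: "x \<in> pts X" for x
  proof -
    have ga: "add_hom (Mst x) (mod_stalk Y' M' (pt f' x)) (?g x)" using cgs(2)[OF _ yt[OF x]] fpt[OF x] by simp
    have gm: "?g x (a \<odot>\<^bsub>Mst x\<^esub> g) = stalk_comor k (pt f' x) a \<odot>\<^bsub>mod_stalk Y' M' (pt f' x)\<^esub> ?g x g"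
      if "a \<in> rgerms Y (pt f x)" "g \<in> Mg x" for a g
      using cgs(3)[OF _ yt[OF x]] fpt[OF x] that by simp
    have al: "stalk_comor k (pt f' x) a \<in> rgerms Y' (pt f' x)"
        "stalk_comor f' x (stalk_comor k (pt f' x) a) = stalk_comor f x a" if "a \<in> rgerms Y (pt f x)" for a
      using ring_hom_closed[OF stalk_comor_hom[OF Y' Y k yt[OF x]], of a] that fpt[OF x]
        stalk_comor_comp[OF X Y' Y f' k x, of a] fk by simp_all
    note L = tens_map_add_hom[OF tens_at[OF x] P'.tens_at[OF x] ga al gm]
      tens_map_tensor[OF tens_at[OF x] P'.tens_at[OF x] ga al gm]
      tens_map_smult[OF tens_at[OF x] P'.tens_at[OF x] ga al gm]
    show ?thesis unfolding S_eq P'.S_eq ten_eq P'.ten_eq using L by simp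
  qed
  have La: "add_hom (S x) (P'.S x) (?\<Lambda> x)" if "x \<in> pts X" for x using T[OF that] by blast
  have Lt: "?\<Lambda> x (ten x a (mgerm Y M (pt f x) V m)) = P'.ten x a (mgerm Y' M' (pt f' x) (preim k V) (c V m))"
    if "x \<in> pts X" "a \<in> rgerms X x" "opn Y V" "pt f x \<in> V" "m \<in> secs M V" for x a V m
  proof -
    have "?\<Lambda> x (ten x a (mgerm Y M (pt f x) V m)) = P'.ten x a (?g x (mgerm Y M (pt f x) V m))"
      using T[OF that(1)] that(2) mod_stalk_carrier[OF that(3-5)] by blast
    then show ?thesis using cgs(1)[OF _ yt[OF that(1)]] fpt[OF that(1)] that by simp
  qed
  have Ls: "?\<Lambda> x (a \<odot>\<^bsub>S x\<^esub> t) = a \<odot>\<^bsub>P'.S x\<^esub> ?\<Lambda> x t"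
    if "x \<in> pts X" "a \<in> rgerms X x" "t \<in> carrier (S x)" for x a t using T[OF that(1)] that(2,3) by blast
  \<comment> \<open>A tensor a \<otimes> m over \<open>V\<close> goes to a \<otimes> c(m) over
    \<open>preim k V\<close>, so the local condition is preserved summand by summand.\<close>
  have Lfs: "P'.fin_sum Z (\<lambda>x. ?\<Lambda> x (restrict sg Z x))" if Z: "opn X Z" and s: "fin_sum Z sg" for Z sg using Z s
  proof (induction rule: fin_sum_induct)
    case zero
    have "P'.fin_sum Z (\<lambda>x. ?\<Lambda> x ((\<lambda>y\<in>Z. \<zero>\<^bsub>S y\<^esub>) x)) \<longleftrightarrow> P'.fin_sum Z (\<lambda>x. \<zero>\<^bsub>P'.S x\<^esub>)"
      using open_top[OF Z] by (intro P'.fin_sum_cong) (simp add: add_hom_zero[OF S_abelian P'.S_abelian La])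
    then show ?case using P'.fin_sum_zero[OF Z] by simp
  next
    case (add tg a V m)
    have ok: "opn Y' (preim k V)" "Z \<subseteq> preim f' (preim k V)" "c V m \<in> secs M' (preim k V)"
      using preim_open[OF k add(5)] add(6) fp f_mapD(2)[OF c, of V m] add(5,7) rs_morphismD(2)[OF k] by auto
    have "P'.fin_sum Z (\<lambda>x. ?\<Lambda> x ((\<lambda>y\<in>Z. pure Z a V m y \<oplus>\<^bsub>S y\<^esub> tg y) x)) \<longleftrightarrow>
       P'.fin_sum Z (\<lambda>x. P'.pure Z a (preim k V) (c V m) x \<oplus>\<^bsub>P'.S x\<^esub> ?\<Lambda> x (tg x))"
    proof (rule P'.fin_sum_cong)
      fix x assume x: "x \<in> Z"
      note xt = open_top[OF Z x]
      have xV: "pt f x \<in> V" using x add(6) mem_preim[OF f] by blast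
      have "?\<Lambda> x ((\<lambda>y\<in>Z. pure Z a V m y \<oplus>\<^bsub>S y\<^esub> tg y) x) = ?\<Lambda> x (pure Z a V m x) \<oplus>\<^bsub>P'.S x\<^esub> ?\<Lambda> x (tg x)"
        using x add_hom_add[OF La[OF xt] pure_closed[OF Z add(4,5,7,6) x] PiE_mem[OF add(2) x]] by simp
      moreover have "?\<Lambda> x (pure Z a V m x) = P'.pure Z a (preim k V) (c V m) x"
        unfolding pure_def P'.pure_def by (rule Lt[OF xt ring_stalk_carrier[OF Z x add(4)] add(5) xV add(7)])
      ultimately show "?\<Lambda> x ((\<lambda>y\<in>Z. pure Z a V m y \<oplus>\<^bsub>S y\<^esub> tg y) x) =
          P'.pure Z a (preim k V) (c V m) x \<oplus>\<^bsub>P'.S x\<^esub> ?\<Lambda> x (tg x)" by simp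
    qed
    moreover have "P'.fin_sum Z (P'.pure Z a (preim k V) (c V m))"
      by (rule P'.fin_sum_pure[OF Z add(4) ok(1,3,2)])
    ultimately show ?case using P'.fin_sum_add[OF Z _ add(1)] by simp
  qed
  have Lsec: "(\<lambda>x\<in>W. ?\<Lambda> x (sg x)) \<in> pb_sections f' M' W" if W: "opn X W" and s: "sg \<in> Sec W" for W sg
  proof (rule P'.sectionI)
    fix x assume x: "x \<in> W"
    show "?\<Lambda> x (sg x) \<in> carrier (P'.S x)"
      by (rule add_hom_closed[OF La[OF open_top[OF W x]] section_closed[OF s x]])
    obtain Z where Z: "opn X Z" "x \<in> Z" "Z \<subseteq> W" "fin_sum Z sg" by (rule section_rep[OF s x])
    have "P'.fin_sum Z (\<lambda>x. ?\<Lambda> x (restrict sg Z x)) \<longleftrightarrow> P'.fin_sum Z (\<lambda>x. ?\<Lambda> x (sg x))"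
      by (rule P'.fin_sum_cong) simp
    then show "\<exists>Z. opn X Z \<and> x \<in> Z \<and> Z \<subseteq> W \<and> P'.fin_sum Z (\<lambda>x. ?\<Lambda> x (sg x))"
      using Lfs[OF Z(1,4)] Z by (intro exI[of _ Z]) simp
  qed
  have ap: "induced_map f' M' P c W sg = (\<lambda>x\<in>W. ?\<Lambda> x (sg x))" if "opn X W" "sg \<in> Sec W" for W sg
    using that by (simp add: induced_map_def pull_simps)
  show "induced_map f' M' P c \<in> sheaf_hom X (pull f M) (pull f' M')" unfolding sheaf_hom_def
  proof (intro CollectI conjI allI impI ballI, unfold pull_simps(1,5) P'.pull_simps(1,5))
    show "induced_map f' M' P c \<in> (\<Pi>\<^sub>E W\<in>{W. opn X W}. Sec W \<rightarrow>\<^sub>E pb_sections f' M' W)"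
    proof (rule PiE_I)
      fix W assume "W \<in> {W. opn X W}"
      then have W: "opn X W" by simp
      show "induced_map f' M' P c W \<in> Sec W \<rightarrow>\<^sub>E pb_sections f' M' W"
      proof (rule PiE_I)
        fix sg assume s: "sg \<in> Sec W"
        show "induced_map f' M' P c W sg \<in> pb_sections f' M' W" unfolding ap[OF W s] by (rule Lsec[OF W s])
      next
        fix sg assume "sg \<notin> Sec W"
        then show "induced_map f' M' P c W sg = undefined" using W by (simp add: induced_map_def pull_simps)
      qed
    qed (simp add: induced_map_def)
    fix W sg tg assume W: "opn X W" and s: "sg \<in> Sec W" and t: "tg \<in> Sec W"
    have st: "sg \<oplus>\<^bsub>msec (pull f M) W\<^esub> tg \<in> Sec W" using section_add[OF W s t] by (simp add: pull_simps)
    show "induced_map f' M' P c W (sg \<oplus>\<^bsub>msec (pull f M) W\<^esub> tg) =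
        induced_map f' M' P c W sg \<oplus>\<^bsub>msec (pull f' M') W\<^esub> induced_map f' M' P c W tg"
      unfolding ap[OF W s] ap[OF W t] ap[OF W st] unfolding P'.pull_simps pull_simps
      by (rule restrict_ext) (use s t open_top[OF W] in "simp add: add_hom_add[OF La] section_closed")
  next
    fix W a sg assume W: "opn X W" and a: "a \<in> rsecs X W" and s: "sg \<in> Sec W"
    have as: "a \<odot>\<^bsub>msec (pull f M) W\<^esub> sg \<in> Sec W" using section_smult[OF W a s] by (simp add: pull_simps)
    show "induced_map f' M' P c W (a \<odot>\<^bsub>msec (pull f M) W\<^esub> sg) = a \<odot>\<^bsub>msec (pull f' M') W\<^esub> induced_map f' M' P c W sg"
      unfolding ap[OF W s] ap[OF W as] unfolding P'.pull_simps pull_simps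
      by (rule restrict_ext) (use s a W open_top[OF W] in "simp add: Ls section_closed ring_stalk_carrier")
  next
    fix V W sg assume VW: "opn X V \<and> opn X W \<and> W \<subseteq> V" and s: "sg \<in> Sec V"
    then have V: "opn X V" and W: "opn X W" and WV: "W \<subseteq> V" by auto
    show "induced_map f' M' P c W (restrict sg W) = restrict (induced_map f' M' P c V sg) W"
      unfolding ap[OF V s] ap[OF W section_restrict[OF W WV s]] using WV
      by (auto simp: fun_eq_iff restrict_def)
  qed
  fix V m assume V: "opn Y V" and m: "m \<in> secs M V"
  note oV = preim_open[OF f V]
  show "induced_map f' M' P c (preim f V) (pull_sec f M V m) = pull_sec f' M' (preim k V) (c V m)"
    unfolding ap[OF oV pull_sec_section[OF V m]] unfolding pull_sec_def fp
  proof (rule restrict_ext)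
    fix x assume x: "x \<in> preim f' (preim k V)"
    then have x': "x \<in> pts X" "pt f x \<in> V" using fp mem_preim[OF f] by auto
    interpret R: ring "ring_stalk X x" by (rule ring_ring_stalk[OF X x'(1)])
    show "?\<Lambda> x ((\<lambda>x\<in>preim f' (preim k V). pb_tensor f M x \<one>\<^bsub>ring_stalk (src f) x\<^esub> (mgerm (tgt f) M (pt f x) V m)) x) =
       pb_tensor f' M' x \<one>\<^bsub>ring_stalk (src f') x\<^esub> (mgerm (tgt f') M' (pt f' x) (preim k V) (c V m))"
      using Lt[OF x'(1) R.one_closed V x'(2) m] x by simp
  qed
qed

end

section \<open>Calculus of sheaf homomorphisms\<close>

lemma sheaf_homD:
  assumes "u \<in> sheaf_hom X M N" "opn X W"
  shows "add_hom (msec M W) (msec N W) (u W)"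
    and "\<And>s. s \<in> secs M W \<Longrightarrow> u W s \<in> secs N W"
    and "\<And>a s. a \<in> rsecs X W \<Longrightarrow> s \<in> secs M W \<Longrightarrow> u W (a \<odot>\<^bsub>msec M W\<^esub> s) = a \<odot>\<^bsub>msec N W\<^esub> u W s"
    and "\<And>V s. \<lbrakk>opn X V; W \<subseteq> V; s \<in> secs M V\<rbrakk> \<Longrightarrow> u W (mres M V W s) = mres N V W (u V s)"
proof -
  have u: "u \<in> (\<Pi>\<^sub>E W\<in>{W. opn X W}. secs M W \<rightarrow>\<^sub>E secs N W)"
    and lin: "\<forall>W. opn X W \<longrightarrow> (\<forall>s\<in>secs M W. \<forall>t\<in>secs M W. u W (s \<oplus>\<^bsub>msec M W\<^esub> t) = u W s \<oplus>\<^bsub>msec N W\<^esub> u W t) \<and>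
          (\<forall>a\<in>rsecs X W. \<forall>s\<in>secs M W. u W (a \<odot>\<^bsub>msec M W\<^esub> s) = a \<odot>\<^bsub>msec N W\<^esub> u W s)"
    and res: "\<forall>V W. opn X V \<and> opn X W \<and> W \<subseteq> V \<longrightarrow> (\<forall>s\<in>secs M V. u W (mres M V W s) = mres N V W (u V s))"
    using assms(1) unfolding sheaf_hom_def by simp_all
  have "u W \<in> secs M W \<rightarrow>\<^sub>E secs N W" using PiE_mem[OF u] assms(2) by simp
  then show cl: "u W s \<in> secs N W" if "s \<in> secs M W" for s using that by (rule PiE_mem)
  show "add_hom (msec M W) (msec N W) (u W)" using cl lin assms(2) by (intro add_homI) simp_all
  show "u W (a \<odot>\<^bsub>msec M W\<^esub> s) = a \<odot>\<^bsub>msec N W\<^esub> u W s" if "a \<in> rsecs X W" "s \<in> secs M W" for a s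
    using lin assms(2) that by simp
  show "u W (mres M V W s) = mres N V W (u V s)" if "opn X V" "W \<subseteq> V" "s \<in> secs M V" for V s
    using res assms(2) that by simp
qed

lemma sheaf_homI:
  assumes "u \<in> extensional {W. opn X W}"
    and "\<And>W. opn X W \<Longrightarrow> u W \<in> extensional (secs M W)"
    and "\<And>W. opn X W \<Longrightarrow> add_hom (msec M W) (msec N W) (u W)"
    and "\<And>W a s. \<lbrakk>opn X W; a \<in> rsecs X W; s \<in> secs M W\<rbrakk> \<Longrightarrow> u W (a \<odot>\<^bsub>msec M W\<^esub> s) = a \<odot>\<^bsub>msec N W\<^esub> u W s"
    and "\<And>V W s. \<lbrakk>opn X V; opn X W; W \<subseteq> V; s \<in> secs M V\<rbrakk> \<Longrightarrow> u W (mres M V W s) = mres N V W (u V s)"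
  shows "u \<in> sheaf_hom X M N"
proof -
  have "u W \<in> secs M W \<rightarrow>\<^sub>E secs N W" if "opn X W" for W
    using assms(2)[OF that] add_hom_closed[OF assms(3)[OF that]] by (auto simp: PiE_def)
  then have "u \<in> (\<Pi>\<^sub>E W\<in>{W. opn X W}. secs M W \<rightarrow>\<^sub>E secs N W)" using assms(1) by (simp add: PiE_def)
  then show ?thesis unfolding sheaf_hom_def using assms(4,5) add_hom_add[OF assms(3)] by simp
qed

lemma sheaf_hom_eqI:
  assumes u: "u \<in> sheaf_hom X M N" and v: "v \<in> sheaf_hom X M N"
    and eq: "\<And>W s. opn X W \<Longrightarrow> s \<in> secs M W \<Longrightarrow> u W s = v W s"
  shows "u = v"
proof -
  have P: "u \<in> (\<Pi>\<^sub>E W\<in>{W. opn X W}. secs M W \<rightarrow>\<^sub>E secs N W)" "v \<in> (\<Pi>\<^sub>E W\<in>{W. opn X W}. secs M W \<rightarrow>\<^sub>E secs N W)"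
    using u v unfolding sheaf_hom_def by simp_all
  show ?thesis
  proof (rule PiE_ext[OF P])
    fix W assume W: "W \<in> {W. opn X W}"
    show "u W = v W" by (rule PiE_ext[OF PiE_mem[OF P(1) W] PiE_mem[OF P(2) W]]) (use W eq in simp)
  qed
qed

lemma sheaf_hom_f_map:
  assumes "u \<in> sheaf_hom X M N"
  shows "f_map (rs_id X) M N u" by (rule f_mapI)
    (simp_all add: preim_rs_id comor_rs_id sheaf_homD(1)[OF assms] sheaf_homD(3)[OF assms] sheaf_homD(4)[OF assms])

text \<open>An \<open>f_map\<close> is unconstrained off the open sets and off the sections, whereas
  \<open>sheaf_hom\<close> consists of extensional functions; hence the two restrictions.\<close>

lemma f_map_sheaf_hom:
  assumes M: "module_sheaf X M" and c: "f_map (rs_id X) M N c"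
  shows "(\<lambda>W\<in>{W. opn X W}. \<lambda>s\<in>secs M W. c W s) \<in> sheaf_hom X M N"
proof (rule sheaf_homI)
  fix W assume W: "opn X W"
  note c' = f_mapD[OF c, unfolded rs_id_simps, OF W, unfolded preim_rs_id[OF W]]
  note lm = left_moduleD[OF module_sheafD(2)[OF M W]]
  show "add_hom (msec M W) (msec N W) ((\<lambda>W\<in>{W. opn X W}. \<lambda>s\<in>secs M W. c W s) W)"
    using W c'(2) abelian_groupE(1)[OF lm(2)] by (intro add_homI) (simp_all add: add_hom_add[OF c'(1)])
  fix a s assume "a \<in> rsecs X W" "s \<in> secs M W"
  then show "(\<lambda>W\<in>{W. opn X W}. \<lambda>s\<in>secs M W. c W s) W (a \<odot>\<^bsub>msec M W\<^esub> s) =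
      a \<odot>\<^bsub>msec N W\<^esub> (\<lambda>W\<in>{W. opn X W}. \<lambda>s\<in>secs M W. c W s) W s"
    using W lm(3) c'(3) by (simp add: comor_rs_id)
next
  fix V W s assume V: "opn X V" and W: "opn X W" "W \<subseteq> V" and s: "s \<in> secs M V"
  then show "(\<lambda>W\<in>{W. opn X W}. \<lambda>s\<in>secs M W. c W s) W (mres M V W s) =
      mres N V W ((\<lambda>W\<in>{W. opn X W}. \<lambda>s\<in>secs M W. c W s) V s)"
    using f_mapD(4)[OF c, of V W s] mres_closed[OF M V W s] by (simp add: preim_rs_id)
qed simp_all

lemma sh_comp_apply: "opn X W \<Longrightarrow> s \<in> secs M W \<Longrightarrow> sh_comp X M v u W s = v W (u W s)" by (simp add: sh_comp_def)

lemma sh_id_apply: "opn X W \<Longrightarrow> s \<in> secs M W \<Longrightarrow> sh_id X M W s = s" by (simp add: sh_id_def)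

lemma sh_add_apply: "opn X W \<Longrightarrow> s \<in> secs M W \<Longrightarrow> sh_add X M N u v W s = u W s \<oplus>\<^bsub>msec N W\<^esub> v W s"
  by (simp add: sh_add_def)

lemma sh_zero_apply: "opn X W \<Longrightarrow> s \<in> secs M W \<Longrightarrow> sh_zero X M N W s = \<zero>\<^bsub>msec N W\<^esub>" by (simp add: sh_zero_def)

lemma sh_comp_hom:
  assumes M: "module_sheaf X M" and u: "u \<in> sheaf_hom X M N" and v: "v \<in> sheaf_hom X N P"
  shows "sh_comp X M v u \<in> sheaf_hom X M P"
proof (rule sheaf_homI)
  fix W assume W: "opn X W"
  note lm = left_moduleD[OF module_sheafD(2)[OF M W]]
  show "add_hom (msec M W) (msec P W) (sh_comp X M v u W)"
    using W sheaf_homD[OF u W] sheaf_homD[OF v W] abelian_groupE(1)[OF lm(2)]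
    by (intro add_homI) (simp_all add: sh_comp_apply add_hom_add)
  fix a s assume "a \<in> rsecs X W" "s \<in> secs M W"
  then show "sh_comp X M v u W (a \<odot>\<^bsub>msec M W\<^esub> s) = a \<odot>\<^bsub>msec P W\<^esub> sh_comp X M v u W s"
    using W sheaf_homD[OF u W] sheaf_homD[OF v W] lm(3) by (simp add: sh_comp_apply)
next
  fix V W s assume "opn X V" "opn X W" "W \<subseteq> V" "s \<in> secs M V"
  then show "sh_comp X M v u W (mres M V W s) = mres P V W (sh_comp X M v u V s)"
    using sheaf_homD(2,4)[OF u] sheaf_homD(2,4)[OF v] mres_closed[OF M] by (simp add: sh_comp_apply)
qed (simp_all add: sh_comp_def)

lemma sh_id_hom:
  assumes M: "module_sheaf X M"
  shows "sh_id X M \<in> sheaf_hom X M M"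
proof (rule sheaf_homI)
  fix W assume W: "opn X W"
  note lm = left_moduleD[OF module_sheafD(2)[OF M W]]
  show "add_hom (msec M W) (msec M W) (sh_id X M W)"
    using W abelian_groupE(1)[OF lm(2)] by (intro add_homI) (simp_all add: sh_id_apply)
  fix a s assume "a \<in> rsecs X W" "s \<in> secs M W"
  then show "sh_id X M W (a \<odot>\<^bsub>msec M W\<^esub> s) = a \<odot>\<^bsub>msec M W\<^esub> sh_id X M W s" using W lm(3) by (simp add: sh_id_apply)
qed (simp_all add: sh_id_apply mres_closed[OF M], simp_all add: sh_id_def)

lemma sh_zero_hom:
  assumes M: "module_sheaf X M" and N: "module_sheaf X N"
  shows "sh_zero X M N \<in> sheaf_hom X M N"
proof (rule sheaf_homI)
  fix W assume W: "opn X W"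
  note lm = left_moduleD[OF module_sheafD(2)[OF M W]] and lN = module_sheafD(2)[OF N W]
  note ln = left_moduleD[OF lN]
  show "add_hom (msec M W) (msec N W) (sh_zero X M N W)"
    using W abelian_groupE(1)[OF lm(2)] abelian_groupE(2,5)[OF ln(2)]
    by (intro add_homI) (simp_all add: sh_zero_apply)
  fix a s assume "a \<in> rsecs X W" "s \<in> secs M W"
  then show "sh_zero X M N W (a \<odot>\<^bsub>msec M W\<^esub> s) = a \<odot>\<^bsub>msec N W\<^esub> sh_zero X M N W s"
    using W lm(3) by (simp add: sh_zero_apply left_module_smult_zero[OF lN])
next
  fix V W s assume V: "opn X V" and W: "opn X W" "W \<subseteq> V" and s: "s \<in> secs M V"
  then show "sh_zero X M N W (mres M V W s) = mres N V W (sh_zero X M N V s)"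
    using add_hom_zero[OF module_sheaf_ab[OF N V] module_sheaf_ab[OF N W(1)] module_sheafD(3)[OF N V W]]
    by (simp add: sh_zero_apply mres_closed[OF M])
qed (simp_all add: sh_zero_def)

lemma sh_add_hom:
  assumes M: "module_sheaf X M" and N: "module_sheaf X N"
    and u: "u \<in> sheaf_hom X M N" and v: "v \<in> sheaf_hom X M N"
  shows "sh_add X M N u v \<in> sheaf_hom X M N"
proof (rule sheaf_homI)
  fix W assume W: "opn X W"
  note lm = left_moduleD[OF module_sheafD(2)[OF M W]] and ln = left_moduleD[OF module_sheafD(2)[OF N W]]
  interpret A: abelian_group "msec N W" by (rule ln(2))
  note [simp] = sheaf_homD(2,3)[OF u W] sheaf_homD(2,3)[OF v W] add_hom_add[OF sheaf_homD(1)[OF u W]]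
     add_hom_add[OF sheaf_homD(1)[OF v W]] abelian_groupE(1)[OF lm(2)] W
  show "add_hom (msec M W) (msec N W) (sh_add X M N u v W)"
    by (intro add_homI) (simp_all add: sh_add_apply A.add.m_ac)
  fix a s assume "a \<in> rsecs X W" "s \<in> secs M W"
  then show "sh_add X M N u v W (a \<odot>\<^bsub>msec M W\<^esub> s) = a \<odot>\<^bsub>msec N W\<^esub> sh_add X M N u v W s"
    by (simp add: sh_add_apply lm(3) ln(5))
next
  fix V W s assume V: "opn X V" and W: "opn X W" "W \<subseteq> V" and s: "s \<in> secs M V"
  then show "sh_add X M N u v W (mres M V W s) = mres N V W (sh_add X M N u v V s)"
    using sheaf_homD(2,4)[OF u] sheaf_homD(2,4)[OF v]
    by (simp add: sh_add_apply mres_closed[OF M] add_hom_add[OF module_sheafD(3)[OF N V W]])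
qed (simp_all add: sh_add_def)

lemma sh_uminus_hom:
  assumes M: "module_sheaf X M" and N: "module_sheaf X N" and u: "u \<in> sheaf_hom X M N"
  shows "(\<lambda>W\<in>{W. opn X W}. \<lambda>s\<in>secs M W. \<ominus>\<^bsub>msec N W\<^esub> u W s) \<in> sheaf_hom X M N" (is "?m \<in> _")
proof (rule sheaf_homI)
  fix W assume W: "opn X W"
  note lm = left_moduleD[OF module_sheafD(2)[OF M W]] and ln = left_moduleD[OF module_sheafD(2)[OF N W]]
  interpret A: abelian_group "msec N W" by (rule ln(2))
  note [simp] = sheaf_homD(2,3)[OF u W] add_hom_add[OF sheaf_homD(1)[OF u W]] abelian_groupE(1)[OF lm(2)] W
  show "add_hom (msec M W) (msec N W) (?m W)" by (intro add_homI) (simp_all add: A.minus_add)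
  fix a s assume as: "a \<in> rsecs X W" "s \<in> secs M W"
  have "add_hom (msec N W) (msec N W) (\<lambda>t. a \<odot>\<^bsub>msec N W\<^esub> t)" using as ln(3,5) by (intro add_homI) simp_all
  from add_hom_minus[OF ln(2) ln(2) this]
  show "?m W (a \<odot>\<^bsub>msec M W\<^esub> s) = a \<odot>\<^bsub>msec N W\<^esub> ?m W s" using as by (simp add: lm(3))
next
  fix V W s assume V: "opn X V" and W: "opn X W" "W \<subseteq> V" and s: "s \<in> secs M V"
  then show "?m W (mres M V W s) = mres N V W (?m V s)"
    using sheaf_homD(2,4)[OF u] add_hom_minus[OF module_sheaf_ab[OF N V] module_sheaf_ab[OF N W(1)] module_sheafD(3)[OF N V W]]
    by (simp add: mres_closed[OF M])
qed simp_all

lemma sh_add_rules: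
  assumes M: "module_sheaf X M" and N: "module_sheaf X N"
  shows "\<And>u v. u \<in> sheaf_hom X M N \<Longrightarrow> v \<in> sheaf_hom X M N \<Longrightarrow> sh_add X M N u v = sh_add X M N v u"
    and "\<And>u v w. \<lbrakk>u \<in> sheaf_hom X M N; v \<in> sheaf_hom X M N; w \<in> sheaf_hom X M N\<rbrakk> \<Longrightarrow>
       sh_add X M N (sh_add X M N u v) w = sh_add X M N u (sh_add X M N v w)"
    and "\<And>u. u \<in> sheaf_hom X M N \<Longrightarrow> sh_add X M N (sh_zero X M N) u = u"
    and "\<And>u. u \<in> sheaf_hom X M N \<Longrightarrow> \<exists>v\<in>sheaf_hom X M N. sh_add X M N v u = sh_zero X M N"
proof -
  fix u assume u: "u \<in> sheaf_hom X M N"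
  note A = module_sheaf_ab[OF N]
  note hom = sh_add_hom[OF M N] sh_zero_hom[OF M N] sh_uminus_hom[OF M N u]
  show "sh_add X M N (sh_zero X M N) u = u" using u abelian_groupE(5)[OF A] sheaf_homD(2)[OF u]
    by (intro sheaf_hom_eqI[of _ X M N] hom) (simp_all add: sh_add_apply sh_zero_apply)
  show "\<exists>v\<in>sheaf_hom X M N. sh_add X M N v u = sh_zero X M N"
    using u abelian_group.l_neg[OF A] sheaf_homD(2)[OF u]
    by (intro bexI[OF _ hom(3)] sheaf_hom_eqI[of _ X M N] hom) (simp_all add: sh_add_apply sh_zero_apply)
  fix v assume v: "v \<in> sheaf_hom X M N"
  show "sh_add X M N u v = sh_add X M N v u"
    using u v sheaf_homD(2)[OF u] sheaf_homD(2)[OF v] abelian_groupE(4)[OF A]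
    by (intro sheaf_hom_eqI[of _ X M N] hom) (simp_all add: sh_add_apply)
  fix w assume w: "w \<in> sheaf_hom X M N"
  show "sh_add X M N (sh_add X M N u v) w = sh_add X M N u (sh_add X M N v w)"
    using u v w sheaf_homD(2)[OF u] sheaf_homD(2)[OF v] sheaf_homD(2)[OF w] abelian_groupE(3)[OF A]
    by (intro sheaf_hom_eqI[of _ X M N] hom) (simp_all add: sh_add_apply)
qed

text \<open>\<open>sh_inv\<close> is defined through \<open>inv_into\<close>, without regard to
  bijectivity. A two-sided inverse among the homomorphisms identifies it, including the default
  value \<open>undefined\<close> outside the domain.\<close>

lemma sh_inv_eq:
  assumes u: "u \<in> sheaf_hom X M N" and v: "v \<in> sheaf_hom X N M"
    and vu: "\<And>W s. opn X W \<Longrightarrow> s \<in> secs M W \<Longrightarrow> v W (u W s) = s"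
    and uv: "\<And>W t. opn X W \<Longrightarrow> t \<in> secs N W \<Longrightarrow> u W (v W t) = t"
  shows "sh_inv X M N u = v"
proof -
  have P: "v \<in> (\<Pi>\<^sub>E W\<in>{W. opn X W}. secs N W \<rightarrow>\<^sub>E secs M W)" using v unfolding sheaf_hom_def by simp
  have inv: "inv_into (secs M W) (u W) t = v W t" if W: "opn X W" and t: "t \<in> secs N W" for W t
  proof (rule inv_into_f_eq)
    show "inj_on (u W) (secs M W)" by (rule inj_on_inverseI[of _ "v W"]) (rule vu[OF W])
  qed (use sheaf_homD(2)[OF v W t] uv[OF W t] in simp_all)
  show ?thesis
  proof (rule ext)
    fix W show "sh_inv X M N u W = v W"
    proof (cases "opn X W")
      case True
      have "v W \<in> secs N W \<rightarrow>\<^sub>E secs M W" using PiE_mem[OF P] True by simp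
      then have "v W t = undefined" if "t \<notin> secs N W" for t using that by (rule PiE_arb)
      then show ?thesis using True inv by (auto simp: sh_inv_def fun_eq_iff restrict_def)
    next
      case False
      then show ?thesis using PiE_arb[OF P, of W] by (simp add: sh_inv_def)
    qed
  qed
qed

section \<open>Functoriality of the pullback\<close>

lemma pullback_mod: "pullback X Y f M \<Longrightarrow> module_sheaf X (pull f M)" by (rule pullback.pull_module_sheaf)

lemma pullbackD:
  assumes "pullback X Y f M"
  shows "ringed_space X" "ringed_space Y" "rs_morphism X Y f" "module_sheaf Y M"
proof -
  interpret pullback X Y f M by fact
  show "ringed_space X" "ringed_space Y" "rs_morphism X Y f" "module_sheaf Y M" by (rule X Y f M)+
qed

lemma pullbackI: "\<lbrakk>ringed_space X; ringed_space Y; rs_morphism X Y f; module_sheaf Y M\<rbrakk> \<Longrightarrow> pullback X Y f M"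
  by (simp add: pullback_def rs_map_def pullback_axioms_def)

lemma pull_sec_closed: "\<lbrakk>pullback X Y f M; opn Y V; m \<in> secs M V\<rbrakk> \<Longrightarrow>
     pull_sec f M V m \<in> secs (pull f M) (preim f V)"
  using pullback.pull_sec_section by (simp add: pullback.pull_simps)

text \<open>The functoriality, naturality and cocycle rules of this section are all proved by this
  comparison on the sections 1 \<otimes> m.\<close>

lemma hom_from_pull_eqI:
  assumes p: "pullback X Y f M" and N: "module_sheaf X N"
    and u: "u \<in> sheaf_hom X (pull f M) N" and v: "v \<in> sheaf_hom X (pull f M) N"
    and gen: "\<And>V m. opn Y V \<Longrightarrow> m \<in> secs M V \<Longrightarrow>
        u (preim f V) (pull_sec f M V m) = v (preim f V) (pull_sec f M V m)"
  shows "u = v"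
proof (rule sheaf_hom_eqI[OF u v])
  interpret pullback X Y f M by fact
  fix W s assume W: "opn X W" and s: "s \<in> secs (pull f M) W"
  show "u W s = v W s"
    by (rule f_map_ext[OF X rs_morphism_id[OF X] N sheaf_hom_f_map[OF u] sheaf_hom_f_map[OF v] gen W
          s[unfolded pull_simps]])
qed

lemma
  assumes p: "pullback X Y f M" and N: "module_sheaf Y N" and u: "u \<in> sheaf_hom Y M N"
  shows pull_map_hom: "pull_map f M N u \<in> sheaf_hom X (pull f M) (pull f N)"
    and pull_map_pull_sec: "\<And>V m. opn Y V \<Longrightarrow> m \<in> secs M V \<Longrightarrow>
      pull_map f M N u (preim f V) (pull_sec f M V m) = pull_sec f N V (u V m)"
proof -
  interpret pullback X Y f M by fact
  have eq: "pull_map f M N u = induced_map f N (\<lambda>V. V) u" by (simp add: pull_map_def induced_map_def)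
  note I = induced_map_hom[OF Y f rs_morphism_id[OF Y] rs_comp_id_left[OF X Y f, symmetric] N sheaf_hom_f_map[OF u], of "\<lambda>V. V"]
    induced_map_pull_sec[OF Y f rs_morphism_id[OF Y] rs_comp_id_left[OF X Y f, symmetric] N sheaf_hom_f_map[OF u], of "\<lambda>V. V"]
  show "pull_map f M N u \<in> sheaf_hom X (pull f M) (pull f N)" unfolding eq by (rule I(1)) (simp add: preim_rs_id)
  show "pull_map f M N u (preim f V) (pull_sec f M V m) = pull_sec f N V (u V m)"
    if "opn Y V" "m \<in> secs M V" for V m unfolding eq using I(2) that by (simp add: preim_rs_id)
qed

lemma pull_map_comp:
  assumes p: "pullback X Y f M" and N: "module_sheaf Y N" and P: "module_sheaf Y P"
    and u: "u \<in> sheaf_hom Y M N" and v: "v \<in> sheaf_hom Y N P"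
  shows "pull_map f M P (sh_comp Y M v u) = sh_comp X (pull f M) (pull_map f N P v) (pull_map f M N u)"
proof -
  note pd = pullbackD[OF p]
  have pN: "pullback X Y f N" and pP: "pullback X Y f P" using pd N P by (simp_all add: pullbackI)
  note vu = sh_comp_hom[OF pd(4) u v]
  show ?thesis
  proof (rule hom_from_pull_eqI[OF p pullback_mod[OF pP] pull_map_hom[OF p P vu]
        sh_comp_hom[OF pullback_mod[OF p] pull_map_hom[OF p N u] pull_map_hom[OF pN P v]]])
    fix V m assume V: "opn Y V" and m: "m \<in> secs M V"
    then show "pull_map f M P (sh_comp Y M v u) (preim f V) (pull_sec f M V m) =
        sh_comp X (pull f M) (pull_map f N P v) (pull_map f M N u) (preim f V) (pull_sec f M V m)"
      using pull_map_pull_sec[OF p P vu V m] pull_map_pull_sec[OF p N u V m]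
        pull_map_pull_sec[OF pN P v V sheaf_homD(2)[OF u V m]]
      by (simp add: sh_comp_apply preim_open[OF pd(3)] pull_sec_closed[OF p])
  qed
qed

lemma pull_map_id:
  assumes p: "pullback X Y f M"
  shows "pull_map f M M (sh_id Y M) = sh_id X (pull f M)"
proof -
  note pd = pullbackD[OF p]
  show ?thesis
    by (rule hom_from_pull_eqI[OF p pullback_mod[OF p] pull_map_hom[OF p pd(4) sh_id_hom[OF pd(4)]] sh_id_hom[OF pullback_mod[OF p]]])
       (simp add: pull_map_pull_sec[OF p pd(4) sh_id_hom[OF pd(4)]] sh_id_apply preim_open[OF pd(3)] pull_sec_closed[OF p])
qed

lemma pull_map_add:
  assumes p: "pullback X Y f M" and N: "module_sheaf Y N"
    and u: "u \<in> sheaf_hom Y M N" and v: "v \<in> sheaf_hom Y M N"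
  shows "pull_map f M N (sh_add Y M N u v) =
    sh_add X (pull f M) (pull f N) (pull_map f M N u) (pull_map f M N v)"
proof -
  note pd = pullbackD[OF p]
  have pN: "pullback X Y f N" using pd N by (simp add: pullbackI)
  note uv = sh_add_hom[OF pd(4) N u v]
  show ?thesis
  proof (rule hom_from_pull_eqI[OF p pullback_mod[OF pN] pull_map_hom[OF p N uv]
       sh_add_hom[OF pullback_mod[OF p] pullback_mod[OF pN] pull_map_hom[OF p N u] pull_map_hom[OF p N v]]])
    fix V m assume V: "opn Y V" and m: "m \<in> secs M V"
    have "add_hom (msec N V) (msec (pull f N) (preim f V)) (pull_sec f N V)"
      using f_mapD(1)[OF pullback.pull_sec_f_map[OF pN]] V pullback.tgt_f[OF pN] by simp
    then show "pull_map f M N (sh_add Y M N u v) (preim f V) (pull_sec f M V m) =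
        sh_add X (pull f M) (pull f N) (pull_map f M N u) (pull_map f M N v) (preim f V) (pull_sec f M V m)"
      using pull_map_pull_sec[OF p N uv V m] pull_map_pull_sec[OF p N u V m] pull_map_pull_sec[OF p N v V m]
        V m sheaf_homD(2)[OF u V m] sheaf_homD(2)[OF v V m]
      by (simp add: sh_add_apply preim_open[OF pd(3)] pull_sec_closed[OF p] add_hom_add)
  qed
qed

lemma pullback_comp: "pullback X Y q (pull f M) \<Longrightarrow> pullback Y Z f M \<Longrightarrow> pullback X Z (f \<cdot> q) M"
  using pullbackD rs_morphism_comp by (metis pullbackI)

lemma
  assumes pq: "pullback X Y q (pull f M)" and pf: "pullback Y Z f M"
  shows pull_comp_hom: "pull_comp q f M \<in> sheaf_hom X (pull (f \<cdot> q) M) (pull q (pull f M))"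
    and pull_comp_pull_sec: "\<And>V m. opn Z V \<Longrightarrow> m \<in> secs M V \<Longrightarrow>
      pull_comp q f M (preim q (preim f V)) (pull_sec (f \<cdot> q) M V m) =
      pull_sec q (pull f M) (preim f V) (pull_sec f M V m)"
proof -
  note dq = pullbackD[OF pq] and df = pullbackD[OF pf]
  interpret P: pullback X Z "f \<cdot> q" M by (rule pullback_comp[OF pq pf])
  have eq: "pull_comp q f M = P.induced_map q (pull f M) (\<lambda>V. preim f V) (pull_sec f M)"
    using rs_morphismD(1,2)[OF dq(3)] by (simp add: pull_comp_def P.induced_map_def)
  note I = P.induced_map_hom[OF dq(2,3) df(3) refl dq(4) pullback.pull_sec_f_map[OF pf] refl]
    P.induced_map_pull_sec[OF dq(2,3) df(3) refl dq(4) pullback.pull_sec_f_map[OF pf] refl]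
  show "pull_comp q f M \<in> sheaf_hom X (pull (f \<cdot> q) M) (pull q (pull f M))" unfolding eq by (rule I(1))
  show "pull_comp q f M (preim q (preim f V)) (pull_sec (f \<cdot> q) M V m) =
      pull_sec q (pull f M) (preim f V) (pull_sec f M V m)" if "opn Z V" "m \<in> secs M V" for V m
    unfolding eq using I(2)[OF that] preim_comp[OF dq(3) df(3)] by simp
qed

abbreviation pull_uncomp :: "('a, 'r, 'b, 's) rs_mor \<Rightarrow> ('b, 's, 'c, 't) rs_mor \<Rightarrow> ('c, 't, 'm) mod_sh \<Rightarrow>
   ('a, ('a, 'r, 'b, ('b, 's, 'c, 'm) pbs) pbs, ('a, 'r, 'c, 'm) pbs) sh_map" where
  "pull_uncomp q f M \<equiv> sh_inv (src q) (pull (f \<cdot> q) M) (pull q (pull f M)) (pull_comp q f M)"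

text \<open>The inverse is obtained from the universal property used twice: the unit of f \<circ> q
  extends to a morphism \<open>w\<close> from f^*M over q, and \<open>w\<close> extends to a
  homomorphism \<open>v\<close> from q^*f^*M over the identity. Both composites with
  \<open>pull_comp\<close> fix the generators, and \<open>sh_inv_eq\<close> identifies
  \<open>v\<close> with \<open>pull_uncomp\<close>.\<close>

lemma
  assumes pq: "pullback X Y q (pull f M)" and pf: "pullback Y Z f M"
  shows pull_uncomp_hom: "pull_uncomp q f M \<in> sheaf_hom X (pull q (pull f M)) (pull (f \<cdot> q) M)"
    and pull_uncomp_comp: "\<And>W s. opn X W \<Longrightarrow> s \<in> secs (pull (f \<cdot> q) M) W \<Longrightarrow>
      pull_uncomp q f M W (pull_comp q f M W s) = s"
    and pull_comp_uncomp: "\<And>W s. opn X W \<Longrightarrow> s \<in> secs (pull q (pull f M)) W \<Longrightarrow>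
      pull_comp q f M W (pull_uncomp q f M W s) = s"
proof -
  note dq = pullbackD[OF pq] and df = pullbackD[OF pf]
  interpret P: pullback X Z "f \<cdot> q" M by (rule pullback_comp[OF pq pf])
  interpret Q: pullback X Y q "pull f M" by (rule pq)
  interpret F: pullback Y Z f M by (rule pf)
  let ?P = "pull (f \<cdot> q) M" and ?Q = "pull q (pull f M)"
  have pp: "preim (f \<cdot> q) V = preim q (preim f V)" for V by (rule preim_comp[OF dq(3) df(3)])
  note mP = P.pull_module_sheaf and mQ = Q.pull_module_sheaf
  have "\<exists>w. f_map q (pull f M) ?P w \<and> (\<forall>V. opn Z V \<longrightarrow> (\<forall>m\<in>secs M V.
       w (preim f V) (pull_sec f M V m) = pull_sec (f \<cdot> q) M V m))"
  proof (rule F.f_map_extend[OF dq(1,3) mP P.pull_sec_f_map])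
    fix w assume "f_map q (pull f M) ?P w" "\<And>V m. opn Z V \<Longrightarrow> m \<in> secs M V \<Longrightarrow>
       w (preim f V) (pull_sec f M V m) = pull_sec (f \<cdot> q) M V m"
    then show ?thesis by (intro exI[of _ w]) simp
  qed
  then obtain w where w: "f_map q (pull f M) ?P w"
    and wg': "\<forall>V. opn Z V \<longrightarrow> (\<forall>m\<in>secs M V. w (preim f V) (pull_sec f M V m) = pull_sec (f \<cdot> q) M V m)"
    by (elim exE conjE)
  have wg: "w (preim f V) (pull_sec f M V m) = pull_sec (f \<cdot> q) M V m" if "opn Z V" "m \<in> secs M V" for V m
    using wg' that by blast
  \<comment> \<open>The extension lemma speaks of composites, so q is written as a composite with
    the identity of X.\<close>
  have w': "f_map (q \<cdot> rs_id X) (pull f M) ?P w" using w rs_comp_id_right[OF dq(1-3)] by simp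
  have "\<exists>v0. f_map (rs_id X) ?Q ?P v0 \<and> (\<forall>W. opn Y W \<longrightarrow> (\<forall>s\<in>secs (pull f M) W.
       v0 (preim q W) (pull_sec q (pull f M) W s) = w W s))"
  proof (rule Q.f_map_extend[OF dq(1) rs_morphism_id[OF dq(1)] mP w'])
    fix v assume "f_map (rs_id X) ?Q ?P v" "\<And>W s. opn Y W \<Longrightarrow> s \<in> secs (pull f M) W \<Longrightarrow>
       v (preim q W) (pull_sec q (pull f M) W s) = w W s"
    then show ?thesis by (intro exI[of _ v]) simp
  qed
  then obtain v0 where v0: "f_map (rs_id X) ?Q ?P v0"
    and v0g: "\<forall>W. opn Y W \<longrightarrow> (\<forall>s\<in>secs (pull f M) W. v0 (preim q W) (pull_sec q (pull f M) W s) = w W s)"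
    by (elim exE conjE)
  define v where "v = (\<lambda>W\<in>{W. opn X W}. \<lambda>s\<in>secs ?Q W. v0 W s)"
  have v: "v \<in> sheaf_hom X ?Q ?P" unfolding v_def by (rule f_map_sheaf_hom[OF mQ v0])
  have vg: "v (preim q W) (pull_sec q (pull f M) W s) = w W s" if "opn Y W" "s \<in> secs (pull f M) W" for W s
    using that preim_open[OF dq(3)] pull_sec_closed[OF pq] v0g by (simp add: v_def)
  note c = pull_comp_hom[OF pq pf] and cg = pull_comp_pull_sec[OF pq pf]
  have cancel: "sh_comp X ?P v (pull_comp q f M) = sh_id X ?P"
  proof (rule hom_from_pull_eqI[OF P.pullback_axioms mP sh_comp_hom[OF mP c v] sh_id_hom[OF mP]])
    fix V m assume V: "opn Z V" and m: "m \<in> secs M V"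
    note oV = preim_open[OF df(3) V]
    have ps: "pull_sec (f \<cdot> q) M V m \<in> secs ?P (preim q (preim f V))"
      using pull_sec_closed[OF P.pullback_axioms V m] pp by simp
    show "sh_comp X ?P v (pull_comp q f M) (preim (f \<cdot> q) V) (pull_sec (f \<cdot> q) M V m) =
        sh_id X ?P (preim (f \<cdot> q) V) (pull_sec (f \<cdot> q) M V m)"
      unfolding pp using ps oV preim_open[OF dq(3) oV] cg[OF V m] vg[OF oV pull_sec_closed[OF pf V m]] wg[OF V m]
      by (simp add: sh_comp_apply sh_id_apply)
  qed
  have vc: "v W (pull_comp q f M W s) = s" if "opn X W" "s \<in> secs ?P W" for W s
    using fun_cong[OF fun_cong[OF cancel], of W s] that by (simp add: sh_comp_apply sh_id_apply)
  \<comment> \<open>The generators of q^*f^*M are 1 \<otimes> s for all sections s of f^*M, not only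
    for s = 1 \<otimes> m; uniqueness over q reduces a general s to that case.\<close>
  have cw: "pull_comp q f M (preim q W) (w W s) = pull_sec q (pull f M) W s"
    if W: "opn Y W" and s: "s \<in> secs (pull f M) W" for W s
  proof (rule F.f_map_ext[OF dq(1,3) mQ, of "\<lambda>W s. pull_comp q f M (preim q W) (w W s)" "pull_sec q (pull f M)"])
    have "f_map (q \<cdot> rs_id X) (pull f M) ?Q (\<lambda>W s. pull_comp q f M (preim q W) (w W s))"
      by (rule f_map_comp[OF rs_morphism_id[OF dq(1)] dq(3) w sheaf_hom_f_map[OF c]])
    then show "f_map q (pull f M) ?Q (\<lambda>W s. pull_comp q f M (preim q W) (w W s))"
      using rs_comp_id_right[OF dq(1-3)] by simp
    fix V m assume "opn Z V" "m \<in> secs M V"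
    then show "pull_comp q f M (preim q (preim f V)) (w (preim f V) (pull_sec f M V m)) =
        pull_sec q (pull f M) (preim f V) (pull_sec f M V m)" by (simp add: wg cg)
  qed (use W s Q.pull_sec_f_map F.pull_simps in simp_all)
  have cancel: "sh_comp X ?Q (pull_comp q f M) v = sh_id X ?Q"
  proof (rule hom_from_pull_eqI[OF pq mQ sh_comp_hom[OF mQ v c] sh_id_hom[OF mQ]])
    fix W s assume W: "opn Y W" and s: "s \<in> secs (pull f M) W"
    then show "sh_comp X ?Q (pull_comp q f M) v (preim q W) (pull_sec q (pull f M) W s) =
        sh_id X ?Q (preim q W) (pull_sec q (pull f M) W s)"
      using cw[OF W s] vg[OF W s] pull_sec_closed[OF pq W s] preim_open[OF dq(3) W]
      by (simp add: sh_comp_apply sh_id_apply)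
  qed
  have cv: "pull_comp q f M W (v W s) = s" if "opn X W" "s \<in> secs ?Q W" for W s
    using fun_cong[OF fun_cong[OF cancel], of W s] that by (simp add: sh_comp_apply sh_id_apply)
  have eq: "pull_uncomp q f M = v" unfolding Q.src_f by (rule sh_inv_eq[OF c v]) (simp_all add: vc cv)
  show "pull_uncomp q f M \<in> sheaf_hom X ?Q ?P" unfolding eq by (rule v)
  show "pull_uncomp q f M W (pull_comp q f M W s) = s" if "opn X W" "s \<in> secs ?P W" for W s
    unfolding eq by (rule vc[OF that])
  show "pull_comp q f M W (pull_uncomp q f M W s) = s" if "opn X W" "s \<in> secs ?Q W" for W s
    unfolding eq by (rule cv[OF that])
qed

text \<open>Both sides send 1 \<otimes> m to 1 \<otimes> (1 \<otimes> u(m)).\<close>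

lemma pull_comp_natural:
  assumes pq: "pullback X Y q (pull f M)" and pf: "pullback Y Z f M" and N: "module_sheaf Z N"
    and u: "u \<in> sheaf_hom Z M N" and W: "opn X W" and s: "s \<in> secs (pull (f \<cdot> q) M) W"
  shows "pull_comp q f N W (pull_map (f \<cdot> q) M N u W s) =
    pull_map q (pull f M) (pull f N) (pull_map f M N u) W (pull_comp q f M W s)"
proof -
  note dq = pullbackD[OF pq] and df = pullbackD[OF pf]
  have pfN: "pullback Y Z f N" by (rule pullbackI[OF df(1-3) N])
  have pqN: "pullback X Y q (pull f N)" by (rule pullbackI[OF dq(1-3) pullback_mod[OF pfN]])
  note pP = pullback_comp[OF pq pf] and pPN = pullback_comp[OF pqN pfN]
  note mP = pullback_mod[OF pP]
  note a = pull_map_hom[OF pP N u] and b = pull_map_hom[OF pf N u] and c = pull_comp_hom[OF pq pf] and d = pull_comp_hom[OF pqN pfN]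
  note e = pull_map_hom[OF pq pullback_mod[OF pfN] b]
  have pp: "preim (f \<cdot> q) V = preim q (preim f V)" for V by (rule preim_comp[OF dq(3) df(3)])
  have "sh_comp X (pull (f \<cdot> q) M) (pull_comp q f N) (pull_map (f \<cdot> q) M N u) =
    sh_comp X (pull (f \<cdot> q) M) (pull_map q (pull f M) (pull f N) (pull_map f M N u)) (pull_comp q f M)"
  proof (rule hom_from_pull_eqI[OF pP pullback_mod[OF pqN] sh_comp_hom[OF mP a d] sh_comp_hom[OF mP c e]])
    fix V m assume V: "opn Z V" and m: "m \<in> secs M V"
    note oV = preim_open[OF df(3) V]
    note ps = pull_sec_closed[OF pP V m, unfolded pp] and um = sheaf_homD(2)[OF u V m]
    show "sh_comp X (pull (f \<cdot> q) M) (pull_comp q f N) (pull_map (f \<cdot> q) M N u) (preim (f \<cdot> q) V) (pull_sec (f \<cdot> q) M V m) =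
      sh_comp X (pull (f \<cdot> q) M) (pull_map q (pull f M) (pull f N) (pull_map f M N u)) (pull_comp q f M) (preim (f \<cdot> q) V) (pull_sec (f \<cdot> q) M V m)"
      unfolding pp using ps preim_open[OF dq(3) oV] pull_map_pull_sec[OF pP N u V m, unfolded pp]
        pull_comp_pull_sec[OF pq pf V m] pull_comp_pull_sec[OF pqN pfN V um] pull_map_pull_sec[OF pf N u V m]
        pull_map_pull_sec[OF pq pullback_mod[OF pfN] b oV pull_sec_closed[OF pf V m]]
      by (simp add: sh_comp_apply)
  qed
  from fun_cong[OF fun_cong[OF this], of W s] show ?thesis using W s by (simp add: sh_comp_apply)
qed

text \<open>Both sides send 1 \<otimes> m to 1 \<otimes> (1 \<otimes> (1 \<otimes> m)). Composition
  of morphisms is strictly associative, so the triple composite has a single pullback and no further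
  isomorphism is involved.\<close>

lemma pull_comp_cocycle:
  assumes p1: "pullback W X q' (pull q (pull t M))" and p2: "pullback X Y q (pull t M)" and p3: "pullback Y Z t M"
    and G: "opn W G" and s: "s \<in> secs (pull (t \<cdot> (q \<cdot> q')) M) G"
  shows "pull_comp q' q (pull t M) G (pull_comp (q \<cdot> q') t M G s) =
    pull_map q' (pull (t \<cdot> q) M) (pull q (pull t M)) (pull_comp q t M) G (pull_comp q' (t \<cdot> q) M G s)"
proof -
  note d1 = pullbackD[OF p1] and d2 = pullbackD[OF p2] and d3 = pullbackD[OF p3]
  have as: "(t \<cdot> q) \<cdot> q' = t \<cdot> (q \<cdot> q')" by (rule rs_comp_assoc[OF d1(1) d2(1) d3(1) d3(2) d1(3) d2(3) d3(3)])
  note p23 = pullback_comp[OF p2 p3]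
  have p1': "pullback W X q' (pull (t \<cdot> q) M)" by (rule pullbackI[OF d1(1-3) pullback_mod[OF p23]])
  note p12 = pullback_comp[OF p1 p2]
  have p123: "pullback W Z (t \<cdot> (q \<cdot> q')) M" using pullback_comp[OF p1' p23] as by simp
  note c12 = pull_comp_hom[OF p1 p2] and c12_3 = pull_comp_hom[OF p12 p3] and c23 = pull_comp_hom[OF p2 p3]
  have c1_23: "pull_comp q' (t \<cdot> q) M \<in> sheaf_hom W (pull (t \<cdot> (q \<cdot> q')) M) (pull q' (pull (t \<cdot> q) M))"
    using pull_comp_hom[OF p1' p23] as by simp
  note m = pull_map_hom[OF p1' d1(4) c23]
  note mP = pullback_mod[OF p123]
  have pp: "preim (t \<cdot> (q \<cdot> q')) V = preim q' (preim q (preim t V))" "preim (t \<cdot> q) V = preim q (preim t V)"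
    "preim (q \<cdot> q') V' = preim q' (preim q V')" for V V'
    using preim_comp[OF d2(3) d3(3)] preim_comp[OF d1(3) d2(3)] preim_comp[OF pullbackD(3)[OF p12] d3(3)] by simp_all
  have "sh_comp W (pull (t \<cdot> (q \<cdot> q')) M) (pull_comp q' q (pull t M)) (pull_comp (q \<cdot> q') t M) =
    sh_comp W (pull (t \<cdot> (q \<cdot> q')) M) (pull_map q' (pull (t \<cdot> q) M) (pull q (pull t M)) (pull_comp q t M)) (pull_comp q' (t \<cdot> q) M)"
  proof (rule hom_from_pull_eqI[OF p123 pullback_mod[OF p1] sh_comp_hom[OF mP c12_3 c12] sh_comp_hom[OF mP c1_23 m]])
    fix V m assume V: "opn Z V" and m: "m \<in> secs M V"
    note o1 = preim_open[OF d3(3) V] note o2 = preim_open[OF d2(3) o1] note o3 = preim_open[OF d1(3) o2]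
    note ps = pull_sec_closed[OF p123 V m, unfolded pp]
    have "pull_comp q' (t \<cdot> q) M (preim q' (preim q (preim t V))) (pull_sec (t \<cdot> (q \<cdot> q')) M V m) =
        pull_sec q' (pull (t \<cdot> q) M) (preim q (preim t V)) (pull_sec (t \<cdot> q) M V m)"
      using pull_comp_pull_sec[OF p1' p23 V m] as pp by simp
    moreover have "pull_map q' (pull (t \<cdot> q) M) (pull q (pull t M)) (pull_comp q t M) (preim q' (preim q (preim t V)))
        (pull_sec q' (pull (t \<cdot> q) M) (preim q (preim t V)) (pull_sec (t \<cdot> q) M V m)) =
        pull_sec q' (pull q (pull t M)) (preim q (preim t V)) (pull_sec q (pull t M) (preim t V) (pull_sec t M V m))"
      using pull_map_pull_sec[OF p1' d1(4) c23 o2, of "pull_sec (t \<cdot> q) M V m"] pull_sec_closed[OF p23 V m] pp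
        pull_comp_pull_sec[OF p2 p3 V m] by simp
    moreover have "pull_comp q' q (pull t M) (preim q' (preim q (preim t V)))
       (pull_comp (q \<cdot> q') t M (preim q' (preim q (preim t V))) (pull_sec (t \<cdot> (q \<cdot> q')) M V m)) =
        pull_sec q' (pull q (pull t M)) (preim q (preim t V)) (pull_sec q (pull t M) (preim t V) (pull_sec t M V m))"
      using pull_comp_pull_sec[OF p12 p3 V m] pp pull_comp_pull_sec[OF p1 p2 o1 pull_sec_closed[OF p3 V m]] by simp
    ultimately show "sh_comp W (pull (t \<cdot> (q \<cdot> q')) M) (pull_comp q' q (pull t M)) (pull_comp (q \<cdot> q') t M)
        (preim (t \<cdot> (q \<cdot> q')) V) (pull_sec (t \<cdot> (q \<cdot> q')) M V m) =
      sh_comp W (pull (t \<cdot> (q \<cdot> q')) M) (pull_map q' (pull (t \<cdot> q) M) (pull q (pull t M)) (pull_comp q t M)) (pull_comp q' (t \<cdot> q) M)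
        (preim (t \<cdot> (q \<cdot> q')) V) (pull_sec (t \<cdot> (q \<cdot> q')) M V m)"
      unfolding pp using ps o3 by (simp add: sh_comp_apply)
  qed
  from fun_cong[OF fun_cong[OF this], of G s] show ?thesis using G s by (simp add: sh_comp_apply)
qed

section \<open>Pullback through the canonical isomorphisms\<close>

lemma rs_mapD: "rs_map X Y f \<Longrightarrow> ringed_space X" "rs_map X Y f \<Longrightarrow> ringed_space Y" "rs_map X Y f \<Longrightarrow> rs_morphism X Y f"
  by (simp_all add: rs_map_def)

lemma rs_map_comp: "rs_map X Y f \<Longrightarrow> rs_map Y Z g \<Longrightarrow> rs_map X Z (g \<cdot> f)"
  using rs_morphism_comp unfolding rs_map_def by blast

lemma rs_map_id: "ringed_space X \<Longrightarrow> rs_map X X (rs_id X)" by (simp add: rs_map_def rs_morphism_id)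

lemma rs_map_assoc: "\<lbrakk>rs_map W X f; rs_map X Y g; rs_map Y Z h\<rbrakk> \<Longrightarrow> (h \<cdot> g) \<cdot> f = h \<cdot> (g \<cdot> f)"
  using rs_comp_assoc unfolding rs_map_def by blast

lemma rs_map_id_right: "rs_map X Y f \<Longrightarrow> f \<cdot> rs_id X = f" using rs_comp_id_right unfolding rs_map_def by blast

lemma rs_map_id_left: "rs_map X Y f \<Longrightarrow> rs_id Y \<cdot> f = f" using rs_comp_id_left unfolding rs_map_def by blast

lemma rs_map_src: "rs_map X Y f \<Longrightarrow> src f = X" using rs_mapD(3) rs_morphismD(1) by blast

lemma pullback_of: "rs_map X Y f \<Longrightarrow> module_sheaf Y M \<Longrightarrow> pullback X Y f M"
  by (simp add: pullback_def pullback_axioms_def)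

lemma pull_module: "rs_map X Y f \<Longrightarrow> module_sheaf Y M \<Longrightarrow> module_sheaf X (pull f M)"
  by (rule pullback_mod[OF pullback_of])

definition pull_along where "pull_along q t r M N u = sh_comp (src q) (pull (t \<cdot> q) M) (pull_uncomp q r N)
       (sh_comp (src q) (pull (t \<cdot> q) M) (pull_map q (pull t M) (pull r N) u) (pull_comp q t M))"

lemma gr_pull_map_eq: "gr_pull_map q t r E F d u = (\<lambda>n. pull_along q t r (E n) (F (n + d)) (u n))"
  by (simp add: gr_pull_map_def pull_along_def)

context
  fixes X :: "('a, 'r) ringed_sp" and Y :: "('b, 's) ringed_sp" and Z :: "('c, 't) ringed_sp" and q
  assumes q: "rs_map X Y q"
begin

lemma pull_comp_closed:
  assumes "rs_map Y Z t" "module_sheaf Z M" "opn X W" "s \<in> secs (pull (t \<cdot> q) M) W"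
  shows "pull_comp q t M W s \<in> secs (pull q (pull t M)) W"
  using sheaf_homD(2)[OF pull_comp_hom[OF pullback_of[OF q pull_module] pullback_of]] assms by blast

lemma pull_uncomp_closed:
  assumes "rs_map Y Z t" "module_sheaf Z M" "opn X W" "s \<in> secs (pull q (pull t M)) W"
  shows "pull_uncomp q t M W s \<in> secs (pull (t \<cdot> q) M) W"
  using sheaf_homD(2)[OF pull_uncomp_hom[OF pullback_of[OF q pull_module] pullback_of]] assms by blast

lemma pull_comp_inj:
  assumes "rs_map Y Z t" "module_sheaf Z M" "opn X W"
    "x \<in> secs (pull (t \<cdot> q) M) W" "y \<in> secs (pull (t \<cdot> q) M) W" "pull_comp q t M W x = pull_comp q t M W y"
  shows "x = y"
  using pull_uncomp_comp[OF pullback_of[OF q pull_module[OF assms(1,2)]] pullback_of[OF assms(1,2)] assms(3)] assms(4-6)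
  by metis

lemma pull_along_hom:
  assumes t: "rs_map Y Z t" and r: "rs_map Y Z r" and M: "module_sheaf Z M" and N: "module_sheaf Z N"
    and u: "u \<in> sheaf_hom Y (pull t M) (pull r N)"
  shows "pull_along q t r M N u \<in> sheaf_hom X (pull (t \<cdot> q) M) (pull (r \<cdot> q) N)"
  unfolding pull_along_def rs_map_src[OF q]
  by (rule sh_comp_hom[OF pull_module[OF rs_map_comp[OF q t] M]
        sh_comp_hom[OF pull_module[OF rs_map_comp[OF q t] M]
          pull_comp_hom[OF pullback_of[OF q pull_module[OF t M]] pullback_of[OF t M]]
          pull_map_hom[OF pullback_of[OF q pull_module[OF t M]] pull_module[OF r N] u]]
        pull_uncomp_hom[OF pullback_of[OF q pull_module[OF r N]] pullback_of[OF r N], unfolded rs_map_src[OF q]]])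

lemma pull_comp_pull_along:
  assumes t: "rs_map Y Z t" and r: "rs_map Y Z r" and M: "module_sheaf Z M" and N: "module_sheaf Z N"
    and u: "u \<in> sheaf_hom Y (pull t M) (pull r N)"
    and W: "opn X W" and s: "s \<in> secs (pull (t \<cdot> q) M) W"
  shows "pull_comp q r N W (pull_along q t r M N u W s) =
    pull_map q (pull t M) (pull r N) u W (pull_comp q t M W s)"
proof -
  note pt = pullback_of[OF q pull_module[OF t M]] and pr = pullback_of[OF q pull_module[OF r N]]
  have "pull_map q (pull t M) (pull r N) u W (pull_comp q t M W s) \<in> secs (pull q (pull r N)) W"
    by (rule sheaf_homD(2)[OF pull_map_hom[OF pt pull_module[OF r N] u] W pull_comp_closed[OF t M W s]])
  then show ?thesis using pull_comp_uncomp[OF pr pullback_of[OF r N] W] s W rs_map_src[OF q]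
    by (simp add: pull_along_def sh_comp_apply)
qed

text \<open>Since \<open>pull_comp\<close> is injective, a map is the pullback of u as soon as its
  square with the two maps \<open>pull_comp\<close> commutes. In this way the inverse isomorphism
  inside \<open>pull_along\<close> stays out of the later arguments.\<close>

lemma pull_along_eqI:
  assumes t: "rs_map Y Z t" and r: "rs_map Y Z r" and M: "module_sheaf Z M" and N: "module_sheaf Z N"
    and u: "u \<in> sheaf_hom Y (pull t M) (pull r N)"
    and v: "v \<in> sheaf_hom X (pull (t \<cdot> q) M) (pull (r \<cdot> q) N)"
    and eq: "\<And>W s. opn X W \<Longrightarrow> s \<in> secs (pull (t \<cdot> q) M) W \<Longrightarrow>
      pull_comp q r N W (v W s) = pull_map q (pull t M) (pull r N) u W (pull_comp q t M W s)"
  shows "pull_along q t r M N u = v"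
proof (rule sheaf_hom_eqI[OF pull_along_hom[OF t r M N u] v])
  fix W s assume W: "opn X W" and s: "s \<in> secs (pull (t \<cdot> q) M) W"
  show "pull_along q t r M N u W s = v W s"
    by (rule pull_comp_inj[OF r N W sheaf_homD(2)[OF pull_along_hom[OF t r M N u] W s] sheaf_homD(2)[OF v W s]])
       (simp add: pull_comp_pull_along[OF t r M N u W s] eq[OF W s])
qed

lemma pull_along_add:
  assumes t: "rs_map Y Z t" and r: "rs_map Y Z r" and M: "module_sheaf Z M" and N: "module_sheaf Z N"
    and u: "u \<in> sheaf_hom Y (pull t M) (pull r N)" and v: "v \<in> sheaf_hom Y (pull t M) (pull r N)"
  shows "pull_along q t r M N (sh_add Y (pull t M) (pull r N) u v) =
    sh_add X (pull (t \<cdot> q) M) (pull (r \<cdot> q) N) (pull_along q t r M N u) (pull_along q t r M N v)"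
proof (rule pull_along_eqI[OF t r M N])
  note mt = pull_module[OF t M] and mr = pull_module[OF r N]
  note pt = pullback_of[OF q mt] and pr = pullback_of[OF q mr]
  note mtq = pull_module[OF rs_map_comp[OF q t] M] and mrq = pull_module[OF rs_map_comp[OF q r] N]
  note hu = pull_along_hom[OF t r M N u] and hv = pull_along_hom[OF t r M N v]
  show "sh_add Y (pull t M) (pull r N) u v \<in> sheaf_hom Y (pull t M) (pull r N)" by (rule sh_add_hom[OF mt mr u v])
  show "sh_add X (pull (t \<cdot> q) M) (pull (r \<cdot> q) N) (pull_along q t r M N u) (pull_along q t r M N v)
     \<in> sheaf_hom X (pull (t \<cdot> q) M) (pull (r \<cdot> q) N)" by (rule sh_add_hom[OF mtq mrq hu hv])
  fix W s assume W: "opn X W" and s: "s \<in> secs (pull (t \<cdot> q) M) W"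
  have c: "add_hom (msec (pull (r \<cdot> q) N) W) (msec (pull q (pull r N)) W) (pull_comp q r N W)"
    by (rule sheaf_homD(1)[OF pull_comp_hom[OF pr pullback_of[OF r N]] W])
  show "pull_comp q r N W (sh_add X (pull (t \<cdot> q) M) (pull (r \<cdot> q) N) (pull_along q t r M N u) (pull_along q t r M N v) W s) =
    pull_map q (pull t M) (pull r N) (sh_add Y (pull t M) (pull r N) u v) W (pull_comp q t M W s)"
    using W s pull_comp_closed[OF t M W s] sheaf_homD(2)[OF hu W s] sheaf_homD(2)[OF hv W s]
    by (simp add: pull_map_add[OF pt mr u v] sh_add_apply add_hom_add[OF c]
        pull_comp_pull_along[OF t r M N u W s] pull_comp_pull_along[OF t r M N v W s])
qed

lemma pull_along_comp:
  assumes t: "rs_map Y Z t" and r: "rs_map Y Z r" and w: "rs_map Y Z w"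
    and M: "module_sheaf Z M" and N: "module_sheaf Z N" and P: "module_sheaf Z P"
    and u: "u \<in> sheaf_hom Y (pull t M) (pull r N)" and v: "v \<in> sheaf_hom Y (pull r N) (pull w P)"
  shows "pull_along q t w M P (sh_comp Y (pull t M) v u) =
    sh_comp X (pull (t \<cdot> q) M) (pull_along q r w N P v) (pull_along q t r M N u)"
proof (rule pull_along_eqI[OF t w M P])
  note mt = pull_module[OF t M] and mr = pull_module[OF r N] and mw = pull_module[OF w P]
  note mtq = pull_module[OF rs_map_comp[OF q t] M]
  note pt = pullback_of[OF q mt]
  note hu = pull_along_hom[OF t r M N u] and hv = pull_along_hom[OF r w N P v]
  show "sh_comp Y (pull t M) v u \<in> sheaf_hom Y (pull t M) (pull w P)" by (rule sh_comp_hom[OF mt u v])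
  show "sh_comp X (pull (t \<cdot> q) M) (pull_along q r w N P v) (pull_along q t r M N u)
     \<in> sheaf_hom X (pull (t \<cdot> q) M) (pull (w \<cdot> q) P)" by (rule sh_comp_hom[OF mtq hu hv])
  fix W s assume W: "opn X W" and s: "s \<in> secs (pull (t \<cdot> q) M) W"
  show "pull_comp q w P W (sh_comp X (pull (t \<cdot> q) M) (pull_along q r w N P v) (pull_along q t r M N u) W s) =
    pull_map q (pull t M) (pull w P) (sh_comp Y (pull t M) v u) W (pull_comp q t M W s)"
    using W s pull_comp_closed[OF t M W s] sheaf_homD(2)[OF hu W s]
    by (simp add: pull_map_comp[OF pt mr mw u v] sh_comp_apply
        pull_comp_pull_along[OF t r M N u W s] pull_comp_pull_along[OF r w N P v W])
qed

lemma pull_along_id: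
  assumes t: "rs_map Y Z t" and M: "module_sheaf Z M"
  shows "pull_along q t t M M (sh_id Y (pull t M)) = sh_id X (pull (t \<cdot> q) M)"
proof (rule pull_along_eqI[OF t t M M])
  note mt = pull_module[OF t M]
  note mtq = pull_module[OF rs_map_comp[OF q t] M]
  note pt = pullback_of[OF q mt]
  show "sh_id Y (pull t M) \<in> sheaf_hom Y (pull t M) (pull t M)" by (rule sh_id_hom[OF mt])
  show "sh_id X (pull (t \<cdot> q) M) \<in> sheaf_hom X (pull (t \<cdot> q) M) (pull (t \<cdot> q) M)" by (rule sh_id_hom[OF mtq])
  fix W s assume W: "opn X W" and s: "s \<in> secs (pull (t \<cdot> q) M) W"
  show "pull_comp q t M W (sh_id X (pull (t \<cdot> q) M) W s) =
    pull_map q (pull t M) (pull t M) (sh_id Y (pull t M)) W (pull_comp q t M W s)"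
    using W s pull_comp_closed[OF t M W s] by (simp add: pull_map_id[OF pt] sh_id_apply)
qed

end

text \<open>Both sides are compared after passing to q'^*q^*r^*N. The cocycle rule is used once for
  the target and once for the source, and naturality of \<open>pull_comp\<close> turns q'^*q^*u into
  the pullback of u along q \<circ> q'.\<close>

lemma pull_along_pull_along:
  assumes q': "rs_map W X q'" and q: "rs_map X Y q" and t: "rs_map Y Z t" and r: "rs_map Y Z r"
    and M: "module_sheaf Z M" and N: "module_sheaf Z N"
    and u: "u \<in> sheaf_hom Y (pull t M) (pull r N)"
  shows "pull_along q' (t \<cdot> q) (r \<cdot> q) M N (pull_along q t r M N u) = pull_along (q \<cdot> q') t r M N u"
proof (rule sym, rule pull_along_eqI[OF rs_map_comp[OF q' q] t r M N u])
  note qq = rs_map_comp[OF q' q] and tq = rs_map_comp[OF q t] and rq = rs_map_comp[OF q r]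
  note at = rs_map_assoc[OF q' q t] and ar = rs_map_assoc[OF q' q r]
  note mt = pull_module[OF t M] and mr = pull_module[OF r N]
  note mqt = pull_module[OF q mt] and mqr = pull_module[OF q mr]
  note mtq = pull_module[OF tq M] and mrq = pull_module[OF rq N]
  note pt = pullback_of[OF q mt] and pr = pullback_of[OF q mr]
  note pt' = pullback_of[OF q' mqt] and pr' = pullback_of[OF q' mqr]
  note ptq = pullback_of[OF q' mtq] and prq = pullback_of[OF q' mrq]
  note hu = pull_along_hom[OF q t r M N u]
  note hu' = pull_along_hom[OF q' tq rq M N hu]
  note qu = pull_map_hom[OF pt mr u]
  note ct = pull_comp_hom[OF pt pullback_of[OF t M]] and cr = pull_comp_hom[OF pr pullback_of[OF r N]]
  let ?L = "pull_along q' (t \<cdot> q) (r \<cdot> q) M N (pull_along q t r M N u)"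
  show L: "?L \<in> sheaf_hom W (pull (t \<cdot> (q \<cdot> q')) M) (pull (r \<cdot> (q \<cdot> q')) N)" using hu' unfolding at ar .
  fix O' s assume O: "opn W O'" and s: "s \<in> secs (pull (t \<cdot> (q \<cdot> q')) M) O'"
  have s': "s \<in> secs (pull ((t \<cdot> q) \<cdot> q') M) O'" using s unfolding at .
  have Ls: "?L O' s \<in> secs (pull (r \<cdot> (q \<cdot> q')) N) O'" by (rule sheaf_homD(2)[OF L O s])
  note cs = pull_comp_closed[OF q' tq M O s']
  \<comment> \<open>The square characterising \<open>pull_along\<close>, as an equality of
    homomorphisms on X, so that \<open>pull_map q'\<close> can be applied to both sides.\<close>
  have com: "sh_comp X (pull (t \<cdot> q) M) (pull_comp q r N) (pull_along q t r M N u) =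
      sh_comp X (pull (t \<cdot> q) M) (pull_map q (pull t M) (pull r N) u) (pull_comp q t M)"
    by (rule sheaf_hom_eqI[OF sh_comp_hom[OF mtq hu cr] sh_comp_hom[OF mtq ct qu]])
       (simp add: sh_comp_apply pull_comp_pull_along[OF q t r M N u])
  have "pull_map q' (pull (t \<cdot> q) M) (pull (r \<cdot> q) N) (pull_along q t r M N u) O' (pull_comp q' (t \<cdot> q) M O' s)
     \<in> secs (pull q' (pull (r \<cdot> q) N)) O'" by (rule sheaf_homD(2)[OF pull_map_hom[OF ptq mrq hu] O cs])
  have "pull_comp q' q (pull r N) O' (pull_comp (q \<cdot> q') r N O' (?L O' s)) =
      pull_map q' (pull (r \<cdot> q) N) (pull q (pull r N)) (pull_comp q r N) O' (pull_comp q' (r \<cdot> q) N O' (?L O' s))"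
    by (rule pull_comp_cocycle[OF pr' pr pullback_of[OF r N] O Ls])
  also have "\<dots> = pull_map q' (pull (r \<cdot> q) N) (pull q (pull r N)) (pull_comp q r N) O'
      (pull_map q' (pull (t \<cdot> q) M) (pull (r \<cdot> q) N) (pull_along q t r M N u) O' (pull_comp q' (t \<cdot> q) M O' s))"
    by (simp only: pull_comp_pull_along[OF q' tq rq M N hu O s'])
  also have "\<dots> = pull_map q' (pull (t \<cdot> q) M) (pull q (pull r N))
      (sh_comp X (pull (t \<cdot> q) M) (pull_comp q r N) (pull_along q t r M N u)) O' (pull_comp q' (t \<cdot> q) M O' s)"
    by (simp only: pull_map_comp[OF ptq mrq mqr hu cr] sh_comp_apply[OF O cs])
  also have "\<dots> = pull_map q' (pull q (pull t M)) (pull q (pull r N)) (pull_map q (pull t M) (pull r N) u) O'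
      (pull_map q' (pull (t \<cdot> q) M) (pull q (pull t M)) (pull_comp q t M) O' (pull_comp q' (t \<cdot> q) M O' s))"
    by (simp only: com pull_map_comp[OF ptq mqt mqr ct qu] sh_comp_apply[OF O cs])
  also have "\<dots> = pull_map q' (pull q (pull t M)) (pull q (pull r N)) (pull_map q (pull t M) (pull r N) u) O'
      (pull_comp q' q (pull t M) O' (pull_comp (q \<cdot> q') t M O' s))"
    by (simp only: pull_comp_cocycle[OF pt' pt pullback_of[OF t M] O s])
  also have "\<dots> = pull_comp q' q (pull r N) O' (pull_map (q \<cdot> q') (pull t M) (pull r N) u O' (pull_comp (q \<cdot> q') t M O' s))"
    by (rule pull_comp_natural[OF pt' pt mr u O pull_comp_closed[OF qq t M O s], symmetric])
  finally show "pull_comp (q \<cdot> q') r N O' (?L O' s) =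
      pull_map (q \<cdot> q') (pull t M) (pull r N) u O' (pull_comp (q \<cdot> q') t M O' s)"
    by (rule pull_comp_inj[OF q' q mr O pull_comp_closed[OF qq r N O Ls]
          sheaf_homD(2)[OF pull_map_hom[OF pullback_of[OF qq mt] mr u] O pull_comp_closed[OF qq t M O s]]])
qed

text \<open>Splitting off the identity is the unit s \<mapsto> 1 \<otimes> s. Both are morphisms
  over the identity out of t^*M, so the generators 1 \<otimes> m suffice.\<close>

lemma pull_comp_rs_id:
  assumes t: "rs_map Y Z t" and M: "module_sheaf Z M" and W: "opn Y W" and s: "s \<in> secs (pull t M) W"
  shows "pull_comp (rs_id Y) t M W s = pull_sec (rs_id Y) (pull t M) W s"
proof -
  note Y = rs_mapD(1)[OF t] note id = rs_map_id[OF Y] note mt = pull_module[OF t M]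
  note p = pullback_of[OF id mt] and pt = pullback_of[OF t M]
  interpret T: pullback Y Z t M by (rule pt)
  have c: "pull_comp (rs_id Y) t M \<in> sheaf_hom Y (pull t M) (pull (rs_id Y) (pull t M))"
    using pull_comp_hom[OF p pt] rs_map_id_right[OF t] by simp
  show ?thesis
  proof (rule T.f_map_ext[OF Y rs_mapD(3)[OF id] pullback_mod[OF p] sheaf_hom_f_map[OF c] pullback.pull_sec_f_map[OF p] _ W
        s[unfolded T.pull_simps]])
    fix V m assume V: "opn Z V" and m: "m \<in> secs M V"
    show "pull_comp (rs_id Y) t M (preim t V) (pull_sec t M V m) = pull_sec (rs_id Y) (pull t M) (preim t V) (pull_sec t M V m)"
      using pull_comp_pull_sec[OF p pt V m] preim_open[OF rs_mapD(3)[OF t] V] rs_map_id_right[OF t] by (simp add: preim_rs_id)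
  qed
qed

lemma pull_along_rs_id:
  assumes t: "rs_map Y Z t" and r: "rs_map Y Z r" and M: "module_sheaf Z M" and N: "module_sheaf Z N"
    and u: "u \<in> sheaf_hom Y (pull t M) (pull r N)"
  shows "pull_along (rs_id Y) t r M N u = u"
proof (rule pull_along_eqI[OF rs_map_id[OF rs_mapD(1)[OF t]] t r M N u, unfolded rs_map_id_right[OF t] rs_map_id_right[OF r], OF u])
  fix W s assume W: "opn Y W" and s: "s \<in> secs (pull t M) W"
  show "pull_comp (rs_id Y) r N W (u W s) = pull_map (rs_id Y) (pull t M) (pull r N) u W (pull_comp (rs_id Y) t M W s)"
    using pull_map_pull_sec[OF pullback_of[OF rs_map_id[OF rs_mapD(1)[OF t]] pull_module[OF t M]]
        pull_module[OF r N] u W s] W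
    by (simp add: pull_comp_rs_id[OF t M W s] pull_comp_rs_id[OF r N W sheaf_homD(2)[OF u W s]] preim_rs_id)
qed

section \<open>From pullbacks along composites to iterated pullbacks\<close>

definition regard where "regard t r f g M N u = sh_comp (src t) (pull t (pull f M)) (pull_comp r g N)
       (sh_comp (src t) (pull t (pull f M)) u (pull_uncomp t f M))"

lemma gr_regard_eq: "gr_regard t r f g E F d u = (\<lambda>n. regard t r f g (E n) (F (n + d)) (u n))"
  by (simp add: gr_regard_def regard_def)

context
  fixes X :: "('a, 'r) ringed_sp" and Y :: "('b, 's) ringed_sp" and Z :: "('c, 't) ringed_sp" and t r f g
  assumes t: "rs_map X Y t" and r: "rs_map X Y r" and f: "rs_map Y Z f" and g: "rs_map Y Z g"
begin

lemma regard_hom: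
  assumes M: "module_sheaf Z M" and N: "module_sheaf Z N"
    and u: "u \<in> sheaf_hom X (pull (f \<cdot> t) M) (pull (g \<cdot> r) N)"
  shows "regard t r f g M N u \<in> sheaf_hom X (pull t (pull f M)) (pull r (pull g N))"
proof -
  note mf = pull_module[OF f M] and mg = pull_module[OF g N]
  note pt = pullback_of[OF t mf] and pr = pullback_of[OF r mg]
  show ?thesis unfolding regard_def rs_map_src[OF t]
    by (rule sh_comp_hom[OF pullback_mod[OF pt] sh_comp_hom[OF pullback_mod[OF pt]
        pull_uncomp_hom[OF pt pullback_of[OF f M], unfolded rs_map_src[OF t]] u] pull_comp_hom[OF pr pullback_of[OF g N]]])
qed

lemma regard_apply: "opn X W \<Longrightarrow> s \<in> secs (pull t (pull f M)) W \<Longrightarrow>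
    regard t r f g M N u W s = pull_comp r g N W (u W (pull_uncomp t f M W s))"
  by (simp add: regard_def rs_map_src[OF t] sh_comp_apply)

lemma regard_add:
  assumes M: "module_sheaf Z M" and N: "module_sheaf Z N"
    and u: "u \<in> sheaf_hom X (pull (f \<cdot> t) M) (pull (g \<cdot> r) N)" and v: "v \<in> sheaf_hom X (pull (f \<cdot> t) M) (pull (g \<cdot> r) N)"
  shows "regard t r f g M N (sh_add X (pull (f \<cdot> t) M) (pull (g \<cdot> r) N) u v) =
    sh_add X (pull t (pull f M)) (pull r (pull g N)) (regard t r f g M N u) (regard t r f g M N v)"
proof -
  note mf = pull_module[OF f M] and mg = pull_module[OF g N]
  note mtf = pull_module[OF t mf] and mrg = pull_module[OF r mg]
  note mft = pull_module[OF rs_map_comp[OF t f] M] and mgr = pull_module[OF rs_map_comp[OF r g] N]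
  note c = sheaf_homD(1)[OF pull_comp_hom[OF pullback_of[OF r mg] pullback_of[OF g N]]]
  show ?thesis
  proof (rule sheaf_hom_eqI[OF regard_hom[OF M N sh_add_hom[OF mft mgr u v]]
        sh_add_hom[OF mtf mrg regard_hom[OF M N u] regard_hom[OF M N v]]])
    fix W s assume W: "opn X W" and s: "s \<in> secs (pull t (pull f M)) W"
    note us = pull_uncomp_closed[OF t f M W s]
    show "regard t r f g M N (sh_add X (pull (f \<cdot> t) M) (pull (g \<cdot> r) N) u v) W s =
      sh_add X (pull t (pull f M)) (pull r (pull g N)) (regard t r f g M N u) (regard t r f g M N v) W s"
      unfolding sh_add_apply[OF W s] regard_apply[OF W s] sh_add_apply[OF W us]
      by (rule add_hom_add[OF c[OF W] sheaf_homD(2)[OF u W us] sheaf_homD(2)[OF v W us]])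
  qed
qed

end

text \<open>In the middle, \<open>pull_uncomp\<close> of the second map cancels
  \<open>pull_comp\<close> of the first.\<close>

lemma regard_comp:
  assumes t: "rs_map X Y t" and r: "rs_map X Y r" and w: "rs_map X Y w"
    and f: "rs_map Y Z f" and g: "rs_map Y Z g" and k: "rs_map Y Z k"
    and M: "module_sheaf Z M" and N: "module_sheaf Z N" and P: "module_sheaf Z P"
    and u: "u \<in> sheaf_hom X (pull (f \<cdot> t) M) (pull (g \<cdot> r) N)"
    and v: "v \<in> sheaf_hom X (pull (g \<cdot> r) N) (pull (k \<cdot> w) P)"
  shows "regard t w f k M P (sh_comp X (pull (f \<cdot> t) M) v u) =
    sh_comp X (pull t (pull f M)) (regard r w g k N P v) (regard t r f g M N u)"
proof -
  note mf = pull_module[OF f M] and mg = pull_module[OF g N]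
  note mtf = pull_module[OF t mf] and mft = pull_module[OF rs_map_comp[OF t f] M]
  note hu = regard_hom[OF t r f g M N u] and hv = regard_hom[OF r w g k N P v]
  show ?thesis
  proof (rule sheaf_hom_eqI[OF regard_hom[OF t w f k M P sh_comp_hom[OF mft u v]] sh_comp_hom[OF mtf hu hv]])
    fix W s assume W: "opn X W" and s: "s \<in> secs (pull t (pull f M)) W"
    note us = pull_uncomp_closed[OF t f M W s]
    note uus = sheaf_homD(2)[OF u W us]
    have rs: "regard t r f g M N u W s \<in> secs (pull r (pull g N)) W" by (rule sheaf_homD(2)[OF hu W s])
    have "pull_uncomp r g N W (regard t r f g M N u W s) = u W (pull_uncomp t f M W s)"
      unfolding regard_apply[OF t r f g W s]
      by (rule pull_uncomp_comp[OF pullback_of[OF r mg] pullback_of[OF g N] W uus])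
    then show "regard t w f k M P (sh_comp X (pull (f \<cdot> t) M) v u) W s =
        sh_comp X (pull t (pull f M)) (regard r w g k N P v) (regard t r f g M N u) W s"
      unfolding sh_comp_apply[OF W s] regard_apply[OF t w f k W s] regard_apply[OF r w g k W rs] sh_comp_apply[OF W us]
      by simp
  qed
qed

lemma regard_id:
  assumes t: "rs_map X Y t" and f: "rs_map Y Z f" and M: "module_sheaf Z M"
  shows "regard t t f f M M (sh_id X (pull (f \<cdot> t) M)) = sh_id X (pull t (pull f M))"
proof -
  note mf = pull_module[OF f M]
  note mtf = pull_module[OF t mf] and mft = pull_module[OF rs_map_comp[OF t f] M]
  show ?thesis
  proof (rule sheaf_hom_eqI[OF regard_hom[OF t t f f M M sh_id_hom[OF mft]] sh_id_hom[OF mtf]])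
    fix W s assume W: "opn X W" and s: "s \<in> secs (pull t (pull f M)) W"
    show "regard t t f f M M (sh_id X (pull (f \<cdot> t) M)) W s = sh_id X (pull t (pull f M)) W s"
      unfolding sh_id_apply[OF W s] regard_apply[OF t t f f W s] sh_id_apply[OF W pull_uncomp_closed[OF t f M W s]]
      by (rule pull_comp_uncomp[OF pullback_of[OF t mf] pullback_of[OF f M] W s])
  qed
qed

text \<open>A section is first moved to the pullback along the composite by
  \<open>pull_uncomp\<close>. There the claim follows from the cocycle rule at the target and, read
  backwards, at the source.\<close>

lemma pull_along_regard:
  assumes q: "rs_map W X q" and t: "rs_map X Y t" and r: "rs_map X Y r" and f: "rs_map Y Z f" and g: "rs_map Y Z g"
    and M: "module_sheaf Z M" and N: "module_sheaf Z N"
    and u: "u \<in> sheaf_hom X (pull (f \<cdot> t) M) (pull (g \<cdot> r) N)"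
  shows "pull_along q t r (pull f M) (pull g N) (regard t r f g M N u) =
    regard (t \<cdot> q) (r \<cdot> q) f g M N (pull_along q (f \<cdot> t) (g \<cdot> r) M N u)"
proof -
  note mf = pull_module[OF f M] and mg = pull_module[OF g N]
  note tq = rs_map_comp[OF q t] and rq = rs_map_comp[OF q r] and ft = rs_map_comp[OF t f] and gr = rs_map_comp[OF r g]
  note at = rs_map_assoc[OF q t f] and ar = rs_map_assoc[OF q r g]
  note mtf = pull_module[OF t mf] and mrg = pull_module[OF r mg]
  note mft = pull_module[OF ft M] and mgr = pull_module[OF gr N]
  note hu = regard_hom[OF t r f g M N u]
  note pu = pull_along_hom[OF q ft gr M N u]
  have pu': "pull_along q (f \<cdot> t) (g \<cdot> r) M N u \<in> sheaf_hom W (pull (f \<cdot> (t \<cdot> q)) M) (pull (g \<cdot> (r \<cdot> q)) N)"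
    using pu unfolding at ar .
  note pf = pullback_of[OF f M] and pg = pullback_of[OF g N]
  note ptf = pullback_of[OF t mf] and prg = pullback_of[OF r mg]
  note pqtf = pullback_of[OF q mtf] and pqrg = pullback_of[OF q mrg]
  note pqft = pullback_of[OF q mft] and pqgr = pullback_of[OF q mgr]
  note ptqf = pullback_of[OF tq mf]
  note ct = pull_comp_hom[OF ptf pf] and cr = pull_comp_hom[OF prg pg]
  have com: "sh_comp X (pull (f \<cdot> t) M) (regard t r f g M N u) (pull_comp t f M) =
      sh_comp X (pull (f \<cdot> t) M) (pull_comp r g N) u"
  proof (rule sheaf_hom_eqI[OF sh_comp_hom[OF mft ct hu] sh_comp_hom[OF mft u cr]])
    fix V s assume V: "opn X V" and s: "s \<in> secs (pull (f \<cdot> t) M) V"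
    show "sh_comp X (pull (f \<cdot> t) M) (regard t r f g M N u) (pull_comp t f M) V s =
        sh_comp X (pull (f \<cdot> t) M) (pull_comp r g N) u V s"
      unfolding sh_comp_apply[OF V s] regard_apply[OF t r f g V pull_comp_closed[OF t f M V s]]
        pull_uncomp_comp[OF ptf pf V s] ..
  qed
  show ?thesis
  proof (rule pull_along_eqI[OF q t r mf mg hu regard_hom[OF tq rq f g M N pu']])
    fix V s assume V: "opn W V" and s: "s \<in> secs (pull (t \<cdot> q) (pull f M)) V"
    let ?s = "pull_uncomp (t \<cdot> q) f M V s"
    note s1 = pull_uncomp_closed[OF tq f M V s]
    have s2: "?s \<in> secs (pull ((f \<cdot> t) \<cdot> q) M) V" using s1 unfolding at .
    note cs = pull_comp_closed[OF q ft M V s2]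
    have ss: "pull_comp (t \<cdot> q) f M V ?s = s" by (rule pull_comp_uncomp[OF ptqf pf V s])
    let ?v = "pull_along q (f \<cdot> t) (g \<cdot> r) M N u V ?s"
    have v: "?v \<in> secs (pull (g \<cdot> (r \<cdot> q)) N) V" by (rule sheaf_homD(2)[OF pu' V s1])
    have "pull_comp q r (pull g N) V (regard (t \<cdot> q) (r \<cdot> q) f g M N (pull_along q (f \<cdot> t) (g \<cdot> r) M N u) V s) =
       pull_comp q r (pull g N) V (pull_comp (r \<cdot> q) g N V ?v)"
      by (simp only: regard_apply[OF tq rq f g V s])
    also have "\<dots> = pull_map q (pull (g \<cdot> r) N) (pull r (pull g N)) (pull_comp r g N) V (pull_comp q (g \<cdot> r) N V ?v)"
      by (rule pull_comp_cocycle[OF pqrg prg pg V v])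
    also have "\<dots> = pull_map q (pull (g \<cdot> r) N) (pull r (pull g N)) (pull_comp r g N) V
        (pull_map q (pull (f \<cdot> t) M) (pull (g \<cdot> r) N) u V (pull_comp q (f \<cdot> t) M V ?s))"
      by (simp only: pull_comp_pull_along[OF q ft gr M N u V s2])
    also have "\<dots> = pull_map q (pull (f \<cdot> t) M) (pull r (pull g N)) (sh_comp X (pull (f \<cdot> t) M) (pull_comp r g N) u) V
        (pull_comp q (f \<cdot> t) M V ?s)"
      by (simp only: pull_map_comp[OF pqft mgr mrg u cr] sh_comp_apply[OF V cs])
    also have "\<dots> = pull_map q (pull t (pull f M)) (pull r (pull g N)) (regard t r f g M N u) V
        (pull_map q (pull (f \<cdot> t) M) (pull t (pull f M)) (pull_comp t f M) V (pull_comp q (f \<cdot> t) M V ?s))"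
      by (simp only: com[symmetric] pull_map_comp[OF pqft mtf mrg ct hu] sh_comp_apply[OF V cs])
    also have "\<dots> = pull_map q (pull t (pull f M)) (pull r (pull g N)) (regard t r f g M N u) V
        (pull_comp q t (pull f M) V s)"
      by (simp only: pull_comp_cocycle[OF pqtf ptf pf V s1, symmetric] ss)
    finally show "pull_comp q r (pull g N) V (regard (t \<cdot> q) (r \<cdot> q) f g M N (pull_along q (f \<cdot> t) (g \<cdot> r) M N u) V s) =
      pull_map q (pull t (pull f M)) (pull r (pull g N)) (regard t r f g M N u) V (pull_comp q t (pull f M) V s)" .
  qed
qed

section \<open>Graded sheaves\<close>

definition gr_module :: "('a, 'r) ringed_sp \<Rightarrow> ('a, 'r, 'm) gr_sh \<Rightarrow> bool" where
  "gr_module X E \<longleftrightarrow> (\<forall>n. module_sheaf X (E n))"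

abbreviation "graded U E \<equiv> gr_module (lev U 0) E"

lemma gr_moduleD: "gr_module X E \<Longrightarrow> module_sheaf X (E n)" by (simp add: gr_module_def)

lemma gr_module_pull: "rs_map X Y f \<Longrightarrow> gr_module Y E \<Longrightarrow> gr_module X (gr_pull f E)"
  by (simp add: gr_module_def gr_pull_def pull_module)

lemma gr_hom_simps: "u \<in> gr_maps X A B d \<longleftrightarrow> (\<forall>n. u n \<in> sheaf_hom X (A n) (B (n + d)))"
  "\<zero>\<^bsub>gr_hom X A B d\<^esub> = (\<lambda>n. sh_zero X (A n) (B (n + d)))"
  "u \<oplus>\<^bsub>gr_hom X A B d\<^esub> v = (\<lambda>n. sh_add X (A n) (B (n + d)) (u n) (v n))" by (simp_all add: gr_hom_def)

lemma gr_hom_abelian: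
  assumes A: "gr_module X A" and B: "gr_module X B"
  shows "abelian_group (gr_hom X A B d)"
proof -
  note m = gr_moduleD[OF A] gr_moduleD[OF B]
  note rules = sh_add_rules[OF m] sh_add_hom[OF m] sh_zero_hom[OF m]
  show ?thesis
  proof (rule abelian_groupI, unfold gr_hom_simps)
    fix u assume u: "\<forall>n. u n \<in> sheaf_hom X (A n) (B (n + d))"
    show "(\<lambda>n. sh_add X (A n) (B (n + d)) (sh_zero X (A n) (B (n + d))) (u n)) = u"
      by (rule ext) (use u rules(3) in simp)
    have "\<forall>n. \<exists>v. v \<in> sheaf_hom X (A n) (B (n + d)) \<and> sh_add X (A n) (B (n + d)) v (u n) = sh_zero X (A n) (B (n + d))"
      using rules(4) u by blast
    then obtain v where "\<forall>n. v n \<in> sheaf_hom X (A n) (B (n + d)) \<and> sh_add X (A n) (B (n + d)) (v n) (u n) = sh_zero X (A n) (B (n + d))"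
      by (rule choice[THEN exE])
    then show "\<exists>v\<in>gr_maps X A B d. (\<lambda>n. sh_add X (A n) (B (n + d)) (v n) (u n)) = (\<lambda>n. sh_zero X (A n) (B (n + d)))"
      by (intro bexI[of _ v]) (simp_all add: gr_hom_simps fun_eq_iff)
    fix v assume v: "\<forall>n. v n \<in> sheaf_hom X (A n) (B (n + d))"
    show "\<forall>n. sh_add X (A n) (B (n + d)) (u n) (v n) \<in> sheaf_hom X (A n) (B (n + d))" using u v rules(5) by simp
    show "(\<lambda>n. sh_add X (A n) (B (n + d)) (u n) (v n)) = (\<lambda>n. sh_add X (A n) (B (n + d)) (v n) (u n))"
      by (rule ext) (rule rules(1); use u v in simp)
    fix w assume w: "\<forall>n. w n \<in> sheaf_hom X (A n) (B (n + d))"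
    show "(\<lambda>n. sh_add X (A n) (B (n + d)) (sh_add X (A n) (B (n + d)) (u n) (v n)) (w n)) =
      (\<lambda>n. sh_add X (A n) (B (n + d)) (u n) (sh_add X (A n) (B (n + d)) (v n) (w n)))"
      by (rule ext) (rule rules(2); use u v w in simp)
  qed (use rules(6) in simp)
qed

text \<open>The degree \<open>D\<close> of a composite is a variable constrained by D = d + e, so
  that any expression with this value may be supplied, such as 0 for -1 + 1.\<close>

context
  fixes X :: "('a, 'r) ringed_sp" and A :: "('a, 'r, 'm) gr_sh" and B :: "('a, 'r, 'n) gr_sh" and C :: "('a, 'r, 'p) gr_sh"
    and d e D :: int
  assumes A: "gr_module X A" and B: "gr_module X B" and C: "gr_module X C" and D: "D = d + e"
begin

lemma gr_comp_closed:
  assumes u: "u \<in> gr_maps X A B d" and v: "v \<in> gr_maps X B C e"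
  shows "gr_comp X A d v u \<in> gr_maps X A C D" unfolding gr_hom_simps
proof
  fix n
  have "v (n + d) \<in> sheaf_hom X (B (n + d)) (C (n + D))" using v unfolding gr_hom_simps D by (metis add.assoc)
  then show "gr_comp X A d v u n \<in> sheaf_hom X (A n) (C (n + D))"
    unfolding gr_comp_def using sh_comp_hom[OF gr_moduleD[OF A]] u unfolding gr_hom_simps by blast
qed

lemma gr_comp_add_hom_right:
  assumes v: "v \<in> gr_maps X B C e"
  shows "add_hom (gr_hom X A B d) (gr_hom X A C D) (\<lambda>u. gr_comp X A d v u)"
proof (rule add_homI)
  fix u assume u: "u \<in> gr_maps X A B d"
  show "gr_comp X A d v u \<in> gr_maps X A C D" by (rule gr_comp_closed[OF u v])
  fix u' assume u': "u' \<in> gr_maps X A B d"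
  show "gr_comp X A d v (u \<oplus>\<^bsub>gr_hom X A B d\<^esub> u') = gr_comp X A d v u \<oplus>\<^bsub>gr_hom X A C D\<^esub> gr_comp X A d v u'"
    unfolding gr_comp_def gr_hom_simps
  proof (rule ext)
    fix n
    note mA = gr_moduleD[OF A, of n] and mB = gr_moduleD[OF B, of "n + d"] and mC = gr_moduleD[OF C, of "n + D"]
    have un: "u n \<in> sheaf_hom X (A n) (B (n + d))" and un': "u' n \<in> sheaf_hom X (A n) (B (n + d))"
      using u u' by (simp_all add: gr_hom_simps)
    have vn: "v (n + d) \<in> sheaf_hom X (B (n + d)) (C (n + D))"
      using v unfolding gr_hom_simps D by (metis add.assoc)
    show "sh_comp X (A n) (v (n + d)) (sh_add X (A n) (B (n + d)) (u n) (u' n)) =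
      sh_add X (A n) (C (n + D)) (sh_comp X (A n) (v (n + d)) (u n)) (sh_comp X (A n) (v (n + d)) (u' n))"
      by (rule sheaf_hom_eqI[OF sh_comp_hom[OF mA sh_add_hom[OF mA mB un un'] vn]
            sh_add_hom[OF mA mC sh_comp_hom[OF mA un vn] sh_comp_hom[OF mA un' vn]]])
         (simp add: sh_comp_apply sh_add_apply add_hom_add[OF sheaf_homD(1)[OF vn]] sheaf_homD(2)[OF un] sheaf_homD(2)[OF un'])
  qed
qed

lemma gr_comp_add_hom_left:
  assumes u: "u \<in> gr_maps X A B d"
  shows "add_hom (gr_hom X B C e) (gr_hom X A C D) (\<lambda>v. gr_comp X A d v u)"
proof (rule add_homI)
  fix v assume v: "v \<in> gr_maps X B C e"
  show "gr_comp X A d v u \<in> gr_maps X A C D" by (rule gr_comp_closed[OF u v])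
  fix v' assume v': "v' \<in> gr_maps X B C e"
  show "gr_comp X A d (v \<oplus>\<^bsub>gr_hom X B C e\<^esub> v') u = gr_comp X A d v u \<oplus>\<^bsub>gr_hom X A C D\<^esub> gr_comp X A d v' u"
    unfolding gr_comp_def gr_hom_simps
  proof (rule ext)
    fix n
    note mA = gr_moduleD[OF A, of n] and mB = gr_moduleD[OF B, of "n + d"] and mC = gr_moduleD[OF C, of "n + D"]
    have D': "n + d + e = n + D" by (simp add: D)
    have un: "u n \<in> sheaf_hom X (A n) (B (n + d))" using u by (simp add: gr_hom_simps)
    have vn: "v (n + d) \<in> sheaf_hom X (B (n + d)) (C (n + D))" "v' (n + d) \<in> sheaf_hom X (B (n + d)) (C (n + D))"
      using v v' unfolding gr_hom_simps D by (metis add.assoc)+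
    show "sh_comp X (A n) (sh_add X (B (n + d)) (C (n + d + e)) (v (n + d)) (v' (n + d))) (u n) =
      sh_add X (A n) (C (n + D)) (sh_comp X (A n) (v (n + d)) (u n)) (sh_comp X (A n) (v' (n + d)) (u n))"
      unfolding D' by (rule sheaf_hom_eqI[OF sh_comp_hom[OF mA un sh_add_hom[OF mB mC vn]]
            sh_add_hom[OF mA mC sh_comp_hom[OF mA un vn(1)] sh_comp_hom[OF mA un vn(2)]]])
         (simp add: sh_comp_apply sh_add_apply sheaf_homD(2)[OF un])
  qed
qed

lemma gr_comp_assoc:
  assumes P: "gr_module X P" and u: "u \<in> gr_maps X A B d" and v: "v \<in> gr_maps X B C e"
    and w: "w \<in> gr_maps X C P c"
  shows "gr_comp X A d (gr_comp X B e w v) u = gr_comp X A D w (gr_comp X A d v u)"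
  unfolding gr_comp_def
proof (rule ext)
  fix n
  have D': "n + d + e = n + D" by (simp add: D)
  note mA = gr_moduleD[OF A, of n] and mB = gr_moduleD[OF B, of "n + d"]
  have un: "u n \<in> sheaf_hom X (A n) (B (n + d))" using u by (simp add: gr_hom_simps)
  have vn: "v (n + d) \<in> sheaf_hom X (B (n + d)) (C (n + D))" using v unfolding gr_hom_simps D by (metis add.assoc)
  have wn: "w (n + D) \<in> sheaf_hom X (C (n + D)) (P (n + D + c))" using w by (simp add: gr_hom_simps)
  show "sh_comp X (A n) (sh_comp X (B (n + d)) (w (n + d + e)) (v (n + d))) (u n) =
      sh_comp X (A n) (w (n + D)) (sh_comp X (A n) (v (n + d)) (u n))" unfolding D'
    by (rule sheaf_hom_eqI[OF sh_comp_hom[OF mA un sh_comp_hom[OF mB vn wn]] sh_comp_hom[OF mA sh_comp_hom[OF mA un vn] wn]])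
       (simp add: sh_comp_apply sheaf_homD(2)[OF un])
qed

end

lemma gr_id_closed: "gr_module X A \<Longrightarrow> gr_id X A \<in> gr_maps X A A 0"
  by (simp add: gr_hom_simps gr_id_def sh_id_hom gr_moduleD)

lemma gr_comp_id:
  assumes A: "gr_module X A" and B: "gr_module X B" and u: "u \<in> gr_maps X A B d"
  shows "gr_comp X A d (gr_id X B) u = u" and "gr_comp X A 0 u (gr_id X A) = u"
proof -
  have un: "u n \<in> sheaf_hom X (A n) (B (n + d))" for n using u by (simp add: gr_hom_simps)
  show "gr_comp X A d (gr_id X B) u = u" unfolding gr_comp_def gr_id_def
    by (rule ext, rule sheaf_hom_eqI[OF sh_comp_hom[OF gr_moduleD[OF A] un sh_id_hom[OF gr_moduleD[OF B]]] un])
       (simp add: sh_comp_apply sh_id_apply sheaf_homD(2)[OF un])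
  have eq: "sh_comp X (A n) (u n) (sh_id X (A n)) = u n" for n
    by (rule sheaf_hom_eqI[OF sh_comp_hom[OF gr_moduleD[OF A] sh_id_hom[OF gr_moduleD[OF A]] un] un])
       (simp add: sh_comp_apply sh_id_apply)
  show "gr_comp X A 0 u (gr_id X A) = u" unfolding gr_comp_def gr_id_def using eq by simp
qed

lemma gr_pull_map_closed:
  assumes "rs_map X Y q" "rs_map Y Z t" "rs_map Y Z r" "gr_module Z E" "gr_module Z F"
    and "u \<in> gr_maps Y (gr_pull t E) (gr_pull r F) d"
  shows "gr_pull_map q t r E F d u \<in> gr_maps X (gr_pull (t \<cdot> q) E) (gr_pull (r \<cdot> q) F) d"
  using assms by (simp add: gr_hom_simps gr_pull_map_eq gr_pull_def pull_along_hom gr_moduleD)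

lemma gr_pull_map_add_hom:
  assumes "rs_map X Y q" "rs_map Y Z t" "rs_map Y Z r" "gr_module Z E" "gr_module Z F"
  shows "add_hom (gr_hom Y (gr_pull t E) (gr_pull r F) d) (gr_hom X (gr_pull (t \<cdot> q) E) (gr_pull (r \<cdot> q) F) d)
    (gr_pull_map q t r E F d)"
proof (rule add_homI)
  fix u v assume "u \<in> gr_maps Y (gr_pull t E) (gr_pull r F) d" "v \<in> gr_maps Y (gr_pull t E) (gr_pull r F) d"
  then have "u n \<in> sheaf_hom Y (pull t (E n)) (pull r (F (n + d)))" "v n \<in> sheaf_hom Y (pull t (E n)) (pull r (F (n + d)))" for n
    by (simp_all add: gr_hom_simps gr_pull_def)
  then show "gr_pull_map q t r E F d (u \<oplus>\<^bsub>gr_hom Y (gr_pull t E) (gr_pull r F) d\<^esub> v) =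
    gr_pull_map q t r E F d u \<oplus>\<^bsub>gr_hom X (gr_pull (t \<cdot> q) E) (gr_pull (r \<cdot> q) F) d\<^esub> gr_pull_map q t r E F d v"
    unfolding gr_hom_simps gr_pull_map_eq gr_pull_def
    by (intro ext pull_along_add[OF assms(1-3) gr_moduleD[OF assms(4)] gr_moduleD[OF assms(5)]])
qed (rule gr_pull_map_closed[OF assms])

lemma gr_pull_map_comp:
  assumes q: "rs_map X Y q" and t: "rs_map Y Z t" and r: "rs_map Y Z r" and w: "rs_map Y Z w"
    and E: "gr_module Z E" and F: "gr_module Z F" and G: "gr_module Z G"
    and u: "u \<in> gr_maps Y (gr_pull t E) (gr_pull r F) d"
    and v: "v \<in> gr_maps Y (gr_pull r F) (gr_pull w G) e" and D: "D = d + e"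
  shows "gr_pull_map q t w E G D (gr_comp Y (gr_pull t E) d v u) =
    gr_comp X (gr_pull (t \<cdot> q) E) d (gr_pull_map q r w F G e v) (gr_pull_map q t r E F d u)"
  unfolding gr_pull_map_eq gr_comp_def gr_pull_def
proof (rule ext)
  fix n
  have D': "n + d + e = n + D" by (simp add: D)
  have un: "u n \<in> sheaf_hom Y (pull t (E n)) (pull r (F (n + d)))" using u by (simp add: gr_hom_simps gr_pull_def)
  have vn: "v (n + d) \<in> sheaf_hom Y (pull r (F (n + d))) (pull w (G (n + D)))"
    using v unfolding gr_hom_simps gr_pull_def D by (metis add.assoc)
  show "pull_along q t w (E n) (G (n + D)) (sh_comp Y (pull t (E n)) (v (n + d)) (u n)) =
    sh_comp X (pull (t \<cdot> q) (E n)) (pull_along q r w (F (n + d)) (G (n + d + e)) (v (n + d)))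
      (pull_along q t r (E n) (F (n + d)) (u n))"
    unfolding D' by (rule pull_along_comp[OF q t r w gr_moduleD[OF E] gr_moduleD[OF F] gr_moduleD[OF G] un vn])
qed

lemma gr_pull_map_id:
  assumes "rs_map X Y q" "rs_map Y Z t" "gr_module Z E"
  shows "gr_pull_map q t t E E 0 (gr_id Y (gr_pull t E)) = gr_id X (gr_pull (t \<cdot> q) E)"
  unfolding gr_pull_map_eq gr_id_def gr_pull_def using pull_along_id[OF assms(1,2) gr_moduleD[OF assms(3)]] by simp

lemma gr_pull_map_pull_map:
  assumes q': "rs_map W X q'" and q: "rs_map X Y q" and t: "rs_map Y Z t" and r: "rs_map Y Z r"
    and E: "gr_module Z E" and F: "gr_module Z F"
    and u: "u \<in> gr_maps Y (gr_pull t E) (gr_pull r F) d"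
  shows "gr_pull_map q' (t \<cdot> q) (r \<cdot> q) E F d (gr_pull_map q t r E F d u) = gr_pull_map (q \<cdot> q') t r E F d u"
  unfolding gr_pull_map_eq
  by (intro ext pull_along_pull_along[OF q' q t r gr_moduleD[OF E] gr_moduleD[OF F]])
     (use u in "simp add: gr_hom_simps gr_pull_def")

lemma gr_pull_map_rs_id:
  assumes t: "rs_map Y Z t" and r: "rs_map Y Z r" and E: "gr_module Z E" and F: "gr_module Z F"
    and u: "u \<in> gr_maps Y (gr_pull t E) (gr_pull r F) d"
  shows "gr_pull_map (rs_id Y) t r E F d u = u" unfolding gr_pull_map_eq
  by (intro ext pull_along_rs_id[OF t r gr_moduleD[OF E] gr_moduleD[OF F]])
     (use u in "simp add: gr_hom_simps gr_pull_def")

text \<open>Pullback along \<open>q\<close> of a map \<open>t\<^sup>*E \<rightarrow> r\<^sup>*F\<close>, regarded as a map \<open>t'\<^sup>*f\<^sup>*E \<rightarrow> r'\<^sup>*g\<^sup>*F\<close>, for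
  \<open>t \<circ> q = f \<circ> t'\<close> and \<open>r \<circ> q = g \<circ> r'\<close>.\<close>

definition gr_transport where
  "gr_transport q t r t' r' f g E F d u = gr_regard t' r' f g E F d (gr_pull_map q t r E F d u)"

text \<open>A commuting square of spaces. For a map from t^*E to r^*F one square describes the
  source and another, with the same \<open>q\<close>, the target.\<close>

locale transport =
  fixes X :: "('a, 'r) ringed_sp" and Y :: "('b, 's) ringed_sp" and X0 :: "('c, 't) ringed_sp" and Z :: "('d, 'u) ringed_sp"
    and q t t' f
  assumes q: "rs_map X Y q" and t: "rs_map Y Z t" and t': "rs_map X X0 t'" and f: "rs_map X0 Z f"
    and square: "t \<cdot> q = f \<cdot> t'"

lemma gr_transport_closed:
  assumes T: "transport X Y X0 Z q t t' f" and R: "transport X Y X0 Z q r r' g" and E: "gr_module Z E" and F: "gr_module Z F"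
    and u: "u \<in> gr_maps Y (gr_pull t E) (gr_pull r F) d"
  shows "gr_transport q t r t' r' f g E F d u \<in> gr_maps X (gr_pull t' (gr_pull f E)) (gr_pull r' (gr_pull g F)) d"
proof -
  interpret T: transport X Y X0 Z q t t' f by (rule T)
  interpret R: transport X Y X0 Z q r r' g by (rule R)
  show ?thesis using gr_pull_map_closed[OF T.q T.t R.t E F u] unfolding T.square R.square
    by (simp add: gr_transport_def gr_regard_eq gr_hom_simps gr_pull_def regard_hom[OF T.t' R.t' T.f R.f] gr_moduleD[OF E] gr_moduleD[OF F])
qed

lemma gr_transport_add_hom:
  assumes T: "transport X Y X0 Z q t t' f" and R: "transport X Y X0 Z q r r' g" and E: "gr_module Z E" and F: "gr_module Z F"
  shows "add_hom (gr_hom Y (gr_pull t E) (gr_pull r F) d) (gr_hom X (gr_pull t' (gr_pull f E)) (gr_pull r' (gr_pull g F)) d)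
    (gr_transport q t r t' r' f g E F d)"
proof (rule add_homI)
  interpret T: transport X Y X0 Z q t t' f by (rule T)
  interpret R: transport X Y X0 Z q r r' g by (rule R)
  fix u assume u: "u \<in> gr_maps Y (gr_pull t E) (gr_pull r F) d"
  show "gr_transport q t r t' r' f g E F d u \<in> gr_maps X (gr_pull t' (gr_pull f E)) (gr_pull r' (gr_pull g F)) d"
    by (rule gr_transport_closed[OF T R E F u])
  fix v assume v: "v \<in> gr_maps Y (gr_pull t E) (gr_pull r F) d"
  have h: "x n \<in> sheaf_hom X (pull (f \<cdot> t') (E n)) (pull (g \<cdot> r') (F (n + d)))"
    if "x \<in> gr_maps X (gr_pull (f \<cdot> t') E) (gr_pull (g \<cdot> r') F) d" for x n
    using that by (simp add: gr_hom_simps gr_pull_def)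
  show "gr_transport q t r t' r' f g E F d (u \<oplus>\<^bsub>gr_hom Y (gr_pull t E) (gr_pull r F) d\<^esub> v) =
    gr_transport q t r t' r' f g E F d u \<oplus>\<^bsub>gr_hom X (gr_pull t' (gr_pull f E)) (gr_pull r' (gr_pull g F)) d\<^esub>
    gr_transport q t r t' r' f g E F d v"
    unfolding gr_transport_def add_hom_add[OF gr_pull_map_add_hom[OF T.q T.t R.t E F] u v] T.square R.square
    unfolding gr_hom_simps gr_regard_eq gr_pull_def
    by (intro ext regard_add[OF T.t' R.t' T.f R.f gr_moduleD[OF E] gr_moduleD[OF F]] h)
       (use gr_pull_map_closed[OF T.q T.t R.t E F u] gr_pull_map_closed[OF T.q T.t R.t E F v] in "unfold T.square R.square")
qed

lemma gr_transport_comp: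
  assumes T: "transport X Y X0 Z q t t' f" and R: "transport X Y X0 Z q r r' g" and W: "transport X Y X0 Z q w w' k"
    and E: "gr_module Z E" and F: "gr_module Z F" and G: "gr_module Z G"
    and u: "u \<in> gr_maps Y (gr_pull t E) (gr_pull r F) d"
    and v: "v \<in> gr_maps Y (gr_pull r F) (gr_pull w G) e" and D: "D = d + e"
  shows "gr_transport q t w t' w' f k E G D (gr_comp Y (gr_pull t E) d v u) =
    gr_comp X (gr_pull t' (gr_pull f E)) d (gr_transport q r w r' w' g k F G e v) (gr_transport q t r t' r' f g E F d u)"
proof -
  interpret T: transport X Y X0 Z q t t' f by (rule T)
  interpret R: transport X Y X0 Z q r r' g by (rule R)
  interpret W: transport X Y X0 Z q w w' k by (rule W)
  note cu = gr_pull_map_closed[OF T.q T.t R.t E F u, unfolded T.square R.square]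
    and cv = gr_pull_map_closed[OF T.q R.t W.t F G v, unfolded R.square W.square]
  show ?thesis unfolding gr_transport_def gr_pull_map_comp[OF T.q T.t R.t W.t E F G u v D] T.square
    unfolding gr_regard_eq gr_comp_def gr_pull_def
  proof (rule ext)
    fix n
    have D': "n + d + e = n + D" by (simp add: D)
    have un: "gr_pull_map q t r E F d u n \<in> sheaf_hom X (pull (f \<cdot> t') (E n)) (pull (g \<cdot> r') (F (n + d)))"
      using cu by (simp add: gr_hom_simps gr_pull_def)
    have vn: "gr_pull_map q r w F G e v (n + d) \<in> sheaf_hom X (pull (g \<cdot> r') (F (n + d))) (pull (k \<cdot> w') (G (n + D)))"
      using cv unfolding gr_hom_simps gr_pull_def D by (metis add.assoc)
    show "regard t' w' f k (E n) (G (n + D)) (sh_comp X (pull (f \<cdot> t') (E n)) (gr_pull_map q r w F G e v (n + d)) (gr_pull_map q t r E F d u n)) =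
      sh_comp X (pull t' (pull f (E n))) (regard r' w' g k (F (n + d)) (G (n + d + e)) (gr_pull_map q r w F G e v (n + d)))
        (regard t' r' f g (E n) (F (n + d)) (gr_pull_map q t r E F d u n))"
      unfolding D' by (rule regard_comp[OF T.t' R.t' W.t' T.f R.f W.f gr_moduleD[OF E] gr_moduleD[OF F] gr_moduleD[OF G] un vn])
  qed
qed

lemma gr_transport_id:
  assumes T: "transport X Y X0 Z q t t' f" and E: "gr_module Z E"
  shows "gr_transport q t t t' t' f f E E 0 (gr_id Y (gr_pull t E)) = gr_id X (gr_pull t' (gr_pull f E))"
proof -
  interpret T: transport X Y X0 Z q t t' f by (rule T)
  show ?thesis unfolding gr_transport_def gr_pull_map_id[OF T.q T.t E] T.square
    unfolding gr_regard_eq gr_id_def gr_pull_def using regard_id[OF T.t' T.f gr_moduleD[OF E]] by simp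
qed

text \<open>Together with \<open>gr_pull_map_transport\<close> this absorbs pullbacks on either side
  into the base morphism, so identities between pulled back maps reduce to equalities of composites
  of morphisms of ringed spaces.\<close>

lemma gr_transport_pull_map:
  assumes p: "rs_map Y' Y p" and q: "rs_map X Y' q" and t: "rs_map Y Z t" and r: "rs_map Y Z r"
    and E: "gr_module Z E" and F: "gr_module Z F"
    and u: "u \<in> gr_maps Y (gr_pull t E) (gr_pull r F) d"
  shows "gr_transport q (t \<cdot> p) (r \<cdot> p) t' r' f g E F d (gr_pull_map p t r E F d u) =
    gr_transport (p \<cdot> q) t r t' r' f g E F d u"
  unfolding gr_transport_def gr_pull_map_pull_map[OF q p t r E F u] ..

lemma gr_pull_map_transport:
  assumes T: "transport X Y X0 Z q t t' f" and R: "transport X Y X0 Z q r r' g" and p: "rs_map X' X p"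
    and E: "gr_module Z E" and F: "gr_module Z F"
    and u: "u \<in> gr_maps Y (gr_pull t E) (gr_pull r F) d"
  shows "gr_pull_map p t' r' (gr_pull f E) (gr_pull g F) d (gr_transport q t r t' r' f g E F d u) =
    gr_transport (q \<cdot> p) t r (t' \<cdot> p) (r' \<cdot> p) f g E F d u"
proof -
  interpret T: transport X Y X0 Z q t t' f by (rule T)
  interpret R: transport X Y X0 Z q r r' g by (rule R)
  note cu = gr_pull_map_closed[OF T.q T.t R.t E F u, unfolded T.square R.square]
  have un: "gr_pull_map q t r E F d u n \<in> sheaf_hom X (pull (f \<cdot> t') (E n)) (pull (g \<cdot> r') (F (n + d)))" for n
    using cu by (simp add: gr_hom_simps gr_pull_def)
  show ?thesis
    unfolding gr_transport_def gr_pull_map_pull_map[OF p T.q T.t R.t E F u, unfolded T.square R.square, symmetric]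
    unfolding gr_regard_eq gr_pull_map_eq[of p] gr_pull_def
    by (intro ext pull_along_regard[OF p T.t' R.t' T.f R.f gr_moduleD[OF E] gr_moduleD[OF F] un])
qed

section \<open>Signed sums\<close>

lemma sgn_act_closed: "abelian_group G \<Longrightarrow> x \<in> carrier G \<Longrightarrow> sgn_act G n x \<in> carrier G"
  by (simp add: sgn_act_def abelian_group.a_inv_closed)

lemma sgn_act_sgn_act: "abelian_group G \<Longrightarrow> x \<in> carrier G \<Longrightarrow> sgn_act G m (sgn_act G n x) = sgn_act G (m + n) x"
  by (auto simp: sgn_act_def abelian_group.a_inv_closed abelian_group.minus_minus)

lemma sgn_act_cong: "even m = even n \<Longrightarrow> sgn_act G m x = sgn_act G n x" by (simp add: sgn_act_def)

lemma add_hom_sgn_act: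
  "\<lbrakk>abelian_group G; abelian_group H; add_hom G H f; x \<in> carrier G\<rbrakk> \<Longrightarrow> f (sgn_act G n x) = sgn_act H n (f x)"
  by (simp add: sgn_act_def add_hom_minus)

lemma sgn_act_add_hom: "abelian_group G \<Longrightarrow> add_hom G G (sgn_act G n)"
  by (rule add_homI) (auto simp: sgn_act_def abelian_group.a_inv_closed abelian_group.minus_add)

text \<open>The shape shared by \<open>tw_delta\<close>, \<open>tw_comp\<close> and
  \<open>homotopy_sum\<close>. Keeping the exponent as a function makes reindexing a matter of
  parities.\<close>

definition ssum :: "('m, 'x) ring_scheme \<Rightarrow> 'i set \<Rightarrow> ('i \<Rightarrow> int) \<Rightarrow> ('i \<Rightarrow> 'm) \<Rightarrow> 'm" where
  "ssum G I n x = (\<Oplus>\<^bsub>G\<^esub>i\<in>I. sgn_act G (n i) (x i))"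

lemma ssum_closed: "abelian_group G \<Longrightarrow> (\<And>i. i \<in> I \<Longrightarrow> x i \<in> carrier G) \<Longrightarrow> ssum G I n x \<in> carrier G" unfolding ssum_def
  using abelian_monoid.finsum_closed[OF abelian_group.axioms(1)] sgn_act_closed by (metis (no_types, lifting) Pi_I)

lemma ssum_cong:
  assumes G: "abelian_group G" and "I = J" "\<And>i. i \<in> J \<Longrightarrow> y i \<in> carrier G"
    "\<And>i. i \<in> J \<Longrightarrow> even (n i) = even (m i)" "\<And>i. i \<in> J \<Longrightarrow> x i = y i"
  shows "ssum G I n x = ssum G J m y"
proof -
  interpret abelian_group G by fact
  show ?thesis unfolding ssum_def
    by (rule finsum_cong') (use assms in "auto simp: sgn_act_closed intro: sgn_act_cong")
qed

lemma ssum_hom: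
  assumes "abelian_group G" "abelian_group H" "add_hom G H f" "\<And>i. i \<in> I \<Longrightarrow> x i \<in> carrier G"
  shows "f (ssum G I n x) = ssum H I n (\<lambda>i. f (x i))"
proof -
  interpret H: abelian_group H by fact
  have "f (ssum G I n x) = (\<Oplus>\<^bsub>H\<^esub>i\<in>I. f (sgn_act G (n i) (x i)))"
    unfolding ssum_def using assms by (intro add_hom_finsum) (auto simp: sgn_act_closed)
  also have "\<dots> = ssum H I n (\<lambda>i. f (x i))" unfolding ssum_def by (rule H.finsum_cong')
       (use assms add_hom_closed[OF assms(3)] in "auto simp: add_hom_sgn_act[OF assms(1-3)] sgn_act_closed")
  finally show ?thesis .
qed

lemma sgn_act_ssum:
  assumes G: "abelian_group G" and x: "\<And>i. i \<in> I \<Longrightarrow> x i \<in> carrier G"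
  shows "sgn_act G k (ssum G I n x) = ssum G I (\<lambda>i. k + n i) x"
proof -
  interpret abelian_group G by fact
  have "sgn_act G k (ssum G I n x) = (\<Oplus>\<^bsub>G\<^esub>i\<in>I. sgn_act G k (sgn_act G (n i) (x i)))"
    unfolding ssum_def using x by (intro add_hom_finsum[OF G G sgn_act_add_hom[OF G]]) (auto simp: sgn_act_closed G)
  also have "\<dots> = ssum G I (\<lambda>i. k + n i) x"
    unfolding ssum_def using x by (intro finsum_cong') (auto simp: sgn_act_sgn_act sgn_act_closed G)
  finally show ?thesis .
qed

lemma ssum_Un:
  fixes G (structure)
  assumes G: "abelian_group G" and "finite I" "finite J" "I \<inter> J = {}" "\<And>i. i \<in> I \<union> J \<Longrightarrow> x i \<in> carrier G"
  shows "ssum G (I \<union> J) n x = ssum G I n x \<oplus> ssum G J n x"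
proof -
  interpret abelian_group G by fact
  show ?thesis unfolding ssum_def using assms by (intro finsum_Un_disjoint) (auto simp: sgn_act_closed)
qed

lemma ssum_split:
  fixes G (structure)
  assumes G: "abelian_group G" and "finite I" "\<And>i. i \<in> I \<Longrightarrow> x i \<in> carrier G"
  shows "ssum G I n x = ssum G {i \<in> I. P i} n x \<oplus> ssum G {i \<in> I. \<not> P i} n x"
proof -
  have "ssum G ({i \<in> I. P i} \<union> {i \<in> I. \<not> P i}) n x = ssum G {i \<in> I. P i} n x \<oplus> ssum G {i \<in> I. \<not> P i} n x"
    using assms by (intro ssum_Un) auto
  moreover have "{i \<in> I. P i} \<union> {i \<in> I. \<not> P i} = I" by blast
  ultimately show ?thesis by simp
qed

text \<open>The double sums in the identities for \<delta>, for composition and for the homotopy sum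
  are matched through such bijections. Only parities of exponents count, and the explicit inverse
  \<rho> replaces proofs of injectivity and surjectivity.\<close>

lemma ssum_reindex:
  assumes G: "abelian_group G" and x: "\<And>i. i \<in> I \<Longrightarrow> x i \<in> carrier G"
    and ij: "\<And>i. i \<in> I \<Longrightarrow> \<pi> i \<in> J" "\<And>i. i \<in> I \<Longrightarrow> \<rho> (\<pi> i) = i"
    and ji: "\<And>j. j \<in> J \<Longrightarrow> \<rho> j \<in> I" "\<And>j. j \<in> J \<Longrightarrow> \<pi> (\<rho> j) = j"
    and n: "\<And>i. i \<in> I \<Longrightarrow> even (n i) = even (m (\<pi> i))" and xy: "\<And>i. i \<in> I \<Longrightarrow> x i = y (\<pi> i)"
  shows "ssum G I n x = ssum G J m y"
proof -
  interpret abelian_group G by fact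
  have J: "J = \<pi> ` I" using ij ji by force
  have inj: "inj_on \<pi> I" by (rule inj_on_inverseI[of _ \<rho>]) (rule ij(2))
  have "ssum G J m y = (\<Oplus>\<^bsub>G\<^esub>i\<in>I. sgn_act G (m (\<pi> i)) (y (\<pi> i)))"
    unfolding ssum_def J using x xy inj by (intro finsum_reindex) (auto simp: sgn_act_closed G)
  also have "\<dots> = ssum G I n x"
    unfolding ssum_def using x xy n by (intro finsum_cong') (auto simp: sgn_act_closed G intro: sgn_act_cong)
  finally show ?thesis ..
qed

lemma ssum_insert:
  fixes G (structure)
  assumes G: "abelian_group G" and "finite I" "j \<notin> I" "x j \<in> carrier G" "\<And>i. i \<in> I \<Longrightarrow> x i \<in> carrier G"
  shows "ssum G (insert j I) n x = sgn_act G (n j) (x j) \<oplus> ssum G I n x"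
proof -
  interpret abelian_group G by fact
  show ?thesis unfolding ssum_def using assms by (subst finsum_insert) (auto simp: sgn_act_closed)
qed

lemma ssum_empty: "abelian_group G \<Longrightarrow> ssum G {} n x = \<zero>\<^bsub>G\<^esub>"
  by (simp add: ssum_def abelian_monoid.finsum_empty abelian_group.axioms(1))

lemma ssum_Sigma:
  fixes G (structure)
  assumes G: "abelian_group G" and I: "finite I" and J: "\<And>i. i \<in> I \<Longrightarrow> finite (J i)"
    and x: "\<And>i j. i \<in> I \<Longrightarrow> j \<in> J i \<Longrightarrow> x i j \<in> carrier G"
  shows "ssum G I n (\<lambda>i. ssum G (J i) (m i) (x i)) = ssum G (Sigma I J) (\<lambda>(i, j). n i + m i j) (\<lambda>(i, j). x i j)"
  using I J x
proof (induction I rule: finite_induct)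
  case empty
  then show ?case by (simp add: ssum_empty[OF G])
next
  case (insert k I)
  have e: "Sigma (insert k I) J = Pair k ` J k \<union> Sigma I J" by auto
  have "ssum G (insert k I) n (\<lambda>i. ssum G (J i) (m i) (x i)) =
      sgn_act G (n k) (ssum G (J k) (m k) (x k)) \<oplus> ssum G (Sigma I J) (\<lambda>(i, j). n i + m i j) (\<lambda>(i, j). x i j)"
    using insert by (subst ssum_insert) (auto simp: G ssum_closed)
  also have "sgn_act G (n k) (ssum G (J k) (m k) (x k)) = ssum G (J k) (\<lambda>j. n k + m k j) (x k)"
    using insert by (intro sgn_act_ssum[OF G]) auto
  also have "\<dots> = ssum G (Pair k ` J k) (\<lambda>(i, j). n i + m i j) (\<lambda>(i, j). x i j)"
    by (rule ssum_reindex[OF G, of _ _ "Pair k" _ snd]) (use insert in auto)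
  also have "\<dots> \<oplus> ssum G (Sigma I J) (\<lambda>(i, j). n i + m i j) (\<lambda>(i, j). x i j) =
      ssum G (Sigma (insert k I) J) (\<lambda>(i, j). n i + m i j) (\<lambda>(i, j). x i j)"
    unfolding e using insert by (subst ssum_Un[OF G]) auto
  finally show ?case .
qed

text \<open>Additive identities in a carrier-based abelian group follow from the same identities in a free
  abelian group, where the simplifier can cancel.\<close>

definition presents :: "('g, 'x) ring_scheme \<Rightarrow> (('g \<Rightarrow>\<^sub>0 int) \<Rightarrow> 'g) \<Rightarrow> bool" where
  "presents G h \<longleftrightarrow> (\<forall>x\<in>carrier G. \<exists>c. x = h c) \<and> (\<forall>a b. h a \<oplus>\<^bsub>G\<^esub> h b = h (a + b)) \<and>
    (\<forall>a. \<ominus>\<^bsub>G\<^esub> h a = h (- a)) \<and> (\<forall>a b. h a \<ominus>\<^bsub>G\<^esub> h b = h (a - b)) \<and> \<zero>\<^bsub>G\<^esub> = h 0"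

lemma abelian_group_presentation:
  assumes "abelian_group G"
  shows "\<exists>h. presents G h"
proof -
  interpret G: abelian_group G by fact
  have "id ` carrier G \<subseteq> carrier (add_monoid G)" by simp
  then obtain h0 where h0: "h0 \<in> hom (free_Abelian_group (carrier G)) (add_monoid G)"
    and h0f: "\<And>x. x \<in> carrier G \<Longrightarrow> h0 (frag_of x) = id x"
    using comm_group.free_Abelian_group_universal[OF G.a_comm_group] by metis
  \<comment> \<open>Generators outside the carrier are sent to 0, which makes \<open>h\<close>
    additive on the whole type of finitely supported functions, without a side condition.\<close>
  define r where "r = frag_extend (\<lambda>x. if x \<in> carrier G then frag_of x else 0)"
  have r: "r a \<in> carrier (free_Abelian_group (carrier G))" for a
    unfolding r_def using keys_frag_extend[of "\<lambda>x. if x \<in> carrier G then frag_of x else 0" a] by (fastforce split: if_splits)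
  define h where "h a = h0 (r a)" for a
  have hc: "h a \<in> carrier G" for a unfolding h_def using hom_in_carrier[OF h0 r] by simp
  have add: "h a \<oplus>\<^bsub>G\<^esub> h b = h (a + b)" for a b
    unfolding h_def using hom_mult[OF h0 r r, of a b] by (simp add: r_def frag_extend_add)
  have zero: "h 0 = \<zero>\<^bsub>G\<^esub>" using add[of 0 0] hc[of 0] by (metis G.add.r_cancel_one' add_0)
  have minus: "\<ominus>\<^bsub>G\<^esub> h a = h (- a)" for a using add[of "- a" a] zero hc by (simp add: G.minus_equality)
  have "\<exists>c. x = h c" if "x \<in> carrier G" for x
    using h0f[OF that] that by (intro exI[of _ "frag_of x"]) (simp add: h_def r_def)
  then have "presents G h" by (simp add: presents_def a_minus_def minus add zero)
  then show ?thesis by (rule exI[of _ h])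
qed

section \<open>Faces of a simplicial ringed space\<close>

text \<open>Statements about \<open>\<tau>\<close> are statements about \<open>\<rho>\<close> for the reversed order of the faces.\<close>

definition face_reversal where "face_reversal U = U\<lparr>face := \<lambda>k i. face U k (k - i)\<rparr>"

lemma face_reversal_simps:
  "lev (face_reversal U) = lev U" "rho (face_reversal U) = tau U" "face (face_reversal U) k i = face U k (k - i)"
proof -
  have "rho (face_reversal U) k p = tau U k p" for k p by (induction k) (simp_all add: face_reversal_def)
  then show "rho (face_reversal U) = tau U" by (intro ext)
qed (simp_all add: face_reversal_def)

text \<open>\<open>face_reversal\<close> changes the faces and keeps the degeneracies, so only the
  face part of the structure is stable under reversal and can be shared by \<open>rho\<close> and
  \<open>tau\<close>.\<close>

locale presimplicial =
  fixes U :: "('a, 'r) simp_rs"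
  assumes lev: "ringed_space (lev U k)"
    and face_map: "i \<le> Suc k \<Longrightarrow> rs_map (lev U (Suc k)) (lev U k) (face U (Suc k) i)"
    and face_face: "\<lbrakk>i < j; j \<le> Suc (Suc k)\<rbrakk> \<Longrightarrow>
      face U (Suc k) i \<cdot> face U (Suc (Suc k)) j = face U (Suc k) (j - 1) \<cdot> face U (Suc (Suc k)) i"
begin

lemma rho_self [simp]: "rho U k k = rs_id (lev U k)" by (cases k) simp_all

lemma rho_Suc: "p \<le> k \<Longrightarrow> rho U (Suc k) p = rho U k p \<cdot> face U (Suc k) (Suc k)" by simp

declare rho.simps [simp del] tau.simps [simp del]

lemma rho_map: "p \<le> k \<Longrightarrow> rs_map (lev U k) (lev U p) (rho U k p)"
proof (induction k)
  case (Suc k)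
  show ?case
  proof (cases "p \<le> k")
    case True
    then show ?thesis using rs_map_comp[OF face_map Suc.IH] by (simp add: rho_Suc)
  next
    case False
    then have "p = Suc k" using Suc.prems by simp
    then show ?thesis using rs_map_id[OF lev] by simp
  qed
qed (simp add: rs_map_id[OF lev])

lemma rho_rho: "m \<le> p \<Longrightarrow> p \<le> k \<Longrightarrow> rho U p m \<cdot> rho U k p = rho U k m"
proof (induction k)
  case 0
  then show ?case using rs_map_id_right[OF rs_map_id[OF lev]] by simp
next
  case (Suc k)
  show ?case
  proof (cases "p \<le> k")
    case True
    then have "rho U p m \<cdot> rho U (Suc k) p = (rho U p m \<cdot> rho U k p) \<cdot> face U (Suc k) (Suc k)"
      using Suc.prems by (simp add: rho_Suc rs_map_assoc[OF face_map rho_map rho_map])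
    then show ?thesis using Suc True by (simp add: rho_Suc)
  next
    case False
    then have "p = Suc k" using Suc.prems by simp
    then show ?thesis using rs_map_id_right[OF rho_map] Suc.prems by simp
  qed
qed

text \<open>Face j omits vertex j, and \<open>rho\<close> down to level p keeps the front vertices
  0..p. Omitting a vertex j \<le> p moves the cut to p + 1; a vertex above the cut, in the next
  lemma, is dropped anyway.\<close>

lemma rho_face_le: "p \<le> k \<Longrightarrow> j \<le> p \<Longrightarrow> rho U k p \<cdot> face U (Suc k) j = face U (Suc p) j \<cdot> rho U (Suc k) (Suc p)"
proof (induction k)
  case 0
  then show ?case using rs_map_id_right[OF face_map] rs_map_id_left[OF face_map] by simp
next
  case (Suc k)
  show ?case
  proof (cases "p \<le> k")
    case True
    have "rho U (Suc k) p \<cdot> face U (Suc (Suc k)) j =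
        rho U k p \<cdot> (face U (Suc k) (Suc k) \<cdot> face U (Suc (Suc k)) j)"
      using True Suc.prems by (simp add: rho_Suc rs_map_assoc[OF face_map face_map rho_map])
    also have "\<dots> = rho U k p \<cdot> (face U (Suc k) j \<cdot> face U (Suc (Suc k)) (Suc (Suc k)))"
      using face_face[of j "Suc (Suc k)" k] True Suc.prems by simp
    also have "\<dots> = (face U (Suc p) j \<cdot> rho U (Suc k) (Suc p)) \<cdot> face U (Suc (Suc k)) (Suc (Suc k))"
      using True Suc.prems by (simp add: rs_map_assoc[OF face_map face_map rho_map, symmetric] Suc.IH)
    also have "\<dots> = face U (Suc p) j \<cdot> rho U (Suc (Suc k)) (Suc p)"
      using True Suc.prems by (simp add: rho_Suc rs_map_assoc[OF face_map rho_map face_map])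
    finally show ?thesis .
  next
    case False
    then have "p = Suc k" using Suc.prems by simp
    then show ?thesis using rs_map_id_right[OF face_map] rs_map_id_left[OF face_map] Suc.prems by simp
  qed
qed

lemma rho_face_gt: "p < j \<Longrightarrow> j \<le> Suc k \<Longrightarrow> rho U k p \<cdot> face U (Suc k) j = rho U (Suc k) p"
proof (induction k)
  case 0
  then have "j = Suc 0" "p = 0" by simp_all
  then show ?case by (simp add: rho_Suc)
next
  case (Suc k)
  show ?case
  proof (cases "j = Suc (Suc k)")
    case True
    then show ?thesis using Suc.prems by (simp add: rho_Suc)
  next
    case False
    then have j: "j \<le> Suc k" "p \<le> k" using Suc.prems by simp_all
    have "rho U (Suc k) p \<cdot> face U (Suc (Suc k)) j =
        rho U k p \<cdot> (face U (Suc k) (Suc k) \<cdot> face U (Suc (Suc k)) j)"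
      using j by (simp add: rho_Suc rs_map_assoc[OF face_map face_map rho_map])
    also have "\<dots> = rho U k p \<cdot> (face U (Suc k) j \<cdot> face U (Suc (Suc k)) (Suc (Suc k)))"
      using face_face[of j "Suc (Suc k)" k] j by simp
    also have "\<dots> = rho U (Suc k) p \<cdot> face U (Suc (Suc k)) (Suc (Suc k))"
      using j Suc.prems by (simp add: rs_map_assoc[OF face_map face_map rho_map, symmetric] Suc.IH)
    finally show ?thesis using j by (simp add: rho_Suc)
  qed
qed

lemma face_reversal_presimplicial: "presimplicial (face_reversal U)"
proof (rule presimplicial.intro)
  fix i j k :: nat assume ij: "i < j" "j \<le> Suc (Suc k)"
  then have "Suc (Suc k) - i - 1 = Suc k - i" "Suc k - (j - 1) = Suc (Suc k) - j" by simp_all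
  with ij face_face[of "Suc (Suc k) - j" "Suc (Suc k) - i" k]
  show "face (face_reversal U) (Suc k) i \<cdot> face (face_reversal U) (Suc (Suc k)) j =
      face (face_reversal U) (Suc k) (j - 1) \<cdot> face (face_reversal U) (Suc (Suc k)) i"
    by (simp add: face_reversal_def)
qed (simp_all add: lev face_map face_reversal_def)

end

locale simplicial =
  fixes U :: "('a, 'r) simp_rs"
  assumes U: "simplicial_ringed_space U"

sublocale simplicial \<subseteq> presimplicial
proof
  fix i j k :: nat assume ij: "i < j" "j \<le> Suc (Suc k)"
  have "\<forall>k i j. i < j \<and> j \<le> k + 2 \<longrightarrow>
        face U (k + 1) i \<cdot> face U (k + 2) j = face U (k + 1) (j - 1) \<cdot> face U (k + 2) i"
    using U unfolding simplicial_ringed_space_def by (elim conjE)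
  from this[THEN spec, THEN spec, THEN spec, of i j k] ij
  show "face U (Suc k) i \<cdot> face U (Suc (Suc k)) j = face U (Suc k) (j - 1) \<cdot> face U (Suc (Suc k)) i" by simp
qed (use U in \<open>simp_all add: simplicial_ringed_space_def rs_map_def\<close>)

sublocale simplicial \<subseteq> rev: presimplicial "face_reversal U"
  rewrites "lev (face_reversal U) = lev U" and "rho (face_reversal U) = tau U"
    and "face (face_reversal U) k i = face U k (k - i)"
  by (fact face_reversal_presimplicial face_reversal_simps)+

context simplicial
begin

lemma tau_Suc: "p \<le> k \<Longrightarrow> tau U (Suc k) p = tau U k p \<cdot> face U (Suc k) 0" by (simp add: tau.simps)

lemmas tau_self [simp] = rev.rho_self
  and tau_map = rev.rho_map and tau_tau = rev.rho_rho

lemma tau_face_gt: "\<lbrakk>r \<le> k; k - r < j; j \<le> Suc k\<rbrakk> \<Longrightarrow>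
     tau U k r \<cdot> face U (Suc k) j = face U (Suc r) (j - (k - r)) \<cdot> tau U (Suc k) (Suc r)"
  using rev.rho_face_le[of r k "Suc k - j"] by (simp add: diff_diff_right Suc_diff_le add.commute)

lemma tau_face_le: "r \<le> k \<Longrightarrow> j \<le> k - r \<Longrightarrow> tau U k r \<cdot> face U (Suc k) j = tau U (Suc k) r"
  using rev.rho_face_gt[of r "Suc k - j" k] by simp

lemma tau_face_top:
  "a \<le> k \<Longrightarrow> face U (Suc a) (Suc a) \<cdot> tau U (Suc k) (Suc a) = tau U k a \<cdot> face U (Suc k) (Suc k)"
proof (induction k)
  case 0
  then show ?case using rs_map_id_right[OF face_map] rs_map_id_left[OF face_map] by simp
next
  case (Suc k)
  show ?case
  proof (cases "a \<le> k")
    case True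
    have "face U (Suc a) (Suc a) \<cdot> tau U (Suc (Suc k)) (Suc a) =
        (face U (Suc a) (Suc a) \<cdot> tau U (Suc k) (Suc a)) \<cdot> face U (Suc (Suc k)) 0"
      using True by (simp add: tau_Suc rs_map_assoc[OF face_map tau_map face_map])
    also have "\<dots> = tau U k a \<cdot> (face U (Suc k) (Suc k) \<cdot> face U (Suc (Suc k)) 0)"
      using True by (simp add: Suc.IH rs_map_assoc[OF face_map face_map tau_map])
    also have "\<dots> = tau U k a \<cdot> (face U (Suc k) 0 \<cdot> face U (Suc (Suc k)) (Suc (Suc k)))"
      using face_face[of 0 "Suc (Suc k)" k] by simp
    also have "\<dots> = tau U (Suc k) a \<cdot> face U (Suc (Suc k)) (Suc (Suc k))"
      using True by (simp add: tau_Suc rs_map_assoc[OF face_map face_map tau_map])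
    finally show ?thesis .
  next
    case False
    then have "a = Suc k" using Suc.prems by simp
    then show ?thesis using rs_map_id_right[OF face_map] rs_map_id_left[OF face_map] by simp
  qed
qed

text \<open>\<open>rho\<close> keeps the first vertices and \<open>tau\<close> the last ones, so
  both composites keep exactly the middle vertices p..p+r of a (p+r+l)-simplex.\<close>

lemma rho_tau: "rho U (r + l) r \<cdot> tau U (p + r + l) (r + l) = tau U (p + r) r \<cdot> rho U (p + r + l) (p + r)"
proof (induction l)
  case 0
  then show ?case using rs_map_id_left[OF tau_map] rs_map_id_right[OF tau_map] by simp
next
  case (Suc l)
  have "rho U (r + Suc l) r \<cdot> tau U (p + r + Suc l) (r + Suc l) =
      rho U (r + l) r \<cdot> (face U (Suc (r + l)) (Suc (r + l)) \<cdot> tau U (Suc (p + r + l)) (Suc (r + l)))"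
    by (simp add: rho_Suc rs_map_assoc[OF tau_map face_map rho_map])
  also have "\<dots> = (rho U (r + l) r \<cdot> tau U (p + r + l) (r + l)) \<cdot> face U (Suc (p + r + l)) (Suc (p + r + l))"
    by (simp add: tau_face_top rs_map_assoc[OF face_map tau_map rho_map])
  also have "\<dots> = tau U (p + r) r \<cdot> (rho U (p + r + l) (p + r) \<cdot> face U (Suc (p + r + l)) (Suc (p + r + l)))"
    by (simp add: Suc.IH rs_map_assoc[OF face_map rho_map tau_map])
  finally show ?case by (simp add: rho_Suc)
qed

text \<open>Vertex p of a k-simplex, as a map to level 0: the end of the front face and the
  beginning of the back face, where the two factors of a product meet.\<close>

abbreviation mid :: "nat \<Rightarrow> nat \<Rightarrow> ('a, 'r, 'a, 'r) rs_mor" where "mid k p \<equiv> tau U p 0 \<cdot> rho U k p"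

lemma mid_eq: "p \<le> k \<Longrightarrow> rho U (k - p) 0 \<cdot> tau U k (k - p) = mid k p"
  using rho_tau[where r = 0 and l = "k - p" and p = p] by simp

section \<open>The cup product of bigraded maps\<close>

text \<open>A summand of \<open>tw_comp\<close> without its sign; the signs are kept in the
  exponents of \<open>ssum\<close>.\<close>

definition cup where "cup E F G k p q s u v = gr_comp (lev U k) (gr_pull (tau U k 0) E) s
     (bi_pull U (rho U k p) F G p q u) (bi_pull U (tau U k (k - p)) E F (k - p) s v)"

lemma bi_hom_abelian: "graded U E \<Longrightarrow> graded U F \<Longrightarrow> abelian_group (bi_hom U E F p q)" unfolding bi_hom_def
  by (rule gr_hom_abelian[OF gr_module_pull[OF tau_map[OF le0]] gr_module_pull[OF rho_map[OF le0]]])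

lemma rho_pull_add_hom:
  assumes "graded U E" "graded U F" "p \<le> k"
  shows "add_hom (bi_hom U E F p q) (gr_hom (lev U k) (gr_pull (mid k p) E) (gr_pull (rho U k 0) F) q)
    (bi_pull U (rho U k p) E F p q)"
  using gr_pull_map_add_hom[OF rho_map[OF assms(3)] tau_map[OF le0] rho_map[OF le0] assms(1,2), of q]
    rho_rho[OF le0 assms(3)] by (simp add: bi_hom_def bi_pull_def[abs_def])

lemma tau_pull_add_hom:
  assumes "graded U E" "graded U F" "p \<le> k"
  shows "add_hom (bi_hom U E F (k - p) q) (gr_hom (lev U k) (gr_pull (tau U k 0) E) (gr_pull (mid k p) F) q)
    (bi_pull U (tau U k (k - p)) E F (k - p) q)"
  using gr_pull_map_add_hom[OF tau_map[OF diff_le_self] tau_map[OF le0] rho_map[OF le0] assms(1,2), of k p q]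
    tau_tau[OF le0 diff_le_self, of k p] mid_eq[OF assms(3)]
  by (simp add: bi_hom_def bi_pull_def[abs_def])

lemma mid_map: "p \<le> k \<Longrightarrow> rs_map (lev U k) (lev U 0) (mid k p)" by (rule rs_map_comp[OF rho_map tau_map]) simp_all

context
  fixes E F G :: "('a, 'r, 'm) gr_sh" and k p :: nat and q s D :: int
  assumes E: "graded U E" and F: "graded U F" and G: "graded U G"
    and p: "p \<le> k" and D: "D = q + s"
begin

private lemma mods: "gr_module (lev U k) (gr_pull (tau U k 0) E)" "gr_module (lev U k) (gr_pull (mid k p) F)"
    "gr_module (lev U k) (gr_pull (rho U k 0) G)"
  by (rule gr_module_pull[OF tau_map[OF le0] E] gr_module_pull[OF mid_map[OF p] F] gr_module_pull[OF rho_map[OF le0] G])+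

private lemma D': "D = s + q" using D by simp

lemma cup_add_hom_left:
  assumes v: "v \<in> bi_maps U E F (k - p) s"
  shows "add_hom (bi_hom U F G p q) (bi_hom U E G k D) (\<lambda>u. cup E F G k p q s u v)"
  unfolding cup_def bi_hom_def[of U E G k] by (rule add_hom_compose[OF rho_pull_add_hom[OF F G p]
        gr_comp_add_hom_left[OF mods D' add_hom_closed[OF tau_pull_add_hom[OF E F p] v]]])

lemma cup_add_hom_right:
  assumes u: "u \<in> bi_maps U F G p q"
  shows "add_hom (bi_hom U E F (k - p) s) (bi_hom U E G k D) (\<lambda>v. cup E F G k p q s u v)"
  unfolding cup_def bi_hom_def[of U E G k] by (rule add_hom_compose[OF tau_pull_add_hom[OF E F p]
        gr_comp_add_hom_right[OF mods D' add_hom_closed[OF rho_pull_add_hom[OF F G p] u]]])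

lemma cup_closed:
  assumes "u \<in> bi_maps U F G p q" "v \<in> bi_maps U E F (k - p) s"
  shows "cup E F G k p q s u v \<in> bi_maps U E G k D"
  by (rule add_hom_closed[OF cup_add_hom_right[OF assms(1)] assms(2)])

text \<open>The two factors get pulled back along their faces composed with x. The result is stated
  with \<open>gr_comp\<close> and not with \<open>cup\<close>, since these base morphisms need not
  be a front and a back face again.\<close>

lemma pull_cup:
  assumes u: "u \<in> bi_maps U F G p q" and v: "v \<in> bi_maps U E F (k - p) s"
    and x: "rs_map X (lev U k) x"
  shows "gr_pull_map x (tau U k 0) (rho U k 0) E G D (cup E F G k p q s u v) =
    gr_comp X (gr_pull (tau U k 0 \<cdot> x) E) s (gr_pull_map (rho U k p \<cdot> x) (tau U p 0) (rho U p 0) F G q u)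
      (gr_pull_map (tau U k (k - p) \<cdot> x) (tau U (k - p) 0) (rho U (k - p) 0) E F s v)"
proof -
  note u' = add_hom_closed[OF rho_pull_add_hom[OF F G p] u] and v' = add_hom_closed[OF tau_pull_add_hom[OF E F p] v]
  have "gr_pull_map x (tau U k 0) (rho U k 0) E G D (cup E F G k p q s u v) =
    gr_comp X (gr_pull (tau U k 0 \<cdot> x) E) s
      (gr_pull_map x (mid k p) (rho U k 0) F G q (bi_pull U (rho U k p) F G p q u))
      (gr_pull_map x (tau U k 0) (mid k p) E F s (bi_pull U (tau U k (k - p)) E F (k - p) s v))"
    unfolding cup_def
    by (rule gr_pull_map_comp[OF x tau_map[OF le0] mid_map[OF p] rho_map[OF le0] E F G v' u' D'])
  also have "gr_pull_map x (mid k p) (rho U k 0) F G q (bi_pull U (rho U k p) F G p q u) =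
      gr_pull_map (rho U k p \<cdot> x) (tau U p 0) (rho U p 0) F G q u"
    using gr_pull_map_pull_map[OF x rho_map[OF p] tau_map[OF le0] rho_map[OF le0] F G] u rho_rho[OF le0 p]
    by (simp add: bi_pull_def bi_hom_def)
  also have "gr_pull_map x (tau U k 0) (mid k p) E F s (bi_pull U (tau U k (k - p)) E F (k - p) s v) =
      gr_pull_map (tau U k (k - p) \<cdot> x) (tau U (k - p) 0) (rho U (k - p) 0) E F s v"
    using gr_pull_map_pull_map[OF x tau_map[OF diff_le_self[of k p]] tau_map[OF le0] rho_map[OF le0] E F] v
      tau_tau[OF le0 diff_le_self, of k p] mid_eq[OF p] by (simp add: bi_pull_def bi_hom_def)
  finally show ?thesis .
qed

text \<open>The last, the middle and the first vertex carry their own maps f, g and h. The map may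
  thus change at the middle vertex, which is what happens when a homotopy acts on one factor
  only.\<close>

lemma transport_cup:
  assumes u: "u \<in> bi_maps U F G p q" and v: "v \<in> bi_maps U E F (k - p) s"
    and T: "transport X (lev U k) X0 (lev U 0) x (tau U k 0) t' f"
    and R: "transport X (lev U k) X0 (lev U 0) x (mid k p) r' g"
    and W: "transport X (lev U k) X0 (lev U 0) x (rho U k 0) w' h"
  shows "gr_transport x (tau U k 0) (rho U k 0) t' w' f h E G D (cup E F G k p q s u v) =
    gr_comp X (gr_pull t' (gr_pull f E)) s
      (gr_transport (rho U k p \<cdot> x) (tau U p 0) (rho U p 0) r' w' g h F G q u)
      (gr_transport (tau U k (k - p) \<cdot> x) (tau U (k - p) 0) (rho U (k - p) 0) t' r' f g E F s v)"
proof -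
  note x = transport.q[OF T]
  note u' = add_hom_closed[OF rho_pull_add_hom[OF F G p] u] and v' = add_hom_closed[OF tau_pull_add_hom[OF E F p] v]
  have "gr_transport x (tau U k 0) (rho U k 0) t' w' f h E G D (cup E F G k p q s u v) =
    gr_comp X (gr_pull t' (gr_pull f E)) s
      (gr_transport x (mid k p) (rho U k 0) r' w' g h F G q (bi_pull U (rho U k p) F G p q u))
      (gr_transport x (tau U k 0) (mid k p) t' r' f g E F s (bi_pull U (tau U k (k - p)) E F (k - p) s v))"
    unfolding cup_def by (rule gr_transport_comp[OF T R W E F G v' u' D'])
  also have "gr_transport x (mid k p) (rho U k 0) r' w' g h F G q (bi_pull U (rho U k p) F G p q u) =
      gr_transport (rho U k p \<cdot> x) (tau U p 0) (rho U p 0) r' w' g h F G q u"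
    using gr_transport_pull_map[OF rho_map[OF p] x tau_map[OF le0] rho_map[OF le0] F G] u rho_rho[OF le0 p]
    by (simp add: bi_pull_def bi_hom_def)
  also have "gr_transport x (tau U k 0) (mid k p) t' r' f g E F s (bi_pull U (tau U k (k - p)) E F (k - p) s v) =
      gr_transport (tau U k (k - p) \<cdot> x) (tau U (k - p) 0) (rho U (k - p) 0) t' r' f g E F s v"
    using gr_transport_pull_map[OF tau_map[OF diff_le_self[of k p]] x tau_map[OF le0] rho_map[OF le0] E F] v
      tau_tau[OF le0 diff_le_self, of k p] mid_eq[OF p] by (simp add: bi_pull_def bi_hom_def)
  finally show ?thesis .
qed

end

text \<open>Both sides equal the triple composite of w on the front face, v on the face of middle
  vertices p..p+r, reached through \<open>?m\<close>, and u on the back face.\<close>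

lemma cup_assoc:
  assumes E: "graded U E" and F: "graded U F" and G: "graded U G" and H: "graded U H"
    and p: "p + r \<le> k" and w: "w \<in> bi_maps U G H p a" and v: "v \<in> bi_maps U F G r b"
    and u: "u \<in> bi_maps U E F (k - (p + r)) c" and D: "D = b + c" and D': "D' = a + b"
  shows "cup E G H k p a D w (cup E F G (k - p) r b c v u) = cup E F H k (p + r) D' c (cup F G H (p + r) p a b w v) u"
proof -
  have pk: "p \<le> k" and rk: "r \<le> k - p" and kpr: "k - p - r = k - (p + r)" using p by simp_all
  have u': "u \<in> bi_maps U E F (k - p - r) c" using u by (simp add: kpr)
  have v': "v \<in> bi_maps U F G (p + r - p) b" using v by simp
  let ?w = "bi_pull U (rho U k p) G H p a w" and ?u = "bi_pull U (tau U k (k - (p + r))) E F (k - (p + r)) c u"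
  let ?m = "tau U (p + r) r \<cdot> rho U k (p + r)"
  have m: "rho U (k - p) r \<cdot> tau U k (k - p) = ?m" using rho_tau[where r = r and l = "k - (p + r)" and p = p] p
    by (simp add: add.assoc[symmetric] del: add.assoc)
  have mr: "rs_map (lev U k) (lev U r) ?m" by (rule rs_map_comp[OF rho_map[OF p] tau_map]) simp
  let ?v = "gr_pull_map ?m (tau U r 0) (rho U r 0) F G b v"
  have wh: "?w \<in> gr_maps (lev U k) (gr_pull (mid k p) G) (gr_pull (rho U k 0) H) a"
    by (rule add_hom_closed[OF rho_pull_add_hom[OF G H pk] w])
  have uh: "?u \<in> gr_maps (lev U k) (gr_pull (tau U k 0) E) (gr_pull (mid k (p + r)) F) c"
    by (rule add_hom_closed[OF tau_pull_add_hom[OF E F p] u])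
  \<comment> \<open>The middle face runs from vertex p to vertex p + r. This equation and the next
    identify its two ends, so that the three factors can be composed.\<close>
  have st: "tau U r 0 \<cdot> ?m = mid k (p + r)"
    using rs_map_assoc[OF rho_map[OF p] tau_map tau_map, of r 0] tau_tau[of 0 r "p + r"] by simp
  have sr: "rho U r 0 \<cdot> ?m = mid k p"
  proof -
    have "rho U r 0 \<cdot> ?m = (rho U r 0 \<cdot> tau U (p + r) r) \<cdot> rho U k (p + r)"
      using rs_map_assoc[OF rho_map[OF p] tau_map rho_map, of r 0] by simp
    also have "rho U r 0 \<cdot> tau U (p + r) r = tau U p 0 \<cdot> rho U (p + r) p" using mid_eq[of p "p + r"] by simp
    also have "\<dots> \<cdot> rho U k (p + r) = mid k p"
      using rs_map_assoc[OF rho_map[OF p] rho_map tau_map, of p 0] rho_rho[of p "p + r" k] p by simp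
    finally show ?thesis .
  qed
  have vh: "?v \<in> gr_maps (lev U k) (gr_pull (mid k (p + r)) F) (gr_pull (mid k p) G) b"
    using gr_pull_map_closed[OF mr tau_map[OF le0] rho_map[OF le0] F G, of v b] v by (simp add: bi_hom_def st sr)
  have "cup E G H k p a D w (cup E F G (k - p) r b c v u) =
      gr_comp (lev U k) (gr_pull (tau U k 0) E) D ?w (gr_comp (lev U k) (gr_pull (tau U k 0) E) c ?v ?u)"
    unfolding cup_def[of E G H] bi_pull_def[of U "tau U k (k - p)"]
    using pull_cup[OF E F G rk D v u' tau_map[OF diff_le_self]] tau_tau[OF le0 diff_le_self, of k p]
      tau_tau[of "k - (p + r)" "k - p" k] p by (simp add: m kpr bi_pull_def)
  also have "\<dots> = gr_comp (lev U k) (gr_pull (tau U k 0) E) c (gr_comp (lev U k) (gr_pull (mid k (p + r)) F) b ?w ?v) ?u"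
    using D by (intro gr_comp_assoc[OF gr_module_pull[OF tau_map[OF le0] E] gr_module_pull[OF mid_map[OF p] F]
        gr_module_pull[OF mid_map[OF pk] G] _ gr_module_pull[OF rho_map[OF le0] H] uh vh wh, symmetric]) simp
  also have "gr_comp (lev U k) (gr_pull (mid k (p + r)) F) b ?w ?v =
      bi_pull U (rho U k (p + r)) F H (p + r) D' (cup F G H (p + r) p a b w v)"
    unfolding bi_pull_def[of U "rho U k (p + r)"]
    using pull_cup[OF F G H _ D' w v' rho_map[OF p]] rho_rho[of p "p + r" k] p by (simp add: bi_pull_def)
  finally show ?thesis unfolding cup_def[of E F H] .
qed

section \<open>Inner faces, pullback and products\<close>

lemma face_pull_add_hom:
  assumes E: "graded U E" and F: "graded U F" and j: "1 \<le> j" "j < k"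
  shows "add_hom (bi_hom U E F (k - 1) q) (bi_hom U E F k q) (bi_pull U (face U k j) E F (k - 1) q)"
proof -
  obtain k' where k: "k = Suc k'" using j by (cases k) auto
  have "tau U k' 0 \<cdot> face U k j = tau U k 0" "rho U k' 0 \<cdot> face U k j = rho U k 0"
    using tau_face_le[of 0 k' j] rho_face_gt[of 0 j k'] j k by simp_all
  then show ?thesis using gr_pull_map_add_hom[OF face_map[of j k'] tau_map[OF le0] rho_map[OF le0] E F, of q] j k
    by (simp add: bi_hom_def bi_pull_def[abs_def])
qed

lemma face_face_pull:
  assumes E: "graded U E" and F: "graded U F" and u: "u \<in> bi_maps U E F (k - 2) q"
    and ij: "1 \<le> i" "i < j" "j < k"
  shows "bi_pull U (face U k j) E F (k - 1) q (bi_pull U (face U (k - 1) i) E F (k - 2) q u) =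
    bi_pull U (face U k i) E F (k - 1) q (bi_pull U (face U (k - 1) (j - 1)) E F (k - 2) q u)"
proof -
  obtain l where k: "k = Suc (Suc l)" using ij by (cases k; cases "k - 1") auto
  have u': "u \<in> gr_maps (lev U l) (gr_pull (tau U l 0) E) (gr_pull (rho U l 0) F) q"
    using u k by (simp add: bi_hom_def)
  have eq: "tau U l 0 \<cdot> face U (Suc l) a = tau U (Suc l) 0" "rho U l 0 \<cdot> face U (Suc l) a = rho U (Suc l) 0"
    if "1 \<le> a" "a \<le> l" for a using tau_face_le[of 0 l a] rho_face_gt[of 0 a l] that by simp_all
  have *: "bi_pull U (face U k b) E F (k - 1) q (bi_pull U (face U (k - 1) a) E F (k - 2) q u) =
     gr_pull_map (face U (Suc l) a \<cdot> face U (Suc (Suc l)) b) (tau U l 0) (rho U l 0) E F q u"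
    if "1 \<le> a" "a \<le> l" "b \<le> Suc l" for a b
    using gr_pull_map_pull_map[OF face_map[of b "Suc l"] face_map[of a l] tau_map[OF le0] rho_map[OF le0] E F u'] that eq[of a]
    by (simp add: bi_pull_def k)
  show ?thesis using *[of i j] *[of "j - 1" i] ij k face_face[of i j l] by simp
qed

text \<open>For j \<le> p the omitted vertex lies in the front part, so the face acts on the front
  factor, whose length grows to p + 1. For j > p, in the next lemma, it acts on the back factor with
  index j - p. The two cases give the Leibniz rule.\<close>

lemma face_cup_le:
  assumes E: "graded U E" and F: "graded U F" and G: "graded U G"
    and u: "u \<in> bi_maps U F G p q" and v: "v \<in> bi_maps U E F (k - p) s" and D: "D = q + s"
    and j: "1 \<le> j" "j \<le> p" "p \<le> k"
  shows "bi_pull U (face U (Suc k) j) E G k D (cup E F G k p q s u v) =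
    cup E F G (Suc k) (Suc p) q s (bi_pull U (face U (Suc p) j) F G p q u) v"
proof -
  have j': "j \<le> Suc k" "j \<le> k - (k - p)" using j by simp_all
  note c = pull_cup[OF E F G j(3) D u v face_map[OF j'(1)]]
  have t: "tau U k (k - p) \<cdot> face U (Suc k) j = tau U (Suc k) (k - p)" by (rule tau_face_le[OF diff_le_self j'(2)])
  have r: "rho U k p \<cdot> face U (Suc k) j = face U (Suc p) j \<cdot> rho U (Suc k) (Suc p)" by (rule rho_face_le[OF j(3,2)])
  have t0: "tau U k 0 \<cdot> face U (Suc k) j = tau U (Suc k) 0" using tau_face_le[of 0 k j] j by simp
  have tp: "tau U p 0 \<cdot> face U (Suc p) j = tau U (Suc p) 0" "rho U p 0 \<cdot> face U (Suc p) j = rho U (Suc p) 0"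
    using tau_face_le[of 0 p j] rho_face_gt[of 0 j p] j by simp_all
  have "gr_pull_map (face U (Suc p) j \<cdot> rho U (Suc k) (Suc p)) (tau U p 0) (rho U p 0) F G q u =
      gr_pull_map (rho U (Suc k) (Suc p)) (tau U (Suc p) 0) (rho U (Suc p) 0) F G q
        (gr_pull_map (face U (Suc p) j) (tau U p 0) (rho U p 0) F G q u)"
    using gr_pull_map_pull_map[OF rho_map[of "Suc p" "Suc k"] face_map[of j p] tau_map[OF le0] rho_map[OF le0] F G, of u q] u j tp
    by (simp add: bi_hom_def)
  then show ?thesis using c by (simp add: cup_def[of E F G "Suc k"] bi_pull_def t r t0)
qed

lemma face_cup_gt:
  assumes E: "graded U E" and F: "graded U F" and G: "graded U G"
    and u: "u \<in> bi_maps U F G p q" and v: "v \<in> bi_maps U E F (k - p) s" and D: "D = q + s"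
    and j: "p < j" "j \<le> k"
  shows "bi_pull U (face U (Suc k) j) E G k D (cup E F G k p q s u v) =
    cup E F G (Suc k) p q s u (bi_pull U (face U (Suc (k - p)) (j - p)) E F (k - p) s v)"
proof -
  have p: "p \<le> k" and j': "j \<le> Suc k" "k - (k - p) < j" "k - (k - p) = p" "Suc k - p = Suc (k - p)" using j by simp_all
  note c = pull_cup[OF E F G p D u v face_map[OF j'(1)]]
  have t: "tau U k (k - p) \<cdot> face U (Suc k) j = face U (Suc (k - p)) (j - p) \<cdot> tau U (Suc k) (Suc (k - p))"
    using tau_face_gt[OF diff_le_self j'(2,1)] j'(3) by simp
  have r: "rho U k p \<cdot> face U (Suc k) j = rho U (Suc k) p" by (rule rho_face_gt[OF j(1) j'(1)])
  have t0: "tau U k 0 \<cdot> face U (Suc k) j = tau U (Suc k) 0" using tau_face_le[of 0 k j] j by simp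
  have jp: "1 \<le> j - p" "j - p \<le> k - p" using j by simp_all
  have tp: "tau U (k - p) 0 \<cdot> face U (Suc (k - p)) (j - p) = tau U (Suc (k - p)) 0"
    "rho U (k - p) 0 \<cdot> face U (Suc (k - p)) (j - p) = rho U (Suc (k - p)) 0"
    using tau_face_le[of 0 "k - p" "j - p"] rho_face_gt[of 0 "j - p" "k - p"] jp by simp_all
  have "gr_pull_map (face U (Suc (k - p)) (j - p) \<cdot> tau U (Suc k) (Suc (k - p))) (tau U (k - p) 0) (rho U (k - p) 0) E F s v =
      gr_pull_map (tau U (Suc k) (Suc (k - p))) (tau U (Suc (k - p)) 0) (rho U (Suc (k - p)) 0) E F s
        (gr_pull_map (face U (Suc (k - p)) (j - p)) (tau U (k - p) 0) (rho U (k - p) 0) E F s v)"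
    using gr_pull_map_pull_map[OF tau_map[of "Suc (k - p)" "Suc k"] face_map[of "j - p" "k - p"] tau_map[OF le0] rho_map[OF le0] E F, of v s] v jp tp
    by (simp add: bi_hom_def)
  then show ?thesis using c by (simp add: cup_def[of E F G "Suc k"] bi_pull_def t r t0 j'(4))
qed

end

section \<open>Signed sums of additive maps\<close>

lemma ssum_add:
  fixes G (structure)
  assumes G: "abelian_group G" and "\<And>i. i \<in> I \<Longrightarrow> x i \<in> carrier G" "\<And>i. i \<in> I \<Longrightarrow> y i \<in> carrier G"
  shows "ssum G I n (\<lambda>i. x i \<oplus> y i) = ssum G I n x \<oplus> ssum G I n y"
proof -
  interpret abelian_group G by fact
  have "ssum G I n (\<lambda>i. x i \<oplus> y i) = (\<Oplus>i\<in>I. sgn_act G (n i) (x i) \<oplus> sgn_act G (n i) (y i))"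
    unfolding ssum_def using assms
    by (intro finsum_cong') (auto simp: sgn_act_closed[OF G] add_hom_add[OF sgn_act_add_hom[OF G]])
  also have "\<dots> = ssum G I n x \<oplus> ssum G I n y"
    unfolding ssum_def using assms by (intro finsum_addf) (auto simp: sgn_act_closed[OF G])
  finally show ?thesis .
qed

lemma ssum_single:
  fixes G (structure)
  assumes G: "abelian_group G" and I: "finite I" "j \<in> I" and x: "x j \<in> carrier G"
    and 0: "\<And>i. i \<in> I \<Longrightarrow> i \<noteq> j \<Longrightarrow> x i = \<zero>"
  shows "ssum G I n x = sgn_act G (n j) (x j)"
proof -
  interpret abelian_group G by fact
  have "ssum G I n x = (\<Oplus>i\<in>I. if j = i then sgn_act G (n i) (x i) else \<zero>)"
    unfolding ssum_def using x 0 by (intro finsum_cong') (auto simp: sgn_act_closed[OF G] sgn_act_def)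
  also have "\<dots> = sgn_act G (n j) (x j)"
  proof -
    have "I = insert j (I - {j})" using I by auto
    moreover have "(\<Oplus>i\<in>insert j (I - {j}). if j = i then sgn_act G (n i) (x i) else \<zero>) =
        sgn_act G (n j) (x j) \<oplus> (\<Oplus>i\<in>I - {j}. if j = i then sgn_act G (n i) (x i) else \<zero>)"
      using I x by (subst finsum_insert) (auto simp: sgn_act_closed[OF G])
    moreover have "(\<Oplus>i\<in>I - {j}. if j = i then sgn_act G (n i) (x i) else \<zero>) = (\<Oplus>i\<in>I - {j}. \<zero>)"
      by (intro finsum_cong') auto
    ultimately show ?thesis using x by (simp add: sgn_act_closed[OF G])
  qed
  finally show ?thesis .
qed

lemma ssum_add_hom:
  assumes H: "abelian_group H" and f: "\<And>i. i \<in> I \<Longrightarrow> add_hom (G i) H (f i)"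
    and x: "\<And>i. i \<in> I \<Longrightarrow> x i \<in> carrier (G i)" and y: "\<And>i. i \<in> I \<Longrightarrow> y i \<in> carrier (G i)"
    and z: "\<And>i. i \<in> I \<Longrightarrow> z i = x i \<oplus>\<^bsub>G i\<^esub> y i"
  shows "ssum H I n (\<lambda>i. f i (z i)) = ssum H I n (\<lambda>i. f i (x i)) \<oplus>\<^bsub>H\<^esub> ssum H I n (\<lambda>i. f i (y i))"
proof -
  interpret abelian_group H by fact
  note cl = add_hom_closed[OF f x] add_hom_closed[OF f y]
  have "ssum H I n (\<lambda>i. f i (z i)) = ssum H I n (\<lambda>i. f i (x i) \<oplus>\<^bsub>H\<^esub> f i (y i))"
    by (rule ssum_cong[OF H refl]) (simp_all add: z cl add_hom_add[OF f x y])
  also have "\<dots> = ssum H I n (\<lambda>i. f i (x i)) \<oplus>\<^bsub>H\<^esub> ssum H I n (\<lambda>i. f i (y i))" by (rule ssum_add[OF H cl])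
  finally show ?thesis .
qed

text \<open>Turns an iterated signed sum with additive maps in between into one sum over pairs,
  ready for \<open>ssum_reindex\<close>. The groups \<open>G i\<close> vary because the bidegree of
  an inner sum may depend on the outer index.\<close>

lemma ssum_hom_nested:
  assumes H: "abelian_group H" and G: "\<And>i. i \<in> I \<Longrightarrow> abelian_group (G i)"
    and f: "\<And>i. i \<in> I \<Longrightarrow> add_hom (G i) H (f i)" and I: "finite I" "\<And>i. i \<in> I \<Longrightarrow> finite (J i)"
    and y: "\<And>i. i \<in> I \<Longrightarrow> y i = ssum (G i) (J i) (m i) (x i)"
    and x: "\<And>i j. i \<in> I \<Longrightarrow> j \<in> J i \<Longrightarrow> x i j \<in> carrier (G i)"
  shows "ssum H I n (\<lambda>i. f i (y i)) = ssum H (Sigma I J) (\<lambda>(i, j). n i + m i j) (\<lambda>(i, j). f i (x i j))"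
proof -
  have cl: "f i (x i j) \<in> carrier H" if "i \<in> I" "j \<in> J i" for i j
    using add_hom_closed[OF f[OF that(1)] x[OF that]] .
  have "ssum H I n (\<lambda>i. f i (y i)) = ssum H I n (\<lambda>i. ssum H (J i) (m i) (\<lambda>j. f i (x i j)))"
    using cl by (intro ssum_cong[OF H]) (simp_all add: ssum_closed[OF H] y ssum_hom[OF G H f x])
  also have "\<dots> = ssum H (Sigma I J) (\<lambda>(i, j). n i + m i j) (\<lambda>(i, j). f i (x i j))" by (rule ssum_Sigma[OF H I cl])
  finally show ?thesis .
qed

context simplicial
begin

section \<open>Bigraded families\<close>

lemma tw_hom_simps: "\<theta> \<in> tw_maps U E F m \<longleftrightarrow> (\<forall>k. \<theta> k \<in> bi_maps U E F k (m - int k))"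
  "\<zero>\<^bsub>tw_hom U E F m\<^esub> = (\<lambda>k. \<zero>\<^bsub>bi_hom U E F k (m - int k)\<^esub>)"
  "\<theta> \<oplus>\<^bsub>tw_hom U E F m\<^esub> \<eta> = (\<lambda>k. \<theta> k \<oplus>\<^bsub>bi_hom U E F k (m - int k)\<^esub> \<eta> k)" by (simp_all add: tw_hom_def)

lemma tw_homD: "\<theta> \<in> tw_maps U E F m \<Longrightarrow> d = m - int k \<Longrightarrow> \<theta> k \<in> bi_maps U E F k d" by (simp add: tw_hom_simps)

lemma tw_hom_abelian:
  assumes E: "graded U E" and F: "graded U F"
  shows "abelian_group (tw_hom U E F m)"
proof -
  note B = bi_hom_abelian[OF E F]
  show ?thesis
  proof (rule abelian_groupI, unfold tw_hom_simps)
    fix u assume u: "\<forall>k. u k \<in> bi_maps U E F k (m - int k)"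
    show "(\<lambda>k. \<zero>\<^bsub>bi_hom U E F k (m - int k)\<^esub> \<oplus>\<^bsub>bi_hom U E F k (m - int k)\<^esub> u k) = u"
      using u abelian_groupE(5)[OF B] by (intro ext) simp
    show "\<exists>y\<in>tw_maps U E F m. (\<lambda>k. y k \<oplus>\<^bsub>bi_hom U E F k (m - int k)\<^esub> u k) = (\<lambda>k. \<zero>\<^bsub>bi_hom U E F k (m - int k)\<^esub>)"
      using u by (intro bexI[of _ "\<lambda>k. \<ominus>\<^bsub>bi_hom U E F k (m - int k)\<^esub> u k"] ext)
        (simp_all add: abelian_group.l_neg[OF B] tw_hom_simps abelian_group.a_inv_closed[OF B])
    fix v assume v: "\<forall>k. v k \<in> bi_maps U E F k (m - int k)"
    show "\<forall>k. u k \<oplus>\<^bsub>bi_hom U E F k (m - int k)\<^esub> v k \<in> bi_maps U E F k (m - int k)"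
      using u v abelian_groupE(1)[OF B] by simp
    show "(\<lambda>k. u k \<oplus>\<^bsub>bi_hom U E F k (m - int k)\<^esub> v k) = (\<lambda>k. v k \<oplus>\<^bsub>bi_hom U E F k (m - int k)\<^esub> u k)"
      using u v abelian_groupE(4)[OF B] by (intro ext) simp
    fix w assume w: "\<forall>k. w k \<in> bi_maps U E F k (m - int k)"
    show "(\<lambda>k. u k \<oplus>\<^bsub>bi_hom U E F k (m - int k)\<^esub> v k \<oplus>\<^bsub>bi_hom U E F k (m - int k)\<^esub> w k) =
       (\<lambda>k. u k \<oplus>\<^bsub>bi_hom U E F k (m - int k)\<^esub> (v k \<oplus>\<^bsub>bi_hom U E F k (m - int k)\<^esub> w k))"
      using u v w abelian_groupE(3)[OF B] by (intro ext) simp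
  qed (use abelian_groupE(2)[OF B] in simp)
qed

lemma tw_sgn_act:
  assumes E: "graded U E" and F: "graded U F" and u: "u \<in> tw_maps U E F m"
  shows "sgn_act (tw_hom U E F m) n u k = sgn_act (bi_hom U E F k (m - int k)) n (u k)"
proof -
  note B = bi_hom_abelian[OF E F]
  have "\<ominus>\<^bsub>tw_hom U E F m\<^esub> u = (\<lambda>k. \<ominus>\<^bsub>bi_hom U E F k (m - int k)\<^esub> u k)"
    using u by (intro abelian_group.minus_equality[OF tw_hom_abelian[OF E F]])
      (simp_all add: tw_hom_simps abelian_group.l_neg[OF B] abelian_group.a_inv_closed[OF B])
  then show ?thesis by (simp add: sgn_act_def)
qed

lemma tw_delta_eq: "tw_delta U E F m \<theta> k = ssum (bi_hom U E F k (m + 1 - int k)) {1..<k} int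
     (\<lambda>j. bi_pull U (face U k j) E F (k - 1) (m - int (k - 1)) (\<theta> (k - 1)))"
  by (simp add: tw_delta_def ssum_def)

lemma tw_comp_eq:
  "tw_comp U E F G m m' u v k = ssum (bi_hom U E G k (m + m' - int k)) {..k} (\<lambda>p. (m - int p) * int (k - p))
     (\<lambda>p. cup E F G k p (m - int p) (m' - int (k - p)) (u p) (v (k - p)))"
  by (simp add: tw_comp_def ssum_def Let_def cup_def)

lemma delta_term_add_hom:
  assumes "graded U E" "graded U F" "1 \<le> j" "j < k"
  shows "add_hom (bi_hom U E F (k - 1) (m - int (k - 1))) (bi_hom U E F k (m + 1 - int k))
    (bi_pull U (face U k j) E F (k - 1) (m - int (k - 1)))"
proof -
  \<comment> \<open>The bounds on j make k - 1 a true predecessor. The internal degree is the same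
    on both sides: \<delta> raises only the simplicial degree.\<close>
  have "m - int (k - 1) = m + 1 - int k" using assms by (simp add: of_nat_diff)
  then show ?thesis using face_pull_add_hom[OF assms] by metis
qed

lemma delta_term_closed:
  assumes "graded U E" "graded U F" "1 \<le> j" "j < k" "\<theta> \<in> tw_maps U E F m"
  shows "bi_pull U (face U k j) E F (k - 1) (m - int (k - 1)) (\<theta> (k - 1)) \<in> bi_maps U E F k (m + 1 - int k)"
  by (rule add_hom_closed[OF delta_term_add_hom[OF assms(1-4)] tw_homD[OF assms(5) refl]])

lemma cup_deg: "p \<le> k \<Longrightarrow> m + m' - int k = (m - int p) + (m' - int (k - p))" by (simp add: of_nat_diff)

lemma comp_term_closed:
  assumes "graded U E" "graded U F" "graded U G" "p \<le> k" "u \<in> tw_maps U F G m" "v \<in> tw_maps U E F m'"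
  shows "cup E F G k p (m - int p) (m' - int (k - p)) (u p) (v (k - p)) \<in> bi_maps U E G k (m + m' - int k)"
  by (rule cup_closed[OF assms(1-4) cup_deg[OF assms(4)] tw_homD[OF assms(5) refl] tw_homD[OF assms(6) refl]])

lemma comp_term_hom_left:
  assumes "graded U E" "graded U F" "graded U G" "p \<le> k" "v \<in> tw_maps U E F m'" "n = m + m'"
  shows "add_hom (bi_hom U F G p (m - int p)) (bi_hom U E G k (n - int k))
    (\<lambda>u. cup E F G k p (m - int p) (m' - int (k - p)) u (v (k - p)))"
  unfolding assms(6) by (rule cup_add_hom_left[OF assms(1-4) cup_deg[OF assms(4)] tw_homD[OF assms(5) refl]])

lemma comp_term_hom_right:
  assumes "graded U E" "graded U F" "graded U G" "p \<le> k" "u \<in> tw_maps U F G m" "n = m + m'"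
  shows "add_hom (bi_hom U E F (k - p) (m' - int (k - p))) (bi_hom U E G k (n - int k))
    (cup E F G k p (m - int p) (m' - int (k - p)) (u p))"
  unfolding assms(6) by (rule cup_add_hom_right[OF assms(1-4) cup_deg[OF assms(4)] tw_homD[OF assms(5) refl]])

lemma tw_delta_add_hom:
  assumes E: "graded U E" and F: "graded U F"
  shows "add_hom (tw_hom U E F m) (tw_hom U E F (m + 1)) (tw_delta U E F m)"
proof (rule add_homI)
  note B = bi_hom_abelian[OF E F]
  fix u assume u: "u \<in> tw_maps U E F m"
  show "tw_delta U E F m u \<in> tw_maps U E F (m + 1)"
    unfolding tw_hom_simps tw_delta_eq using delta_term_closed[OF E F _ _ u] by (intro allI ssum_closed[OF B]) simp
  fix v assume v: "v \<in> tw_maps U E F m"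
  show "tw_delta U E F m (u \<oplus>\<^bsub>tw_hom U E F m\<^esub> v) = tw_delta U E F m u \<oplus>\<^bsub>tw_hom U E F (m + 1)\<^esub> tw_delta U E F m v"
  proof (rule ext)
    fix k
    show "tw_delta U E F m (u \<oplus>\<^bsub>tw_hom U E F m\<^esub> v) k = (tw_delta U E F m u \<oplus>\<^bsub>tw_hom U E F (m + 1)\<^esub> tw_delta U E F m v) k"
      unfolding tw_hom_simps tw_delta_eq
      by (rule ssum_add_hom[OF B, where G = "\<lambda>_. bi_hom U E F (k - 1) (m - int (k - 1))"
            and f = "\<lambda>j. bi_pull U (face U k j) E F (k - 1) (m - int (k - 1))" and x = "\<lambda>_. u (k - 1)" and y = "\<lambda>_. v (k - 1)"])
        (simp_all only: delta_term_add_hom[OF E F] tw_homD[OF u refl] tw_homD[OF v refl] atLeastLessThan_iff)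
  qed
qed

lemma tw_comp_add_hom_left:
  assumes E: "graded U E" and F: "graded U F" and G: "graded U G"
    and v: "v \<in> tw_maps U E F m'"
  shows "add_hom (tw_hom U F G m) (tw_hom U E G (m + m')) (\<lambda>u. tw_comp U E F G m m' u v)"
proof (rule add_homI)
  note B = bi_hom_abelian[OF E G]
  fix u assume u: "u \<in> tw_maps U F G m"
  show "tw_comp U E F G m m' u v \<in> tw_maps U E G (m + m')"
    unfolding tw_hom_simps tw_comp_eq using comp_term_closed[OF E F G _ u v] by (intro allI ssum_closed[OF B]) simp
  fix u' assume u': "u' \<in> tw_maps U F G m"
  show "tw_comp U E F G m m' (u \<oplus>\<^bsub>tw_hom U F G m\<^esub> u') v =
      tw_comp U E F G m m' u v \<oplus>\<^bsub>tw_hom U E G (m + m')\<^esub> tw_comp U E F G m m' u' v"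
  proof (rule ext)
    fix k
    show "tw_comp U E F G m m' (u \<oplus>\<^bsub>tw_hom U F G m\<^esub> u') v k =
      (tw_comp U E F G m m' u v \<oplus>\<^bsub>tw_hom U E G (m + m')\<^esub> tw_comp U E F G m m' u' v) k"
      unfolding tw_hom_simps tw_comp_eq
      by (rule ssum_add_hom[OF B, where G = "\<lambda>p. bi_hom U F G p (m - int p)" and x = u and y = u'
            and f = "\<lambda>p u. cup E F G k p (m - int p) (m' - int (k - p)) u (v (k - p))"])
        (simp_all only: comp_term_hom_left[OF E F G _ v refl] tw_homD[OF u refl] tw_homD[OF u' refl] atMost_iff)
  qed
qed

lemma tw_comp_add_hom_right:
  assumes E: "graded U E" and F: "graded U F" and G: "graded U G"
    and u: "u \<in> tw_maps U F G m"
  shows "add_hom (tw_hom U E F m') (tw_hom U E G (m + m')) (tw_comp U E F G m m' u)"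
proof (rule add_homI)
  note B = bi_hom_abelian[OF E G]
  fix v assume v: "v \<in> tw_maps U E F m'"
  show "tw_comp U E F G m m' u v \<in> tw_maps U E G (m + m')"
    by (rule add_hom_closed[OF tw_comp_add_hom_left[OF E F G v] u])
  fix v' assume v': "v' \<in> tw_maps U E F m'"
  show "tw_comp U E F G m m' u (v \<oplus>\<^bsub>tw_hom U E F m'\<^esub> v') =
      tw_comp U E F G m m' u v \<oplus>\<^bsub>tw_hom U E G (m + m')\<^esub> tw_comp U E F G m m' u v'"
  proof (rule ext)
    fix k
    show "tw_comp U E F G m m' u (v \<oplus>\<^bsub>tw_hom U E F m'\<^esub> v') k =
      (tw_comp U E F G m m' u v \<oplus>\<^bsub>tw_hom U E G (m + m')\<^esub> tw_comp U E F G m m' u v') k"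
      unfolding tw_hom_simps tw_comp_eq
      by (rule ssum_add_hom[OF B, where G = "\<lambda>p. bi_hom U E F (k - p) (m' - int (k - p))" and x = "\<lambda>p. v (k - p)" and y = "\<lambda>p. v' (k - p)"
            and f = "\<lambda>p. cup E F G k p (m - int p) (m' - int (k - p)) (u p)"])
        (simp_all only: comp_term_hom_right[OF E F G _ u refl] tw_homD[OF v refl] tw_homD[OF v' refl] atMost_iff)
  qed
qed

lemma tw_comp_closed:
  assumes "graded U E" "graded U F" "graded U G" "u \<in> tw_maps U F G m" "v \<in> tw_maps U E F m'" "n = m + m'"
  shows "tw_comp U E F G m m' u v \<in> tw_maps U E G n"
  unfolding assms(6) by (rule add_hom_closed[OF tw_comp_add_hom_right[OF assms(1-4)] assms(5)])

lemma tw_delta_closed: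
  assumes "graded U E" "graded U F" "u \<in> tw_maps U E F m" "n = m + 1"
  shows "tw_delta U E F m u \<in> tw_maps U E F n"
  unfolding assms(4) by (rule add_hom_closed[OF tw_delta_add_hom[OF assms(1,2)] assms(3)])

text \<open>The simplicial identity matches a pair (j, i) with i < j to (i, j - 1), whose exponent
  is smaller by one. These pairs and the remaining ones therefore cancel.\<close>

lemma tw_delta_delta:
  assumes E: "graded U E" and F: "graded U F" and u: "u \<in> tw_maps U E F m"
  shows "tw_delta U E F (m + 1) (tw_delta U E F m u) = \<zero>\<^bsub>tw_hom U E F (m + 2)\<^esub>" (is "?lhs = ?rhs")
proof (rule ext)
  fix k
  note B = bi_hom_abelian[OF E F]
  let ?H = "bi_hom U E F k (m + 2 - int k)"
  interpret H: abelian_group ?H by (rule B)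
  let ?T = "\<lambda>(j, i). bi_pull U (face U k j) E F (k - 1) (m + 1 - int (k - 1))
     (bi_pull U (face U (k - 1) i) E F (k - 2) (m - int (k - 2)) (u (k - 2)))"
  let ?I = "Sigma {1..<k} (\<lambda>_. {1..<k - 1})"
  have k2: "k - 1 - 1 = k - 2" by simp
  have hom: "add_hom (bi_hom U E F (k - 1) (m + 1 - int (k - 1))) ?H (bi_pull U (face U k j) E F (k - 1) (m + 1 - int (k - 1)))"
    if "j \<in> {1..<k}" for j
    using delta_term_add_hom[OF E F, of j k "m + 1"] that by (simp add: add.assoc)
  have cl: "bi_pull U (face U (k - 1) i) E F (k - 2) (m - int (k - 2)) (u (k - 2)) \<in> bi_maps U E F (k - 1) (m + 1 - int (k - 1))"
    if "i \<in> {1..<k - 1}" for i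
  proof -
    have "m + 1 - int (k - 1) = m - int (k - 2)" using that unfolding atLeastLessThan_iff by arith
    then show ?thesis using delta_term_closed[OF E F _ _ u, of i "k - 1"] that by (simp only: k2 atLeastLessThan_iff)
  qed
  have T: "?T ji \<in> carrier ?H" if "ji \<in> ?I" for ji using that add_hom_closed[OF hom cl] by auto
  have "tw_delta U E F (m + 1) (tw_delta U E F m u) k =
      ssum ?H {1..<k} int (\<lambda>j. bi_pull U (face U k j) E F (k - 1) (m + 1 - int (k - 1)) (tw_delta U E F m u (k - 1)))"
    by (simp add: tw_delta_eq[of E F "m + 1"] add.assoc)
  also have "\<dots> = ssum ?H ?I (\<lambda>(j, i). int j + int i) (\<lambda>(j, i). bi_pull U (face U k j) E F (k - 1) (m + 1 - int (k - 1))
     (bi_pull U (face U (k - 1) i) E F (k - 2) (m - int (k - 2)) (u (k - 2))))"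
    by (rule ssum_hom_nested[OF B B hom]) (simp_all only: tw_delta_eq k2 cl finite_atMost finite_atLeastLessThan)
  also have "\<dots> = ssum ?H {x \<in> ?I. snd x < fst x} (\<lambda>(j, i). int j + int i) ?T \<oplus>\<^bsub>?H\<^esub>
      ssum ?H {x \<in> ?I. \<not> snd x < fst x} (\<lambda>(j, i). int j + int i) ?T"
    by (rule ssum_split[OF B _ T]) simp_all
  also have "ssum ?H {x \<in> ?I. snd x < fst x} (\<lambda>(j, i). int j + int i) ?T =
      ssum ?H {x \<in> ?I. \<not> snd x < fst x} (\<lambda>x. 1 + (\<lambda>(j, i). int j + int i) x) ?T"
  proof (rule ssum_reindex[OF B, where \<pi> = "\<lambda>(j, i). (i, j - 1)" and \<rho> = "\<lambda>(a, b). (b + 1, a)"])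
    fix x assume xI: "x \<in> {x \<in> ?I. snd x < fst x}"
    then show "?T x \<in> carrier ?H" using T by blast
    from xI obtain j i where x: "x = (j, i)" "1 \<le> i" "i < j" "j < k" by (cases x) auto
    have d: "m - int (k - 2) = m + 1 - int (k - 1)" using x(2-) by arith
    have "u (k - 2) \<in> bi_maps U E F (k - 2) (m + 1 - int (k - 1))" by (rule tw_homD[OF u d[symmetric]])
    from face_face_pull[OF E F this x(2-4)]
    show "?T x = ?T (case x of (j, i) \<Rightarrow> (i, j - 1))" by (simp add: x(1) d)
  qed auto
  also have "\<dots> = sgn_act ?H 1 (ssum ?H {x \<in> ?I. \<not> snd x < fst x} (\<lambda>(j, i). int j + int i) ?T)"
    by (rule sgn_act_ssum[OF B, symmetric]) (use T in blast)
  also have "\<dots> \<oplus>\<^bsub>?H\<^esub> ssum ?H {x \<in> ?I. \<not> snd x < fst x} (\<lambda>(j, i). int j + int i) ?T = \<zero>\<^bsub>?H\<^esub>"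
    using H.l_neg[OF ssum_closed[OF B, of "{x \<in> ?I. \<not> snd x < fst x}" ?T]] T by (simp add: sgn_act_def)
  finally show "?lhs k = ?rhs k" by (simp add: tw_hom_simps)
qed

text \<open>Splitting first at p and then r further on, or first at p + r and then at p, gives the
  same triple product by \<open>cup_assoc\<close>. Under (p, r) \<mapsto> (p + r, p) the exponents
  are equal, not just congruent.\<close>

lemma tw_comp_assoc:
  assumes E: "graded U E" and F: "graded U F" and G: "graded U G" and H: "graded U H"
    and w: "w \<in> tw_maps U G H m1" and v: "v \<in> tw_maps U F G m2" and u: "u \<in> tw_maps U E F m3"
  shows "tw_comp U E G H m1 (m2 + m3) w (tw_comp U E F G m2 m3 v u) =
    tw_comp U E F H (m1 + m2) m3 (tw_comp U F G H m1 m2 w v) u" (is "?lhs = ?rhs")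
proof (rule ext)
  fix k
  note BEH = bi_hom_abelian[OF E H] and BEG = bi_hom_abelian[OF E G] and BFH = bi_hom_abelian[OF F H]
  let ?H = "bi_hom U E H k (m1 + m2 + m3 - int k)"
  have deg: "m1 + (m2 + m3) - int k = m1 + m2 + m3 - int k" by simp
  let ?L = "\<lambda>(p, r). cup E G H k p (m1 - int p) (m2 + m3 - int (k - p)) (w p)
     (cup E F G (k - p) r (m2 - int r) (m3 - int (k - p - r)) (v r) (u (k - p - r)))"
  let ?R = "\<lambda>(P, p). cup E F H k P (m1 + m2 - int P) (m3 - int (k - P))
     (cup F G H P p (m1 - int p) (m2 - int (P - p)) (w p) (v (P - p))) (u (k - P))"
  have hL: "add_hom (bi_hom U E G (k - p) (m2 + m3 - int (k - p))) ?H (cup E G H k p (m1 - int p) (m2 + m3 - int (k - p)) (w p))"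
    if "p \<in> {..k}" for p by (rule comp_term_hom_right[OF E G H _ w]) (use that in simp_all)
  have cL: "cup E F G (k - p) r (m2 - int r) (m3 - int (k - p - r)) (v r) (u (k - p - r)) \<in> bi_maps U E G (k - p) (m2 + m3 - int (k - p))"
    if "r \<in> {..k - p}" for p r by (rule comp_term_closed[OF E F G _ v u]) (use that in simp)
  have hR: "add_hom (bi_hom U F H P (m1 + m2 - int P)) ?H (\<lambda>x. cup E F H k P (m1 + m2 - int P) (m3 - int (k - P)) x (u (k - P)))"
    if "P \<in> {..k}" for P by (rule comp_term_hom_left[OF E F H _ u]) (use that in simp_all)
  have cR: "cup F G H P p (m1 - int p) (m2 - int (P - p)) (w p) (v (P - p)) \<in> bi_maps U F H P (m1 + m2 - int P)"
    if "p \<in> {..P}" for p P by (rule comp_term_closed[OF F G H _ w v]) (use that in simp)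
  have "tw_comp U E G H m1 (m2 + m3) w (tw_comp U E F G m2 m3 v u) k =
    ssum ?H (Sigma {..k} (\<lambda>p. {..k - p})) (\<lambda>(p, r). (m1 - int p) * int (k - p) + (m2 - int r) * int (k - p - r)) ?L"
    unfolding tw_comp_eq[of E G H] deg
    by (rule ssum_hom_nested[OF BEH BEG hL]) (simp_all only: tw_comp_eq cL finite_atMost finite_atLeastLessThan)
  also have "\<dots> = ssum ?H (Sigma {..k} (\<lambda>P. {..P})) (\<lambda>(P, p). (m1 + m2 - int P) * int (k - P) + (m1 - int p) * int (P - p)) ?R"
  proof (rule ssum_reindex[OF BEH, where \<pi> = "\<lambda>(p, r). (p + r, p)" and \<rho> = "\<lambda>(P, p). (p, P - p)"])
    fix x assume "x \<in> Sigma {..k} (\<lambda>p. {..k - p})"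
    then obtain p r where x: "x = (p, r)" "p + r \<le> k" by (cases x) auto
    show "?L x \<in> carrier ?H" using add_hom_closed[OF hL cL] x by simp
    have "k - p - r = k - (p + r)" by simp
    then show "?L x = ?R (case x of (p, r) \<Rightarrow> (p + r, p))"
      using cup_assoc[OF E F G H x(2) tw_homD[OF w refl] tw_homD[OF v refl] tw_homD[OF u refl], of "m2 + m3 - int (k - p)" "m1 + m2 - int (p + r)"] x
      by (simp add: of_nat_diff)
    have "(m1 - int p) * int (k - p) + (m2 - int r) * int (k - p - r) =
        (m1 + m2 - int (p + r)) * int (k - (p + r)) + (m1 - int p) * int (p + r - p)"
      using x by (simp add: of_nat_diff algebra_simps)
    then show "even ((\<lambda>(p, r). (m1 - int p) * int (k - p) + (m2 - int r) * int (k - p - r)) x) =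
      even ((\<lambda>(P, p). (m1 + m2 - int P) * int (k - P) + (m1 - int p) * int (P - p)) (case x of (p, r) \<Rightarrow> (p + r, p)))"
      by (simp only: x(1) prod.case)
  qed auto
  also have "\<dots> = tw_comp U E F H (m1 + m2) m3 (tw_comp U F G H m1 m2 w v) u k" unfolding tw_comp_eq[of E F H]
    by (rule ssum_hom_nested[OF BEH BFH hR, symmetric]) (simp_all only: tw_comp_eq cR finite_atMost finite_atLeastLessThan)
  finally show "?lhs k = ?rhs k" .
qed

text \<open>Each inner face acts on one of the factors. Since \<delta> omits the outer faces, the
  inner faces of the two factors account exactly for those of the product, and no boundary term is
  left at the middle vertex.\<close>

lemma tw_leibniz:
  assumes E: "graded U E" and F: "graded U F" and G: "graded U G"
    and u: "u \<in> tw_maps U F G m" and v: "v \<in> tw_maps U E F m'"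
  shows "tw_delta U E G (m + m') (tw_comp U E F G m m' u v) =
    tw_comp U E F G (m + 1) m' (tw_delta U F G m u) v \<oplus>\<^bsub>tw_hom U E G (m + m' + 1)\<^esub>
    sgn_act (tw_hom U E G (m + m' + 1)) m (tw_comp U E F G m (m' + 1) u (tw_delta U E F m' v))" (is "?lhs = ?rhs")
proof (rule ext)
  fix k
  note BEG = bi_hom_abelian[OF E G] and BFG = bi_hom_abelian[OF F G] and BEF = bi_hom_abelian[OF E F]
  let ?H = "bi_hom U E G k (m + m' + 1 - int k)"
  let ?I = "Sigma {1..<k} (\<lambda>_. {..k - 1})"
  let ?n = "\<lambda>(j, p). int j + (m - int p) * int (k - 1 - p)"
  let ?T = "\<lambda>(j, p). bi_pull U (face U k j) E G (k - 1) (m + m' - int (k - 1))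
     (cup E F G (k - 1) p (m - int p) (m' - int (k - 1 - p)) (u p) (v (k - 1 - p)))"
  have hT: "add_hom (bi_hom U E G (k - 1) (m + m' - int (k - 1))) ?H (bi_pull U (face U k j) E G (k - 1) (m + m' - int (k - 1)))"
    if "j \<in> {1..<k}" for j using delta_term_add_hom[OF E G, of j k "m + m'"] that by simp
  have cT: "cup E F G (k - 1) p (m - int p) (m' - int (k - 1 - p)) (u p) (v (k - 1 - p)) \<in> bi_maps U E G (k - 1) (m + m' - int (k - 1))"
    if "p \<in> {..k - 1}" for p by (rule comp_term_closed[OF E F G _ u v]) (use that in simp)
  have T: "?T x \<in> carrier ?H" if "x \<in> ?I" for x using that add_hom_closed[OF hT cT] by auto
  let ?I1 = "Sigma {..k} (\<lambda>p. {1..<p})"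
  let ?n1 = "\<lambda>(p, j). (m + 1 - int p) * int (k - p) + int j"
  let ?T1 = "\<lambda>(p, j). cup E F G k p (m + 1 - int p) (m' - int (k - p))
     (bi_pull U (face U p j) F G (p - 1) (m - int (p - 1)) (u (p - 1))) (v (k - p))"
  have h1: "add_hom (bi_hom U F G p (m + 1 - int p)) ?H (\<lambda>x. cup E F G k p (m + 1 - int p) (m' - int (k - p)) x (v (k - p)))"
    if "p \<in> {..k}" for p by (rule comp_term_hom_left[OF E F G _ v]) (use that in simp_all)
  have c1: "bi_pull U (face U p j) F G (p - 1) (m - int (p - 1)) (u (p - 1)) \<in> bi_maps U F G p (m + 1 - int p)"
    if "j \<in> {1..<p}" for p j by (rule delta_term_closed[OF F G _ _ u]) (use that in simp_all)
  let ?I2 = "Sigma {..k} (\<lambda>p. {1..<k - p})"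
  let ?n2 = "\<lambda>(p, j). (m - int p) * int (k - p) + int j"
  let ?T2 = "\<lambda>(p, j). cup E F G k p (m - int p) (m' + 1 - int (k - p)) (u p)
     (bi_pull U (face U (k - p) j) E F (k - p - 1) (m' - int (k - p - 1)) (v (k - p - 1)))"
  have h2: "add_hom (bi_hom U E F (k - p) (m' + 1 - int (k - p))) ?H (cup E F G k p (m - int p) (m' + 1 - int (k - p)) (u p))"
    if "p \<in> {..k}" for p by (rule comp_term_hom_right[OF E F G _ u]) (use that in simp_all)
  have c2: "bi_pull U (face U (k - p) j) E F (k - p - 1) (m' - int (k - p - 1)) (v (k - p - 1)) \<in> bi_maps U E F (k - p) (m' + 1 - int (k - p))"
    if "j \<in> {1..<k - p}" for p j by (rule delta_term_closed[OF E F _ _ v]) (use that in simp_all)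
  have T2: "?T2 x \<in> carrier ?H" if "x \<in> ?I2" for x using that add_hom_closed[OF h2 c2] by auto
  have "tw_delta U E G (m + m') (tw_comp U E F G m m' u v) k = ssum ?H ?I ?n ?T" unfolding tw_delta_eq
    by (rule ssum_hom_nested[OF BEG BEG hT]) (simp_all only: tw_comp_eq cT finite_atMost finite_atLeastLessThan)
  also have "\<dots> = ssum ?H {x \<in> ?I. fst x \<le> snd x} ?n ?T \<oplus>\<^bsub>?H\<^esub> ssum ?H {x \<in> ?I. \<not> fst x \<le> snd x} ?n ?T"
    by (rule ssum_split[OF BEG _ T]) simp_all
  also have "ssum ?H {x \<in> ?I. fst x \<le> snd x} ?n ?T = ssum ?H ?I1 ?n1 ?T1"
  proof (rule ssum_reindex[OF BEG, where \<pi> = "\<lambda>(j, p). (p + 1, j)" and \<rho> = "\<lambda>(p, j). (j, p - 1)"])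
    fix x assume xI: "x \<in> {x \<in> ?I. fst x \<le> snd x}"
    then show "?T x \<in> carrier ?H" using T by blast
    from xI obtain j p where x: "x = (j, p)" "1 \<le> j" "j < k" "p \<le> k - 1" "j \<le> p" by (cases x) auto
    then obtain l where k: "k = Suc l" by (cases k) auto
    have d: "m + m' - int l = m - int p + (m' - int (l - p))" using x k by (intro cup_deg) simp
    show "?T x = ?T1 (case x of (j, p) \<Rightarrow> (p + 1, j))"
      using face_cup_le[OF E F G tw_homD[OF u refl] tw_homD[OF v refl] d x(2,5)] x k by simp
    show "even (?n x) = even (?n1 (case x of (j, p) \<Rightarrow> (p + 1, j)))" using x k by (simp add: add.commute)
  qed auto
  also have "\<dots> = tw_comp U E F G (m + 1) m' (tw_delta U F G m u) v k"
  proof -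
    have d: "m + 1 + m' - int k = m + m' + 1 - int k" by simp
    show ?thesis unfolding tw_comp_eq d
      by (rule ssum_hom_nested[OF BEG BFG h1, symmetric]) (simp_all only: tw_delta_eq c1 finite_atMost finite_atLeastLessThan)
  qed
  also have "ssum ?H {x \<in> ?I. \<not> fst x \<le> snd x} ?n ?T = ssum ?H ?I2 (\<lambda>x. m + ?n2 x) ?T2"
  proof (rule ssum_reindex[OF BEG, where \<pi> = "\<lambda>(j, p). (p, j - p)" and \<rho> = "\<lambda>(p, j). (p + j, p)"])
    fix x assume xI: "x \<in> {x \<in> ?I. \<not> fst x \<le> snd x}"
    then show "?T x \<in> carrier ?H" using T by blast
    from xI obtain j p where x: "x = (j, p)" "1 \<le> j" "j < k" "p \<le> k - 1" "p < j" by (cases x) auto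
    then obtain l where k: "k = Suc l" by (cases k) auto
    have d: "m + m' - int l = m - int p + (m' - int (l - p))" using x k by (intro cup_deg) simp
    have s: "Suc l - p = Suc (l - p)" using x k by simp
    have d2: "m' - int (l - p) = m' + 1 - int (Suc (l - p))" by simp
    have jl: "j \<le> l" using x k by simp
    show "?T x = ?T2 (case x of (j, p) \<Rightarrow> (p, j - p))"
      using face_cup_gt[OF E F G tw_homD[OF u refl] tw_homD[OF v refl] d x(5) jl] x k by (simp add: s algebra_simps)
    \<comment> \<open>Acting on the second factor lengthens it by one, which adds m - p to the
      exponent of the product, while the face index drops by p; modulo 2 the net change is
      m.\<close>
    have "m + ((m - int p) * int (k - p) + int (j - p)) = 2 * (m - int p) + (int j + (m - int p) * int (k - 1 - p))"
      using x k by (simp add: of_nat_diff algebra_simps)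
    then show "even (?n x) = even (m + ?n2 (case x of (j, p) \<Rightarrow> (p, j - p)))" by (simp only: x(1) prod.case) simp
  qed auto
  also have "\<dots> = sgn_act ?H m (ssum ?H ?I2 ?n2 ?T2)" by (rule sgn_act_ssum[OF BEG T2, symmetric])
  also have "ssum ?H ?I2 ?n2 ?T2 = tw_comp U E F G m (m' + 1) u (tw_delta U E F m' v) k"
  proof -
    have d: "m + (m' + 1) - int k = m + m' + 1 - int k" by simp
    show ?thesis unfolding tw_comp_eq d
      by (rule ssum_hom_nested[OF BEG BEF h2, symmetric]) (simp_all only: tw_delta_eq c2 finite_atMost finite_atLeastLessThan)
  qed
  also have "sgn_act ?H m (tw_comp U E F G m (m' + 1) u (tw_delta U E F m' v) k) =
      sgn_act (tw_hom U E G (m + m' + 1)) m (tw_comp U E F G m (m' + 1) u (tw_delta U E F m' v)) k"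
    by (rule tw_sgn_act[OF E G tw_comp_closed[OF E F G u tw_delta_closed[OF E F v refl]], symmetric]) simp
  finally show "?lhs k = ?rhs k" by (simp add: tw_hom_simps)
qed

lemma bi_pull_rs_id:
  assumes E: "graded U E" and F: "graded U F" and u: "u \<in> bi_maps U E F k q"
  shows "bi_pull U (rs_id (lev U k)) E F k q u = u"
  using gr_pull_map_rs_id[OF tau_map[OF le0] rho_map[OF le0] E F] u by (simp add: bi_pull_def bi_hom_def)

lemma tw_ident_closed:
  assumes E: "graded U (fst \<E>)"
  shows "tw_ident U \<E> \<in> tw_maps U (fst \<E>) (fst \<E>) 0"
proof -
  have "gr_id (lev U 0) (gr_pull (tau U 0 0) (fst \<E>)) \<in> bi_maps U (fst \<E>) (fst \<E>) 0 0"
    using gr_id_closed[OF gr_module_pull[OF rs_map_id[OF lev] E]] by (simp add: bi_hom_def)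
  then show ?thesis using abelian_groupE(2)[OF bi_hom_abelian[OF E E]] by (simp add: tw_hom_simps tw_ident_def)
qed

text \<open>The identity family lives in simplicial degree 0 only, so a single summand survives, p =
  0 or p = k. Its sign exponent is 0 and the other factor is pulled back along an identity.\<close>

lemma tw_comp_ident:
  assumes E: "graded U E" and F: "graded U F" and u: "u \<in> tw_maps U E F m"
  shows "fst \<F> = F \<Longrightarrow> tw_comp U E F F 0 m (tw_ident U \<F>) u = u"
    and "fst \<E> = E \<Longrightarrow> tw_comp U E E F m 0 u (tw_ident U \<E>) = u"
proof -
  note B = bi_hom_abelian[OF E F]
  note uk = tw_homD[OF u refl]
  assume fF: "fst \<F> = F"
  have iF: "tw_ident U \<F> \<in> tw_maps U F F 0" using tw_ident_closed[of \<F>] F fF by simp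
  show "tw_comp U E F F 0 m (tw_ident U \<F>) u = u"
  proof (rule ext)
    fix k
    have "bi_pull U (rho U k 0) F F 0 0 (tw_ident U \<F> 0) = gr_id (lev U k) (gr_pull (rho U k 0) F)"
      using gr_pull_map_id[OF rho_map[OF le0] rs_map_id[OF lev] F, of k] rs_map_id_left[OF rho_map[OF le0]] fF
      by (simp add: tw_ident_def bi_pull_def)
    then have 0: "cup E F F k 0 (0 - int 0) (m - int (k - 0)) (tw_ident U \<F> 0) (u (k - 0)) = u k"
      using bi_pull_rs_id[OF E F uk] gr_comp_id(1)[OF gr_module_pull[OF tau_map[OF le0] E] gr_module_pull[OF rho_map[OF le0] F] uk[unfolded bi_hom_def]] uk
      by (simp add: cup_def bi_hom_def)
    have z: "cup E F F k p (0 - int p) (m - int (k - p)) (tw_ident U \<F> p) (u (k - p)) = \<zero>\<^bsub>bi_hom U E F k (0 + m - int k)\<^esub>"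
      if "p \<in> {..k}" "p \<noteq> 0" for p
      using add_hom_zero[OF bi_hom_abelian[OF F F] B cup_add_hom_left[OF E F F _ cup_deg uk], of p k 0] that fF
      by (simp add: tw_ident_def)
    have "tw_comp U E F F 0 m (tw_ident U \<F>) u k = sgn_act (bi_hom U E F k (0 + m - int k)) ((0 - int 0) * int (k - 0))
        (cup E F F k 0 (0 - int 0) (m - int (k - 0)) (tw_ident U \<F> 0) (u (k - 0)))"
      unfolding tw_comp_eq by (rule ssum_single[OF B _ _ _ z]) (use comp_term_closed[OF E F F _ iF u, of 0 k] in simp_all)
    then show "tw_comp U E F F 0 m (tw_ident U \<F>) u k = u k" unfolding 0 by (simp add: sgn_act_def)
  qed
next
  note B = bi_hom_abelian[OF E F]
  note uk = tw_homD[OF u refl]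
  assume fE: "fst \<E> = E"
  have iE: "tw_ident U \<E> \<in> tw_maps U E E 0" using tw_ident_closed[of \<E>] E fE by simp
  show "tw_comp U E E F m 0 u (tw_ident U \<E>) = u"
  proof (rule ext)
    fix k
    have "bi_pull U (tau U k 0) E E 0 0 (tw_ident U \<E> 0) = gr_id (lev U k) (gr_pull (tau U k 0) E)"
      using gr_pull_map_id[OF tau_map[OF le0] rs_map_id[OF lev] E, of k] rs_map_id_left[OF tau_map[OF le0]] fE
      by (simp add: tw_ident_def bi_pull_def)
    then have 0: "cup E E F k k (m - int k) (0 - int (k - k)) (u k) (tw_ident U \<E> (k - k)) = u k"
      using bi_pull_rs_id[OF E F uk] gr_comp_id(2)[OF gr_module_pull[OF tau_map[OF le0] E] gr_module_pull[OF rho_map[OF le0] F] uk[unfolded bi_hom_def]] uk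
      by (simp add: cup_def bi_hom_def)
    have z: "cup E E F k p (m - int p) (0 - int (k - p)) (u p) (tw_ident U \<E> (k - p)) = \<zero>\<^bsub>bi_hom U E F k (m + 0 - int k)\<^esub>"
      if "p \<in> {..k}" "p \<noteq> k" for p
      using add_hom_zero[OF bi_hom_abelian[OF E E] B comp_term_hom_right[OF E E F _ u, of p k "m + 0" 0]] that fE
      by (simp add: tw_ident_def)
    have "tw_comp U E E F m 0 u (tw_ident U \<E>) k = sgn_act (bi_hom U E F k (m + 0 - int k)) ((m - int k) * int (k - k))
        (cup E E F k k (m - int k) (0 - int (k - k)) (u k) (tw_ident U \<E> (k - k)))"
      unfolding tw_comp_eq by (rule ssum_single[OF B _ _ _ z]) (use comp_term_closed[OF E E F _ u iE, of k k] in simp_all)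
    then show "tw_comp U E E F m 0 u (tw_ident U \<E>) k = u k" unfolding 0 by (simp add: sgn_act_def)
  qed
qed

end

section \<open>Pullback along maps between simplicial ringed spaces\<close>

locale simplicial_pair = U: simplicial U + V: simplicial V
  for U :: "('a, 'r) simp_rs" and V :: "('b, 's) simp_rs"
begin

text \<open>\<open>q : U\<^sub>k \<rightarrow> V\<^sub>l\<close> with \<open>\<tau>\<^bsub>l,0\<^esub> \<circ> q = f \<circ> \<tau>\<^bsub>k,0\<^esub>\<close> and \<open>\<rho>\<^bsub>l,0\<^esub> \<circ> q = g \<circ> \<rho>\<^bsub>k,0\<^esub>\<close>; the components of
  simplicial maps and of simplicial homotopies are of this kind.\<close>

definition ends :: "('a, 'r, 'b, 's) rs_mor \<Rightarrow> ('a, 'r, 'b, 's) rs_mor \<Rightarrow> nat \<Rightarrow> nat \<Rightarrow> ('a, 'r, 'b, 's) rs_mor \<Rightarrow> bool" where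
  "ends f g k l q \<longleftrightarrow> transport (lev U k) (lev V l) (lev U 0) (lev V 0) q (tau V l 0) (tau U k 0) f \<and>
     transport (lev U k) (lev V l) (lev U 0) (lev V 0) q (rho V l 0) (rho U k 0) g"

lemma endsD:
  assumes "ends f g k l q"
  shows "transport (lev U k) (lev V l) (lev U 0) (lev V 0) q (tau V l 0) (tau U k 0) f"
    and "transport (lev U k) (lev V l) (lev U 0) (lev V 0) q (rho V l 0) (rho U k 0) g"
    and "rs_map (lev U k) (lev V l) q" using assms transport.q by (auto simp: ends_def)

lemma simp_pull_transport:
  "simp_pull U V f g k l q E F d = gr_transport q (tau V l 0) (rho V l 0) (tau U k 0) (rho U k 0) f g E F d"
  by (rule ext) (simp add: simp_pull_def gr_transport_def)

context
  fixes E F :: "('b, 's, 'm) gr_sh" and f g :: "('a, 'r, 'b, 's) rs_mor"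
  assumes E: "graded V E" and F: "graded V F"
begin

lemma simp_pull_add_hom:
  assumes "ends f g k l q"
  shows "add_hom (bi_hom V E F l d) (bi_hom U (gr_pull f E) (gr_pull g F) k d) (simp_pull U V f g k l q E F d)"
  unfolding simp_pull_transport bi_hom_def by (rule gr_transport_add_hom[OF endsD(1,2)[OF assms] E F])

lemma bi_pull_simp_pull:
  assumes "ends f g k l q" "rs_map X (lev U k) p" "u \<in> bi_maps V E F l d"
  shows "bi_pull U p (gr_pull f E) (gr_pull g F) k d (simp_pull U V f g k l q E F d u) =
    gr_transport (q \<cdot> p) (tau V l 0) (rho V l 0) (tau U k 0 \<cdot> p) (rho U k 0 \<cdot> p) f g E F d u"
  unfolding simp_pull_transport bi_pull_def
  by (rule gr_pull_map_transport[OF endsD(1,2)[OF assms(1)] assms(2) E F assms(3)[unfolded bi_hom_def]])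

lemma simp_pull_face:
  assumes q: "ends f g k (Suc l) q" and j: "1 \<le> j" "j \<le> l" and u: "u \<in> bi_maps V E F l d"
  shows "simp_pull U V f g k (Suc l) q E F d (bi_pull V (face V (Suc l) j) E F l d u) =
    gr_transport (face V (Suc l) j \<cdot> q) (tau V l 0) (rho V l 0) (tau U k 0) (rho U k 0) f g E F d u"
proof -
  have e: "tau V l 0 \<cdot> face V (Suc l) j = tau V (Suc l) 0" "rho V l 0 \<cdot> face V (Suc l) j = rho V (Suc l) 0"
    using V.tau_face_le[of 0 l j] V.rho_face_gt[of 0 j l] j by simp_all
  have "j \<le> Suc l" using j by simp
  from gr_transport_pull_map[OF V.face_map[OF this] endsD(3)[OF q] V.tau_map[OF le0] V.rho_map[OF le0] E F u[unfolded bi_hom_def]]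
  show ?thesis unfolding simp_pull_transport bi_pull_def e .
qed

text \<open>Both sides are the transport of u along the common diagonal of the square
  \<open>sq\<close>.\<close>

lemma face_simp_pull:
  assumes q: "ends f g (Suc k) (Suc l) q" and q': "ends f g k l q'"
    and sq: "face V (Suc l) j \<cdot> q = q' \<cdot> face U (Suc k) i" and j: "1 \<le> j" "j \<le> l" and i: "1 \<le> i" "i \<le> k"
    and u: "u \<in> bi_maps V E F l d"
  shows "simp_pull U V f g (Suc k) (Suc l) q E F d (bi_pull V (face V (Suc l) j) E F l d u) =
    bi_pull U (face U (Suc k) i) (gr_pull f E) (gr_pull g F) k d (simp_pull U V f g k l q' E F d u)"
proof -
  have e: "tau U k 0 \<cdot> face U (Suc k) i = tau U (Suc k) 0" "rho U k 0 \<cdot> face U (Suc k) i = rho U (Suc k) 0"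
    using U.tau_face_le[of 0 k i] U.rho_face_gt[of 0 i k] i by simp_all
  have "i \<le> Suc k" using i by simp
  from bi_pull_simp_pull[OF q' U.face_map[OF this] u] show ?thesis unfolding simp_pull_face[OF q j u] sq e ..
qed

end

text \<open>\<open>q\<close> restricts to \<open>q1\<close> on the front face and to
  \<open>q2\<close> on the back face, with \<open>m\<close> at the common vertex. The splitting
  indices p in V and p' in U differ when the front part is a homotopy map, which raises the level by
  one.\<close>

lemma simp_pull_cup:
  assumes E: "graded V E" and F: "graded V F" and G: "graded V G"
    and q: "ends f g k l q" and q1: "ends m g p' p q1" and q2: "ends f m (k - p') (l - p) q2"
    and p: "p \<le> l" and p': "p' \<le> k"
    and rho: "rho V l p \<cdot> q = q1 \<cdot> rho U k p'" and tau: "tau V l (l - p) \<cdot> q = q2 \<cdot> tau U k (k - p')"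
    and D: "D = a + s" and u: "u \<in> bi_maps V F G p a" and v: "v \<in> bi_maps V E F (l - p) s"
  shows "simp_pull U V f g k l q E G D (V.cup E F G l p a s u v) =
    U.cup (gr_pull f E) (gr_pull m F) (gr_pull g G) k p' a s
      (simp_pull U V m g p' p q1 F G a u) (simp_pull U V f m (k - p') (l - p) q2 E F s v)"
proof -
  note r = U.rho_map[OF p'] and t = U.tau_map[OF diff_le_self[of k p']]
  note qm = endsD(3)[OF q] and q1m = endsD(3)[OF q1] and q2m = endsD(3)[OF q2]
  \<comment> \<open>At the common vertex \<open>q\<close> is \<open>m\<close>: this supplies the
    middle square for \<open>transport_cup\<close>.\<close>
  have "V.mid l p \<cdot> q = tau V p 0 \<cdot> (rho V l p \<cdot> q)"
    by (rule rs_map_assoc[OF qm V.rho_map[OF p] V.tau_map[OF le0]])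
  also have "\<dots> = (tau V p 0 \<cdot> q1) \<cdot> rho U k p'"
    unfolding rho by (rule rs_map_assoc[OF r q1m V.tau_map[OF le0], symmetric])
  also have "\<dots> = m \<cdot> U.mid k p'" unfolding transport.square[OF endsD(1)[OF q1]]
    by (rule rs_map_assoc[OF r U.tau_map[OF le0] transport.f[OF endsD(1)[OF q1]]])
  finally have M: "transport (lev U k) (lev V l) (lev U 0) (lev V 0) q (V.mid l p) (U.mid k p') m"
    by (intro transport.intro qm V.mid_map[OF p] U.mid_map[OF p'] transport.f[OF endsD(1)[OF q1]])
  show ?thesis
    unfolding simp_pull_transport[of f g] V.transport_cup[OF E F G p D u v endsD(1)[OF q] M endsD(2)[OF q]]
      U.cup_def bi_pull_simp_pull[OF F G q1 r u] bi_pull_simp_pull[OF E F q2 t v]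
      rho tau U.rho_rho[OF le0 p'] U.tau_tau[OF le0 diff_le_self[of k p']] U.mid_eq[OF p'] ..
qed

end

section \<open>Simplicial maps\<close>

text \<open>Compatibility with last faces alone yields \<open>map_rho\<close>. For the reversed
  spaces the last faces are the original first ones, and the same lemma yields
  \<open>map_tau\<close>.\<close>

locale last_face_mapping = U: presimplicial U + V: presimplicial V
  for U :: "('a, 'r) simp_rs" and V :: "('b, 's) simp_rs" +
  fixes f :: "nat \<Rightarrow> ('a, 'r, 'b, 's) rs_mor"
  assumes map_map: "rs_map (lev U k) (lev V k) (f k)"
    and map_last: "face V (Suc k) (Suc k) \<cdot> f (Suc k) = f k \<cdot> face U (Suc k) (Suc k)"
begin

lemma map_rho: "p \<le> k \<Longrightarrow> rho V k p \<cdot> f k = f p \<cdot> rho U k p"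
proof (induction k)
  case 0
  then show ?case using rs_map_id_left[OF map_map] rs_map_id_right[OF map_map] by simp
next
  case (Suc k)
  show ?case
  proof (cases "p \<le> k")
    case True
    have "rho V (Suc k) p \<cdot> f (Suc k) = (rho V k p \<cdot> f k) \<cdot> face U (Suc k) (Suc k)"
      using True by (simp add: V.rho_Suc map_last rs_map_assoc[OF map_map V.face_map V.rho_map]
          rs_map_assoc[OF U.face_map map_map V.rho_map])
    then show ?thesis using True by (simp add: Suc.IH U.rho_Suc rs_map_assoc[OF U.face_map U.rho_map map_map])
  next
    case False
    then have "p = Suc k" using Suc.prems by simp
    then show ?thesis using rs_map_id_left[OF map_map] rs_map_id_right[OF map_map] by simp
  qed
qed

end

locale simplicial_mapping = simplicial_pair U V for U :: "('a, 'r) simp_rs" and V :: "('b, 's) simp_rs" +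
  fixes f :: "nat \<Rightarrow> ('a, 'r, 'b, 's) rs_mor"
  assumes f: "simplicial_map U V f"

sublocale simplicial_mapping \<subseteq> last_face_mapping
  by unfold_locales (use f U.lev V.lev in \<open>simp_all add: simplicial_map_def rs_map_def\<close>)

context simplicial_mapping
begin

abbreviation "pb \<equiv> gr_pull (f 0)"
abbreviation "pm \<equiv> tw_pull_mor U V f"
abbreviation "pl k \<equiv> simp_pull U V (f 0) (f 0) k k (f k)"

lemma map_face: "i \<le> Suc k \<Longrightarrow> face V (Suc k) i \<cdot> f (Suc k) = f k \<cdot> face U (Suc k) i"
  using f by (simp add: simplicial_map_def)

lemma map_tau: "p \<le> k \<Longrightarrow> tau V k p \<cdot> f k = f p \<cdot> tau U k p"
  by (rule last_face_mapping.map_rho[of "face_reversal U" "face_reversal V", unfolded face_reversal_simps])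
    (simp add: last_face_mapping_def last_face_mapping_axioms_def face_reversal_simps map_map map_face
      U.face_reversal_presimplicial V.face_reversal_presimplicial)

lemma map_ends: "ends (f 0) (f 0) k k (f k)" unfolding ends_def
  by (intro conjI transport.intro map_map V.tau_map V.rho_map U.tau_map U.rho_map map_tau map_rho le0)

lemma tw_pull_mor_add_hom:
  assumes E: "graded V E" and F: "graded V F"
  shows "add_hom (tw_hom V E F m) (tw_hom U (pb E) (pb F) m) (pm E F m)"
proof (rule add_homI)
  note A = simp_pull_add_hom[OF E F map_ends]
  fix u assume u: "u \<in> tw_maps V E F m"
  show "pm E F m u \<in> tw_maps U (pb E) (pb F) m"
    using add_hom_closed[OF A V.tw_homD[OF u refl]] by (simp add: U.tw_hom_simps tw_pull_mor_def)
  fix v assume v: "v \<in> tw_maps V E F m"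
  show "pm E F m (u \<oplus>\<^bsub>tw_hom V E F m\<^esub> v) = pm E F m u \<oplus>\<^bsub>tw_hom U (pb E) (pb F) m\<^esub> pm E F m v"
    using add_hom_add[OF A V.tw_homD[OF u refl] V.tw_homD[OF v refl]] by (simp add: U.tw_hom_simps V.tw_hom_simps tw_pull_mor_def)
qed

lemma tw_pull_mor_comp:
  assumes E: "graded V E" and F: "graded V F" and G: "graded V G"
    and u: "u \<in> tw_maps V F G m" and v: "v \<in> tw_maps V E F m'"
  shows "pm E G (m + m') (tw_comp V E F G m m' u v) =
    tw_comp U (pb E) (pb F) (pb G) m m' (pm F G m u) (pm E F m' v)" (is "?lhs = ?rhs")
proof (rule ext)
  fix k
  let ?H = "bi_hom U (pb E) (pb G) k (m + m' - int k)"
  note BV = V.bi_hom_abelian[OF E G]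
  have BU: "abelian_group ?H" by (intro U.bi_hom_abelian gr_module_pull[OF map_map] E G)
  note A = simp_pull_add_hom[OF E G map_ends]
  have c: "V.cup E F G k p (m - int p) (m' - int (k - p)) (u p) (v (k - p)) \<in> bi_maps V E G k (m + m' - int k)"
    if "p \<in> {..k}" for p by (rule V.comp_term_closed[OF E F G _ u v]) (use that in simp)
  have "pm E G (m + m') (tw_comp V E F G m m' u v) k =
    ssum ?H {..k} (\<lambda>p. (m - int p) * int (k - p)) (\<lambda>p. pl k E G (m + m' - int k)
      (V.cup E F G k p (m - int p) (m' - int (k - p)) (u p) (v (k - p))))"
    unfolding tw_pull_mor_def V.tw_comp_eq by (rule ssum_hom[OF BV BU A c])
  also have "\<dots> = tw_comp U (pb E) (pb F) (pb G) m m' (pm F G m u) (pm E F m' v) k" unfolding U.tw_comp_eq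
  proof (rule ssum_cong[OF BU refl _ refl])
    fix p assume p: "p \<in> {..k}"
    then have pk: "p \<le> k" by simp
    show eq: "pl k E G (m + m' - int k) (V.cup E F G k p (m - int p) (m' - int (k - p)) (u p) (v (k - p))) =
      U.cup (pb E) (pb F) (pb G) k p (m - int p) (m' - int (k - p)) (pm F G m u p) (pm E F m' v (k - p))"
      unfolding tw_pull_mor_def
      by (rule simp_pull_cup[OF E F G map_ends map_ends map_ends pk pk map_rho[OF pk] map_tau[OF diff_le_self]
            V.cup_deg[OF pk] V.tw_homD[OF u refl] V.tw_homD[OF v refl]])
    show "U.cup (pb E) (pb F) (pb G) k p (m - int p) (m' - int (k - p))
        (pm F G m u p) (pm E F m' v (k - p)) \<in> carrier ?H"
      unfolding eq[symmetric] by (rule add_hom_closed[OF A c[OF p]])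
  qed
  finally show "?lhs k = ?rhs k" .
qed

lemma tw_pull_mor_delta:
  assumes E: "graded V E" and F: "graded V F" and u: "u \<in> tw_maps V E F m"
  shows "pm E F (m + 1) (tw_delta V E F m u) = tw_delta U (pb E) (pb F) m (pm E F m u)" (is "?lhs = ?rhs")
proof (rule ext)
  fix k
  let ?H = "bi_hom U (pb E) (pb F) k (m + 1 - int k)"
  note BV = V.bi_hom_abelian[OF E F]
  have BU: "abelian_group ?H" by (intro U.bi_hom_abelian gr_module_pull[OF map_map] E F)
  note A = simp_pull_add_hom[OF E F map_ends]
  have c: "bi_pull V (face V k j) E F (k - 1) (m - int (k - 1)) (u (k - 1)) \<in> bi_maps V E F k (m + 1 - int k)"
    if "j \<in> {1..<k}" for j by (rule V.delta_term_closed[OF E F _ _ u]) (use that in simp_all)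
  have "pm E F (m + 1) (tw_delta V E F m u) k = ssum ?H {1..<k} int (\<lambda>j. pl k E F (m + 1 - int k)
      (bi_pull V (face V k j) E F (k - 1) (m - int (k - 1)) (u (k - 1))))"
    unfolding tw_pull_mor_def V.tw_delta_eq by (rule ssum_hom[OF BV BU A c])
  also have "\<dots> = tw_delta U (pb E) (pb F) m (pm E F m u) k" unfolding U.tw_delta_eq
  proof (rule ssum_cong[OF BU refl _ refl])
    fix j assume j: "j \<in> {1..<k}"
    then obtain l where k: "k = Suc l" and j': "1 \<le> j" "j \<le> l" "j \<le> Suc l" by (cases k) auto
    have d: "m + 1 - int (Suc l) = m - int l" by simp
    show eq: "pl k E F (m + 1 - int k) (bi_pull V (face V k j) E F (k - 1) (m - int (k - 1)) (u (k - 1))) =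
      bi_pull U (face U k j) (pb E) (pb F) (k - 1) (m - int (k - 1)) (pm E F m u (k - 1))"
      unfolding tw_pull_mor_def k d diff_Suc_1
      by (rule face_simp_pull[OF E F map_ends map_ends map_face[OF j'(3)] j'(1,2) j'(1,2) V.tw_homD[OF u refl]])
    show "bi_pull U (face U k j) (pb E) (pb F) (k - 1) (m - int (k - 1)) (pm E F m u (k - 1)) \<in> carrier ?H"
      unfolding eq[symmetric] by (rule add_hom_closed[OF A c[OF j]])
  qed
  finally show "?lhs k = ?rhs k" .
qed

lemma tw_pull_mor_ident:
  assumes E: "graded V (fst \<E>)" and E': "fst \<E>' = pb (fst \<E>)"
  shows "pm (fst \<E>) (fst \<E>) 0 (tw_ident V \<E>) = tw_ident U \<E>'"
proof (rule ext)
  fix k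
  show "pm (fst \<E>) (fst \<E>) 0 (tw_ident V \<E>) k = tw_ident U \<E>' k"
  proof (cases k)
    case 0
    then show ?thesis using gr_transport_id[OF endsD(1)[OF map_ends[of 0]] E]
      by (simp add: tw_pull_mor_def tw_ident_def simp_pull_transport E')
  next
    case (Suc l)
    note E0 = gr_module_pull[OF map_map[of 0] E]
    show ?thesis
      using add_hom_zero[OF V.bi_hom_abelian[OF E E] U.bi_hom_abelian[OF E0 E0] simp_pull_add_hom[OF E E map_ends]] Suc
      by (simp add: tw_pull_mor_def tw_ident_def E')
  qed
qed

end

section \<open>Simplicial homotopies\<close>

text \<open>The part of a homotopy seen by \<open>rho\<close>. Reversing the faces and replacing i
  by k - i exchanges f and g, so \<open>rev_homotopy\<close> is an instance of the same locale with
  f in the place of g and gives the statements on \<open>tau\<close>.\<close>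

locale last_face_homotopy = last_face_mapping U V g
  for U :: "('a, 'r) simp_rs" and V :: "('b, 's) simp_rs" and g +
  fixes h :: "nat \<Rightarrow> nat \<Rightarrow> ('a, 'r, 'b, 's) rs_mor"
  assumes h_map: "i \<le> k \<Longrightarrow> rs_map (lev U k) (lev V (Suc k)) (h k i)"
    and h_last: "face V (Suc k) (Suc k) \<cdot> h k k = g k"
    and h_top: "i \<le> k \<Longrightarrow>
      face V (Suc (Suc k)) (Suc (Suc k)) \<cdot> h (Suc k) i = h k i \<cdot> face U (Suc k) (Suc k)"
begin

text \<open>In the prism, the (k+1)-simplex of \<open>h k i\<close> has its vertices 0..i over g and
  its vertices i+1..k+1 over f. The front face 0..p+1 with i \<le> p contains the change from g to
  f, so it is of homotopy type again; the front face 0..p with p \<le> i, in the next lemma, lies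
  over g entirely.\<close>

lemma h_rho_gt: "i \<le> p \<Longrightarrow> p \<le> k \<Longrightarrow> rho V (Suc k) (Suc p) \<cdot> h k i = h p i \<cdot> rho U k p"
proof (induction k)
  case 0
  then show ?case using rs_map_id_left[OF h_map] rs_map_id_right[OF h_map] by simp
next
  case (Suc k)
  show ?case
  proof (cases "p \<le> k")
    case True
    then have i: "i \<le> Suc k" "i \<le> k" using Suc.prems by simp_all
    have "rho V (Suc (Suc k)) (Suc p) \<cdot> h (Suc k) i = rho V (Suc k) (Suc p) \<cdot> (face V (Suc (Suc k)) (Suc (Suc k)) \<cdot> h (Suc k) i)"
      using True by (simp add: V.rho_Suc rs_map_assoc[OF h_map[OF i(1)] V.face_map V.rho_map])
    also have "\<dots> = (rho V (Suc k) (Suc p) \<cdot> h k i) \<cdot> face U (Suc k) (Suc k)"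
      using True h_top[of i k] i by (simp add: rs_map_assoc[OF U.face_map h_map[OF i(2)] V.rho_map])
    also have "\<dots> = h p i \<cdot> rho U (Suc k) p"
      using True Suc by (simp add: U.rho_Suc rs_map_assoc[OF U.face_map U.rho_map h_map])
    finally show ?thesis .
  next
    case False
    then have "p = Suc k" using Suc.prems by simp
    then show ?thesis using rs_map_id_left[OF h_map] rs_map_id_right[OF h_map] Suc.prems by simp
  qed
qed

lemma h_rho_le: "p \<le> i \<Longrightarrow> i \<le> k \<Longrightarrow> rho V (Suc k) p \<cdot> h k i = g p \<cdot> rho U k p"
proof (induction k)
  case 0
  then show ?case using h_last[of 0] rs_map_id_left[OF map_map] rs_map_id_right[OF map_map] by (simp add: V.rho_Suc rs_map_id_left[OF V.face_map])
next
  case (Suc k)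
  then have p: "p \<le> Suc k" by simp
  have *: "rho V (Suc (Suc k)) p \<cdot> h (Suc k) i = rho V (Suc k) p \<cdot> (face V (Suc (Suc k)) (Suc (Suc k)) \<cdot> h (Suc k) i)"
    using p by (simp add: V.rho_Suc rs_map_assoc[OF h_map[OF Suc.prems(2)] V.face_map V.rho_map])
  show ?case
  proof (cases "i \<le> k")
    case True
    note * also have "rho V (Suc k) p \<cdot> (face V (Suc (Suc k)) (Suc (Suc k)) \<cdot> h (Suc k) i) = (rho V (Suc k) p \<cdot> h k i) \<cdot> face U (Suc k) (Suc k)"
      using True h_top[of i k] p by (simp add: rs_map_assoc[OF U.face_map h_map[OF True] V.rho_map])
    also have "\<dots> = g p \<cdot> rho U (Suc k) p"
      using True Suc by (simp add: U.rho_Suc rs_map_assoc[OF U.face_map U.rho_map map_map])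
    finally show ?thesis .
  next
    case False
    then have "i = Suc k" using Suc.prems by simp
    then show ?thesis using * h_last map_rho[OF p] by simp
  qed
qed

end

locale simplicial_homotopic = simplicial_pair U V + F: simplicial_mapping U V f + G: simplicial_mapping U V g
  for U :: "('a, 'r) simp_rs" and V :: "('b, 's) simp_rs" and f g +
  fixes h :: "nat \<Rightarrow> nat \<Rightarrow> ('a, 'r, 'b, 's) rs_mor"
  assumes h: "simplicial_homotopy U V f g h"
begin

lemma hty_map: "i \<le> k \<Longrightarrow> rs_map (lev U k) (lev V (Suc k)) (h k i)"
  using h U.lev V.lev by (simp add: simplicial_homotopy_def rs_map_def)

lemma hty_face_first: "face V (Suc k) 0 \<cdot> h k 0 = f k"
  and hty_face_last: "face V (Suc k) (Suc k) \<cdot> h k k = g k"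
  and hty_face_diag: "0 < i \<Longrightarrow> i \<le> k \<Longrightarrow> face V (Suc k) i \<cdot> h k i = face V (Suc k) i \<cdot> h k (i - 1)"
  using h by (simp_all add: simplicial_homotopy_def)

lemma hty_face_lt: "i < j \<Longrightarrow> j \<le> k \<Longrightarrow> face V (Suc k) i \<cdot> h k j = h (k - 1) (j - 1) \<cdot> face U k i"
proof -
  have "\<forall>p i j. i < j \<and> j \<le> p \<longrightarrow> face V (p + 1) i \<cdot> h p j = h (p - 1) (j - 1) \<cdot> face U p i"
    using h unfolding simplicial_homotopy_def by (elim conjE)
  then show "i < j \<Longrightarrow> j \<le> k \<Longrightarrow> face V (Suc k) i \<cdot> h k j = h (k - 1) (j - 1) \<cdot> face U k i" by simp
qed

lemma hty_face_gt: "Suc j < i \<Longrightarrow> i \<le> Suc k \<Longrightarrow> face V (Suc k) i \<cdot> h k j = h (k - 1) j \<cdot> face U k (i - 1)"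
proof -
  have "\<forall>p i j. j + 1 < i \<and> i \<le> p + 1 \<longrightarrow> face V (p + 1) i \<cdot> h p j = h (p - 1) j \<cdot> face U p (i - 1)"
    using h unfolding simplicial_homotopy_def by (elim conjE)
  then show "Suc j < i \<Longrightarrow> i \<le> Suc k \<Longrightarrow> face V (Suc k) i \<cdot> h k j = h (k - 1) j \<cdot> face U k (i - 1)" by simp
qed

sublocale last_face_homotopy U V g h
  by (intro last_face_homotopy.intro last_face_homotopy_axioms.intro hty_map hty_face_last)
    (simp_all add: G.last_face_mapping_axioms hty_face_gt)

lemma rev_homotopy: "last_face_homotopy (face_reversal U) (face_reversal V) f (\<lambda>k i. h k (k - i))"
  using hty_map hty_face_first hty_face_lt[of 0 _ "Suc _"] F.map_map F.map_face
  by (simp add: last_face_homotopy_def last_face_homotopy_axioms_def last_face_mapping_def last_face_mapping_axioms_def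
      face_reversal_simps U.face_reversal_presimplicial V.face_reversal_presimplicial Suc_diff_le)

lemmas rev_rho_le = last_face_homotopy.h_rho_le[OF rev_homotopy, unfolded face_reversal_simps]
  and rev_rho_gt = last_face_homotopy.h_rho_gt[OF rev_homotopy, unfolded face_reversal_simps]

lemma hty_tau_gt: "r \<le> k \<Longrightarrow> i \<le> k - r \<Longrightarrow> tau V (Suc k) r \<cdot> h k i = f r \<cdot> tau U k r"
  using rev_rho_le[of r "k - i" k] by simp

lemma hty_tau_le: "\<lbrakk>r \<le> k; k - r \<le> i; i \<le> k\<rbrakk> \<Longrightarrow> tau V (Suc k) (Suc r) \<cdot> h k i = h r (i - (k - r)) \<cdot> tau U k r"
  using rev_rho_gt[of "k - i" r k] by (simp add: diff_diff_right add.commute)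

lemma hty_ends: "i \<le> k \<Longrightarrow> ends (f 0) (g 0) k (Suc k) (h k i)" unfolding ends_def
  by (intro conjI transport.intro hty_map V.tau_map V.rho_map U.tau_map U.rho_map F.map_map G.map_map
      hty_tau_gt h_rho_le le0) simp_all

abbreviation "hp k i \<equiv> simp_pull U V (f 0) (g 0) k (Suc k) (h k i)"
abbreviation "Hs \<equiv> homotopy_sum U V f g h"

lemma Hs_eq: "Hs E F m \<phi> k = ssum (bi_hom U (F.pb E) (G.pb F) k (m - 1 - int k)) {..k} int
     (\<lambda>i. hp k i E F (m - int (Suc k)) (\<phi> (Suc k)))" by (simp add: homotopy_sum_def ssum_def Let_def)

context
  fixes E F :: "('b, 's, 'm) gr_sh"
  assumes E: "graded V E" and F: "graded V F"
begin

lemma Hs_hom: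
  assumes "i \<le> k" "n = m - 1"
  shows "add_hom (bi_hom V E F (Suc k) (m - int (Suc k))) (bi_hom U (F.pb E) (G.pb F) k (n - int k))
    (hp k i E F (m - int (Suc k)))"
proof -
  have "m - int (Suc k) = n - int k" using assms(2) by simp
  then show ?thesis using simp_pull_add_hom[OF E F hty_ends[OF assms(1)]] by metis
qed

private lemma B: "abelian_group (bi_hom U (F.pb E) (G.pb F) k d)"
  by (intro U.bi_hom_abelian gr_module_pull[OF F.map_map] gr_module_pull[OF G.map_map] E F)

lemma Hs_add_hom:
  assumes n: "n = m - 1"
  shows "add_hom (tw_hom V E F m) (tw_hom U (F.pb E) (G.pb F) n) (Hs E F m)" unfolding n
proof (rule add_homI)
  fix u assume u: "u \<in> tw_maps V E F m"
  have c: "hp k i E F (m - int (Suc k)) (u (Suc k)) \<in>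
      bi_maps U (F.pb E) (G.pb F) k (m - 1 - int k)" if "i \<in> {..k}" for i k
    by (rule add_hom_closed[OF Hs_hom V.tw_homD[OF u refl]]) (use that in simp_all)
  show "Hs E F m u \<in> tw_maps U (F.pb E) (G.pb F) (m - 1)"
    unfolding U.tw_hom_simps Hs_eq by (intro allI ssum_closed[OF B c])
  fix v assume v: "v \<in> tw_maps V E F m"
  show "Hs E F m (u \<oplus>\<^bsub>tw_hom V E F m\<^esub> v) = Hs E F m u \<oplus>\<^bsub>tw_hom U (F.pb E) (G.pb F) (m - 1)\<^esub> Hs E F m v"
  proof (rule ext)
    fix k
    show "Hs E F m (u \<oplus>\<^bsub>tw_hom V E F m\<^esub> v) k = (Hs E F m u \<oplus>\<^bsub>tw_hom U (F.pb E) (G.pb F) (m - 1)\<^esub> Hs E F m v) k"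
      unfolding U.tw_hom_simps V.tw_hom_simps Hs_eq
      by (rule ssum_add_hom[OF B, where G = "\<lambda>_. bi_hom V E F (Suc k) (m - int (Suc k))" and x = "\<lambda>_. u (Suc k)" and y = "\<lambda>_. v (Suc k)"
            and f = "\<lambda>i. hp k i E F (m - int (Suc k))"])
        (simp_all only: Hs_hom V.tw_homD[OF u refl] V.tw_homD[OF v refl] atMost_iff)
  qed
qed

lemmas Hs_closed = add_hom_closed[OF Hs_add_hom]

lemma Hs_delta:
  assumes u: "u \<in> tw_maps V E F m"
  shows "Hs E F (m + 1) (tw_delta V E F m u) =
    sgn_act (tw_hom U (F.pb E) (G.pb F) m) 1 (tw_delta U (F.pb E) (G.pb F) (m - 1) (Hs E F m u))" (is "?lhs = ?rhs")
proof (rule ext)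
  fix k
  let ?E = "F.pb E" and ?F = "G.pb F"
  note E' = gr_module_pull[OF F.map_map[of 0] E] and F' = gr_module_pull[OF G.map_map[of 0] F]
  let ?H = "bi_hom U ?E ?F k (m - int k)"
  interpret H: abelian_group ?H by (rule B)
  let ?T = "\<lambda>(i, j). hp k i E F (m - int k) (bi_pull V (face V (Suc k) j) E F k (m - int k) (u k))"
  let ?I = "Sigma {..k} (\<lambda>_. {1..<Suc k})"
  let ?n = "\<lambda>(i, j). int i + int j"
  have d: "m + 1 - int (Suc k) = m - int k" "m + 1 - 1 - int k = m - int k" by simp_all
  have u': "u k \<in> bi_maps V E F k (m - int k)" by (rule V.tw_homD[OF u refl])
  have hom: "add_hom (bi_hom V E F (Suc k) (m - int k)) ?H (hp k i E F (m - int k))" if "i \<in> {..k}" for i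
    by (rule simp_pull_add_hom[OF E F hty_ends]) (use that in simp)
  have cl: "bi_pull V (face V (Suc k) j) E F k (m - int k) (u k) \<in> bi_maps V E F (Suc k) (m - int k)"
    if "j \<in> {1..<Suc k}" for j
    using V.delta_term_closed[OF E F _ _ u, of j "Suc k"] that by (simp only: d(1) diff_Suc_1 atLeastLessThan_iff)
  have T: "?T x \<in> carrier ?H" if "x \<in> ?I" for x using that add_hom_closed[OF hom cl] by auto
  let ?P = "\<lambda>(i, j). j = i \<or> j = Suc i"
  \<comment> \<open>Pairs (i, i) and pairs (i, i + 1). As j runs over the inner faces 1..k only, (i,
    i) \<mapsto> (i - 1, i) is a bijection between the two families, and
    \<open>hty_face_diag\<close> makes the terms equal. The outer faces, which would give f and g,
    do not occur.\<close>
  let ?D = "{x \<in> {x \<in> ?I. ?P x}. snd x = fst x}" and ?D' = "{x \<in> {x \<in> ?I. ?P x}. snd x \<noteq> fst x}"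
  have "Hs E F (m + 1) (tw_delta V E F m u) k = ssum ?H ?I ?n ?T" unfolding Hs_eq d
    by (rule ssum_hom_nested[OF B V.bi_hom_abelian[OF E F] hom])
      (simp_all only: V.tw_delta_eq d diff_Suc_1 cl finite_atMost finite_atLeastLessThan)
  also have "\<dots> = ssum ?H {x \<in> ?I. ?P x} ?n ?T \<oplus>\<^bsub>?H\<^esub> ssum ?H {x \<in> ?I. \<not> ?P x} ?n ?T"
    by (rule ssum_split[OF B _ T]) simp_all
  also have "ssum ?H {x \<in> ?I. ?P x} ?n ?T = ssum ?H ?D ?n ?T \<oplus>\<^bsub>?H\<^esub> ssum ?H ?D' ?n ?T"
    by (rule ssum_split[OF B _ T]) auto
  also have "ssum ?H ?D ?n ?T = ssum ?H ?D' (\<lambda>x. 1 + ?n x) ?T"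
  proof (rule ssum_reindex[OF B, where \<pi> = "\<lambda>(i, j). (i - 1, j)" and \<rho> = "\<lambda>(i, j). (i + 1, j)"])
    fix x assume xD: "x \<in> ?D"
    then show "?T x \<in> carrier ?H" using T by blast
    from xD obtain i where x: "x = (i, i)" and i: "0 < i" "1 \<le> i" "i \<le> k" "i - 1 \<le> k" by (cases x) auto
    show "?T x = ?T (case x of (i, j) \<Rightarrow> (i - 1, j))"
      using simp_pull_face[OF E F hty_ends[OF i(3)] i(2,3) u'] simp_pull_face[OF E F hty_ends[OF i(4)] i(2,3) u']
      by (simp only: x prod.case hty_face_diag[OF i(1,3)])
    show "even (?n x) = even (1 + ?n (case x of (i, j) \<Rightarrow> (i - 1, j)))" using i by (simp add: x of_nat_diff)
  qed auto
  also have "\<dots> = sgn_act ?H 1 (ssum ?H ?D' ?n ?T)" by (rule sgn_act_ssum[OF B, symmetric]) (use T in blast)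
  also have "\<dots> \<oplus>\<^bsub>?H\<^esub> ssum ?H ?D' ?n ?T = \<zero>\<^bsub>?H\<^esub>"
    using H.l_neg[OF ssum_closed[OF B, of ?D' ?T]] T by (simp add: sgn_act_def)
  also have "\<zero>\<^bsub>?H\<^esub> \<oplus>\<^bsub>?H\<^esub> ssum ?H {x \<in> ?I. \<not> ?P x} ?n ?T = ssum ?H {x \<in> ?I. \<not> ?P x} ?n ?T"
    by (rule H.l_zero[OF ssum_closed[OF B]]) (use T in blast)
  finally have 1: "Hs E F (m + 1) (tw_delta V E F m u) k = ssum ?H {x \<in> ?I. \<not> ?P x} ?n ?T" .
  let ?S = "\<lambda>(j, i). bi_pull U (face U k j) ?E ?F (k - 1) (m - 1 - int (k - 1))
     (hp (k - 1) i E F (m - int (Suc (k - 1))) (u (Suc (k - 1))))"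
  let ?J = "Sigma {1..<k} (\<lambda>_. {..k - 1})"
  have d': "m - 1 + 1 = m" by simp
  have hom': "add_hom (bi_hom U ?E ?F (k - 1) (m - 1 - int (k - 1))) ?H (bi_pull U (face U k j) ?E ?F (k - 1) (m - 1 - int (k - 1)))"
    if "j \<in> {1..<k}" for j
    using U.delta_term_add_hom[OF E' F', of j k "m - 1"] that by (simp only: d' atLeastLessThan_iff)
  have cl': "hp (k - 1) i E F (m - int (Suc (k - 1))) (u (Suc (k - 1)))
     \<in> bi_maps U ?E ?F (k - 1) (m - 1 - int (k - 1))" if "i \<in> {..k - 1}" for i
    by (rule add_hom_closed[OF Hs_hom V.tw_homD[OF u refl]]) (use that in simp_all)
  have S: "?S x \<in> carrier ?H" if "x \<in> ?J" for x using that add_hom_closed[OF hom' cl'] by auto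
  have e: "tw_delta U ?E ?F (m - 1) (Hs E F m u) k = ssum ?H ?J ?n ?S" unfolding U.tw_delta_eq d'
    by (rule ssum_hom_nested[OF B B hom']) (simp_all only: Hs_eq cl' finite_atMost finite_atLeastLessThan)
  have 2: "sgn_act ?H 1 (tw_delta U ?E ?F (m - 1) (Hs E F m u) k) = ssum ?H ?J (\<lambda>x. 1 + ?n x) ?S"
    unfolding e by (rule sgn_act_ssum[OF B S])
  \<comment> \<open>For j < i the face j passes to the other side of the homotopy map, whose index
    drops to i - 1; for j > i + 1 the face itself becomes j - 1. Either way one index drops by one,
    which produces the sign -1. A pair (j, i) in the target comes from the first case exactly when j
    \<le> i.\<close>
  have 3: "ssum ?H {x \<in> ?I. \<not> ?P x} ?n ?T = ssum ?H ?J (\<lambda>x. 1 + ?n x) ?S"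
  proof (rule ssum_reindex[OF B, where \<pi> = "\<lambda>(i, j). if j < i then (j, i - 1) else (j - 1, i)"
        and \<rho> = "\<lambda>(j, i). if j \<le> i then (i + 1, j) else (i, j + 1)"])
    fix x assume xI: "x \<in> {x \<in> ?I. \<not> ?P x}"
    then show "?T x \<in> carrier ?H" using T by blast
    from xI obtain i j where x: "x = (i, j)" and ij: "i \<le> k" "1 \<le> j" "j \<le> k" "j \<noteq> i" "j \<noteq> Suc i" by (cases x) auto
    then obtain l where k: "k = Suc l" by (cases k) auto
    have ul: "u (Suc l) \<in> bi_maps V E F (Suc l) (m - int (Suc l))" by (rule V.tw_homD[OF u refl])
    have dl: "m - 1 - int l = m - int (Suc l)" by simp
    show "?T x = ?S (case x of (i, j) \<Rightarrow> if j < i then (j, i - 1) else (j - 1, i))"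
    proof (cases "j < i")
      case True
      then have b: "j \<le> Suc l" "i \<le> Suc l" "i - 1 \<le> l" "j \<le> l" "1 \<le> Suc l" using ij k by simp_all
      have sq: "face V (Suc (Suc l)) j \<cdot> h (Suc l) i = h l (i - 1) \<cdot> face U (Suc l) j"
        using hty_face_lt[OF True b(2)] by simp
      show ?thesis
        using face_simp_pull[OF E F hty_ends[OF b(2)] hty_ends[OF b(3)] sq ij(2) b(1) ij(2) b(4) ul] True
        by (simp only: x k prod.case if_True diff_Suc_1 dl)
    next
      case False
      then have b: "j \<le> Suc l" "Suc i < j" "j \<le> Suc (Suc l)" "i \<le> Suc l" "i \<le> l" "1 \<le> j - 1" "j - 1 \<le> l" using ij k by linarith+
      have sq: "face V (Suc (Suc l)) j \<cdot> h (Suc l) i = h l i \<cdot> face U (Suc l) (j - 1)"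
        using hty_face_gt[OF b(2,3)] by simp
      show ?thesis using face_simp_pull[OF E F hty_ends[OF b(4)] hty_ends[OF b(5)] sq ij(2) b(1,6,7) ul] False
        by (simp only: x k prod.case if_False diff_Suc_1 dl)
    qed
    show "even (?n x) = even (1 + ?n (case x of (i, j) \<Rightarrow> if j < i then (j, i - 1) else (j - 1, i)))"
      using ij by (auto simp: x of_nat_diff)
    show "(case x of (i, j) \<Rightarrow> if j < i then (j, i - 1) else (j - 1, i)) \<in> ?J" using ij by (auto simp: x)
    show "(case case x of (i, j) \<Rightarrow> if j < i then (j, i - 1) else (j - 1, i) of (j, i) \<Rightarrow> if j \<le> i then (i + 1, j) else (i, j + 1)) = x"
      using ij by (auto simp: x)
  next
    fix x assume "x \<in> ?J"
    then obtain j i where x: "x = (j, i)" and ij: "1 \<le> j" "j < k" "i \<le> k - 1" by (cases x) auto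
    show "(case x of (j, i) \<Rightarrow> if j \<le> i then (i + 1, j) else (i, j + 1)) \<in> {x \<in> ?I. \<not> ?P x}"
      using ij by (auto simp: x)
    show "(case case x of (j, i) \<Rightarrow> if j \<le> i then (i + 1, j) else (i, j + 1) of (i, j) \<Rightarrow> if j < i then (j, i - 1) else (j - 1, i)) = x"
      using ij by (auto simp: x)
  qed
  have "tw_delta U ?E ?F (m - 1) (Hs E F m u) \<in> tw_maps U ?E ?F m"
    by (rule U.tw_delta_closed[OF E' F' Hs_closed[OF refl u]]) simp
  from U.tw_sgn_act[OF E' F' this]
  show "?lhs k = ?rhs k" by (simp only: 1 2 3)
qed

end

text \<open>The middle vertex p of the (k+1)-simplex lies over f if i < p and over g if p \<le> i.
  In the first case the front factor receives the homotopy map with index i at level p - 1 and the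
  back factor receives f; in the second the front factor receives g and the back factor the homotopy
  map with index i - p. Accordingly the intermediate object is f^*F in the first product and g^*F in
  the second.\<close>

lemma Hs_comp:
  assumes E: "graded V E" and F: "graded V F" and G: "graded V G"
    and u: "u \<in> tw_maps V F G m" and v: "v \<in> tw_maps V E F m'"
  shows "Hs E G (m + m') (tw_comp V E F G m m' u v) =
    tw_comp U (F.pb E) (F.pb F) (G.pb G) (m - 1) m' (Hs F G m u) (F.pm E F m' v)
    \<oplus>\<^bsub>tw_hom U (F.pb E) (G.pb G) (m + m' - 1)\<^esub> sgn_act (tw_hom U (F.pb E) (G.pb G) (m + m' - 1)) m
      (tw_comp U (F.pb E) (G.pb F) (G.pb G) m (m' - 1) (G.pm F G m u) (Hs E F m' v))" (is "?lhs = ?rhs")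
proof (rule ext)
  fix k
  let ?E = "F.pb E" and ?F = "F.pb F" and ?F' = "G.pb F" and ?G = "G.pb G"
  note E' = gr_module_pull[OF F.map_map[of 0] E] and F' = gr_module_pull[OF F.map_map[of 0] F]
    and F'' = gr_module_pull[OF G.map_map[of 0] F] and G' = gr_module_pull[OF G.map_map[of 0] G]
  note fv = add_hom_closed[OF F.tw_pull_mor_add_hom[OF E F] v] and gu = add_hom_closed[OF G.tw_pull_mor_add_hom[OF F G] u]
    and Hu = Hs_closed[OF F G refl u] and Hv = Hs_closed[OF E F refl v]
  let ?H = "bi_hom U ?E ?G k (m + m' - 1 - int k)"
  have B: "abelian_group ?H" by (rule U.bi_hom_abelian[OF E' G'])
  let ?c = "\<lambda>p. V.cup E F G (Suc k) p (m - int p) (m' - int (Suc k - p)) (u p) (v (Suc k - p))"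
  let ?T = "\<lambda>(i, p). hp k i E G (m + m' - int (Suc k)) (?c p)"
  let ?I = "Sigma {..k} (\<lambda>_. {..Suc k})"
  let ?n = "\<lambda>(i, p). int i + (m - int p) * int (Suc k - p)"
  have hom: "add_hom (bi_hom V E G (Suc k) (m + m' - int (Suc k))) ?H (hp k i E G (m + m' - int (Suc k)))"
    if "i \<in> {..k}" for i by (rule Hs_hom[OF E G]) (use that in simp_all)
  have cl: "?c p \<in> bi_maps V E G (Suc k) (m + m' - int (Suc k))" if "p \<in> {..Suc k}" for p
    by (rule V.comp_term_closed[OF E F G _ u v]) (use that in simp)
  have T: "?T x \<in> carrier ?H" if "x \<in> ?I" for x using that add_hom_closed[OF hom cl] by auto
  let ?T1 = "\<lambda>(p, i). U.cup ?E ?F ?G k p (m - 1 - int p) (m' - int (k - p))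
     (hp p i F G (m - int (Suc p)) (u (Suc p))) (F.pm E F m' v (k - p))"
  let ?I1 = "Sigma {..k} (\<lambda>p. {..p})"
  let ?n1 = "\<lambda>(p, i). (m - 1 - int p) * int (k - p) + int i"
  have h1: "add_hom (bi_hom U ?F ?G p (m - 1 - int p)) ?H (\<lambda>x. U.cup ?E ?F ?G k p (m - 1 - int p) (m' - int (k - p)) x (F.pm E F m' v (k - p)))"
    if "p \<in> {..k}" for p by (rule U.comp_term_hom_left[OF E' F' G' _ fv]) (use that in simp_all)
  have c1: "hp p i F G (m - int (Suc p)) (u (Suc p)) \<in> bi_maps U ?F ?G p (m - 1 - int p)" if "i \<in> {..p}" for p i
    by (rule add_hom_closed[OF Hs_hom[OF F G] V.tw_homD[OF u refl]]) (use that in simp_all)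
  let ?T2 = "\<lambda>(p, i). U.cup ?E ?F' ?G k p (m - int p) (m' - 1 - int (k - p)) (G.pm F G m u p)
     (hp (k - p) i E F (m' - int (Suc (k - p))) (v (Suc (k - p))))"
  let ?I2 = "Sigma {..k} (\<lambda>p. {..k - p})"
  let ?n2 = "\<lambda>(p, i). (m - int p) * int (k - p) + int i"
  have h2: "add_hom (bi_hom U ?E ?F' (k - p) (m' - 1 - int (k - p))) ?H (U.cup ?E ?F' ?G k p (m - int p) (m' - 1 - int (k - p)) (G.pm F G m u p))"
    if "p \<in> {..k}" for p by (rule U.comp_term_hom_right[OF E' F'' G' _ gu]) (use that in simp_all)
  have c2: "hp (k - p) i E F (m' - int (Suc (k - p))) (v (Suc (k - p)))
      \<in> bi_maps U ?E ?F' (k - p) (m' - 1 - int (k - p))" if "i \<in> {..k - p}" for p i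
    by (rule add_hom_closed[OF Hs_hom[OF E F] V.tw_homD[OF v refl]]) (use that in simp_all)
  have T2: "?T2 x \<in> carrier ?H" if "x \<in> ?I2" for x using that add_hom_closed[OF h2 c2] by auto
  have D: "m + m' - int (Suc k) = m - int p + (m' - int (Suc k - p))" if "p \<le> Suc k" for p
    by (rule V.cup_deg[OF that])
  have "Hs E G (m + m') (tw_comp V E F G m m' u v) k = ssum ?H ?I ?n ?T" unfolding Hs_eq
    by (rule ssum_hom_nested[OF B V.bi_hom_abelian[OF E G] hom]) (simp_all only: V.tw_comp_eq cl finite_atMost)
  also have "\<dots> = ssum ?H {x \<in> ?I. fst x < snd x} ?n ?T \<oplus>\<^bsub>?H\<^esub> ssum ?H {x \<in> ?I. \<not> fst x < snd x} ?n ?T"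
    by (rule ssum_split[OF B _ T]) simp_all
  also have "ssum ?H {x \<in> ?I. fst x < snd x} ?n ?T = ssum ?H ?I1 ?n1 ?T1"
  proof (rule ssum_reindex[OF B, where \<pi> = "\<lambda>(i, p). (p - 1, i)" and \<rho> = "\<lambda>(p, i). (i, p + 1)"])
    fix x assume xI: "x \<in> {x \<in> ?I. fst x < snd x}"
    then show "?T x \<in> carrier ?H" using T by blast
    from xI obtain i p where x': "x = (i, p)" "i \<le> k" "p \<le> Suc k" "i < p" by (cases x) auto
    then obtain r where p: "p = Suc r" by (cases p) auto
    note x = x'(1)[unfolded p] and ik = x'(2) and pk = x'(3)[unfolded p]
    have i: "i \<le> r" "r \<le> k" "i \<le> k - (k - r)" using x' p by simp_all
    have tau: "tau V (Suc k) (Suc k - Suc r) \<cdot> h k i = f (k - r) \<cdot> tau U k (k - r)"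
      using hty_tau_gt[OF diff_le_self i(3)] by simp
    have v': "v (Suc k - Suc r) \<in> bi_maps V E F (Suc k - Suc r) (m' - int (Suc k - Suc r))" by (rule V.tw_homD[OF v refl])
    have e: "ends (f 0) (f 0) (k - r) (Suc k - Suc r) (f (k - r))" using F.map_ends by simp
    have d: "m - 1 - int r = m - int (Suc r)" by simp
    show "?T x = ?T1 (case x of (i, p) \<Rightarrow> (p - 1, i))"
      using simp_pull_cup[OF E F G hty_ends[OF ik] hty_ends[OF i(1)] e pk i(2) h_rho_gt[OF i(1,2)] tau D[OF pk]
          V.tw_homD[OF u refl] v'] by (simp only: x prod.case diff_Suc_1 diff_Suc_Suc tw_pull_mor_def d)
    \<comment> \<open>With H on the front factor, the internal degree of that factor and the length
      of the back factor stay the same, hence so does the exponent.\<close>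
    have "(m - 1 - int r) * int (k - r) + int i = int i + (m - int (Suc r)) * int (Suc k - Suc r)" by (simp add: d)
    then show "even (?n x) = even (?n1 (case x of (i, p) \<Rightarrow> (p - 1, i)))" by (simp only: x prod.case diff_Suc_1)
  qed auto
  also have "\<dots> = tw_comp U ?E ?F ?G (m - 1) m' (Hs F G m u) (F.pm E F m' v) k"
  proof -
    have d: "m - 1 + m' - int k = m + m' - 1 - int k" by simp
    show ?thesis unfolding U.tw_comp_eq d
      by (rule ssum_hom_nested[OF B U.bi_hom_abelian[OF F' G'] h1, symmetric]) (simp_all only: Hs_eq c1 finite_atMost)
  qed
  also have "ssum ?H {x \<in> ?I. \<not> fst x < snd x} ?n ?T = ssum ?H ?I2 (\<lambda>x. m + ?n2 x) ?T2"
  proof (rule ssum_reindex[OF B, where \<pi> = "\<lambda>(i, p). (p, i - p)" and \<rho> = "\<lambda>(p, i). (p + i, p)"])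
    fix x assume xI: "x \<in> {x \<in> ?I. \<not> fst x < snd x}"
    then show "?T x \<in> carrier ?H" using T by blast
    from xI obtain i p where x: "x = (i, p)" and ik: "i \<le> k" and pi: "p \<le> i" by (cases x) auto
    have i: "p \<le> k" "p \<le> Suc k" "i - p \<le> k - p" "k - (k - p) \<le> i" using ik pi by simp_all
    have s: "Suc k - p = Suc (k - p)" "k - (k - p) = p" using i by simp_all
    have tau: "tau V (Suc k) (Suc k - p) \<cdot> h k i = h (k - p) (i - p) \<cdot> tau U k (k - p)"
      using hty_tau_le[OF diff_le_self i(4) ik] by (simp only: s)
    have v': "v (Suc k - p) \<in> bi_maps V E F (Suc k - p) (m' - int (Suc k - p))" by (rule V.tw_homD[OF v refl])
    have e: "ends (f 0) (g 0) (k - p) (Suc k - p) (h (k - p) (i - p))" unfolding s by (rule hty_ends[OF i(3)])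
    have d: "m' - 1 - int (k - p) = m' - int (Suc (k - p))" by simp
    show "?T x = ?T2 (case x of (i, p) \<Rightarrow> (p, i - p))"
      using simp_pull_cup[OF E F G hty_ends[OF ik] G.map_ends e i(2,1) h_rho_le[OF pi ik] tau D[OF i(2)]
          V.tw_homD[OF u refl] v'] by (simp only: x prod.case tw_pull_mor_def d s)
    \<comment> \<open>With H on the back factor, that factor loses one level, which removes m - p
      from the exponent, and i becomes i - p; together this is the sign (-1)^m.\<close>
    have "m + ((m - int p) * int (k - p) + int (i - p)) = 2 * int (i - p) - 2 * int i + 2 * int p + (int i + (m - int p) * int (Suc k - p))"
      using i pi by (simp add: of_nat_diff algebra_simps)
    then have "m + ((m - int p) * int (k - p) + int (i - p)) = 2 * (int (i - p) - int i + int p) + (int i + (m - int p) * int (Suc k - p))"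
      by simp
    then show "even (?n x) = even (m + ?n2 (case x of (i, p) \<Rightarrow> (p, i - p)))"
      by (simp only: x prod.case) (simp, blast)
  qed auto
  also have "\<dots> = sgn_act ?H m (ssum ?H ?I2 ?n2 ?T2)" by (rule sgn_act_ssum[OF B T2, symmetric])
  also have "ssum ?H ?I2 ?n2 ?T2 = tw_comp U ?E ?F' ?G m (m' - 1) (G.pm F G m u) (Hs E F m' v) k"
  proof -
    have d: "m + (m' - 1) - int k = m + m' - 1 - int k" by simp
    show ?thesis unfolding U.tw_comp_eq d
      by (rule ssum_hom_nested[OF B U.bi_hom_abelian[OF E' F''] h2, symmetric]) (simp_all only: Hs_eq c2 finite_atMost)
  qed
  also have "sgn_act ?H m (tw_comp U ?E ?F' ?G m (m' - 1) (G.pm F G m u) (Hs E F m' v) k) =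
      sgn_act (tw_hom U ?E ?G (m + m' - 1)) m (tw_comp U ?E ?F' ?G m (m' - 1) (G.pm F G m u) (Hs E F m' v)) k"
    by (rule U.tw_sgn_act[OF E' G' U.tw_comp_closed[OF E' F'' G' gu Hv], symmetric]) simp
  finally show "?lhs k = ?rhs k" by (simp only: U.tw_hom_simps)
qed

end

section \<open>The dg-category of twisted complexes\<close>

text \<open>Here x1 .. x7 stand for \<delta>b\<cdot>u, b\<cdot>\<delta>u, \<delta>u\<cdot>a,
  u\<cdot>\<delta>a, b\<cdot>b\<cdot>u, b\<cdot>u\<cdot>a and u\<cdot>a\<cdot>a in d(du); the two
  hypotheses \<open>r\<close> are the equations of the twisted complexes multiplied by u.\<close>

lemma diff_square_identity:
  fixes G :: "('g, 'x) ring_scheme" (structure)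
  assumes G: "abelian_group G" and x: "x1 \<in> carrier G" "x2 \<in> carrier G" "x3 \<in> carrier G" "x4 \<in> carrier G"
    "x5 \<in> carrier G" "x6 \<in> carrier G" "x7 \<in> carrier G" and r: "x1 \<oplus> x5 = \<zero>" "x4 \<oplus> x7 = \<zero>"
  shows "(((\<zero> \<oplus> (x1 \<oplus> sgn_act G 1 x2)) \<ominus> sgn_act G m (x3 \<oplus> sgn_act G m x4)) \<oplus>
    ((x2 \<oplus> x5) \<ominus> sgn_act G m x6)) \<ominus> sgn_act G (m + 1) ((x3 \<oplus> x6) \<ominus> sgn_act G m x7) = \<zero>"
proof -
  interpret abelian_group G by (rule G)
  have "x1 = \<ominus> x5" "x4 = \<ominus> x7" using r x by (simp_all add: minus_equality)
  from abelian_group_presentation[OF G] obtain h :: "('g \<Rightarrow>\<^sub>0 int) \<Rightarrow> 'g" where "presents G h" by (rule exE)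
  note h = this[unfolded presents_def, THEN conjunct1] this[unfolded presents_def, THEN conjunct2]
  obtain c2 c3 c5 c6 c7 where c: "x2 = h c2" "x3 = h c3" "x5 = h c5" "x6 = h c6" "x7 = h c7"
    using h(1) x by metis
  show ?thesis unfolding \<open>x1 = _\<close> \<open>x4 = _\<close> c by (cases "even m") (simp_all add: sgn_act_def h(2) algebra_simps)
qed

text \<open>Here x1 .. x5 stand for \<delta>v\<cdot>u, v\<cdot>\<delta>u, c\<cdot>v\<cdot>u,
  v\<cdot>u\<cdot>a and v\<cdot>b\<cdot>u; the last occurs twice on the right and cancels.\<close>

lemma leibniz_identity:
  fixes G :: "('g, 'x) ring_scheme" (structure)
  assumes G: "abelian_group G" and x: "x1 \<in> carrier G" "x2 \<in> carrier G" "x3 \<in> carrier G" "x4 \<in> carrier G" "x5 \<in> carrier G"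
  shows "((x1 \<oplus> sgn_act G p x2) \<oplus> x3) \<ominus> sgn_act G (p + q) x4 =
    ((x1 \<oplus> x3) \<ominus> sgn_act G p x5) \<oplus> sgn_act G p ((x2 \<oplus> x5) \<ominus> sgn_act G q x4)"
proof -
  from abelian_group_presentation[OF G] obtain h :: "('g \<Rightarrow>\<^sub>0 int) \<Rightarrow> 'g" where "presents G h" by (rule exE)
  note h = this[unfolded presents_def, THEN conjunct1] this[unfolded presents_def, THEN conjunct2]
  obtain c1 c2 c3 c4 c5 where c: "x1 = h c1" "x2 = h c2" "x3 = h c3" "x4 = h c4" "x5 = h c5"
    using h(1) x by metis
  show ?thesis unfolding c by (cases "even p"; cases "even q") (simp_all add: sgn_act_def h(2) algebra_simps)
qed

text \<open>The differential in \<open>tw_diff_eq\<close> has the shape (x + y) - (-1)^n z. This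
  lemma and the next two treat that shape once, for additive maps, carriers and sums.\<close>

lemma add_hom_diff_formula:
  assumes G: "abelian_group G" and H: "abelian_group H" and f: "add_hom G H f"
    and x: "x \<in> carrier G" "y \<in> carrier G" "z \<in> carrier G"
  shows "f ((x \<oplus>\<^bsub>G\<^esub> y) \<ominus>\<^bsub>G\<^esub> sgn_act G n z) = (f x \<oplus>\<^bsub>H\<^esub> f y) \<ominus>\<^bsub>H\<^esub> sgn_act H n (f z)"
  using x by (simp add: add_hom_diff[OF G H f] add_hom_add[OF f] add_hom_sgn_act[OF G H f]
      abelian_groupE(1)[OF G] sgn_act_closed[OF G])

lemma diff_formula_closed:
  "\<lbrakk>abelian_group G; x \<in> carrier G; y \<in> carrier G; z \<in> carrier G\<rbrakk> \<Longrightarrow> (x \<oplus>\<^bsub>G\<^esub> y) \<ominus>\<^bsub>G\<^esub> sgn_act G n z \<in> carrier G"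
  by (simp add: abelian_group.minus_closed abelian_groupE(1) sgn_act_closed)

lemma diff_formula_add:
  fixes G :: "('g, 'x) ring_scheme" (structure)
  assumes G: "abelian_group G" and x: "x \<in> carrier G" "y \<in> carrier G" "z \<in> carrier G" "x' \<in> carrier G" "y' \<in> carrier G" "z' \<in> carrier G"
  shows "((x \<oplus> x') \<oplus> (y \<oplus> y')) \<ominus> sgn_act G n (z \<oplus> z') =
    ((x \<oplus> y) \<ominus> sgn_act G n z) \<oplus> ((x' \<oplus> y') \<ominus> sgn_act G n z')"
proof -
  from abelian_group_presentation[OF G] obtain h :: "('g \<Rightarrow>\<^sub>0 int) \<Rightarrow> 'g" where "presents G h" by (rule exE)
  note h = this[unfolded presents_def, THEN conjunct1] this[unfolded presents_def, THEN conjunct2]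
  obtain c1 c2 c3 c4 c5 c6 where c: "x = h c1" "y = h c2" "z = h c3" "x' = h c4" "y' = h c5" "z' = h c6"
    using h(1) x by metis
  show ?thesis unfolding c by (cases "even n") (simp_all add: sgn_act_def h(2) algebra_simps)
qed

context simplicial
begin

abbreviation "Hom X Y \<equiv> tw_hom U (fst X) (fst Y)"
abbreviation "maps X Y \<equiv> tw_maps U (fst X) (fst Y)"
abbreviation "Cmp X Y Z \<equiv> tw_comp U (fst X) (fst Y) (fst Z)"

lemma twistedD:
  assumes "twisted_complex U \<E>"
  shows "graded U (fst \<E>)" and "snd \<E> \<in> maps \<E> \<E> 1"
    and "tw_delta U (fst \<E>) (fst \<E>) 1 (snd \<E>) \<oplus>\<^bsub>Hom \<E> \<E> 2\<^esub>
      Cmp \<E> \<E> \<E> 1 1 (snd \<E>) (snd \<E>) = \<zero>\<^bsub>Hom \<E> \<E> 2\<^esub>"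
  using assms by (auto simp: twisted_complex_def gr_module_def split: prod.splits)

lemma tw_diff_eq: "tw_diff U \<E> \<F> m u = (tw_delta U (fst \<E>) (fst \<F>) m u \<oplus>\<^bsub>Hom \<E> \<F> (m + 1)\<^esub>
     Cmp \<E> \<F> \<F> 1 m (snd \<F>) u) \<ominus>\<^bsub>Hom \<E> \<F> (m + 1)\<^esub>
     sgn_act (Hom \<E> \<F> (m + 1)) m (Cmp \<E> \<E> \<F> m 1 u (snd \<E>))"
  by (simp add: tw_diff_def Let_def split: prod.splits)

text \<open>The same facts with the degrees as separate variables, so that they apply up to
  rearrangement of the degrees.\<close>

lemma tw_delta_hom: "\<lbrakk>graded U E; graded U F; n = m + 1\<rbrakk> \<Longrightarrow>
     add_hom (tw_hom U E F m) (tw_hom U E F n) (tw_delta U E F m)" using tw_delta_add_hom by blast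

lemma tw_comp_hom_left: "\<lbrakk>graded U E; graded U F; graded U G; v \<in> tw_maps U E F m'; n = m + m'\<rbrakk> \<Longrightarrow> add_hom (tw_hom U F G m) (tw_hom U E G n) (\<lambda>u. tw_comp U E F G m m' u v)"
  using tw_comp_add_hom_left by blast

lemma tw_comp_hom_right: "\<lbrakk>graded U E; graded U F; graded U G; u \<in> tw_maps U F G m; n = m + m'\<rbrakk> \<Longrightarrow> add_hom (tw_hom U E F m') (tw_hom U E G n) (tw_comp U E F G m m' u)"
  using tw_comp_add_hom_right by blast

lemma tw_leibniz_deg:
  assumes "graded U E" "graded U F" "graded U G"
    "u \<in> tw_maps U F G m" "v \<in> tw_maps U E F m'" "n = m + m'" "n1 = n + 1" "m1 = m + 1" "m1' = m' + 1"
  shows "tw_delta U E G n (tw_comp U E F G m m' u v) = tw_comp U E F G m1 m' (tw_delta U F G m u) v \<oplus>\<^bsub>tw_hom U E G n1\<^esub>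
    sgn_act (tw_hom U E G n1) m (tw_comp U E F G m m1' u (tw_delta U E F m' v))"
  unfolding assms(6-9) by (rule tw_leibniz[OF assms(1-5)])

lemma tw_comp_assoc_deg:
  assumes "graded U E" "graded U F" "graded U G" "graded U H"
    "w \<in> tw_maps U G H m1" "v \<in> tw_maps U F G m2" "u \<in> tw_maps U E F m3" "n = m2 + m3" "n' = m1 + m2"
  shows "tw_comp U E G H m1 n w (tw_comp U E F G m2 m3 v u) = tw_comp U E F H n' m3 (tw_comp U F G H m1 m2 w v) u"
  unfolding assms(8,9) by (rule tw_comp_assoc[OF assms(1-7)])

context
  fixes \<E> \<F> :: "('a, 'r, 'm) tw_obj"
  assumes \<E>: "twisted_complex U \<E>" and \<F>: "twisted_complex U \<F>"
begin

private lemmas E = twistedD(1)[OF \<E>] and F = twistedD(1)[OF \<F>]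
  and a = twistedD(2)[OF \<E>] and b = twistedD(2)[OF \<F>]

lemma diff_terms_closed:
  assumes u: "u \<in> maps \<E> \<F> m" and n: "n = m + 1"
  shows "tw_delta U (fst \<E>) (fst \<F>) m u \<in> maps \<E> \<F> n"
    and "Cmp \<E> \<F> \<F> 1 m (snd \<F>) u \<in> maps \<E> \<F> n"
    and "Cmp \<E> \<E> \<F> m 1 u (snd \<E>) \<in> maps \<E> \<F> n"
  using tw_delta_closed[OF E F u n] tw_comp_closed[OF E F F b u, of n] tw_comp_closed[OF E E F u a n] n by simp_all

lemma tw_diff_add_hom: "add_hom (Hom \<E> \<F> m) (Hom \<E> \<F> (m + 1)) (tw_diff U \<E> \<F> m)"
proof (rule add_homI)
  let ?H = "Hom \<E> \<F> (m + 1)"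
  fix u assume u: "u \<in> maps \<E> \<F> m"
  note cu = diff_terms_closed[OF u refl]
  show "tw_diff U \<E> \<F> m u \<in> carrier ?H"
    unfolding tw_diff_eq by (rule diff_formula_closed[OF tw_hom_abelian[OF E F] cu])
  fix v assume v: "v \<in> maps \<E> \<F> m"
  note cv = diff_terms_closed[OF v refl]
  have l: "add_hom (Hom \<E> \<F> m) ?H (Cmp \<E> \<F> \<F> 1 m (snd \<F>))" by (rule tw_comp_hom_right[OF E F F b]) simp
  show "tw_diff U \<E> \<F> m (u \<oplus>\<^bsub>Hom \<E> \<F> m\<^esub> v) = tw_diff U \<E> \<F> m u \<oplus>\<^bsub>?H\<^esub> tw_diff U \<E> \<F> m v"
    unfolding tw_diff_eq add_hom_add[OF tw_delta_hom[OF E F refl] u v] add_hom_add[OF l u v]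
      add_hom_add[OF tw_comp_hom_left[OF E E F a refl] u v]
    by (rule diff_formula_add[OF tw_hom_abelian[OF E F] cu cv])
qed

text \<open>After expansion by the Leibniz rule and associativity, \<delta>\<delta>u vanishes and
  the mixed terms cancel in pairs. What is left is (\<delta>b + b\<cdot>b)\<cdot>u and
  u\<cdot>(\<delta>a + a\<cdot>a) up to sign, both zero.\<close>

lemma tw_diff_diff:
  assumes u: "u \<in> maps \<E> \<F> m"
  shows "tw_diff U \<E> \<F> (m + 1) (tw_diff U \<E> \<F> m u) = \<zero>\<^bsub>Hom \<E> \<F> (m + 2)\<^esub>"
proof -
  let ?E = "fst \<E>" and ?F = "fst \<F>" and ?a = "snd \<E>" and ?b = "snd \<F>"
  let ?H1 = "tw_hom U ?E ?F (m + 1)" and ?H = "tw_hom U ?E ?F (m + 2)"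
  note B1 = tw_hom_abelian[OF E F, of "m + 1"] and B = tw_hom_abelian[OF E F, of "m + 2"]
  have d: "m + 1 + 1 = m + 2" "m + 2 = m + 1 + 1" "m + 1 = 1 + m" "m + 2 = 1 + (m + 1)" "(2::int) = 1 + 1" "m + 2 = 2 + m" by simp_all
  note x = diff_terms_closed[OF u refl]
  note h1 = add_hom_diff_formula[OF B1 B tw_delta_hom[OF E F d(2)] x]
    and h2 = add_hom_diff_formula[OF B1 B tw_comp_hom_right[OF E F F b d(4)] x]
    and h3 = add_hom_diff_formula[OF B1 B tw_comp_hom_left[OF E E F a d(2)] x]
  have l1: "tw_delta U ?E ?F (m + 1) (tw_comp U ?E ?F ?F 1 m ?b u) =
      tw_comp U ?E ?F ?F 2 m (tw_delta U ?F ?F 1 ?b) u \<oplus>\<^bsub>?H\<^esub> sgn_act ?H 1 (tw_comp U ?E ?F ?F 1 (m + 1) ?b (tw_delta U ?E ?F m u))"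
    by (rule tw_leibniz_deg[OF E F F b u]) simp_all
  have l2: "tw_delta U ?E ?F (m + 1) (tw_comp U ?E ?E ?F m 1 u ?a) =
      tw_comp U ?E ?E ?F (m + 1) 1 (tw_delta U ?E ?F m u) ?a \<oplus>\<^bsub>?H\<^esub> sgn_act ?H m (tw_comp U ?E ?E ?F m 2 u (tw_delta U ?E ?E 1 ?a))"
    by (rule tw_leibniz_deg[OF E E F u a]) simp_all
  note s1 = tw_comp_assoc_deg[OF E F F F b b u d(3,5)] and s2 = tw_comp_assoc_deg[OF E E F F b u a refl d(3)]
    and s3 = tw_comp_assoc_deg[OF E E E F u a a d(5) refl]
  have da: "tw_delta U ?E ?E 1 ?a \<in> tw_maps U ?E ?E 2" and db: "tw_delta U ?F ?F 1 ?b \<in> tw_maps U ?F ?F 2"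
    by (rule tw_delta_closed[OF E E a] tw_delta_closed[OF F F b]; simp)+
  have aa: "tw_comp U ?E ?E ?E 1 1 ?a ?a \<in> tw_maps U ?E ?E 2" and bb: "tw_comp U ?F ?F ?F 1 1 ?b ?b \<in> tw_maps U ?F ?F 2"
    by (rule tw_comp_closed[OF E E E a a] tw_comp_closed[OF F F F b b]; simp)+
  note hl = tw_comp_hom_left[OF E F F u d(6)] and hr = tw_comp_hom_right[OF E E F u refl]
  have r1: "tw_comp U ?E ?F ?F 2 m (tw_delta U ?F ?F 1 ?b) u \<oplus>\<^bsub>?H\<^esub> tw_comp U ?E ?F ?F 2 m (tw_comp U ?F ?F ?F 1 1 ?b ?b) u = \<zero>\<^bsub>?H\<^esub>"
    unfolding add_hom_add[OF hl db bb, symmetric] twistedD(3)[OF \<F>]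
    by (rule add_hom_zero[OF tw_hom_abelian[OF F F] B hl])
  have r2: "tw_comp U ?E ?E ?F m 2 u (tw_delta U ?E ?E 1 ?a) \<oplus>\<^bsub>?H\<^esub> tw_comp U ?E ?E ?F m 2 u (tw_comp U ?E ?E ?E 1 1 ?a ?a) = \<zero>\<^bsub>?H\<^esub>"
    unfolding add_hom_add[OF hr da aa, symmetric] twistedD(3)[OF \<E>]
    by (rule add_hom_zero[OF tw_hom_abelian[OF E E] B hr])
  note c = add_hom_closed[OF hl db] add_hom_closed[OF tw_comp_hom_right[OF E F F b d(4)] x(1)]
    add_hom_closed[OF tw_comp_hom_left[OF E E F a d(2)] x(1)] add_hom_closed[OF hr da] add_hom_closed[OF hl bb]
    add_hom_closed[OF tw_comp_hom_right[OF E F F b d(4)] x(3)] add_hom_closed[OF hr aa]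
  show ?thesis
    unfolding tw_diff_eq[of \<E> \<F> "m + 1"] d(1) tw_diff_eq[of \<E> \<F> m] h1 h2 h3 tw_delta_delta[OF E F u] l1 l2 s1 s2[symmetric] s3[symmetric]
    by (rule diff_square_identity[OF B c r1 r2])
qed

end

lemma tw_diff_comp:
  assumes \<E>: "twisted_complex U \<E>" and \<F>: "twisted_complex U \<F>" and \<G>: "twisted_complex U \<G>"
    and v: "v \<in> maps \<F> \<G> p" and u: "u \<in> maps \<E> \<F> q"
  shows "tw_diff U \<E> \<G> (p + q) (Cmp \<E> \<F> \<G> p q v u) =
    Cmp \<E> \<F> \<G> (p + 1) q (tw_diff U \<F> \<G> p v) u \<oplus>\<^bsub>Hom \<E> \<G> (p + q + 1)\<^esub>
    sgn_act (Hom \<E> \<G> (p + q + 1)) p (Cmp \<E> \<F> \<G> p (q + 1) v (tw_diff U \<E> \<F> q u))"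
proof -
  let ?E = "fst \<E>" and ?F = "fst \<F>" and ?G = "fst \<G>" and ?a = "snd \<E>" and ?b = "snd \<F>" and ?c = "snd \<G>"
  note E = twistedD(1)[OF \<E>] and F = twistedD(1)[OF \<F>] and G = twistedD(1)[OF \<G>]
    and a = twistedD(2)[OF \<E>] and b = twistedD(2)[OF \<F>] and c = twistedD(2)[OF \<G>]
  let ?H = "tw_hom U ?E ?G (p + q + 1)"
  note B = tw_hom_abelian[OF E G, of "p + q + 1"]
  have d: "p + q + 1 = p + 1 + q" "p + q + 1 = p + (q + 1)" "p + 1 = 1 + p" "q + 1 = 1 + q" by simp_all
  note xv = diff_terms_closed[OF \<F> \<G> v refl] and xu = diff_terms_closed[OF \<E> \<F> u refl]
  note hl = tw_comp_hom_left[OF E F G u d(1)] and hr = tw_comp_hom_right[OF E F G v d(2)]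
  note h1 = add_hom_diff_formula[OF tw_hom_abelian[OF F G] B hl xv] and h2 = add_hom_diff_formula[OF tw_hom_abelian[OF E F] B hr xu]
  note s1 = tw_comp_assoc_deg[OF E F G G c v u refl d(3)] and s2 = tw_comp_assoc_deg[OF E E F G v u a refl refl]
    and s3 = tw_comp_assoc_deg[OF E F F G v b u d(4) refl]
  note x = add_hom_closed[OF hl xv(1)] add_hom_closed[OF hr xu(1)] add_hom_closed[OF hl xv(2)] add_hom_closed[OF hr xu(3)] add_hom_closed[OF hr xu(2)]
  show ?thesis unfolding tw_diff_eq h1 h2 tw_leibniz[OF E F G v u] s1 s2[symmetric] s3[symmetric]
    by (rule leibniz_identity[OF B x])
qed

theorem dg_category_Tw: "dg_category (Tw U :: (('a, 'r, 'm) tw_obj, ('a, 'r, 'm) tw_mor) dg_cat)"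
  unfolding dg_category_def Tw_def dg_cat.simps Ball_def mem_Collect_eq additive_map_iff_add_hom
  by (intro conjI allI impI)
    (assumption | rule tw_hom_abelian tw_diff_add_hom tw_diff_diff tw_comp_add_hom_left tw_comp_add_hom_right tw_diff_comp
      tw_comp_assoc tw_ident_closed tw_comp_ident[OF _ _ _ refl] twistedD(1))+

end

section \<open>The pullback functor\<close>

lemma chain_map_transport:
  assumes T: "transport X Y X0 Z q t t' f" and R: "transport X Y X0 Z q r r' f" and E: "gr_module Z E"
    and dA: "dA \<in> gr_maps Y (gr_pull t E) (gr_pull t E) 1" and dB: "dB \<in> gr_maps Y (gr_pull r E) (gr_pull r E) 1"
    and u: "chain_map Y (gr_pull t E) dA (gr_pull r E) dB u"
  shows "chain_map X (gr_pull t' (gr_pull f E)) (gr_transport q t t t' t' f f E E 1 dA)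
    (gr_pull r' (gr_pull f E)) (gr_transport q r r r' r' f f E E 1 dB) (gr_transport q t r t' r' f f E E 0 u)"
proof -
  have u': "u \<in> gr_maps Y (gr_pull t E) (gr_pull r E) 0" and c: "gr_comp Y (gr_pull t E) 0 dB u = gr_comp Y (gr_pull t E) 1 u dA"
    using u by (simp_all add: chain_map_def)
  have d: "(1::int) = 0 + 1" "(1::int) = 1 + 0" by simp_all
  show ?thesis
    unfolding chain_map_def gr_transport_comp[OF T R R E E E u' dB d(1), symmetric] gr_transport_comp[OF T T R E E E dA u' d(2), symmetric] c
    using gr_transport_closed[OF T R E E u'] by simp
qed

lemma chain_homotopic_transport:
  assumes T: "transport X Y X0 Z q t t' f" and R: "transport X Y X0 Z q r r' f" and E: "gr_module Z E"
    and dA: "dA \<in> gr_maps Y (gr_pull t E) (gr_pull t E) 1" and dB: "dB \<in> gr_maps Y (gr_pull r E) (gr_pull r E) 1"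
    and u: "u \<in> gr_maps Y (gr_pull t E) (gr_pull r E) 0" and v: "v \<in> gr_maps Y (gr_pull t E) (gr_pull r E) 0"
    and uv: "chain_homotopic Y (gr_pull t E) dA (gr_pull r E) dB u v"
  shows "chain_homotopic X (gr_pull t' (gr_pull f E)) (gr_transport q t t t' t' f f E E 1 dA)
    (gr_pull r' (gr_pull f E)) (gr_transport q r r r' r' f f E E 1 dB)
    (gr_transport q t r t' r' f f E E 0 u) (gr_transport q t r t' r' f f E E 0 v)"
proof -
  let ?A = "gr_pull t E" and ?B = "gr_pull r E" and ?A' = "gr_pull t' (gr_pull f E)" and ?B' = "gr_pull r' (gr_pull f E)"
  note A = gr_module_pull[OF transport.t[OF T] E] and B = gr_module_pull[OF transport.t[OF R] E]
  note G = gr_hom_abelian[OF A B] and G' = gr_hom_abelian[OF gr_module_pull[OF transport.t'[OF T] gr_module_pull[OF transport.f[OF T] E]]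
      gr_module_pull[OF transport.t'[OF R] gr_module_pull[OF transport.f[OF R] E]]]
  from uv obtain s where s: "s \<in> gr_maps Y ?A ?B (-1)"
    and e: "u \<ominus>\<^bsub>gr_hom Y ?A ?B 0\<^esub> v = gr_comp Y ?A (-1) dB s \<oplus>\<^bsub>gr_hom Y ?A ?B 0\<^esub> gr_comp Y ?A 1 s dA"
    by (auto simp: chain_homotopic_def)
  note S = gr_transport_add_hom[OF T R E E, of 0]
  have d: "(0::int) = -1 + 1" "(0::int) = 1 + -1" by simp_all
  note x = gr_comp_closed[OF A B B d(1) s dB] and y = gr_comp_closed[OF A A B d(2) dA s]
  have "gr_transport q t r t' r' f f E E 0 u \<ominus>\<^bsub>gr_hom X ?A' ?B' 0\<^esub> gr_transport q t r t' r' f f E E 0 v =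
     gr_comp X ?A' (-1) (gr_transport q r r r' r' f f E E 1 dB) (gr_transport q t r t' r' f f E E (-1) s) \<oplus>\<^bsub>gr_hom X ?A' ?B' 0\<^esub>
     gr_comp X ?A' 1 (gr_transport q t r t' r' f f E E (-1) s) (gr_transport q t t t' t' f f E E 1 dA)"
    unfolding add_hom_diff[OF G G' S u v, symmetric] e add_hom_add[OF S x y]
      gr_transport_comp[OF T R R E E E s dB d(1)] gr_transport_comp[OF T T R E E E dA s d(2)] ..
  with gr_transport_closed[OF T R E E s] show ?thesis unfolding chain_homotopic_def by blast
qed

text \<open>Transport is additive and compatible with composition and identities, so it carries an
  inverse up to homotopy, together with the two homotopies, to another one. With it the
  invertibility of \<open>a^{1,0}\<close> passes to the pulled back complex.\<close>

lemma homotopy_invertible_transport: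
  assumes T: "transport X Y X0 Z q t t' f" and R: "transport X Y X0 Z q r r' f" and E: "gr_module Z E"
    and dA: "dA \<in> gr_maps Y (gr_pull t E) (gr_pull t E) 1" and dB: "dB \<in> gr_maps Y (gr_pull r E) (gr_pull r E) 1"
    and u: "homotopy_invertible Y (gr_pull t E) dA (gr_pull r E) dB u"
  shows "homotopy_invertible X (gr_pull t' (gr_pull f E)) (gr_transport q t t t' t' f f E E 1 dA)
    (gr_pull r' (gr_pull f E)) (gr_transport q r r r' r' f f E E 1 dB) (gr_transport q t r t' r' f f E E 0 u)"
proof -
  note A = gr_module_pull[OF transport.t[OF T] E] and B = gr_module_pull[OF transport.t[OF R] E]
  from u obtain v where cu: "chain_map Y (gr_pull t E) dA (gr_pull r E) dB u" and cv: "chain_map Y (gr_pull r E) dB (gr_pull t E) dA v"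
    and h: "chain_homotopic Y (gr_pull t E) dA (gr_pull t E) dA (gr_comp Y (gr_pull t E) 0 v u) (gr_id Y (gr_pull t E))"
      "chain_homotopic Y (gr_pull r E) dB (gr_pull r E) dB (gr_comp Y (gr_pull r E) 0 u v) (gr_id Y (gr_pull r E))"
    unfolding homotopy_invertible_def by blast
  have d: "(0::int) = 0 + 0" by simp
  have u': "u \<in> gr_maps Y (gr_pull t E) (gr_pull r E) 0" and v': "v \<in> gr_maps Y (gr_pull r E) (gr_pull t E) 0"
    using cu cv by (simp_all add: chain_map_def)
  note h1 = chain_homotopic_transport[OF T T E dA dA gr_comp_closed[OF A B A d u' v'] gr_id_closed[OF A] h(1),
      unfolded gr_transport_comp[OF T R T E E E u' v' d] gr_transport_id[OF T E]]
    and h2 = chain_homotopic_transport[OF R R E dB dB gr_comp_closed[OF B A B d v' u'] gr_id_closed[OF B] h(2),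
      unfolded gr_transport_comp[OF R T R E E E v' u' d] gr_transport_id[OF R E]]
  show ?thesis unfolding homotopy_invertible_def
    using chain_map_transport[OF T R E dA dB cu] chain_map_transport[OF R T E dB dA cv] h1 h2 by blast
qed

lemma fobj_pullback [simp]: "fst (fobj (tw_pullback U V f) \<E>) = gr_pull (f 0) (fst \<E>)"
  "snd (fobj (tw_pullback U V f) \<E>) = tw_pull_mor U V f (fst \<E>) (fst \<E>) 1 (snd \<E>)"
  by (simp_all add: tw_pullback_def split: prod.splits)

context simplicial_mapping
begin

text \<open>Identifies the transported differential with the one that \<open>twisted_complex\<close>
  prescribes for the pulled back complex; \<open>p\<close> and \<open>p'\<close> stand for tau, or
  for rho, from level 1 to level 0.\<close>

lemma transport_vertex:
  assumes E: "graded V E" and x: "x \<in> bi_maps V E E 0 1"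
    and p: "rs_map (lev V 1) (lev V 0) p" and p': "rs_map (lev U 1) (lev U 0) p'" and sq: "p \<cdot> f 1 = f 0 \<cdot> p'"
  shows "gr_transport (f 1) p p p' p' (f 0) (f 0) E E 1 (bi_pull V p E E 0 1 x) =
    bi_pull U p' (pb E) (pb E) 0 1 (pl 0 E E 1 x)"
proof -
  have i: "tau V 0 0 \<cdot> p = p" "rho V 0 0 \<cdot> p = p" "tau U 0 0 \<cdot> p' = p'" "rho U 0 0 \<cdot> p' = p'"
    using rs_map_id_left[OF p] rs_map_id_left[OF p'] by simp_all
  note 1 = gr_transport_pull_map[OF p map_map V.tau_map[OF le0] V.rho_map[OF le0] E E x[unfolded bi_hom_def], unfolded i]
  show ?thesis unfolding bi_pull_simp_pull[OF E E map_ends p' x] i sq[symmetric] unfolding bi_pull_def by (rule 1)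
qed

lemma tw_pull_mor_comp_deg:
  assumes "graded V E" "graded V F" "graded V G" "u \<in> tw_maps V F G m" "v \<in> tw_maps V E F m'" "n = m + m'"
  shows "pm E G n (tw_comp V E F G m m' u v) = tw_comp U (pb E) (pb F) (pb G) m m' (pm F G m u) (pm E F m' v)"
  unfolding assms(6) by (rule tw_pull_mor_comp[OF assms(1-5)])

lemma twisted_pullback:
  assumes "twisted_complex V \<E>"
  shows "twisted_complex U (fobj (tw_pullback U V f) \<E>)"
proof -
  obtain E a where e: "\<E> = (E, a)" by (cases \<E>)
  note X = assms[unfolded e]
  note E = V.twistedD(1)[OF X, simplified] and a = V.twistedD(2)[OF X, simplified]
    and eq = V.twistedD(3)[OF X, simplified]
  let ?E = "pb E" and ?a = "pm E E 1 a"
  note E' = gr_module_pull[OF map_map[of 0] E] and A = add_hom_closed[OF tw_pull_mor_add_hom[OF E E]]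
  have d: "(2::int) = 1 + 1" by simp
  note da = V.tw_delta_closed[OF E E a d] and aa = V.tw_comp_closed[OF E E E a a d]
  have "tw_delta U ?E ?E 1 ?a \<oplus>\<^bsub>tw_hom U ?E ?E 2\<^esub> tw_comp U ?E ?E ?E 1 1 ?a ?a =
      pm E E 2 (tw_delta V E E 1 a \<oplus>\<^bsub>tw_hom V E E 2\<^esub> tw_comp V E E E 1 1 a a)"
    unfolding add_hom_add[OF tw_pull_mor_add_hom[OF E E] da aa] tw_pull_mor_comp_deg[OF E E E a a d]
    using tw_pull_mor_delta[OF E E a] by (simp only: d)
  also have "\<dots> = \<zero>\<^bsub>tw_hom U ?E ?E 2\<^esub>"
    unfolding eq by (rule add_hom_zero[OF V.tw_hom_abelian[OF E E] U.tw_hom_abelian[OF E' E'] tw_pull_mor_add_hom[OF E E]])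
  finally have eq': "tw_delta U ?E ?E 1 ?a \<oplus>\<^bsub>tw_hom U ?E ?E 2\<^esub> tw_comp U ?E ?E ?E 1 1 ?a ?a = \<zero>\<^bsub>tw_hom U ?E ?E 2\<^esub>" .
  have a0: "a 0 \<in> bi_maps V E E 0 1" by (rule V.tw_homD[OF a]) simp
  have le: "(0::nat) \<le> 1" by simp
  note tV = V.tau_map[OF le] and rV = V.rho_map[OF le] and tU = U.tau_map[OF le] and rU = U.rho_map[OF le]
  have cl: "bi_pull V p E E 0 1 (a 0) \<in> gr_maps (lev V 1) (gr_pull p E) (gr_pull p E) 1"
    if p: "rs_map (lev V 1) (lev V 0) p" for p
    using gr_pull_map_closed[OF p V.tau_map[OF le0[of 0]] V.rho_map[OF le0] E E a0[unfolded bi_hom_def]] rs_map_id_left[OF p]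
    by (simp add: bi_pull_def)
  have hi: "homotopy_invertible (lev V 1) (gr_pull (tau V 1 0) E) (bi_pull V (tau V 1 0) E E 0 1 (a 0))
       (gr_pull (rho V 1 0) E) (bi_pull V (rho V 1 0) E E 0 1 (a 0)) (a 1)"
    using X by (simp add: twisted_complex_def)
  have m0: "?a 0 = pl 0 E E 1 (a 0)"
    and m1: "?a 1 = gr_transport (f 1) (tau V 1 0) (rho V 1 0) (tau U 1 0) (rho U 1 0) (f 0) (f 0) E E 0 (a 1)"
    by (simp_all add: tw_pull_mor_def simp_pull_transport)
  have "homotopy_invertible (lev U 1) (gr_pull (tau U 1 0) ?E) (bi_pull U (tau U 1 0) ?E ?E 0 1 (?a 0))
       (gr_pull (rho U 1 0) ?E) (bi_pull U (rho U 1 0) ?E ?E 0 1 (?a 0)) (?a 1)"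
    unfolding m0 m1 transport_vertex[OF E a0 tV tU map_tau[OF le], symmetric] transport_vertex[OF E a0 rV rU map_rho[OF le], symmetric]
    by (rule homotopy_invertible_transport[OF endsD(1,2)[OF map_ends] E cl[OF tV] cl[OF rV] hi])
  then show ?thesis
    using E' A[OF a] eq' unfolding e by (simp add: tw_pullback_def twisted_complex_def gr_module_def)
qed

lemma tw_pull_mor_diff:
  assumes \<E>: "twisted_complex V \<E>" and \<F>: "twisted_complex V \<F>" and u: "u \<in> V.maps \<E> \<F> m"
  shows "pm (fst \<E>) (fst \<F>) (m + 1) (tw_diff V \<E> \<F> m u) =
    tw_diff U (fobj (tw_pullback U V f) \<E>) (fobj (tw_pullback U V f) \<F>) m (pm (fst \<E>) (fst \<F>) m u)"
proof -
  note E = V.twistedD(1)[OF \<E>] and F = V.twistedD(1)[OF \<F>]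
    and a = V.twistedD(2)[OF \<E>] and b = V.twistedD(2)[OF \<F>]
  note E' = gr_module_pull[OF map_map[of 0] E] and F' = gr_module_pull[OF map_map[of 0] F]
  have d: "m + 1 = 1 + m" by simp
  show ?thesis unfolding V.tw_diff_eq U.tw_diff_eq fobj_pullback
      add_hom_diff_formula[OF V.tw_hom_abelian[OF E F] U.tw_hom_abelian[OF E' F'] tw_pull_mor_add_hom[OF E F] V.diff_terms_closed[OF \<E> \<F> u refl]]
      tw_pull_mor_delta[OF E F u] tw_pull_mor_comp_deg[OF E F F b u d] tw_pull_mor_comp_deg[OF E E F u a refl] ..
qed

theorem dg_functor_pullback: "dg_functor (Tw V :: (('b, 's, 'm) tw_obj, ('b, 's, 'm) tw_mor) dg_cat)
     (Tw U :: (('a, 'r, ('a, 'r, 'b, 'm) pbs) tw_obj, ('a, 'r, ('a, 'r, 'b, 'm) pbs) tw_mor) dg_cat) (tw_pullback U V f)"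
proof -
  have fm: "fmor (tw_pullback U V f) \<E> \<F> = pm (fst \<E>) (fst \<F>)" for \<E> \<F> :: "('b, 's, 'm) tw_obj"
    by (intro ext) (simp add: tw_pullback_def)
  show ?thesis
    unfolding dg_functor_def Tw_def dg_cat.simps Ball_def mem_Collect_eq additive_map_iff_add_hom fm fobj_pullback
    by (intro conjI allI impI)
      (assumption | rule twisted_pullback tw_pull_mor_ident fobj_pullback(1) tw_pull_mor_add_hom tw_pull_mor_diff
        tw_pull_mor_comp V.twistedD(1))+
qed

end

section \<open>The natural transformation\<close>

text \<open>Here x1 .. x5 stand for \<delta>(Hu), g^*b\<cdot>Hu, Hu\<cdot>f^*a, g^*u\<cdot>Ha and
  Hb\<cdot>f^*u. The bracket in the last term is H(du), and the factor (-1)^m before it is the sign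
  of \<open>\<Phi>\<^sub>1\<close> in degree m + 1.\<close>

lemma unary_identity:
  fixes G :: "('g, 'x) ring_scheme" (structure)
  assumes G: "abelian_group G" and x: "x1 \<in> carrier G" "x2 \<in> carrier G" "x3 \<in> carrier G" "x4 \<in> carrier G" "x5 \<in> carrier G"
  shows "sgn_act G (m - 1) ((x1 \<oplus> x2) \<ominus> sgn_act G (m - 1) x3) \<oplus> sgn_act G (m - 1) x4 \<oplus> sgn_act G (- m) x5 \<oplus>
    sgn_act G 1 (sgn_act G m ((sgn_act G 1 x1 \<oplus> (x5 \<oplus> sgn_act G 1 x2)) \<ominus> sgn_act G m (x3 \<oplus> sgn_act G m x4))) = \<zero>"
proof -
  from abelian_group_presentation[OF G] obtain h :: "('g \<Rightarrow>\<^sub>0 int) \<Rightarrow> 'g" where "presents G h" by (rule exE)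
  note h = this[unfolded presents_def, THEN conjunct1] this[unfolded presents_def, THEN conjunct2]
  obtain c1 c2 c3 c4 c5 where c: "x1 = h c1" "x2 = h c2" "x3 = h c3" "x4 = h c4" "x5 = h c5"
    using h(1) x by metis
  show ?thesis unfolding c by (cases "even m") (simp_all add: sgn_act_def h(2) algebra_simps)
qed

text \<open>Here x and y stand for Hv\<cdot>f^*u and g^*v\<cdot>Hu with u of degree m and v of
  degree n; the last bracket is H(v\<cdot>u) as given by \<open>Hs_comp\<close>.\<close>

lemma binary_identity:
  fixes G :: "('g, 'x) ring_scheme" (structure)
  assumes G: "abelian_group G" and x: "x \<in> carrier G" "y \<in> carrier G"
  shows "sgn_act G (n - 1) (sgn_act G (m - 1) y) \<oplus> sgn_act G (- (m + n) + 1) (sgn_act G (n - 1) x) \<oplus>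
    sgn_act G n (sgn_act G (n + m - 1) (x \<oplus> sgn_act G n y)) = \<zero>"
proof -
  from abelian_group_presentation[OF G] obtain h :: "('g \<Rightarrow>\<^sub>0 int) \<Rightarrow> 'g" where "presents G h" by (rule exE)
  note h = this[unfolded presents_def, THEN conjunct1] this[unfolded presents_def, THEN conjunct2]
  obtain c d where c: "x = h c" "y = h d" using h(1) x by metis
  show ?thesis unfolding c by (cases "even n"; cases "even m") (simp_all add: sgn_act_def h(2) algebra_simps)
qed

context simplicial_homotopic
begin

lemma Hs_comp_deg:
  assumes "graded V E" "graded V F" "graded V G"
    "u \<in> tw_maps V F G m" "v \<in> tw_maps V E F m'" "n = m + m'" "n1 = n - 1" "m1 = m - 1" "m1' = m' - 1"
  shows "Hs E G n (tw_comp V E F G m m' u v) =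
    tw_comp U (F.pb E) (F.pb F) (G.pb G) m1 m' (Hs F G m u) (F.pm E F m' v)
    \<oplus>\<^bsub>tw_hom U (F.pb E) (G.pb G) n1\<^esub> sgn_act (tw_hom U (F.pb E) (G.pb G) n1) m
      (tw_comp U (F.pb E) (G.pb F) (G.pb G) m m1' (G.pm F G m u) (Hs E F m' v))"
  unfolding assms(6-9) by (rule Hs_comp[OF assms(1-5)])

lemma Hs_delta_deg:
  assumes "graded V E" "graded V F" "u \<in> tw_maps V E F m" "n = m + 1" "n' = m - 1"
  shows "Hs E F n (tw_delta V E F m u) =
    sgn_act (tw_hom U (F.pb E) (G.pb F) m) 1 (tw_delta U (F.pb E) (G.pb F) n' (Hs E F m u))"
  unfolding assms(4,5) by (rule Hs_delta[OF assms(1-3)])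

lemma Hs_twisted_closed:
  assumes \<E>: "twisted_complex V \<E>"
  shows "Hs (fst \<E>) (fst \<E>) 1 (snd \<E>) \<in> tw_maps U (F.pb (fst \<E>)) (G.pb (fst \<E>)) 0"
  by (rule Hs_closed[OF V.twistedD(1)[OF \<E>] V.twistedD(1)[OF \<E>] _ V.twistedD(2)[OF \<E>]]) simp

lemma diff_Hs_twisted:
  assumes \<E>: "twisted_complex V \<E>"
  shows "tw_diff U (fobj (tw_pullback U V f) \<E>) (fobj (tw_pullback U V g) \<E>) 0 (Hs (fst \<E>) (fst \<E>) 1 (snd \<E>)) =
    \<zero>\<^bsub>tw_hom U (F.pb (fst \<E>)) (G.pb (fst \<E>)) 1\<^esub>"
proof -
  let ?E = "fst \<E>" and ?a = "snd \<E>"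
  let ?H = "tw_hom U (F.pb ?E) (G.pb ?E) 1"
  note E = V.twistedD(1)[OF \<E>] and a = V.twistedD(2)[OF \<E>]
  note E' = gr_module_pull[OF F.map_map[of 0] E] and E'' = gr_module_pull[OF G.map_map[of 0] E]
  interpret H: abelian_group ?H by (rule U.tw_hom_abelian[OF E' E''])
  have d: "(2::int) = 1 + 1" "(1::int) = 2 - 1" "(0::int) = 1 - 1" "0 + 1 = (1::int)" by simp_all
  note da = V.tw_delta_closed[OF E E a d(1)] and aa = V.tw_comp_closed[OF E E E a a d(1)]
  note A = Hs_add_hom[OF E E d(2)]
  have "Hs ?E ?E 2 (tw_delta V ?E ?E 1 ?a \<oplus>\<^bsub>tw_hom V ?E ?E 2\<^esub> tw_comp V ?E ?E ?E 1 1 ?a ?a) = \<zero>\<^bsub>?H\<^esub>"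
    unfolding V.twistedD(3)[OF \<E>] by (rule add_hom_zero[OF V.tw_hom_abelian[OF E E] H.abelian_group_axioms A])
  then have r: "sgn_act ?H 1 (tw_delta U (F.pb ?E) (G.pb ?E) 0 (Hs ?E ?E 1 ?a)) \<oplus>\<^bsub>?H\<^esub>
     (tw_comp U (F.pb ?E) (F.pb ?E) (G.pb ?E) 0 1 (Hs ?E ?E 1 ?a) (F.pm ?E ?E 1 ?a) \<oplus>\<^bsub>?H\<^esub>
      sgn_act ?H 1 (tw_comp U (F.pb ?E) (G.pb ?E) (G.pb ?E) 1 0 (G.pm ?E ?E 1 ?a) (Hs ?E ?E 1 ?a))) = \<zero>\<^bsub>?H\<^esub>"
    unfolding add_hom_add[OF A da aa] Hs_delta_deg[OF E E a d(1,3)] Hs_comp_deg[OF E E E a a d(1,2,3,3)] .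
  have c: "tw_delta U (F.pb ?E) (G.pb ?E) 0 (Hs ?E ?E 1 ?a) \<in> carrier ?H"
    "tw_comp U (F.pb ?E) (G.pb ?E) (G.pb ?E) 1 0 (G.pm ?E ?E 1 ?a) (Hs ?E ?E 1 ?a) \<in> carrier ?H"
    "tw_comp U (F.pb ?E) (F.pb ?E) (G.pb ?E) 0 1 (Hs ?E ?E 1 ?a) (F.pm ?E ?E 1 ?a) \<in> carrier ?H"
    using U.diff_terms_closed[OF F.twisted_pullback[OF \<E>] G.twisted_pullback[OF \<E>], of "Hs ?E ?E 1 ?a" 0 1] Hs_twisted_closed[OF \<E>] by simp_all
  \<comment> \<open>The right-hand side is minus the image under H of the twisted complex equation,
    as expanded in \<open>r\<close>; the left-hand side is the differential of
    \<open>\<Phi>\<^sub>0\<close>.\<close>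
  have *: "(x \<oplus>\<^bsub>?H\<^esub> y) \<ominus>\<^bsub>?H\<^esub> sgn_act ?H 0 z = \<ominus>\<^bsub>?H\<^esub> (sgn_act ?H 1 x \<oplus>\<^bsub>?H\<^esub> (z \<oplus>\<^bsub>?H\<^esub> sgn_act ?H 1 y))"
    if "x \<in> carrier ?H" "y \<in> carrier ?H" "z \<in> carrier ?H" for x y z
    using that by (simp add: sgn_act_def H.minus_eq H.minus_add H.a_ac)
  show ?thesis unfolding U.tw_diff_eq fobj_pullback d(4) *[OF c] r by simp
qed

text \<open>The relation for l = 1, with \<open>\<Phi>\<^sub>0\<close> and
  \<open>\<Phi>\<^sub>1\<close> written out. Expanding H(du), the products with b and a contribute
  the two terms with \<open>\<Phi>\<^sub>0\<close>, and everything else is the differential of the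
  homotopy sum of u.\<close>

lemma unary_relation:
  assumes \<E>: "twisted_complex V \<E>" and \<F>: "twisted_complex V \<F>" and u: "u \<in> V.maps \<E> \<F> m"
    and H: "H = tw_hom U (F.pb (fst \<E>)) (G.pb (fst \<F>)) m"
  shows "tw_diff U (fobj (tw_pullback U V f) \<E>) (fobj (tw_pullback U V g) \<F>) (m - 1)
      (sgn_act (tw_hom U (F.pb (fst \<E>)) (G.pb (fst \<F>)) (m - 1)) (m - 1) (Hs (fst \<E>) (fst \<F>) m u)) \<oplus>\<^bsub>H\<^esub>
    sgn_act H (m - 1) (tw_comp U (F.pb (fst \<E>)) (G.pb (fst \<E>)) (G.pb (fst \<F>)) m 0
      (G.pm (fst \<E>) (fst \<F>) m u) (Hs (fst \<E>) (fst \<E>) 1 (snd \<E>))) \<oplus>\<^bsub>H\<^esub>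
    sgn_act H (- m) (tw_comp U (F.pb (fst \<E>)) (F.pb (fst \<F>)) (G.pb (fst \<F>)) 0 m
      (Hs (fst \<F>) (fst \<F>) 1 (snd \<F>)) (F.pm (fst \<E>) (fst \<F>) m u)) \<oplus>\<^bsub>H\<^esub>
    sgn_act H 1 (sgn_act H m (Hs (fst \<E>) (fst \<F>) (m + 1) (tw_diff V \<E> \<F> m u))) = \<zero>\<^bsub>H\<^esub>"
proof -
  let ?E = "fst \<E>" and ?F = "fst \<F>"
  note E = V.twistedD(1)[OF \<E>] and a = V.twistedD(2)[OF \<E>]
    and F = V.twistedD(1)[OF \<F>] and b = V.twistedD(2)[OF \<F>]
  note E' = gr_module_pull[OF F.map_map[of 0] E] and E'' = gr_module_pull[OF G.map_map[of 0] E]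
    and F' = gr_module_pull[OF F.map_map[of 0] F] and F'' = gr_module_pull[OF G.map_map[of 0] F]
  note \<E>' = F.twisted_pullback[OF \<E>] and \<F>' = G.twisted_pullback[OF \<F>]
  have B: "abelian_group H" unfolding H by (rule U.tw_hom_abelian[OF E' F''])
  have d: "m = m + 1 - 1" "m + 1 = 1 + m" "(0::int) = 1 - 1" "m - 1 + 1 = m" "m = 0 + m" "m = m + 0" by simp_all
  note Hu = Hs_closed[OF E F refl u] and fu = add_hom_closed[OF F.tw_pull_mor_add_hom[OF E F] u]
    and gu = add_hom_closed[OF G.tw_pull_mor_add_hom[OF E F] u]
  have D: "add_hom (tw_hom U (F.pb ?E) (G.pb ?F) (m - 1)) H (tw_diff U (fobj (tw_pullback U V f) \<E>) (fobj (tw_pullback U V g) \<F>) (m - 1))"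
    using U.tw_diff_add_hom[OF \<E>' \<F>', of "m - 1"] by (simp add: H)
  note 1 = add_hom_sgn_act[OF U.tw_hom_abelian[OF E' F''] B D Hu]
  note 2 = add_hom_diff_formula[OF V.tw_hom_abelian[OF E F] U.tw_hom_abelian[OF E' F''] Hs_add_hom[OF E F d(1)] V.diff_terms_closed[OF \<E> \<F> u refl]]
  have x: "tw_delta U (F.pb ?E) (G.pb ?F) (m - 1) (Hs ?E ?F m u) \<in> carrier H"
    "tw_comp U (F.pb ?E) (G.pb ?F) (G.pb ?F) 1 (m - 1) (G.pm ?F ?F 1 (snd \<F>)) (Hs ?E ?F m u) \<in> carrier H"
    "tw_comp U (F.pb ?E) (F.pb ?E) (G.pb ?F) (m - 1) 1 (Hs ?E ?F m u) (F.pm ?E ?E 1 (snd \<E>)) \<in> carrier H"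
    using U.diff_terms_closed[OF \<E>' \<F>', of "Hs ?E ?F m u" "m - 1" m] Hu by (simp_all add: H)
  note y = U.tw_comp_closed[OF E' E'' F'' gu Hs_twisted_closed[OF \<E>] d(6), folded H]
    U.tw_comp_closed[OF E' F' F'' Hs_twisted_closed[OF \<F>] fu d(5), folded H]
  show ?thesis unfolding 1 unfolding U.tw_diff_eq V.tw_diff_eq fobj_pullback d(4) H[symmetric] 2[folded H]
      Hs_delta_deg[OF E F u refl refl, folded H] Hs_comp_deg[OF E F F b u d(2) d(1) d(3) refl, folded H] Hs_comp_deg[OF E E F u a refl d(1) refl d(3), folded H]
    by (rule unary_identity[OF B x y])
qed

text \<open>The relation for l = 2 without the terms that contain
  \<open>\<Phi>\<^sub>2\<close>.\<close>

lemma binary_relation: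
  assumes E: "graded V E" and F: "graded V F" and G: "graded V G"
    and u: "u \<in> tw_maps V E F m" and v: "v \<in> tw_maps V F G n"
    and H: "H = tw_hom U (F.pb E) (G.pb G) (n + m - 1)"
  shows "sgn_act H (n - 1) (tw_comp U (F.pb E) (G.pb F) (G.pb G) n (m - 1) (G.pm F G n v)
      (sgn_act (tw_hom U (F.pb E) (G.pb F) (m - 1)) (m - 1) (Hs E F m u))) \<oplus>\<^bsub>H\<^esub>
    sgn_act H (- (m + n) + 1) (tw_comp U (F.pb E) (F.pb F) (G.pb G) (n - 1) m
      (sgn_act (tw_hom U (F.pb F) (G.pb G) (n - 1)) (n - 1) (Hs F G n v)) (F.pm E F m u)) \<oplus>\<^bsub>H\<^esub>
    sgn_act H n (sgn_act H (n + m - 1) (Hs E G (n + m) (tw_comp V E F G n m v u))) = \<zero>\<^bsub>H\<^esub>"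
proof -
  note E' = gr_module_pull[OF F.map_map[of 0] E] and F' = gr_module_pull[OF F.map_map[of 0] F]
    and F'' = gr_module_pull[OF G.map_map[of 0] F] and G'' = gr_module_pull[OF G.map_map[of 0] G]
  note Hu = Hs_closed[OF E F refl u] and Hv = Hs_closed[OF F G refl v]
    and fu = add_hom_closed[OF F.tw_pull_mor_add_hom[OF E F] u] and gv = add_hom_closed[OF G.tw_pull_mor_add_hom[OF F G] v]
  have B: "abelian_group H" unfolding H by (rule U.tw_hom_abelian[OF E' G''])
  have d: "n + m - 1 = n + (m - 1)" "n + m - 1 = n - 1 + m" by simp_all
  note hr = U.tw_comp_hom_right[OF E' F'' G'' gv d(1), folded H] and hl = U.tw_comp_hom_left[OF E' F' G'' fu d(2), folded H]
  show ?thesis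
    unfolding add_hom_sgn_act[OF U.tw_hom_abelian[OF E' F''] B hr Hu] add_hom_sgn_act[OF U.tw_hom_abelian[OF F' G''] B hl Hv]
      Hs_comp[OF E F G v u, folded H]
    by (rule binary_identity[OF B add_hom_closed[OF hl Hv] add_hom_closed[OF hr Hu]])
qed

end

section \<open>Evaluation of the transformation on words of composable morphisms\<close>

lemma Tw_simps: "X \<in> dobj (Tw U) \<longleftrightarrow> twisted_complex U X" "dhom (Tw U) X Y n = tw_hom U (fst X) (fst Y) n"
  "ddiff (Tw U) = tw_diff U" "dcomp (Tw U) X Y Z p q = tw_comp U (fst X) (fst Y) (fst Z) p q"
  by (simp_all add: Tw_def fun_eq_iff)

lemma fmor_pullback: "fmor (tw_pullback U V f) X Y n = tw_pull_mor U V f (fst X) (fst Y) n"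
  by (simp add: tw_pullback_def fun_eq_iff)

lemma tensor_word_empty: "b < a \<Longrightarrow> tensor_word X m u b a = []" by (simp add: tensor_word_def)

lemma tensor_word_Suc:
  "a \<le> Suc b \<Longrightarrow> tensor_word X m u (Suc b) a = (X b, X (Suc b), m (Suc b), u (Suc b)) # tensor_word X m u b a"
  by (simp add: tensor_word_def)

lemma length_tensor_word: "length (tensor_word X m u b a) = Suc b - a" by (auto simp: tensor_word_def Suc_diff_le)

lemma degree_tensor_word: "1 \<le> a \<Longrightarrow> sum_list (map (\<lambda>(_, _, n, _). n) (tensor_word X m u b a)) = sum m {a..b}"
proof (induction b)
  case 0
  then show ?case by (simp add: tensor_word_empty)
next
  case (Suc b)
  show ?case
  proof (cases "a \<le> Suc b")
    case True
    then show ?thesis using Suc by (simp add: tensor_word_Suc)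
  next
    case False
    then show ?thesis by (simp add: tensor_word_empty)
  qed
qed

lemma sum_remove_atLeastAtMost:
  fixes m :: "nat \<Rightarrow> int"
  assumes "1 \<le> i" "i \<le> l"
  shows "sum m {1..l} = sum m {i + 1..l} + m i + sum m {1..i - 1}"
proof -
  have "{1..l} = insert i ({i + 1..l} \<union> {1..i - 1})" using assms by auto
  then have "sum m {1..l} = m i + sum m ({i + 1..l} \<union> {1..i - 1})" using assms by simp
  also have "sum m ({i + 1..l} \<union> {1..i - 1}) = sum m {i + 1..l} + sum m {1..i - 1}"
    by (rule sum.union_disjoint) auto
  finally show ?thesis by simp
qed

lemma finsum_zeros: "abelian_group G \<Longrightarrow> (\<And>i. i \<in> I \<Longrightarrow> x i = \<zero>\<^bsub>G\<^esub>) \<Longrightarrow> finsum G x I = \<zero>\<^bsub>G\<^esub>"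
proof -
  assume G: "abelian_group G" and x: "\<And>i. i \<in> I \<Longrightarrow> x i = \<zero>\<^bsub>G\<^esub>"
  interpret abelian_group G by fact
  have "finsum G x I = finsum G (\<lambda>i. \<zero>\<^bsub>G\<^esub>) I" by (rule finsum_cong') (simp_all add: x)
  then show ?thesis by simp
qed

lemma finsum_one:
  fixes x :: "nat \<Rightarrow> 'g"
  assumes G: "abelian_group G" and "x 1 \<in> carrier G"
  shows "finsum G x {1..1} = x 1"
proof -
  interpret abelian_group G by fact
  have "finsum G x (insert 1 {}) = x 1" using assms(2) by (subst finsum_insert) simp_all
  then show ?thesis by simp
qed

lemma sgn_act_zero: "abelian_group G \<Longrightarrow> sgn_act G n \<zero>\<^bsub>G\<^esub> = \<zero>\<^bsub>G\<^esub>"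
  using add_hom_zero[OF _ _ sgn_act_add_hom] by blast

context simplicial_homotopic
begin

abbreviation "\<Phi> \<equiv> homotopy_transformation U V f g h"

abbreviation (input) "nat_hom X Y \<equiv> tw_hom U (F.pb (fst X)) (G.pb (fst Y))"

lemma transformation_long:
  assumes "2 \<le> length us" "fst (snd (hd us)) = Y" "n = sum_list (map (\<lambda>(_, _, n, _). n) us) - int (length us)"
  shows "\<Phi> X us = \<zero>\<^bsub>nat_hom X Y n\<^esub>"
proof -
  obtain x y us' where us: "us = x # y # us'" using assms(1) by (cases us; cases "tl us") auto
  show ?thesis using assms(2,3) unfolding us by (cases x) (simp add: homotopy_transformation_def)
qed

lemma transformation_word:
  assumes "1 \<le> a" "a < b" "n = sum m {a..b} - int (Suc b - a)"
  shows "\<Phi> Y (tensor_word X m u b a) = \<zero>\<^bsub>nat_hom Y (X b) n\<^esub>"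
proof (rule transformation_long)
  obtain b' where b: "b = Suc b'" using assms by (cases b) auto
  show "fst (snd (hd (tensor_word X m u b a))) = X b" using assms by (simp add: b tensor_word_Suc)
qed (use assms in "simp_all add: length_tensor_word degree_tensor_word")

text \<open>Serves both sums of the relation: j = i for words in which \<open>u i\<close> is
  replaced by its differential, j = i + 1 for words in which two neighbours are composed. The number
  l - j + i is the length of the word.\<close>

lemma transformation_insert:
  assumes "j \<le> l" "1 \<le> i" "2 \<le> l - j + i" "n = sum m {j + 1..l} + d + sum m {1..i - 1} - int (l - j + i)"
  shows "\<Phi> Y (tensor_word X m u l (j + 1) @ [(x, X j, d, w)] @ tensor_word X m u (i - 1) 1) = \<zero>\<^bsub>nat_hom Y (X l) n\<^esub>" (is "\<Phi> Y ?w = _")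
proof (rule transformation_long)
  show "fst (snd (hd ?w)) = X l"
  proof (cases "j = l")
    case True
    then show ?thesis by (simp add: tensor_word_empty)
  next
    case False
    then obtain l' where "l = Suc l'" "j + 1 \<le> Suc l'" using assms(1) by (cases l) auto
    then show ?thesis by (simp add: tensor_word_Suc)
  qed
  have "length ?w = l - j + i" using assms(1,2) by (simp add: length_tensor_word)
  then show "2 \<le> length ?w"
    "n = sum_list (map (\<lambda>(_, _, n, _). n) ?w) -
      int (length ?w)"
    using assms(3,4) degree_tensor_word[of "j + 1" X m u l] degree_tensor_word[of 1 X m u "i - 1"] by (simp_all only: map_append sum_list_append list.map prod.case sum_list.Cons sum_list.Nil)
qed

lemma transformation_nil: "\<Phi> X [] = Hs (fst X) (fst X) 1 (snd X)"
  and transformation_single: "\<Phi> X [(x, Y, n, u)] = sgn_act (nat_hom X Y (n - 1)) (n - 1) (Hs (fst X) (fst Y) n u)"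
  by (simp_all add: homotopy_transformation_def)

lemma nat_hom_abelian: "twisted_complex V X \<Longrightarrow> twisted_complex V Y \<Longrightarrow> abelian_group (nat_hom X Y n)"
  by (intro U.tw_hom_abelian gr_module_pull[OF F.map_map] gr_module_pull[OF G.map_map] V.twistedD(1))

context
  fixes l :: nat and X :: "nat \<Rightarrow> ('b, 's, 'm) tw_obj" and m and u
  assumes l: "1 \<le> l" and comp: "composable (Tw V) l X m u"
begin

private lemma X: "i \<le> l \<Longrightarrow> twisted_complex V (X i)" using comp by (simp add: composable_def Tw_simps)

private lemma u: "1 \<le> i \<Longrightarrow> i \<le> l \<Longrightarrow> u i \<in> V.maps (X (i - 1)) (X i) (m i)"
  using comp by (simp add: composable_def Tw_simps)

lemma transformation_single_hom:
  assumes "l = 1"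
  shows "add_hom (V.Hom (X 0) (X 1) (m 1)) (nat_hom (X 0) (X 1) (m 1 - 1))
    (\<lambda>v. \<Phi> (X 0) [(X 0, X 1, m 1, v)])" unfolding transformation_single
  by (rule add_hom_compose[OF Hs_add_hom sgn_act_add_hom[OF nat_hom_abelian]])
    (simp_all add: X assms V.twistedD(1))

lemma transformation_closed: "\<Phi> (X 0) (tensor_word X m u l 1) \<in> carrier (nat_hom (X 0) (X l) ((\<Sum>j=1..l. m j) - int l))"
proof (cases "l = 1")
  case True
  then have "tensor_word X m u l 1 = [(X 0, X 1, m 1, u 1)]" by (simp add: tensor_word_Suc tensor_word_empty)
  then show ?thesis using add_hom_closed[OF transformation_single_hom[OF True], of "u 1"] u[of 1] True by simp
next
  case False
  then have "\<Phi> (X 0) (tensor_word X m u l 1) = \<zero>\<^bsub>nat_hom (X 0) (X l) ((\<Sum>j=1..l. m j) - int l)\<^esub>"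
    using l by (intro transformation_word) simp_all
  then show ?thesis using abelian_groupE(2)[OF nat_hom_abelian[OF X X]] by simp
qed

lemma transformation_additive:
  assumes i: "i \<in> {1..l}" and v: "v \<in> V.maps (X (i - 1)) (X i) (m i)"
  shows "\<Phi> (X 0) (tensor_word X m (u(i := u i \<oplus>\<^bsub>V.Hom (X (i - 1)) (X i) (m i)\<^esub> v)) l 1) =
    \<Phi> (X 0) (tensor_word X m u l 1) \<oplus>\<^bsub>nat_hom (X 0) (X l) ((\<Sum>j=1..l. m j) - int l)\<^esub> \<Phi> (X 0) (tensor_word X m (u(i := v)) l 1)"
proof (cases "l = 1")
  case True
  then have i1: "i = 1" using i by simp
  have w: "tensor_word X m w l 1 = [(X 0, X 1, m 1, w 1)]" for w using True by (simp add: tensor_word_Suc tensor_word_empty)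
  show ?thesis
    unfolding w i1 using add_hom_add[OF transformation_single_hom[OF True], of "u 1" v] u[of 1] v True i1 by simp
next
  case False
  have z: "\<Phi> (X 0) (tensor_word X m w l 1) = \<zero>\<^bsub>nat_hom (X 0) (X l) ((\<Sum>j=1..l. m j) - int l)\<^esub>" for w
    using l False by (intro transformation_word) simp_all
  show ?thesis unfolding z using abelian_groupE(2,5)[OF nat_hom_abelian[OF X X]] by simp
qed

lemma transformation_relation:
  assumes H: "H = nat_hom (X 0) (X l) ((\<Sum>j=1..l. m j) - int l + 1)"
  shows "\<zero>\<^bsub>H\<^esub> =
    tw_diff U (fobj (tw_pullback U V f) (X 0)) (fobj (tw_pullback U V g) (X l)) ((\<Sum>j=1..l. m j) - int l) (\<Phi> (X 0) (tensor_word X m u l 1))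
    \<oplus>\<^bsub>H\<^esub> sgn_act H (m l - 1)
      (tw_comp U (F.pb (fst (X 0))) (G.pb (fst (X (l - 1)))) (G.pb (fst (X l))) (m l) ((\<Sum>j=1..l-1. m j) - (int l - 1))
        (G.pm (fst (X (l - 1))) (fst (X l)) (m l) (u l)) (\<Phi> (X 0) (tensor_word X m u (l - 1) 1)))
    \<oplus>\<^bsub>H\<^esub> sgn_act H (- (\<Sum>j=1..l. m j) + int l - 1)
      (tw_comp U (F.pb (fst (X 0))) (F.pb (fst (X 1))) (G.pb (fst (X l))) ((\<Sum>j=2..l. m j) - (int l - 1)) (m 1)
        (\<Phi> (X 1) (tensor_word X m u l 2)) (F.pm (fst (X 0)) (fst (X 1)) (m 1) (u 1)))
    \<oplus>\<^bsub>H\<^esub> (\<Oplus>\<^bsub>H\<^esub>i\<in>{1..l}. sgn_act H ((\<Sum>j=i+1..l. m j) + int l - int i + 1)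
      (\<Phi> (X 0) (tensor_word X m u l (i + 1) @ [(X (i - 1), X i, m i + 1, tw_diff V (X (i - 1)) (X i) (m i) (u i))] @ tensor_word X m u (i - 1) 1)))
    \<oplus>\<^bsub>H\<^esub> (\<Oplus>\<^bsub>H\<^esub>i\<in>{1..l-1}. sgn_act H ((\<Sum>j=i+1..l. m j) + int l - int i + 1)
      (\<Phi> (X 0) (tensor_word X m u l (i + 2) @ [(X (i - 1), X (i + 1), m (i + 1) + m i,
        V.Cmp (X (i - 1)) (X i) (X (i + 1)) (m (i + 1)) (m i) (u (i + 1)) (u i))] @ tensor_word X m u (i - 1) 1)))"
    (is "_ = ?P1 \<oplus>\<^bsub>H\<^esub> ?P2 \<oplus>\<^bsub>H\<^esub> ?P3 \<oplus>\<^bsub>H\<^esub> ?P4 \<oplus>\<^bsub>H\<^esub> ?P5")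
proof -
  note X0 = X[OF le0] and Xl = X[OF order_refl] and X1 = X[OF l]
  have B: "abelian_group H" unfolding H by (rule nat_hom_abelian[OF X0 Xl])
  interpret H: abelian_group H by (rule B)
  have u1: "u 1 \<in> V.maps (X 0) (X 1) (m 1)" using u[of 1] l by simp
  have m: "graded U (F.pb (fst (X i)))" "graded U (G.pb (fst (X i)))" if "i \<le> l" for i
    by (rule gr_module_pull[OF F.map_map V.twistedD(1)[OF X[OF that]]] gr_module_pull[OF G.map_map V.twistedD(1)[OF X[OF that]]])+
  \<comment> \<open>Words of length at least 2 are sent to zero, so for l \<ge> 2 the differential
    term and the sum over the differentials of the arguments vanish.\<close>
  have P1: "?P1 = \<zero>\<^bsub>H\<^esub>" and P4: "?P4 = \<zero>\<^bsub>H\<^esub>" if l2: "2 \<le> l"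
  proof -
    have "\<Phi> (X 0) (tensor_word X m u l 1) = \<zero>\<^bsub>nat_hom (X 0) (X l) ((\<Sum>j=1..l. m j) - int l)\<^esub>"
      using l2 by (intro transformation_word) simp_all
    then show "?P1 = \<zero>\<^bsub>H\<^esub>"
      using add_hom_zero[OF nat_hom_abelian[OF X0 Xl] B U.tw_diff_add_hom[OF F.twisted_pullback[OF X0] G.twisted_pullback[OF Xl],
            of "(\<Sum>j=1..l. m j) - int l", unfolded fobj_pullback, folded H]] by simp
    show "?P4 = \<zero>\<^bsub>H\<^esub>"
    proof (rule finsum_zeros[OF B])
      fix i assume i: "i \<in> {1..l}"
      have d: "(\<Sum>j=1..l. m j) - int l + 1 = sum m {i + 1..l} + (m i + 1) + sum m {1..i - 1} - int (l - i + i)"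
        using sum_remove_atLeastAtMost[of i l m] i by simp
      have z: "\<Phi> (X 0) (tensor_word X m u l (i + 1) @ [(X (i - 1), X i, m i + 1, tw_diff V (X (i - 1)) (X i) (m i) (u i))] @ tensor_word X m u (i - 1) 1) = \<zero>\<^bsub>H\<^esub>"
        unfolding H by (rule transformation_insert[OF _ _ _ d]) (use i l2 in simp_all)
      show "sgn_act H ((\<Sum>j=i+1..l. m j) + int l - int i + 1) (\<Phi> (X 0) (tensor_word X m u l (i + 1) @
          [(X (i - 1), X i, m i + 1, tw_diff V (X (i - 1)) (X i) (m i) (u i))] @ tensor_word X m u (i - 1) 1)) = \<zero>\<^bsub>H\<^esub>"
        unfolding z by (rule sgn_act_zero[OF B])
    qed
  qed
  \<comment> \<open>For l = 1 the last sum is empty; for l = 2 only terms with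
    \<open>\<Phi>\<^sub>1\<close> remain; from l = 3 on, even composing two arguments leaves a word
    of length at least 2.\<close>
  consider "l = 1" | "l = 2" | "3 \<le> l" using l by linarith
  then show ?thesis
  proof cases
    case 1
    have w: "tensor_word X m u 1 1 = [(X 0, X 1, m 1, u 1)]" "tensor_word X m u 0 1 = []" "tensor_word X m u 1 2 = []"
      by (simp_all add: tensor_word_Suc tensor_word_empty)
    have s: "sum m {1..1} = m 1" "sum m {1..0} = 0" "sum m {2..1} = 0" by simp_all
    have n: "(1::nat) - 1 = 0" "1 + 1 = (2::nat)" "int 1 = 1" by simp_all
    have z: "m 1 - 1 + 1 = m 1" "(0::int) - (1 - 1) = 0" "- m 1 + 1 - 1 = - m 1" "0 + 1 - 1 + 1 = (1::int)" "m 1 + 1 - 1 = m 1" by simp_all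
    have H1: "H = nat_hom (X 0) (X 1) (m 1)" unfolding H 1 s n z ..
    have c: "sgn_act H 1 (sgn_act H (m 1) (Hs (fst (X 0)) (fst (X 1)) (m 1 + 1) (tw_diff V (X 0) (X 1) (m 1) (u 1)))) \<in> carrier H"
      unfolding H1 using u1 1
      by (intro sgn_act_closed nat_hom_abelian X Hs_closed add_hom_closed[OF V.tw_diff_add_hom] V.twistedD(1)) simp_all
    have e: "finsum H x {1..0} = \<zero>\<^bsub>H\<^esub>" for x :: "nat \<Rightarrow> _" by simp
    note r = unary_relation[OF X0 X1 u1 H1]
    have "?P1 \<oplus>\<^bsub>H\<^esub> ?P2 \<oplus>\<^bsub>H\<^esub> ?P3 \<oplus>\<^bsub>H\<^esub> ?P4 = \<zero>\<^bsub>H\<^esub>"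
      using r c by (simp only: 1 n w s z finsum_one[OF B] transformation_nil transformation_single append_Nil append_Nil2 H1[symmetric])
    then show ?thesis by (simp only: 1 n e H.r_zero H.zero_closed)
  next
    case 2
    then have l2: "1 \<le> l" "2 \<le> l" "l = 2" by simp_all
    note E = V.twistedD(1)[OF X[OF le0]] V.twistedD(1)[OF X[OF l2(1)]] V.twistedD(1)[OF X[OF l2(2)]]
    have w: "tensor_word X m u 1 1 = [(X 0, X 1, m 1, u 1)]" "tensor_word X m u 2 2 = [(X 1, X 2, m 2, u 2)]"
      "tensor_word X m u 2 3 = []" "tensor_word X m u 0 1 = []"
      using tensor_word_Suc[of 2 1 X m u] by (simp_all add: tensor_word_Suc tensor_word_empty numeral_2_eq_2)
    have s: "sum m {1..2} = m 1 + m 2" "sum m {1..1} = m 1" "sum m {2..2} = m 2" by (simp_all add: numeral_2_eq_2)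
    have n: "(2::nat) - 1 = 1" "(1::nat) - 1 = 0" "1 + 1 = (2::nat)" "1 + 2 = (3::nat)" "int 2 - 1 = 1" by simp_all
    have z: "- (m 1 + m 2) + int 2 - 1 = - (m 1 + m 2) + 1" by simp
    \<comment> \<open>For l = 2 and i = 1 the exponent of the composition term is the degree of
      \<open>u 2\<close> increased by 2.\<close>
    have e: "sgn_act H (m 2 + int 2 - int 1 + 1) x = sgn_act H (m 2) x" for x by (simp add: sgn_act_def)
    have H2: "H = nat_hom (X 0) (X 2) (m 2 + m 1 - 1)" unfolding H 2 s by (simp add: add.commute)
    have u1': "u 1 \<in> V.maps (X 0) (X 1) (m 1)" and u2': "u 2 \<in> V.maps (X 1) (X 2) (m 2)"
      using u1 u[of 2] 2 by simp_all
    have c: "sgn_act H (m 2) (sgn_act H (m 2 + m 1 - 1) (Hs (fst (X 0)) (fst (X 2)) (m 2 + m 1)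
        (V.Cmp (X 0) (X 1) (X 2) (m 2) (m 1) (u 2) (u 1)))) \<in> carrier H"
      using E l2 unfolding H2
      by (intro sgn_act_closed nat_hom_abelian X Hs_closed[OF _ _ refl] V.tw_comp_closed[OF E u2' u1' refl]) simp_all
    have r: "?P2 \<oplus>\<^bsub>H\<^esub> ?P3 \<oplus>\<^bsub>H\<^esub> ?P5 = \<zero>\<^bsub>H\<^esub>" using binary_relation[OF E u1' u2' H2] c l2(1,2)
      by (simp only: l2(3) n z s w e finsum_one[OF B] transformation_single append_Nil append_Nil2 H2[symmetric])
    note gu = add_hom_closed[OF G.tw_pull_mor_add_hom[OF E(2,3)] u2'] and fu = add_hom_closed[OF F.tw_pull_mor_add_hom[OF E(1,2)] u1']
      and Hu = sgn_act_closed[OF nat_hom_abelian Hs_closed[OF E(1,2) refl u1']] and Hv = sgn_act_closed[OF nat_hom_abelian Hs_closed[OF E(2,3) refl u2']]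
    have "tw_comp U (F.pb (fst (X 0))) (G.pb (fst (X 1))) (G.pb (fst (X 2))) (m 2) (m 1 - 1)
        (G.pm (fst (X 1)) (fst (X 2)) (m 2) (u 2)) (sgn_act (nat_hom (X 0) (X 1) (m 1 - 1)) (m 1 - 1) (Hs (fst (X 0)) (fst (X 1)) (m 1) (u 1))) \<in> carrier H"
      "tw_comp U (F.pb (fst (X 0))) (F.pb (fst (X 1))) (G.pb (fst (X 2))) (m 2 - 1) (m 1)
        (sgn_act (nat_hom (X 1) (X 2) (m 2 - 1)) (m 2 - 1) (Hs (fst (X 1)) (fst (X 2)) (m 2) (u 2))) (F.pm (fst (X 0)) (fst (X 1)) (m 1) (u 1)) \<in> carrier H"
      unfolding H2 by (rule U.tw_comp_closed[OF m(1) m(2) m(2) gu Hu] U.tw_comp_closed[OF m(1) m(1) m(2) Hv fu]; simp add: l2(3) X)+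
    then have c': "?P2 \<in> carrier H" "?P3 \<in> carrier H"
      by (simp_all only: l2(3) n s w transformation_single sgn_act_closed[OF B])
    show ?thesis unfolding P1[OF l2(2)] P4[OF l2(2)] using r c' by simp
  next
    case 3
    then have l3: "2 \<le> l" "l - 1 \<le> l" by simp_all
    have n1: "(\<Sum>j=1..l-1. m j) - (int l - 1) = sum m {1..l - 1} - int (Suc (l - 1) - 1)"
      "(\<Sum>j=2..l. m j) - (int l - 1) = sum m {2..l} - int (Suc l - 2)" using 3 by (simp_all add: of_nat_diff)
    have S: "(\<Sum>j=1..l. m j) - int l + 1 = m l + ((\<Sum>j=1..l-1. m j) - (int l - 1))"
      "(\<Sum>j=1..l. m j) - int l + 1 = (\<Sum>j=2..l. m j) - (int l - 1) + m 1"
      using sum_remove_atLeastAtMost[of l l m] sum_remove_atLeastAtMost[of 1 l m] l by (simp_all add: numeral_2_eq_2)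
    have gu: "G.pm (fst (X (l - 1))) (fst (X l)) (m l) (u l) \<in> tw_maps U (G.pb (fst (X (l - 1)))) (G.pb (fst (X l))) (m l)"
      by (rule add_hom_closed[OF G.tw_pull_mor_add_hom[OF V.twistedD(1)[OF X[OF l3(2)]] V.twistedD(1)[OF Xl]] u[OF l order_refl]])
    have fu: "F.pm (fst (X 0)) (fst (X 1)) (m 1) (u 1) \<in> tw_maps U (F.pb (fst (X 0))) (F.pb (fst (X 1))) (m 1)"
      using add_hom_closed[OF F.tw_pull_mor_add_hom[OF V.twistedD(1)[OF X0] V.twistedD(1)[OF X1]], of "u 1"] u[of 1] l by simp
    have P2: "?P2 = \<zero>\<^bsub>H\<^esub>"
    proof -
      have "\<Phi> (X 0) (tensor_word X m u (l - 1) 1) = \<zero>\<^bsub>nat_hom (X 0) (X (l - 1)) ((\<Sum>j=1..l-1. m j) - (int l - 1))\<^esub>"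
        by (rule transformation_word[OF _ _ n1(1)]) (use 3 in simp_all)
      then show ?thesis
        using add_hom_zero[OF nat_hom_abelian[OF X0 X[OF l3(2)]] B U.tw_comp_hom_right[OF m(1)[OF le0] m(2)[OF l3(2)] m(2)[OF order_refl] gu S(1), folded H]]
        by (simp only: sgn_act_zero[OF B])
    qed
    have P3: "?P3 = \<zero>\<^bsub>H\<^esub>"
    proof -
      have "\<Phi> (X 1) (tensor_word X m u l 2) = \<zero>\<^bsub>nat_hom (X 1) (X l) ((\<Sum>j=2..l. m j) - (int l - 1))\<^esub>"
        by (rule transformation_word[OF _ _ n1(2)]) (use 3 in simp_all)
      then show ?thesis
        using add_hom_zero[OF nat_hom_abelian[OF X1 Xl] B U.tw_comp_hom_left[OF m(1)[OF le0] m(1)[OF l] m(2)[OF order_refl] fu S(2), folded H]]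
        by (simp only: sgn_act_zero[OF B])
    qed
    have P5: "?P5 = \<zero>\<^bsub>H\<^esub>"
    proof (rule finsum_zeros[OF B])
      fix i assume i: "i \<in> {1..l - 1}"
      then have il: "1 \<le> i" "i + 1 \<le> l" using l by auto
      have "sum m {i + 1..l} = m (i + 1) + sum m {i + 1 + 1..l}"
        using sum.atLeast_Suc_atMost[of "i + 1" l m] il by simp
      then have d: "(\<Sum>j=1..l. m j) - int l + 1 = sum m {(i + 1) + 1..l} + (m (i + 1) + m i) + sum m {1..i - 1} - int (l - (i + 1) + i)"
        using sum_remove_atLeastAtMost[of i l m] il by (simp add: of_nat_diff)
      have i2: "i + 2 = (i + 1) + 1" by simp
      have z: "\<Phi> (X 0) (tensor_word X m u l (i + 2) @ [(X (i - 1), X (i + 1), m (i + 1) + m i,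
        V.Cmp (X (i - 1)) (X i) (X (i + 1)) (m (i + 1)) (m i) (u (i + 1)) (u i))] @ tensor_word X m u (i - 1) 1) = \<zero>\<^bsub>H\<^esub>"
        unfolding H i2 by (rule transformation_insert[OF il(2,1) _ d]) (use 3 il in simp)
      show "sgn_act H ((\<Sum>j=i+1..l. m j) + int l - int i + 1) (\<Phi> (X 0) (tensor_word X m u l (i + 2) @ [(X (i - 1), X (i + 1), m (i + 1) + m i,
        V.Cmp (X (i - 1)) (X i) (X (i + 1)) (m (i + 1)) (m i) (u (i + 1)) (u i))] @ tensor_word X m u (i - 1) 1)) = \<zero>\<^bsub>H\<^esub>"
        unfolding z by (rule sgn_act_zero[OF B])
    qed
    show ?thesis unfolding P1[OF l3(1)] P2 P3 P4[OF l3(1)] P5 by simp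
  qed
qed

end

end

theorem theorem3p10:
  fixes U :: "('a, 'r) simp_rs" and V :: "('b, 's) simp_rs"
    and f g :: "nat \<Rightarrow> ('a, 'r, 'b, 's) rs_mor"
    and h :: "nat \<Rightarrow> nat \<Rightarrow> ('a, 'r, 'b, 's) rs_mor"
  assumes "simplicial_ringed_space U" and "simplicial_ringed_space V"
    and "simplicial_map U V f" and "simplicial_map U V g"
    and "simplicial_homotopy U V f g h"
  shows "A_infinity_nat_trans (Tw V :: (('b, 's, 'm) tw_obj, ('b, 's, 'm) tw_mor) dg_cat)
           (Tw U :: (('a, 'r, ('a, 'r, 'b, 'm) pbs) tw_obj, ('a, 'r, ('a, 'r, 'b, 'm) pbs) tw_mor) dg_cat)
           (tw_pullback U V f) (tw_pullback U V g) (homotopy_transformation U V f g h)"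
proof -
  interpret simplicial_homotopic U V f g h using assms by unfold_locales
  show ?thesis unfolding A_infinity_nat_trans_def Let_def Tw_simps(2-4) fmor_pullback fobj_pullback
  proof (intro conjI ballI allI impI)
    fix X :: "('b, 's, 'm) tw_obj" assume "X \<in> dobj (Tw V)"
    then have X: "twisted_complex V X" by (simp add: Tw_simps)
    show "\<Phi> X [] \<in> carrier (nat_hom X X 0)" unfolding transformation_nil by (rule Hs_twisted_closed[OF X])
    show "tw_diff U (fobj (tw_pullback U V f) X) (fobj (tw_pullback U V g) X) 0 (\<Phi> X []) = \<zero>\<^bsub>nat_hom X X 1\<^esub>"
      unfolding transformation_nil by (rule diff_Hs_twisted[OF X])
  qed (assumption | rule V.dg_category_Tw U.dg_category_Tw F.dg_functor_pullback
      G.dg_functor_pullback transformation_closed transformation_additive transformation_relation refl)+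
qed

end
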